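(* (Anchor Lemma) Let $\Gamma$ be a Jordan curve in $\overline{\mathbb{C}}$ bounding a Jordan domain $\Omega$. Let $A$ be a collar neighbourhood of $\Gamma$ in $\Omega$ and let $\Gamma_\epsilon=f(\{|z|=e^{-\epsilon}\})$ for a biholomorphism $f:\mathbb{D}^+\to\Omega$ and $\epsilon>0$. For any $h\in\mathcal{D}_{\mathrm{harm}}(A)$ and $\alpha\in\mathcal{A}(A)$, $$\lim_{\epsilon\searrow0}\int_{\Gamma_\epsilon}\alpha(w)h(w)=\lim_{\epsilon\searrow0}\int_{\Gamma_\epsilon}\alpha(w)\,\mathbf{G}_{A,\Omega}h(w).$$ In particular, if $h$ has CNT boundary values equal to zero except possibly on a null set, then for any $\alpha\in\mathcal{A}(A)$, $$\lim_{\epsilon\searrow0}\int_{\Gamma_\epsilon}\alpha(w)h(w)=0.$$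
   Context: $\overline{\mathbb{C}}$ is the Riemann sphere, $\mathbb{D}^+=\{|z|<1\}$; harmonicity/holomorphicity at $\infty$ is defined using the coordinate $1/z$. For an open connected $U\subset\overline{\mathbb{C}}$, $\mathcal{D}_{\mathrm{harm}}(U)$ is the set of complex-valued harmonic functions on $U$ with finite Dirichlet energy $\frac1\pi\iint_{U\setminus\{\infty\}}\left(|\partial h/\partial z|^2+|\partial h/\partial\bar z|^2\right)dA$, and $\mathcal{A}(U)$ (Bergman space) is the set of holomorphic one-forms $a(z)\,dz$ on $U$ with $\frac1\pi\iint_{U\setminus\{\infty\}}|a|^2\,dA<\infty$. A collar neighbourhood of $\Gamma$ in $\Omega$ is a set $f(\{z: r<|z|<1\})$ with $r\in(0,1)$ and $f:\mathbb{D}^+\to\Omega$ a biholomorphism. The curves $\Gamma_\epsilon$ carry the orientation induced by $f$ from the counterclockwise circle; for $\epsilon$ small they lie in $A$. Biholomorphisms $f:\mathbb{D}^+\to\Omega$ extend to homeomorphisms of closures. A set $I\subset\Gamma$ is null (with respect to $\Omega$) if it is Borel and $f^{-1}(I)$ has logarithmic capacity zero for some (equivalently every) such $f$. A function $h$ on $\Omega$ or on a collar neighbourhood has CNT limit $\zeta$ at $p\in\Gamma$ if $h\circ f$ has non-tangential limit $\zeta$ at $f^{-1}(p)$, i.e. for every $M>1$, $h(f(z))\to\zeta$ as $z\to f^{-1}(p)$ within $\{z\in\mathbb{D}^+:|f^{-1}(p)-z|<M(1-|z|)\}$. The bounce operator $\mathbf{G}_{A,\Omega}:\mathcal{D}_{\mathrm{harm}}(A)\to\mathcal{D}_{\mathrm{harm}}(\Omega)$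 takes $h$ to the unique $H\in\mathcal{D}_{\mathrm{harm}}(\Omega)$ whose CNT boundary values agree with those of $h$ except possibly on a null set. *)

theory Defs
  imports "HOL-Probability.Probability" "HOL-Complex_Analysis.Complex_Analysis"
begin

section \<open>The Riemann sphere\<close>

text \<open>
  A point of the Riemann sphere is \<^term>\<open>Some z\<close> for a finite \<^term>\<open>z\<close>, or
  \<^term>\<open>None\<close> for infinity. The two coordinates are \<open>z\<close> and \<open>w = 1/z\<close>; they have
  the parametrizations \<^term>\<open>Some\<close> and \<open>chart_inf\<close>, with inverses \<^term>\<open>the\<close> and
  \<open>coord_inf\<close> (the latter is meaningful only away from \<^term>\<open>Some 0\<close>).
\<close>

abbreviation riemann_sphere :: "complex option topology" where
  "riemann_sphere \<equiv> Alexandroff_compactification euclidean"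

definition chart_inf :: "complex \<Rightarrow> complex option" where
  "chart_inf w = (if w = 0 then None else Some (1 / w))"

definition coord_inf :: "complex option \<Rightarrow> complex" where
  "coord_inf p = (case p of None \<Rightarrow> 0 | Some z \<Rightarrow> 1 / z)"

definition jordan_curve :: "complex option set \<Rightarrow> bool" where
  "jordan_curve \<Gamma> \<longleftrightarrow>
     (\<exists>g. embedding_map (top_of_set (sphere (0::complex) 1)) riemann_sphere g \<and>
          \<Gamma> = g ` sphere 0 1)"

text \<open>The Jordan domains bounded by \<open>\<Gamma>\<close> are the components of its complement.\<close>

definition jordan_domain :: "complex option set \<Rightarrow> complex option set \<Rightarrow> bool" where
  "jordan_domain \<Gamma> \<Omega> \<longleftrightarrow>
     jordan_curve \<Gamma> \<and> \<Omega> \<in> connected_components_of (subtopology riemann_sphere (- \<Gamma>))"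

definition holomorphic_from_sphere :: "(complex option \<Rightarrow> complex) \<Rightarrow> complex option set \<Rightarrow> bool" where
  "holomorphic_from_sphere g U \<longleftrightarrow>
     (g \<circ> Some) holomorphic_on {z. Some z \<in> U} \<and>
     (g \<circ> chart_inf) holomorphic_on {w. chart_inf w \<in> U}"

text \<open>Continuity makes the two sets on which holomorphy is required open when \<open>V\<close> is.\<close>

definition holomorphic_to_sphere :: "(complex \<Rightarrow> complex option) \<Rightarrow> complex set \<Rightarrow> bool" where
  "holomorphic_to_sphere f V \<longleftrightarrow>
     continuous_map (top_of_set V) riemann_sphere f \<and>
     (the \<circ> f) holomorphic_on {z \<in> V. f z \<noteq> None} \<and>
     (coord_inf \<circ> f) holomorphic_on {z \<in> V. f z \<noteq> Some 0}"

definition disk_biholomorphism :: "(complex \<Rightarrow> complex option) \<Rightarrow> complex option set \<Rightarrow> bool" where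
  "disk_biholomorphism f \<Omega> \<longleftrightarrow>
     bij_betw f (ball 0 1) \<Omega> \<and>
     holomorphic_to_sphere f (ball 0 1) \<and>
     holomorphic_from_sphere (the_inv_into (ball 0 1) f) \<Omega>"

definition collar_nbhd :: "complex option set \<Rightarrow> complex option set \<Rightarrow> bool" where
  "collar_nbhd \<Omega> A \<longleftrightarrow>
     (\<exists>f r. disk_biholomorphism f \<Omega> \<and> 0 < r \<and> r < 1 \<and> A = f ` {z. r < cmod z \<and> cmod z < 1})"


section \<open>Harmonic functions and one-forms with finite energy\<close>

definition partial_x :: "(complex \<Rightarrow> complex) \<Rightarrow> complex \<Rightarrow> complex" where
  "partial_x h z = frechet_derivative h (at z) 1"

definition partial_y :: "(complex \<Rightarrow> complex) \<Rightarrow> complex \<Rightarrow> complex" where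
  "partial_y h z = frechet_derivative h (at z) \<i>"

definition wirtinger_z :: "(complex \<Rightarrow> complex) \<Rightarrow> complex \<Rightarrow> complex" where
  "wirtinger_z h z = (partial_x h z - \<i> * partial_y h z) / 2"

definition wirtinger_zbar :: "(complex \<Rightarrow> complex) \<Rightarrow> complex \<Rightarrow> complex" where
  "wirtinger_zbar h z = (partial_x h z + \<i> * partial_y h z) / 2"

definition C1_on :: "complex set \<Rightarrow> (complex \<Rightarrow> complex) \<Rightarrow> bool" where
  "C1_on S h \<longleftrightarrow>
     h differentiable_on S \<and> continuous_on S (partial_x h) \<and> continuous_on S (partial_y h)"

text \<open>Used for open \<open>S\<close> only.\<close>

definition harmonic_on :: "complex set \<Rightarrow> (complex \<Rightarrow> complex) \<Rightarrow> bool" where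
  "harmonic_on S h \<longleftrightarrow>
     C1_on S h \<and> C1_on S (partial_x h) \<and> C1_on S (partial_y h) \<and>
     (\<forall>z\<in>S. partial_x (partial_x h) z + partial_y (partial_y h) z = 0)"

definition sphere_harmonic_on :: "complex option set \<Rightarrow> (complex option \<Rightarrow> complex) \<Rightarrow> bool" where
  "sphere_harmonic_on U h \<longleftrightarrow>
     harmonic_on {z. Some z \<in> U} (h \<circ> Some) \<and>
     harmonic_on {w. chart_inf w \<in> U} (h \<circ> chart_inf)"

definition dirichlet_energy :: "complex option set \<Rightarrow> (complex option \<Rightarrow> complex) \<Rightarrow> ennreal" where
  "dirichlet_energy U h =
     ennreal (1 / pi) *
     (\<integral>\<^sup>+z\<in>{z. Some z \<in> U}. ennreal ((cmod (wirtinger_z (h \<circ> Some) z))\<^sup>2 +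
                                   (cmod (wirtinger_zbar (h \<circ> Some) z))\<^sup>2) \<partial>lborel)"

definition D_harm :: "complex option set \<Rightarrow> (complex option \<Rightarrow> complex) set" where
  "D_harm U = {h. sphere_harmonic_on U h \<and> dirichlet_energy U h < \<infinity>}"

text \<open>
  A one-form on \<open>U\<close> is represented by its coefficient \<open>a\<close> in \<open>a(z) dz\<close> on the finite part
  of \<open>U\<close>. In the coordinate \<open>w = 1/z\<close> it reads \<open>- a(1/w) / w\<^sup>2 dw\<close>; holomorphy at infinity
  means that this coefficient has a holomorphic extension \<open>b\<close> across \<open>w = 0\<close>.
\<close>

definition holomorphic_one_form :: "complex option set \<Rightarrow> (complex \<Rightarrow> complex) \<Rightarrow> bool" where
  "holomorphic_one_form U a \<longleftrightarrow>
     a holomorphic_on {z. Some z \<in> U} \<and>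
     (\<exists>b. b holomorphic_on {w. chart_inf w \<in> U} \<and>
          (\<forall>w. w \<noteq> 0 \<and> chart_inf w \<in> U \<longrightarrow> b w = - a (1 / w) / w\<^sup>2))"

definition bergman :: "complex option set \<Rightarrow> (complex \<Rightarrow> complex) set" where
  "bergman U =
     {a. holomorphic_one_form U a \<and>
         ennreal (1 / pi) * (\<integral>\<^sup>+z\<in>{z. Some z \<in> U}. ennreal ((cmod (a z))\<^sup>2) \<partial>lborel) < \<infinity>}"

text \<open>
  The integral of \<open>h(w) a(w) dw\<close> over the image under \<open>f\<close> of the counterclockwise circle
  \<open>|z| = e\<^sup>-\<^sup>\<epsilon>\<close>. If that image passes through infinity, then it does so at a single
  point, which does not affect the integral.
\<close>

definition level_curve_integral ::
    "(complex \<Rightarrow> complex option) \<Rightarrow> real \<Rightarrow> (complex \<Rightarrow> complex) \<Rightarrow> (complex option \<Rightarrow> complex) \<Rightarrow> complex" where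
  "level_curve_integral f \<epsilon> a h =
     contour_integral (the \<circ> f \<circ> circlepath 0 (exp (- \<epsilon>))) (\<lambda>w. a w * h (Some w))"


section \<open>Logarithmic capacity and null sets\<close>

text \<open>The diagonal is treated separately because \<^term>\<open>ln (0::real) = 0\<close>.\<close>

definition log_kernel :: "complex \<Rightarrow> complex \<Rightarrow> ereal" where
  "log_kernel z w = (if z = w then \<infinity> else ereal (- ln (dist z w)))"

text \<open>
  Positive minus negative part of the integral of \<open>log (1/|z - w|)\<close> (\<^const>\<open>e2ennreal\<close>
  truncates at 0); the second term is finite for compactly supported \<open>\<mu>\<close>.
\<close>

definition log_energy :: "complex measure \<Rightarrow> ereal" where
  "log_energy \<mu> =
     enn2ereal (\<integral>\<^sup>+z. (\<integral>\<^sup>+w. e2ennreal (log_kernel z w) \<partial>\<mu>) \<partial>\<mu>) -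
     enn2ereal (\<integral>\<^sup>+z. (\<integral>\<^sup>+w. e2ennreal (- log_kernel z w) \<partial>\<mu>) \<partial>\<mu>)"

definition compactly_supported_probs :: "complex set \<Rightarrow> complex measure set" where
  "compactly_supported_probs E =
     {\<mu>. prob_space \<mu> \<and> sets \<mu> = sets borel \<and> (\<exists>K. compact K \<and> K \<subseteq> E \<and> emeasure \<mu> K = 1)}"

definition log_capacity :: "complex set \<Rightarrow> ennreal" where
  "log_capacity E =
     (SUP \<mu>\<in>compactly_supported_probs E.
        if log_energy \<mu> = \<infinity> then 0 else ennreal (exp (- real_of_ereal (log_energy \<mu>))))"

text \<open>
  Boundary values of the homeomorphic extension of a biholomorphism \<open>f\<close> from the open disk
  onto a Jordan domain to the closures (Caratheodory).
\<close>

definition boundary_ext :: "(complex \<Rightarrow> complex option) \<Rightarrow> complex \<Rightarrow> complex option" where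
  "boundary_ext f q = (THE p. limitin riemann_sphere f p (at q within ball 0 1))"

text \<open>
  In \<open>null_on\<close> and \<open>cnt_limit\<close> below, "for some \<open>f\<close>" and "for every \<open>f\<close>" are equivalent:
  two choices of \<open>f\<close> differ by a Moebius transformation of the disk.
\<close>

definition null_on :: "complex option set \<Rightarrow> complex option set \<Rightarrow> complex option set \<Rightarrow> bool" where
  "null_on \<Gamma> \<Omega> I \<longleftrightarrow>
     I \<subseteq> \<Gamma> \<and> I \<in> sigma_sets UNIV {U. openin riemann_sphere U} \<and>
     (\<exists>f. disk_biholomorphism f \<Omega> \<and>
          log_capacity {q \<in> sphere 0 1. boundary_ext f q \<in> I} = 0)"


section \<open>CNT boundary values and the bounce operator\<close>

definition nontangential_limit :: "(complex \<Rightarrow> complex) \<Rightarrow> complex \<Rightarrow> complex \<Rightarrow> bool" where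
  "nontangential_limit g q \<zeta> \<longleftrightarrow>
     (\<forall>M>1. (g \<longlongrightarrow> \<zeta>) (at q within {z \<in> ball 0 1. cmod (q - z) < M * (1 - cmod z)}))"

text \<open>
  If \<open>h\<close> is given on a collar neighbourhood only, then its values elsewhere are irrelevant:
  \<open>f z\<close> lies in the collar for all \<open>z\<close> in the disk close to the unit circle.
\<close>

definition cnt_limit ::
    "complex option set \<Rightarrow> (complex option \<Rightarrow> complex) \<Rightarrow> complex option \<Rightarrow> complex \<Rightarrow> bool" where
  "cnt_limit \<Omega> h p \<zeta> \<longleftrightarrow>
     (\<exists>f q. disk_biholomorphism f \<Omega> \<and> q \<in> sphere 0 1 \<and> boundary_ext f q = p \<and>
            nontangential_limit (h \<circ> f) q \<zeta>)"

definition cnt_agree ::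
    "complex option set \<Rightarrow> complex option set \<Rightarrow> (complex option \<Rightarrow> complex) \<Rightarrow>
     (complex option \<Rightarrow> complex) \<Rightarrow> bool" where
  "cnt_agree \<Gamma> \<Omega> h H \<longleftrightarrow>
     (\<exists>N. null_on \<Gamma> \<Omega> N \<and> (\<forall>p\<in>\<Gamma> - N. \<exists>\<zeta>. cnt_limit \<Omega> h p \<zeta> \<and> cnt_limit \<Omega> H p \<zeta>))"

text \<open>
  \<^term>\<open>extensional \<Omega>\<close> fixes the irrelevant values outside \<open>\<Omega>\<close>, so that \<open>H\<close> is unique as
  a HOL function. The collar on which \<open>h\<close> is given enters only through \<open>h\<close>.
\<close>

definition bounce ::
    "complex option set \<Rightarrow> complex option set \<Rightarrow> (complex option \<Rightarrow> complex) \<Rightarrow>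
     complex option \<Rightarrow> complex" where
  "bounce \<Gamma> \<Omega> h = (THE H. H \<in> D_harm \<Omega> \<and> H \<in> extensional \<Omega> \<and> cnt_agree \<Gamma> \<Omega> h H)"

end

theory Submission
  imports Defs
begin

text \<open>
  Everything is pulled back to the unit disc by \<open>f\<close>. Near the unit circle a harmonic function
  \<open>u\<close> of finite energy is \<open>P + cnj Q + 2c log |z|\<close> with \<open>P\<close>, \<open>Q\<close> holomorphic on an annulus.
  Reflecting the parts of \<open>P\<close> and \<open>Q\<close> that are holomorphic in \<open>1/z\<close> across the circle and
  dropping the logarithm gives \<open>v = G + cnj K\<close> with \<open>G\<close>, \<open>K\<close> in the Dirichlet space of the
  disc and \<open>u - v = O(1 - |z|)\<close>.

  By Beurling's theorem \<open>G\<close> and \<open>K\<close> have radial limits off a set of capacity zero; these are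
  nontangential because \<open>(1 - |z|) |G'(z)|\<close> tends to 0 at the circle. Hence \<open>v\<close> has the boundary values
  of \<open>u\<close>, and it is determined by them, since the radial maximal functions are integrable and
  the Fourier coefficients of the boundary values can therefore be computed by dominated
  convergence. So \<open>v\<close> represents the bounce of \<open>h\<close>.

  The pulled back one-form \<open>b dz\<close> satisfies \<open>(1 - |z|) |b(z)| \<rightarrow> 0\<close>, so the integrals of \<open>b u\<close>
  and \<open>b v\<close> over \<open>|z| = s\<close> have the same limit. The limit exists because the integral of \<open>b G\<close> is
  constant and that of \<open>b cnj K\<close> is a power series in \<open>s\<^sup>2\<close> with absolutely summable coefficients.

  Caratheodory's extension theorem, needed to identify \<open>\<Gamma>\<close> with the circle, is proved by the
  length-area method.
\<close>

subsection \<open>Conformal change of variables\<close>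

text \<open>\<open>bounce\<close> is a definite description, so existence and uniqueness of its
  value are both needed, and they involve different kinds of smallness: the exceptional set in the
  existence part must have capacity zero, while uniqueness uses only that such sets have zero arc
  length. One maximal inequality, for probability measures of finite logarithmic energy on the
  circle, serves both. Applied to measures carried by a divergence set it rules them out; applied to
  normalised arc length, which also has finite energy, it bounds the radial maximal function in the
  mean. It is proved by duality: the moments of such a measure satisfy a bound on sum |x_n|^2 / n,
  because sum (z cnj w)^n / n is a logarithmic kernel. \<open>null_on\<close>,
  \<open>cnt_limit\<close> and \<open>collar_nbhd\<close> each choose a biholomorphism of their own;
  Lipschitz bounds for disc automorphisms carry their information to the given \<open>f\<close>. The
  domain may contain infinity, so the length-area argument is preceded by the choice of a chart in
  which the domain is bounded, and circles are taken beyond the single possible pole of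
  \<open>f\<close>.\<close>

definition vec_of_complex :: "complex \<Rightarrow> real^2" where
  "vec_of_complex z = vector [Re z, Im z]"

text \<open>The plane is identified with \<open>real^2\<close> because the Jacobian formula for the
  measure of an image is phrased with the determinant of a matrix.\<close>

definition complex_of_vec :: "real^2 \<Rightarrow> complex" where
  "complex_of_vec v = Complex (v$1) (v$2)"

lemma vec_of_complex_nth [simp]: "vec_of_complex z $ 1 = Re z" "vec_of_complex z $ 2 = Im z"
  by (auto simp: vec_of_complex_def)

lemma complex_of_vec_inverse [simp]: "vec_of_complex (complex_of_vec v) = v"
  by (auto simp: vec_eq_iff forall_2 complex_of_vec_def)

lemma vec_of_complex_inverse [simp]: "complex_of_vec (vec_of_complex v) = v"
  by (auto simp: complex_of_vec_def)

lemma linear_vec_of_complex: "bounded_linear vec_of_complex"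
  by (rule linear_conv_bounded_linear[THEN iffD1], rule linearI)
     (auto simp: vec_eq_iff forall_2)

lemma linear_complex_of_vec: "bounded_linear complex_of_vec"
  by (rule linear_conv_bounded_linear[THEN iffD1], rule linearI)
     (auto simp: complex_of_vec_def complex_eq_iff)

lemma vec_of_complex_measurable [measurable]: "vec_of_complex \<in> borel_measurable borel"
  by (intro borel_measurable_continuous_onI linear_continuous_on linear_vec_of_complex)

lemma complex_of_vec_measurable [measurable]: "complex_of_vec \<in> borel_measurable borel"
  by (intro borel_measurable_continuous_onI linear_continuous_on linear_complex_of_vec)

lemma lborel_vec_of_complex: "lborel = distr lborel borel vec_of_complex"
proof (rule lborel_eqI)
  fix l u :: "real^2"
  assume le: "\<And>b. b \<in> Basis \<Longrightarrow> l \<bullet> b \<le> u \<bullet> b"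
  have "vec_of_complex -` box l u = box (complex_of_vec l) (complex_of_vec u)"
    by (auto simp: box_def complex_of_vec_def Basis_vec_def inner_axis Basis_complex_def forall_2)
  moreover have "l $ 1 \<le> u $ 1" "l $ 2 \<le> u $ 2"
    using le[of "axis 1 1"] le[of "axis 2 1"] by (auto simp: Basis_vec_def inner_axis)
  ultimately show "emeasure (distr lborel borel vec_of_complex) (box l u) = (\<Prod>b\<in>Basis. (u - l) \<bullet> b)"
    by (subst emeasure_distr)
       (auto simp: emeasure_lborel_box_eq Basis_complex_def complex_of_vec_def Basis_vec_def
        prod.UNION_disjoint UNIV_2 inner_axis axis_eq_axis)
qed auto

lemma lborel_complex_of_vec: "lborel = distr lborel borel complex_of_vec"
proof -
  have "distr (distr lborel borel vec_of_complex) borel complex_of_vec = distr lborel borel (\<lambda>x. x)"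
    by (subst distr_distr) (auto simp: o_def)
  then show ?thesis
    by (metis distr_id2 lborel_vec_of_complex sets_lborel)
qed

text \<open>Multiplication by c is a rotation combined with scaling by |c|, so its Jacobian is
  |c|^2. This is the origin of the factor |deriv|^2 in every conformal area formula below.\<close>

lemma det_complex_mult:
  "det (matrix (\<lambda>h. vec_of_complex (c * complex_of_vec h))) = (cmod c)\<^sup>2"
  unfolding det_2 cmod_power2 matrix_def
  by (simp add: complex_of_vec_def axis_def power2_eq_square)

lemma continuous_on_deriv_holomorphic:
  assumes "f holomorphic_on S" "open S"
  shows "continuous_on S (deriv f)"
  using assms holomorphic_deriv holomorphic_on_imp_continuous_on by blast

text \<open>An injective holomorphic map has a holomorphic inverse, so the image of T is a preimage
  under a continuous map on an open set and hence Borel. The area formula is the real change of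
  variables in \<open>real^2\<close>, split according to whether the Jacobian is integrable.\<close>

lemma emeasure_conformal_image:
  assumes S: "open S" and hol: "\<phi> holomorphic_on S" and inj: "inj_on \<phi> S"
    and T: "T \<in> sets borel" "T \<subseteq> S"
  shows "\<phi> ` T \<in> sets borel"
    and "emeasure lborel (\<phi> ` T) = (\<integral>\<^sup>+z\<in>T. ennreal ((cmod (deriv \<phi> z))\<^sup>2) \<partial>lborel)"
proof -
  obtain \<psi> where psi: "\<psi> holomorphic_on \<phi> ` S" "\<And>z. z \<in> S \<Longrightarrow> \<psi> (\<phi> z) = z"
    using holomorphic_has_inverse[OF hol S inj] by metis
  have oS: "open (\<phi> ` S)"
    using open_mapping_thm3[OF hol S inj] .
  have img: "\<phi> ` T = \<psi> -` T \<inter> \<phi> ` S"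
    using T psi by (auto simp: image_iff)
  have "\<psi> -` T \<inter> \<phi> ` S \<in> sets borel"
    using borel_measurable_continuous_on_restrict[of "\<phi> ` S" \<psi>] psi(1) T(1) oS
    by (auto simp: holomorphic_on_imp_continuous_on measurable_def space_restrict_space
        sets_restrict_space_iff)
  then show borel: "\<phi> ` T \<in> sets borel"
    using img by simp
  let ?v = vec_of_complex and ?c = complex_of_vec
  define T' where "T' = ?c -` T"
  define g where "g = (\<lambda>x. ?v (\<phi> (?c x)))"
  define k where "k = (\<lambda>x. (cmod (deriv \<phi> (?c x)))\<^sup>2)"
  have T': "T' \<in> sets borel" unfolding T'_def
    using measurable_sets_borel[OF complex_of_vec_measurable T(1)] .
  have gT: "g ` T' = ?c -` (\<phi> ` T)"
  proof (intro set_eqI iffI)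
    fix x assume "x \<in> ?c -` (\<phi> ` T)"
    then obtain z where z: "z \<in> T" "?c x = \<phi> z" by auto
    then have "x = g (?v z)" unfolding g_def by (metis complex_of_vec_inverse vec_of_complex_inverse)
    then show "x \<in> g ` T'" using z unfolding T'_def by auto
  qed (auto simp: g_def T'_def)
  have gTb: "g ` T' \<in> sets borel"
    unfolding gT using measurable_sets_borel[OF complex_of_vec_measurable borel] .
  have eg: "emeasure lborel (\<phi> ` T) = emeasure lborel (g ` T')"
    unfolding gT using borel
    by (subst lborel_complex_of_vec, subst emeasure_distr) auto
  have der: "(g has_derivative (\<lambda>h. ?v (deriv \<phi> (?c x) * ?c h))) (at x within T')" if "x \<in> T'" for x
  proof -
    have "(\<phi> has_field_derivative deriv \<phi> (?c x)) (at (?c x))"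
      by (rule holomorphic_derivI[OF hol S]) (use that T in \<open>auto simp: T'_def\<close>)
    then have "(\<phi> has_derivative (\<lambda>h. deriv \<phi> (?c x) * h)) (at (?c x))"
      by (simp add: has_field_derivative_def)
    then have "(\<phi> has_derivative (\<lambda>h. deriv \<phi> (?c x) * h)) (at (?c x) within ?c ` T')"
      by (rule has_derivative_at_withinI)
    from has_derivative_in_compose[OF bounded_linear_imp_has_derivative[OF linear_complex_of_vec] this]
    have "((\<lambda>x. \<phi> (?c x)) has_derivative (\<lambda>h. deriv \<phi> (?c x) * ?c h)) (at x within T')" .
    from bounded_linear.has_derivative[OF linear_vec_of_complex this]
    show ?thesis unfolding g_def .
  qed
  have injg: "inj_on g T'"
    using inj T unfolding g_def T'_def inj_on_def
    by (metis complex_of_vec_inverse subset_iff vec_of_complex_inverse vimageE)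
  have kdet: "\<bar>det (matrix (\<lambda>h. ?v (deriv \<phi> (?c x) * ?c h)))\<bar> = k x" for x
    unfolding det_complex_mult k_def by simp
  have leb: "T' \<in> sets lebesgue" using T' by auto
  have km: "(\<lambda>x. indicator T' x * k x) \<in> borel_measurable borel"
  proof -
    have "(\<lambda>z. indicator T z *\<^sub>R deriv \<phi> z) \<in> borel_measurable borel"
    proof -
      have "(\<lambda>z. indicator S z *\<^sub>R deriv \<phi> z) \<in> borel_measurable borel"
        by (rule borel_measurable_continuous_on_indicator) (use S continuous_on_deriv_holomorphic[OF hol S] in auto)
      then have "(\<lambda>z. indicator T z *\<^sub>R (indicator S z *\<^sub>R deriv \<phi> z)) \<in> borel_measurable borel"
        using T(1) by measurable
      moreover have "(\<lambda>z. indicator T z *\<^sub>R (indicator S z *\<^sub>R deriv \<phi> z)) = (\<lambda>z. indicator T z *\<^sub>R deriv \<phi> z)"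
        using T by (intro ext) (auto simp: indicator_def)
      ultimately show ?thesis by simp
    qed
    then have "(\<lambda>x. (cmod (indicator T (?c x) *\<^sub>R deriv \<phi> (?c x)))\<^sup>2) \<in> borel_measurable borel"
      by measurable
    moreover have "(\<lambda>x. (cmod (indicator T (?c x) *\<^sub>R deriv \<phi> (?c x)))\<^sup>2) = (\<lambda>x. indicator T' x * k x)"
      unfolding T'_def k_def by (auto simp: indicator_def)
    ultimately show ?thesis by simp
  qed
  have nn: "(\<integral>\<^sup>+z\<in>T. ennreal ((cmod (deriv \<phi> z))\<^sup>2) \<partial>lborel) = (\<integral>\<^sup>+x. ennreal (indicator T' x * k x) \<partial>lborel)"
  proof -
    have "(\<integral>\<^sup>+z\<in>T. ennreal ((cmod (deriv \<phi> z))\<^sup>2) \<partial>lborel) = (\<integral>\<^sup>+z. ennreal (indicator T' (?v z) * k (?v z)) \<partial>lborel)"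
      by (intro nn_integral_cong) (auto simp: T'_def k_def indicator_def)
    also have "\<dots> = (\<integral>\<^sup>+x. ennreal (indicator T' x * k x) \<partial>distr lborel borel ?v)"
      using km by (subst nn_integral_distr) auto
    finally show ?thesis using lborel_vec_of_complex by simp
  qed
  have eqk: "(\<lambda>x. indicator T' x * k x) = (\<lambda>x. if x \<in> T' then k x else 0)"
    by (auto simp: indicator_def)
  have ion: "(\<lambda>x. indicator T' x * k x) integrable_on UNIV \<longleftrightarrow> k integrable_on T'"
    unfolding eqk by (rule integrable_restrict_UNIV)
  have iv: "integral UNIV (\<lambda>x. indicator T' x * k x) = integral T' k"
    unfolding eqk by (rule integral_restrict_UNIV)
  have nonneg: "0 \<le> indicator T' x * k x" for x
    by (auto simp: k_def)
  show "emeasure lborel (\<phi> ` T) = (\<integral>\<^sup>+z\<in>T. ennreal ((cmod (deriv \<phi> z))\<^sup>2) \<partial>lborel)"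
  proof (cases "k integrable_on T'")
    case True
    have "measure lebesgue (g ` T') = integral T' k"
      using measure_differentiable_image_eq[OF leb der injg] True unfolding kdet by blast
    moreover have lm: "g ` T' \<in> lmeasurable"
      using measurable_differentiable_image_eq[OF leb der injg] True unfolding kdet by blast
    ultimately have "emeasure lebesgue (g ` T') = ennreal (integral T' k)"
      by (metis emeasure_eq_measure2)
    then have "emeasure lborel (g ` T') = ennreal (integral T' k)"
      using gTb by simp
    moreover have "((\<lambda>x. indicator T' x * k x) has_integral integral T' k) UNIV"
      using ion iv True integrable_integral by metis
    then have "(\<integral>\<^sup>+x. ennreal (indicator T' x * k x) \<partial>lborel) = ennreal (integral T' k)"
      using nn_integral_has_integral_lborel[OF km nonneg] by blast
    ultimately show ?thesis using eg nn by simp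
  next
    case False
    \<comment> \<open>If the Jacobian is not integrable, the image has infinite measure and the
      nonnegative integral diverges, so the formula holds with both sides infinite.\<close>
    then have "g ` T' \<notin> lmeasurable"
      using measurable_differentiable_image_eq[OF leb der injg] unfolding kdet by blast
    then have "emeasure lborel (g ` T') = \<infinity>"
      using gTb by (auto simp: fmeasurable_def less_top[symmetric])
    moreover have "(\<integral>\<^sup>+x. ennreal (indicator T' x * k x) \<partial>lborel) = \<infinity>"
    proof (rule ccontr)
      assume "\<not> ?thesis"
      then have "(\<lambda>x. indicator T' x * k x) integrable_on UNIV"
        using nn_integral_integrable_on[OF km nonneg] by (simp add: less_top)
      then show False using False ion by simp
    qed
    ultimately show ?thesis using eg nn by simp
  qed
qed

text \<open>Two measures are compared: the image under the map of the density |deriv|^2, and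
  Lebesgue measure restricted to the image set. They agree on Borel sets by the area formula, hence
  integrate every nonnegative g alike.\<close>

lemma nn_integral_conformal:
  assumes S: "open S" and hol: "\<phi> holomorphic_on S" and inj: "inj_on \<phi> S"
    and g [measurable]: "g \<in> borel_measurable borel"
  shows "(\<integral>\<^sup>+w\<in>\<phi> ` S. g w \<partial>lborel) = (\<integral>\<^sup>+z\<in>S. g (\<phi> z) * ennreal ((cmod (deriv \<phi> z))\<^sup>2) \<partial>lborel)"
proof -
  have oS: "open (\<phi> ` S)"
    using open_mapping_thm3[OF hol S inj] .
  have [measurable]: "S \<in> sets borel" "\<phi> ` S \<in> sets borel"
    using S oS by auto
  \<comment> \<open>Extension by 0 turns the map into a Borel function on the whole plane; the
    values off \<open>S\<close> have no weight because the density \<open>d\<close> vanishes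
    there.\<close>
  define \<phi>' where "\<phi>' = (\<lambda>z. indicator S z *\<^sub>R \<phi> z)"
  have [measurable]: "\<phi>' \<in> borel_measurable borel" unfolding \<phi>'_def
    by (rule borel_measurable_continuous_on_indicator) (use S hol in \<open>auto intro: holomorphic_on_imp_continuous_on\<close>)
  define d where "d = (\<lambda>z. ennreal ((cmod (indicator S z *\<^sub>R deriv \<phi> z))\<^sup>2))"
  have [measurable]: "d \<in> borel_measurable borel"
  proof -
    have "(\<lambda>z. indicator S z *\<^sub>R deriv \<phi> z) \<in> borel_measurable borel"
      by (rule borel_measurable_continuous_on_indicator) (use S continuous_on_deriv_holomorphic[OF hol S] in auto)
    then show ?thesis unfolding d_def by measurable
  qed
  define M where "M = distr (density lborel d) borel \<phi>'"
  have eqM: "M = density lborel (indicator (\<phi> ` S))"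
  proof (rule measure_eqI)
    show "sets M = sets (density lborel (indicator (\<phi> ` S)))" by (simp add: M_def)
    fix B assume "B \<in> sets M"
    then have B [measurable]: "B \<in> sets borel" by (simp add: M_def)
    define T where "T = \<phi>' -` B \<inter> S"
    have T: "T \<in> sets borel" "T \<subseteq> S" unfolding T_def
      using measurable_sets_borel[OF \<open>\<phi>' \<in> borel_measurable borel\<close> B] S by auto
    have "emeasure M B = (\<integral>\<^sup>+z. d z * indicator (\<phi>' -` B) z \<partial>lborel)"
      unfolding M_def using measurable_sets_borel[OF \<open>\<phi>' \<in> borel_measurable borel\<close> B]
      by (subst emeasure_distr) (auto simp: emeasure_density)
    also have "\<dots> = (\<integral>\<^sup>+z\<in>T. ennreal ((cmod (deriv \<phi> z))\<^sup>2) \<partial>lborel)"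
      by (intro nn_integral_cong) (auto simp: T_def d_def indicator_def)
    also have "\<dots> = emeasure lborel (\<phi> ` T)"
      using emeasure_conformal_image(2)[OF S hol inj T] by simp
    also have "\<phi> ` T = \<phi> ` S \<inter> B"
      by (auto simp: T_def \<phi>'_def)
    also have "emeasure lborel (\<phi> ` S \<inter> B) = emeasure (density lborel (indicator (\<phi> ` S))) B"
      by (subst emeasure_density) (auto simp flip: indicator_inter_arith simp: Int_commute)
    finally show "emeasure M B = emeasure (density lborel (indicator (\<phi> ` S))) B" .
  qed
  have "(\<integral>\<^sup>+w\<in>\<phi> ` S. g w \<partial>lborel) = (\<integral>\<^sup>+w. g w \<partial>M)"
    unfolding eqM by (subst nn_integral_density) (auto simp: mult.commute)
  also have "\<dots> = (\<integral>\<^sup>+z. d z * g (\<phi>' z) \<partial>lborel)"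
    unfolding M_def by (subst nn_integral_distr) (auto simp: nn_integral_density)
  also have "\<dots> = (\<integral>\<^sup>+z\<in>S. g (\<phi> z) * ennreal ((cmod (deriv \<phi> z))\<^sup>2) \<partial>lborel)"
    by (intro nn_integral_cong) (auto simp: d_def \<phi>'_def indicator_def mult.commute)
  finally show ?thesis .
qed

section \<open>Iterated integrals and logarithmic polar coordinates\<close>

lemma lborel_complex_eq_pair:
  "(lborel :: complex measure) = distr (lborel \<Otimes>\<^sub>M lborel) borel (\<lambda>(x, y). Complex x y)"
proof -
  have [measurable]: "(\<lambda>z::real\<times>real. Complex (fst z) (snd z)) \<in> borel_measurable borel"
    unfolding Complex_eq by (intro borel_measurable_continuous_onI continuous_intros)
  have "lborel = distr (lborel :: (real\<times>real) measure) borel (\<lambda>z. Complex (fst z) (snd z))"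
  proof (rule lborel_eqI)
    fix l u :: complex
    assume le: "\<And>b. b \<in> Basis \<Longrightarrow> l \<bullet> b \<le> u \<bullet> b"
    have "(\<lambda>z. Complex (fst z) (snd z)) -` box l u = box (Re l, Im l) (Re u, Im u)"
      by (auto simp: box_def Basis_complex_def Basis_prod_def)
    moreover have "Re l \<le> Re u" "Im l \<le> Im u"
      using le[of 1] le[of "\<i>"] by (auto simp: Basis_complex_def)
    ultimately show "emeasure (distr (lborel :: (real\<times>real) measure) borel (\<lambda>z. Complex (fst z) (snd z))) (box l u) = (\<Prod>b\<in>Basis. (u - l) \<bullet> b)"
      by (subst emeasure_distr)
       (auto simp: emeasure_lborel_box_eq Basis_complex_def Basis_prod_def)
  qed auto
  then show ?thesis by (simp add: lborel_prod case_prod_unfold)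
qed

lemma nn_integral_complex_iterated:
  assumes [measurable]: "g \<in> borel_measurable borel"
  shows "(\<integral>\<^sup>+z. g z \<partial>lborel) = (\<integral>\<^sup>+x. \<integral>\<^sup>+y. g (Complex x y) \<partial>lborel \<partial>lborel)"
proof -
  have [measurable]: "(\<lambda>z::real\<times>real. Complex (fst z) (snd z)) \<in> borel_measurable borel"
    unfolding Complex_eq by (intro borel_measurable_continuous_onI continuous_intros)
  have [measurable]: "(\<lambda>z::real\<times>real. Complex (fst z) (snd z)) \<in> (lborel \<Otimes>\<^sub>M lborel) \<rightarrow>\<^sub>M borel"
    by (simp add: lborel_prod)
  have "(\<integral>\<^sup>+z. g z \<partial>lborel) = (\<integral>\<^sup>+z. g (Complex (fst z) (snd z)) \<partial>(lborel \<Otimes>\<^sub>M lborel))"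
    by (subst lborel_complex_eq_pair) (simp add: nn_integral_distr case_prod_unfold)
  also have "\<dots> = (\<integral>\<^sup>+x. \<integral>\<^sup>+y. g (Complex x y) \<partial>lborel \<partial>lborel)"
    by (subst lborel.nn_integral_fst[symmetric]) (auto)
  finally show ?thesis .
qed

text \<open>The exponential maps a strip of height 2 pi conformally onto the plane minus a ray, with
  Jacobian exp(2t); the image is not the whole plane, hence an inequality. The centre
  \<open>a\<close> and the cut direction \<open>b\<close> are kept free so that circles about
  boundary points of the disc can be treated.\<close>

lemma nn_integral_log_polar_le:
  assumes g [measurable]: "g \<in> borel_measurable borel"
  shows "(\<integral>\<^sup>+t. (\<integral>\<^sup>+\<theta>\<in>{b<..<b + 2 * pi}. (g (a + exp (Complex t \<theta>)) * ennreal (exp (2 * t))) \<partial>lborel) \<partial>lborel)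
           \<le> (\<integral>\<^sup>+z. g z \<partial>lborel)"
proof -
  define S where "S = {z. Im z > b} \<inter> {z. Im z < b + 2 * pi}"
  define \<phi> where "\<phi> = (\<lambda>z. a + exp z)"
  have S: "open S" unfolding S_def
    by (intro open_Int open_halfspace_Im_gt open_halfspace_Im_lt)
  have hol: "\<phi> holomorphic_on S" unfolding \<phi>_def by (intro holomorphic_intros)
  have inj: "inj_on \<phi> S"
  proof (rule inj_onI)
    fix x y assume xy: "x \<in> S" "y \<in> S" "\<phi> x = \<phi> y"
    show "x = y"
      by (rule exp_complex_eqI) (use xy in \<open>auto simp: \<phi>_def S_def\<close>)
  qed
  have d: "deriv \<phi> z = exp z" for z
    unfolding \<phi>_def by (rule DERIV_imp_deriv) (auto intro!: derivative_eq_intros)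
  have [measurable]: "S \<in> sets borel" using S by auto
  have [measurable]: "\<phi> \<in> borel_measurable borel" unfolding \<phi>_def by measurable
  have "(\<integral>\<^sup>+t. (\<integral>\<^sup>+\<theta>\<in>{b<..<b + 2 * pi}. (g (a + exp (Complex t \<theta>)) * ennreal (exp (2 * t))) \<partial>lborel) \<partial>lborel)
      = (\<integral>\<^sup>+t. \<integral>\<^sup>+\<theta>. g (\<phi> (Complex t \<theta>)) * ennreal ((cmod (exp (Complex t \<theta>)))\<^sup>2) * indicator S (Complex t \<theta>) \<partial>lborel \<partial>lborel)"
    by (intro nn_integral_cong)
       (auto simp: \<phi>_def S_def indicator_def power2_eq_square simp flip: exp_add)
  also have "\<dots> = (\<integral>\<^sup>+z\<in>S. g (\<phi> z) * ennreal ((cmod (exp z))\<^sup>2) \<partial>lborel)"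
    by (subst nn_integral_complex_iterated) auto
  also have "\<dots> = (\<integral>\<^sup>+w\<in>\<phi> ` S. g w \<partial>lborel)"
    by (subst nn_integral_conformal[OF S hol inj g]) (simp add: d)
  also have "\<dots> \<le> (\<integral>\<^sup>+z. g z \<partial>lborel)"
    by (intro nn_integral_mono) (auto simp: indicator_def)
  finally show ?thesis .
qed

subsection \<open>Laurent splitting on an annulus\<close>

abbreviation annulus :: "real \<Rightarrow> complex set" where
  "annulus r \<equiv> {z. r < cmod z \<and> cmod z < 1}"

abbreviation square_integral :: "complex set \<Rightarrow> (complex \<Rightarrow> complex) \<Rightarrow> ennreal" where
  "square_integral S p \<equiv> \<integral>\<^sup>+z\<in>S. ennreal ((cmod (p z))\<^sup>2) \<partial>lborel"

lemma open_annulus: "open {z::complex. a < cmod z \<and> cmod z < b}"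
  by (intro open_Collect_conj open_Collect_less continuous_intros)

lemma contour_integral_circle_eq:
  "contour_integral (circlepath 0 s) g = integral {0..2*pi} (\<lambda>\<theta>. g (of_real s * cis \<theta>) * of_real s * \<i> * cis \<theta>)"
  unfolding circlepath_def by (subst contour_integral_part_circlepath_eq) auto

lemma contour_integral_circle_indep:
  assumes hol: "g holomorphic_on {z. a < cmod z \<and> cmod z < b}"
    and "0 < s" "a < s" "s < b" "0 < t" "a < t" "t < b"
  shows "contour_integral (circlepath 0 s) g = contour_integral (circlepath 0 t) g"
proof (rule Cauchy_theorem_homotopic_loops[OF _ open_annulus hol])
  show "homotopic_loops {z. a < cmod z \<and> cmod z < b} (circlepath 0 s) (circlepath 0 t)"
  proof (rule homotopic_loops_linear)
    fix x :: real assume "x \<in> {0..1}"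
    let ?e = "exp (2 * complex_of_real pi * \<i> * of_real x)"
    have n: "cmod ?e = 1" by (simp add: norm_exp_eq_Re)
    show "closed_segment (circlepath 0 s x) (circlepath 0 t x) \<subseteq> {z. a < cmod z \<and> cmod z < b}"
    proof
      fix z assume "z \<in> closed_segment (circlepath 0 s x) (circlepath 0 t x)"
      then obtain u where u: "0 \<le> u" "u \<le> 1" "z = (1 - u) *\<^sub>R (of_real s * ?e) + u *\<^sub>R (of_real t * ?e)"
        by (auto simp: closed_segment_def circlepath)
      have z: "z = of_real ((1 - u) * s + u * t) * ?e"
        unfolding u(3) by (simp add: scaleR_conv_of_real algebra_simps)
      have pos: "0 \<le> (1 - u) * s + u * t" using u assms by auto
      have cz: "cmod z = (1 - u) * s + u * t"
        unfolding z norm_mult n norm_of_real using pos by simp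
      have "a < (1 - u) * s + u * t"
        using convex_bound_lt[of "-s" "-a" "-t" "1 - u" u] u assms by auto
      moreover have "(1 - u) * s + u * t < b"
        using convex_bound_lt[of s b t "1 - u" u] u assms by auto
      ultimately show "z \<in> {z. a < cmod z \<and> cmod z < b}" using cz by simp
    qed
  qed auto
qed auto

text \<open>Covers both Cauchy kernels of a Laurent splitting: 1/(w - z) for the regular part and
  1/(1 - w z) for the principal part, written in the reciprocal variable.\<close>

lemma holomorphic_on_kernel_integral:
  fixes k u v :: "real \<Rightarrow> complex"
  assumes "continuous_on {0..c} k" "continuous_on {0..c} u" "continuous_on {0..c} v"
    and "convex U" and nz: "\<And>z \<theta>. z \<in> U \<Longrightarrow> \<theta> \<in> {0..c} \<Longrightarrow> u \<theta> - v \<theta> * z \<noteq> 0"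
  shows "(\<lambda>z. integral {0..c} (\<lambda>\<theta>. k \<theta> / (u \<theta> - v \<theta> * z))) holomorphic_on U"
proof -
  have "(\<lambda>z. integral (cbox 0 c) (\<lambda>\<theta>. k \<theta> / (u \<theta> - v \<theta> * z))) holomorphic_on U"
  proof (rule leibniz_rule_holomorphic[where fx = "\<lambda>z \<theta>. k \<theta> * v \<theta> / (u \<theta> - v \<theta> * z)^2"])
    fix z \<theta> assume z: "z \<in> U" "\<theta> \<in> cbox 0 c"
    have "((\<lambda>z. k \<theta> / (u \<theta> - v \<theta> * z)) has_field_derivative k \<theta> * v \<theta> / (u \<theta> - v \<theta> * z)^2) (at z)"
      using nz[of z \<theta>] z by (auto intro!: derivative_eq_intros simp: power2_eq_square)
    then show "((\<lambda>z. k \<theta> / (u \<theta> - v \<theta> * z)) has_field_derivative k \<theta> * v \<theta> / (u \<theta> - v \<theta> * z)^2) (at z within U)"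
      by (rule has_field_derivative_at_within)
  next
    fix z assume z: "z \<in> U"
    show "(\<lambda>\<theta>. k \<theta> / (u \<theta> - v \<theta> * z)) integrable_on cbox 0 c"
      by (rule integrable_continuous) (use assms z in \<open>auto intro!: continuous_intros\<close>)
  next
    have "continuous_on (U \<times> cbox 0 c) (\<lambda>x. k (snd x) * v (snd x) / (u (snd x) - v (snd x) * fst x)^2)"
      using assms nz
      by (intro continuous_intros) (auto intro!: continuous_on_compose2[of "{0..c}" _ _ snd] continuous_intros)
    then show "continuous_on (U \<times> cbox 0 c) (\<lambda>(z, \<theta>). k \<theta> * v \<theta> / (u \<theta> - v \<theta> * z)^2)"
      by (simp add: case_prod_unfold)
  qed (use assms in auto)
  then show ?thesis by simp
qed

lemma circle_continuous:
  assumes "continuous_on S p" "\<And>z. cmod z = \<bar>s\<bar> \<Longrightarrow> z \<in> S"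
  shows "continuous_on T (\<lambda>\<theta>. p (of_real s * cis \<theta>))"
  by (rule continuous_on_compose2[OF assms(1)]) (auto intro!: continuous_intros assms(2) simp: norm_mult)

lemma norm_inverse_less:
  fixes w :: complex
  assumes "0 < t" "t < cmod w"
  shows "cmod (1 / w) < 1 / t"
  using assms by (simp add: norm_divide frac_less2)

text \<open>Cauchy's formula for an annulus: p(z) is the difference of the Cauchy integrals over an
  outer and an inner circle. The inner one is holomorphic in 1/z and vanishes at infinity, which is
  the shape l(1/z)/z.\<close>

lemma laurent_split:
  assumes r: "0 \<le> r" "r < t" "t < 1" and hol: "p holomorphic_on annulus r"
  obtains p1 l where "p1 holomorphic_on ball 0 1" "l holomorphic_on ball 0 (1 / t)"
    "\<And>z. z \<in> annulus t \<Longrightarrow> p z = p1 z + l (1 / z) / z"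
proof -
  define s where "s = (t + 1) / 2"
  have s: "t < s" "s < 1" "0 < s" "0 < t" using r by (auto simp: s_def)
  have contp: "continuous_on (annulus r) p"
    using hol holomorphic_on_imp_continuous_on by blast
  have [simp]: "complex_of_real pi \<noteq> 0" by simp
  define C where "C = (\<lambda>z. integral {0..2*pi} (\<lambda>\<theta>. (p (of_real s * cis \<theta>) * of_real s * \<i> * cis \<theta> / (2 * of_real pi * \<i>)) / (of_real s * cis \<theta> - 1 * z)))"
  define l where "l = (\<lambda>z. integral {0..2*pi} (\<lambda>\<theta>. (p (of_real t * cis \<theta>) * of_real t * \<i> * cis \<theta> / (2 * of_real pi * \<i>)) / (1 - (of_real t * cis \<theta>) * z)))"
  have holC: "C holomorphic_on ball 0 s"
    unfolding C_def
  proof (rule holomorphic_on_kernel_integral)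
    show "of_real s * cis \<theta> - 1 * z \<noteq> 0" if "z \<in> ball 0 s" for z \<theta>
    proof
      assume "of_real s * cis \<theta> - 1 * z = 0"
      then have "cmod z = s" using s by (metis abs_of_pos mult_1 norm_cis norm_mult norm_of_real right_minus_eq mult.right_neutral)
      then show False using that by simp
    qed
  qed (use s r in \<open>auto intro!: continuous_intros circle_continuous[OF contp]\<close>)
  have holl: "l holomorphic_on ball 0 (1 / t)"
    unfolding l_def
  proof (rule holomorphic_on_kernel_integral)
    show "1 - of_real t * cis \<theta> * z \<noteq> 0" if "z \<in> ball 0 (1 / t)" for z \<theta>
    proof
      assume "1 - of_real t * cis \<theta> * z = 0"
      then have "cmod (of_real t * cis \<theta> * z) = 1" by (metis norm_one right_minus_eq)
      then have "t * cmod z = 1" using s by (simp add: norm_mult)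
      then show False using that s by (simp add: field_simps)
    qed
  qed (use s r in \<open>auto intro!: continuous_intros circle_continuous[OF contp]\<close>)
  have key: "p z = C z + l (1 / z) / z" if z: "t < cmod z" "cmod z < s" for z
  proof -
    have z0: "z \<noteq> 0" using z s by auto
    \<comment> \<open>The difference quotient has a removable singularity at z, so its integral does
      not depend on the radius. Separating its two terms on the outer and on the inner circle yields
      the formula, since 1/(w - z) integrates to 2 pi i on the former and to 0 on the
      latter.\<close>
    define g where "g = (\<lambda>w. if w = z then deriv p z else (p w - p z) / (w - z))"
    have holg: "g holomorphic_on annulus r"
      unfolding g_def using pole_lemma_open[OF hol open_annulus] .
    have eq: "contour_integral (circlepath 0 s) g = contour_integral (circlepath 0 t) g"
      by (rule contour_integral_circle_indep[OF holg]) (use s r in auto)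
    have I: "contour_integral (circlepath 0 \<rho>) g
         = contour_integral (circlepath 0 \<rho>) (\<lambda>w. p w / (w - z)) - p z * contour_integral (circlepath 0 \<rho>) (\<lambda>w. 1 / (w - z))"
      if \<rho>: "\<rho> = s \<or> \<rho> = t" for \<rho>
    proof -
      have pim: "path_image (circlepath 0 \<rho>) = sphere 0 \<rho>" "w \<noteq> z" "w \<in> annulus r" if "w \<in> sphere 0 \<rho>" for w
        using \<rho> that z s r by auto
      have sub: "path_image (circlepath 0 \<rho>) \<subseteq> annulus r - {z}"
        using \<rho> z s r by auto
      have op: "open (annulus r - {z})" by (intro open_delete open_annulus)
      have "contour_integral (circlepath 0 \<rho>) g = contour_integral (circlepath 0 \<rho>) (\<lambda>w. p w / (w - z) - p z * (1 / (w - z)))"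
      proof (rule contour_integral_cong)
        fix w assume "w \<in> path_image (circlepath 0 \<rho>)"
        then have "w \<noteq> z" using sub by auto
        then show "g w = p w / (w - z) - p z * (1 / (w - z))"
          unfolding g_def by (simp add: diff_divide_distrib)
      qed simp
      also have "\<dots> = contour_integral (circlepath 0 \<rho>) (\<lambda>w. p w / (w - z)) - contour_integral (circlepath 0 \<rho>) (\<lambda>w. p z * (1 / (w - z)))"
      proof (rule contour_integral_diff)
        show "(\<lambda>w. p w / (w - z)) contour_integrable_on circlepath 0 \<rho>"
          by (rule contour_integrable_holomorphic_simple[OF _ op _ sub])
             (auto intro!: holomorphic_intros holomorphic_on_subset[OF hol])
        show "(\<lambda>w. p z * (1 / (w - z))) contour_integrable_on circlepath 0 \<rho>"
          by (rule contour_integrable_holomorphic_simple[OF _ op _ sub])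
             (auto intro!: holomorphic_intros)
      qed
      also have "contour_integral (circlepath 0 \<rho>) (\<lambda>w. p z * (1 / (w - z))) = p z * contour_integral (circlepath 0 \<rho>) (\<lambda>w. 1 / (w - z))"
        by (rule contour_integral_lmul, rule contour_integrable_holomorphic_simple[OF _ op _ sub])
           (auto intro!: holomorphic_intros)
      finally show ?thesis .
    qed
    have Is: "contour_integral (circlepath 0 s) (\<lambda>w. 1 / (w - z)) = 2 * of_real pi * \<i>"
      using Cauchy_integral_circlepath_simple[of "\<lambda>_. 1" 0 s z] z
      by (auto intro!: contour_integral_unique)
    have It: "contour_integral (circlepath 0 t) (\<lambda>w. 1 / (w - z)) = 0"
    proof (rule contour_integral_unique, rule Cauchy_theorem_convex_simple[of _ "ball 0 (cmod z)"])
      show "(\<lambda>w. 1 / (w - z)) holomorphic_on ball 0 (cmod z)"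
        by (intro holomorphic_intros) auto
    qed (use z s in auto)
    have Cs: "contour_integral (circlepath 0 s) (\<lambda>w. p w / (w - z)) = 2 * of_real pi * \<i> * C z"
    proof -
      have gen: "c * (X / c / A) = X / A" if "c \<noteq> 0" for c X A :: complex
        using that by simp
      show ?thesis
        unfolding C_def contour_integral_circle_eq integral_mult_right[symmetric]
        by (intro integral_cong, subst gen) (auto simp: mult_ac)
    qed
    have Ct: "contour_integral (circlepath 0 t) (\<lambda>w. p w / (w - z)) = - (2 * of_real pi * \<i>) * (l (1 / z) / z)"
    proof -
      have "l (1 / z) / z = integral {0..2*pi} (\<lambda>\<theta>. (p (of_real t * cis \<theta>) * of_real t * \<i> * cis \<theta> / (2 * of_real pi * \<i>)) / (1 - (of_real t * cis \<theta>) * (1 / z)) * (1 / z))"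
        unfolding l_def by (subst integral_mult_left) simp
      then have "- (2 * of_real pi * \<i>) * (l (1 / z) / z) = integral {0..2*pi} (\<lambda>\<theta>. - (2 * of_real pi * \<i>) * ((p (of_real t * cis \<theta>) * of_real t * \<i> * cis \<theta> / (2 * of_real pi * \<i>)) / (1 - (of_real t * cis \<theta>) * (1 / z)) * (1 / z)))"
        by (subst integral_mult_right) simp
      also have "\<dots> = integral {0..2*pi} (\<lambda>\<theta>. p (of_real t * cis \<theta>) / (of_real t * cis \<theta> - z) * of_real t * \<i> * cis \<theta>)"
      proof (rule integral_cong)
        fix \<theta> :: real
        have "cmod (of_real t * cis \<theta>) \<noteq> cmod z" using z s by (simp add: norm_mult)
        then have ne: "of_real t * cis \<theta> - z \<noteq> 0" by auto
        then have ne': "1 - (of_real t * cis \<theta>) * (1 / z) \<noteq> 0" using z0 by (auto simp: field_simps)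
        have d: "(1 - (of_real t * cis \<theta>) * (1 / z)) * z = - (of_real t * cis \<theta> - z)"
          using z0 by (simp add: field_simps)
        have gen: "- c * (X / c / A * (1 / z)) = - (X / (A * z))" if "c \<noteq> 0" for c X A :: complex
          using that by simp
        show "- (2 * of_real pi * \<i>) * ((p (of_real t * cis \<theta>) * of_real t * \<i> * cis \<theta> / (2 * of_real pi * \<i>)) / (1 - (of_real t * cis \<theta>) * (1 / z)) * (1 / z)) = p (of_real t * cis \<theta>) / (of_real t * cis \<theta> - z) * of_real t * \<i> * cis \<theta>"
          by (subst gen, simp, subst d, simp) (metis minus_diff_eq minus_divide_right)
      qed
      also have "\<dots> = contour_integral (circlepath 0 t) (\<lambda>w. p w / (w - z))"
        unfolding contour_integral_circle_eq ..
      finally show ?thesis by simp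
    qed
    have "2 * of_real pi * \<i> * C z - p z * (2 * of_real pi * \<i>) = - (2 * of_real pi * \<i>) * (l (1 / z) / z)"
      using eq I[of s] I[of t] Is It Cs Ct by simp
    then have "(2 * of_real pi * \<i>) * (C z + l (1 / z) / z - p z) = 0" by (simp add: algebra_simps)
    then show ?thesis by simp
  qed
  \<comment> \<open>The Cauchy integral \<open>C\<close> represents the regular part only inside
    radius \<open>s\<close>; the difference of p and the principal part continues it to the rest of
    the unit disc.\<close>
  define p1 where "p1 = (\<lambda>z. if cmod z < s then C z else p z - l (1 / z) / z)"
  have p1': "p1 z = p z - l (1 / z) / z" if "z \<in> annulus t" for z
    using key[of z] that by (auto simp: p1_def)
  have "p1 holomorphic_on ball 0 s \<union> annulus t"
  proof (rule holomorphic_on_Un)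
    show "p1 holomorphic_on ball 0 s"
      using holC by (rule holomorphic_transform) (auto simp: p1_def)
    have "(\<lambda>z. l (1 / z)) holomorphic_on annulus t"
      by (rule holomorphic_on_compose_gen[OF _ holl, unfolded o_def, of "\<lambda>z. 1 / z"])
         (use s norm_inverse_less in \<open>auto intro!: holomorphic_intros\<close>)
    then have "(\<lambda>z. p z - l (1 / z) / z) holomorphic_on annulus t"
      using r s by (intro holomorphic_intros holomorphic_on_subset[OF hol]) auto
    then show "p1 holomorphic_on annulus t"
      by (rule holomorphic_transform) (use p1' in auto)
  qed (auto simp: open_annulus)
  moreover have "ball 0 s \<union> annulus t = ball (0::complex) 1" using s by auto
  ultimately have "p1 holomorphic_on ball 0 1" by simp
  then show ?thesis
    using that[of p1 l] holl p1' by (simp add: algebra_simps)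
qed

text \<open>If H is a primitive of h, then -H(1/w) is a single-valued primitive of h(1/w)/w^2
  outside radius t. This is what removes principal parts from coefficient integrals.\<close>

lemma contour_integral_inverse_square:
  assumes h: "h holomorphic_on ball 0 (1 / t)" and t: "0 < t" "t < \<rho>"
  shows "((\<lambda>w. h (1 / w) / w\<^sup>2) has_contour_integral 0) (circlepath 0 \<rho>)"
proof -
  obtain H where H: "\<And>x. x \<in> ball 0 (1 / t) \<Longrightarrow> (H has_field_derivative h x) (at x within ball 0 (1/t))"
    using holomorphic_convex_primitive'[OF _ _ h] by auto
  show ?thesis
  proof (rule Cauchy_theorem_primitive[of "{w. t < cmod w}" "\<lambda>w. - H (1 / w)"])
    fix w :: complex assume w: "w \<in> {w. t < cmod w}"
    then have w0: "w \<noteq> 0" using t by auto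
    have "1 / w \<in> ball 0 (1 / t)" using w t norm_inverse_less by auto
    then have "(H has_field_derivative h (1 / w)) (at (1 / w))"
      using H by (metis at_within_open open_ball)
    moreover have "((\<lambda>w. 1 / w) has_field_derivative - 1 / w\<^sup>2) (at w)"
      using w0 by (auto intro!: derivative_eq_intros simp: power2_eq_square)
    ultimately have "((\<lambda>w. H (1 / w)) has_field_derivative h (1 / w) * (- 1 / w\<^sup>2)) (at w)"
      by (rule DERIV_chain2)
    then have "((\<lambda>w. - H (1 / w)) has_field_derivative - (h (1 / w) * (- 1 / w\<^sup>2))) (at w)"
      by (rule DERIV_minus)
    then show "((\<lambda>w. - H (1 / w)) has_field_derivative h (1 / w) / w\<^sup>2) (at w within {w. t < cmod w})"
      by (auto intro: has_field_derivative_at_within)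
  qed (use t in auto)
qed

text \<open>Division by w^(n+1) turns the principal part into a function of 1/w divided by w^2,
  which integrates to 0; only the Taylor coefficient of the regular part survives.\<close>

lemma laurent_coefficient:
  assumes r: "0 < t" "t < \<rho>" "\<rho> < 1"
    and p1: "p1 holomorphic_on ball 0 1" and l: "l holomorphic_on ball 0 (1 / t)"
    and eq: "\<And>z. z \<in> annulus t \<Longrightarrow> p z = p1 z + l (1 / z) / z"
  shows "contour_integral (circlepath 0 \<rho>) (\<lambda>w. p w / w ^ Suc n) = 2 * of_real pi * \<i> * ((deriv ^^ n) p1 0 / fact n)"
proof -
  have "((\<lambda>w. p1 w / (w - 0) ^ Suc n) has_contour_integral (2 * of_real pi * \<i> / fact n * (deriv ^^ n) p1 0)) (circlepath 0 \<rho>)"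
  proof -
    have "continuous_on (cball 0 \<rho>) p1" "p1 holomorphic_on ball 0 \<rho>" "0 \<in> ball (0::complex) \<rho>"
      using r by (auto intro!: holomorphic_on_imp_continuous_on holomorphic_on_subset[OF p1])
    from Cauchy_has_contour_integral_higher_derivative_circlepath[OF this, of n] show ?thesis by simp
  qed
  moreover have "((\<lambda>w. (l (1 / w) * (1 / w) ^ n) / w\<^sup>2) has_contour_integral 0) (circlepath 0 \<rho>)"
    by (rule contour_integral_inverse_square[of "\<lambda>\<zeta>. l \<zeta> * \<zeta> ^ n" t]) (use r l in \<open>auto intro!: holomorphic_intros\<close>)
  ultimately have "((\<lambda>w. p1 w / (w - 0) ^ Suc n + (l (1 / w) * (1 / w) ^ n) / w\<^sup>2) has_contour_integral (2 * of_real pi * \<i> / fact n * (deriv ^^ n) p1 0) + 0) (circlepath 0 \<rho>)"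
    by (rule has_contour_integral_add)
  then have "((\<lambda>w. p w / w ^ Suc n) has_contour_integral (2 * of_real pi * \<i> / fact n * (deriv ^^ n) p1 0) + 0) (circlepath 0 \<rho>)"
  proof (rule has_contour_integral_eq)
    fix w assume "w \<in> path_image (circlepath 0 \<rho>)"
    then have w: "w \<in> annulus t" using r by auto
    then have "w \<noteq> 0" using r by auto
    then show "p1 w / (w - 0) ^ Suc n + (l (1 / w) * (1 / w) ^ n) / w\<^sup>2 = p w / w ^ Suc n"
      unfolding eq[OF w] by (simp add: add_divide_distrib power_one_over power2_eq_square mult.commute mult.left_commute)
  qed
  then show ?thesis by (simp add: contour_integral_unique)
qed

subsection \<open>Bessel inequality and finite energy\<close>

lemma integral_cis:
  fixes k :: int
  shows "integral {0..2*pi} (\<lambda>\<theta>. cis (of_int k * \<theta>)) = (if k = 0 then 2 * of_real pi else 0)"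
proof (cases "k = 0")
  case False
  have "((\<lambda>\<theta>. cis (of_int k * \<theta>)) has_integral (cis (of_int k * (2*pi)) / (\<i> * of_int k) - cis (of_int k * 0) / (\<i> * of_int k))) {0..2*pi}"
  proof (rule fundamental_theorem_of_calculus)
    fix x :: real
    show "((\<lambda>\<theta>. cis (of_int k * \<theta>) / (\<i> * of_int k)) has_vector_derivative cis (of_int k * x)) (at x within {0..2*pi})"
      unfolding cis_conv_exp using False
      by (auto intro!: derivative_eq_intros has_vector_derivative_real_field simp: field_simps)
  qed simp
  moreover have "cis (of_int k * (2*pi)) = 1"
    using cis_multiple_2pi[of "of_int k"] by (simp add: mult.commute)
  ultimately show ?thesis using False by (simp add: integral_unique)
qed (simp add: scaleR_conv_of_real)

text \<open>Bessel's inequality for finitely many nonnegative frequencies: with S the Fourier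
  partial sum, both the cross term and the norm of S equal \<open>Q\<close>, so expanding |F - S|^2
  >= 0 leaves Q <= integral |F|^2.\<close>

lemma bessel_circle:
  fixes F :: "real \<Rightarrow> complex"
  assumes F: "continuous_on {0..2*pi} F"
    and d: "\<And>n. n \<le> N \<Longrightarrow> integral {0..2*pi} (\<lambda>\<theta>. F \<theta> * cis (- real n * \<theta>)) = 2 * of_real pi * d n"
  shows "2 * pi * (\<Sum>n\<le>N. (cmod (d n))\<^sup>2) \<le> integral {0..2*pi} (\<lambda>\<theta>. (cmod (F \<theta>))\<^sup>2)"
proof -
  define S where "S = (\<lambda>\<theta>. \<Sum>n\<le>N. d n * cis (real n * \<theta>))"
  have cS: "continuous_on {0..2*pi} S" unfolding S_def by (intro continuous_intros)
  note ci = integrable_continuous_interval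
  have cnjS: "cnj (S \<theta>) = (\<Sum>n\<le>N. cnj (d n) * cis (- real n * \<theta>))" for \<theta>
    unfolding S_def by (simp add: cis_cnj)
  have cc: "cnj z * (2 * of_real pi * z) = 2 * of_real pi * of_real ((cmod z)\<^sup>2)" for z
    by (simp only: complex_norm_square mult_ac)
  have FS: "integral {0..2*pi} (\<lambda>\<theta>. F \<theta> * cnj (S \<theta>)) = 2 * of_real pi * of_real (\<Sum>n\<le>N. (cmod (d n))\<^sup>2)"
  proof -
    have "integral {0..2*pi} (\<lambda>\<theta>. F \<theta> * cnj (S \<theta>)) = integral {0..2*pi} (\<lambda>\<theta>. \<Sum>n\<le>N. cnj (d n) * (F \<theta> * cis (- real n * \<theta>)))"
      unfolding cnjS by (intro integral_cong) (simp add: sum_distrib_left algebra_simps)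
    also have "\<dots> = (\<Sum>n\<le>N. cnj (d n) * (2 * of_real pi * d n))"
    proof (subst integral_sum)
      show "(\<Sum>n\<le>N. integral {0..2*pi} (\<lambda>\<theta>. cnj (d n) * (F \<theta> * cis (- real n * \<theta>)))) = (\<Sum>n\<le>N. cnj (d n) * (2 * of_real pi * d n))"
        by (intro sum.cong refl) (simp only: integral_mult_right d atMost_iff)
    qed (auto intro!: ci continuous_intros F)
    also have "\<dots> = 2 * of_real pi * of_real (\<Sum>n\<le>N. (cmod (d n))\<^sup>2)"
      by (simp only: cc of_real_sum of_real_mult sum_distrib_left)
    finally show ?thesis .
  qed
  have SS: "integral {0..2*pi} (\<lambda>\<theta>. S \<theta> * cnj (S \<theta>)) = 2 * of_real pi * of_real (\<Sum>n\<le>N. (cmod (d n))\<^sup>2)"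
  proof -
    have Sn: "integral {0..2*pi} (\<lambda>\<theta>. S \<theta> * cis (- real n * \<theta>)) = 2 * of_real pi * d n" if "n \<le> N" for n
    proof -
      have "integral {0..2*pi} (\<lambda>\<theta>. S \<theta> * cis (- real n * \<theta>)) = integral {0..2*pi} (\<lambda>\<theta>. \<Sum>m\<le>N. d m * cis (of_int (int m - int n) * \<theta>))"
        unfolding S_def sum_distrib_right
        by (intro integral_cong sum.cong refl) (simp add: cis_mult mult.assoc left_diff_distrib)
      also have "\<dots> = (\<Sum>m\<le>N. d m * (if int m - int n = 0 then 2 * of_real pi else 0))"
      proof (subst integral_sum)
        show "(\<Sum>m\<le>N. integral {0..2*pi} (\<lambda>\<theta>. d m * cis (of_int (int m - int n) * \<theta>))) = (\<Sum>m\<le>N. d m * (if int m - int n = 0 then 2 * of_real pi else 0))"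
          by (simp only: integral_mult_right integral_cis)
      qed (auto intro!: ci continuous_intros)
      also have "\<dots> = (\<Sum>m\<le>N. if m = n then d m * (2 * of_real pi) else 0)"
        by (intro sum.cong) auto
      also have "\<dots> = 2 * of_real pi * d n" using that by simp
      finally show ?thesis .
    qed
    have "integral {0..2*pi} (\<lambda>\<theta>. S \<theta> * cnj (S \<theta>)) = integral {0..2*pi} (\<lambda>\<theta>. \<Sum>n\<le>N. cnj (d n) * (S \<theta> * cis (- real n * \<theta>)))"
      unfolding cnjS by (intro integral_cong) (simp add: sum_distrib_left algebra_simps)
    also have "\<dots> = (\<Sum>n\<le>N. cnj (d n) * (2 * of_real pi * d n))"
    proof (subst integral_sum)
      show "(\<Sum>n\<le>N. integral {0..2*pi} (\<lambda>\<theta>. cnj (d n) * (S \<theta> * cis (- real n * \<theta>)))) = (\<Sum>n\<le>N. cnj (d n) * (2 * of_real pi * d n))"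
        by (intro sum.cong refl) (simp only: integral_mult_right Sn atMost_iff)
    qed (auto intro!: ci continuous_intros cS)
    also have "\<dots> = 2 * of_real pi * of_real (\<Sum>n\<le>N. (cmod (d n))\<^sup>2)"
      by (simp only: cc of_real_sum of_real_mult sum_distrib_left)
    finally show ?thesis .
  qed
  define Q where "Q = 2 * pi * (\<Sum>n\<le>N. (cmod (d n))\<^sup>2)"
  have FSr: "integral {0..2*pi} (\<lambda>\<theta>. Re (F \<theta> * cnj (S \<theta>))) = Q"
  proof -
    have "integral {0..2*pi} (\<lambda>\<theta>. Re (F \<theta> * cnj (S \<theta>))) = Re (integral {0..2*pi} (\<lambda>\<theta>. F \<theta> * cnj (S \<theta>)))"
      by (rule integral_linear[OF _ bounded_linear_Re, unfolded o_def]) (auto intro!: ci continuous_intros F cS)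
    then show ?thesis unfolding FS Q_def by simp
  qed
  have SSr: "integral {0..2*pi} (\<lambda>\<theta>. (cmod (S \<theta>))\<^sup>2) = Q"
  proof -
    have "integral {0..2*pi} (\<lambda>\<theta>. (cmod (S \<theta>))\<^sup>2) = integral {0..2*pi} (\<lambda>\<theta>. Re (S \<theta> * cnj (S \<theta>)))"
      by (intro integral_cong) (simp add: complex_norm_square[symmetric])
    also have "\<dots> = Re (integral {0..2*pi} (\<lambda>\<theta>. S \<theta> * cnj (S \<theta>)))"
      by (rule integral_linear[OF _ bounded_linear_Re, unfolded o_def]) (auto intro!: ci continuous_intros F cS)
    finally show ?thesis unfolding SS Q_def by simp
  qed
  have "0 \<le> integral {0..2*pi} (\<lambda>\<theta>. (cmod (F \<theta> - S \<theta>))\<^sup>2)"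
    by (rule Henstock_Kurzweil_Integration.integral_nonneg) (auto intro!: ci continuous_intros F cS)
  also have "\<dots> = integral {0..2*pi} (\<lambda>\<theta>. (cmod (F \<theta>))\<^sup>2 - 2 * Re (F \<theta> * cnj (S \<theta>)) + (cmod (S \<theta>))\<^sup>2)"
    by (intro integral_cong) (simp only: cmod_power2, simp add: power2_eq_square algebra_simps)
  also have "\<dots> = integral {0..2*pi} (\<lambda>\<theta>. (cmod (F \<theta>))\<^sup>2) - 2 * Q + Q"
    by (subst integral_add, (auto intro!: ci continuous_intros F cS)[2],
        subst integral_diff, (auto intro!: ci continuous_intros F cS)[2])
       (simp only: integral_mult_right FSr SSr)
  finally show ?thesis unfolding Q_def by simp
qed

lemma continuous_nn_integral_Icc:
  fixes f :: "real \<Rightarrow> real"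
  assumes "continuous_on {a..b} f" "\<And>x. x \<in> {a..b} \<Longrightarrow> 0 \<le> f x"
  shows "(\<integral>\<^sup>+x\<in>{a<..<b}. ennreal (f x) \<partial>lborel) = ennreal (integral {a..b} f)"
proof -
  let ?f = "\<lambda>x. if x \<in> {a..b} then f x else 0"
  have "(f has_integral integral {a..b} f) {a..b}"
    using assms(1) integrable_continuous_interval by blast
  then have "(?f has_integral integral {a..b} f) {a..b}"
    by (rule has_integral_eq[rotated]) auto
  then have "(?f has_integral integral {a..b} f) {a<..<b}"
    by (simp add: has_integral_Icc_iff_Ioo)
  then have "integral\<^sup>N lborel (\<lambda>x. ennreal (?f x) * indicator {a<..<b} x) = ennreal (integral {a..b} f)"
    by (rule nn_integral_has_integral_lebesgue'[rotated]) (use assms in auto)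
  moreover have "(\<integral>\<^sup>+x\<in>{a<..<b}. ennreal (f x) \<partial>lborel) = integral\<^sup>N lborel (\<lambda>x. ennreal (?f x) * indicator {a<..<b} x)"
    by (intro nn_integral_cong) (auto simp: indicator_def)
  ultimately show ?thesis by simp
qed

text \<open>Bessel's inequality on each circle, integrated over the logarithm of the radius, bounds
  the energy of the regular part by the energy of p on the annulus. The principal part contributes
  nothing to the coefficient integrals for nonnegative frequencies.\<close>

lemma laurent_coefficients_energy:
  assumes r: "0 < t" "t < 1"
    and p1: "p1 holomorphic_on ball 0 1" and l: "l holomorphic_on ball 0 (1 / t)"
    and eq: "\<And>z. z \<in> annulus t \<Longrightarrow> p z = p1 z + l (1 / z) / z"
    and fin: "square_integral (annulus t) p < \<infinity>"
  shows "summable (\<lambda>n. (cmod ((deriv ^^ n) p1 0 / fact n))\<^sup>2 / real (Suc n))"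
proof -
  define c where "c = (\<lambda>n. (deriv ^^ n) p1 0 / fact n)"
  have "(\<lambda>z. l (1 / z)) holomorphic_on annulus t"
    by (rule holomorphic_on_compose_gen[OF _ l, unfolded o_def, of "\<lambda>z. 1 / z"])
       (use r norm_inverse_less in \<open>auto intro!: holomorphic_intros\<close>)
  then have "(\<lambda>z. p1 z + l (1 / z) / z) holomorphic_on annulus t"
    using r by (intro holomorphic_intros holomorphic_on_subset[OF p1]) auto
  then have "p holomorphic_on annulus t"
    by (rule holomorphic_transform) (use eq in auto)
  then have contp: "continuous_on (annulus t) p"
    using holomorphic_on_imp_continuous_on by blast
  define g where "g = (\<lambda>z. ennreal ((cmod (indicator (annulus t) z *\<^sub>R p z))\<^sup>2))"
  have [measurable]: "annulus t \<in> sets borel" using open_annulus by auto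
  have "(\<lambda>z. indicator (annulus t) z *\<^sub>R p z) \<in> borel_measurable borel"
    by (rule borel_measurable_continuous_on_indicator) (use contp in auto)
  then have [measurable]: "g \<in> borel_measurable borel" unfolding g_def by measurable
  have geq: "(\<integral>\<^sup>+z. g z \<partial>lborel) = square_integral (annulus t) p"
    by (intro nn_integral_cong) (auto simp: g_def indicator_def)
  define E where "E = enn2real (\<integral>\<^sup>+z. g z \<partial>lborel)"
  have E: "(\<integral>\<^sup>+z. g z \<partial>lborel) = ennreal E"
    using fin unfolding E_def geq by simp
  have circ: "2 * pi * (\<Sum>n\<le>N. (cmod (c n))\<^sup>2 * \<rho> ^ (2 * n)) \<le> integral {0..2*pi} (\<lambda>\<theta>. (cmod (p (of_real \<rho> * cis \<theta>)))\<^sup>2)"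
    if \<rho>: "t < \<rho>" "\<rho> < 1" for \<rho> N
  proof -
    have cont: "continuous_on {0..2*pi} (\<lambda>\<theta>. p (of_real \<rho> * cis \<theta>))"
      by (rule circle_continuous[OF contp]) (use \<rho> r in auto)
    have "2 * pi * (\<Sum>n\<le>N. (cmod (c n * of_real \<rho> ^ n))\<^sup>2) \<le> integral {0..2*pi} (\<lambda>\<theta>. (cmod (p (of_real \<rho> * cis \<theta>)))\<^sup>2)"
    proof (rule bessel_circle[OF cont])
      fix n
      have "2 * of_real pi * \<i> * c n = contour_integral (circlepath 0 \<rho>) (\<lambda>w. p w / w ^ Suc n)"
        unfolding c_def using laurent_coefficient[OF r(1) \<rho> p1 l eq] by simp
      also have "\<dots> = integral {0..2*pi} (\<lambda>\<theta>. (\<i> / of_real \<rho> ^ n) * (p (of_real \<rho> * cis \<theta>) * cis (- real n * \<theta>)))"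
        unfolding contour_integral_circle_eq
      proof (rule integral_cong)
        fix \<theta>
        have "cis (- real n * \<theta>) * cis (real n * \<theta>) = 1" by (simp add: cis_mult)
        then have "cis (- real n * \<theta>) * cis \<theta> ^ n = 1" using Complex.DeMoivre[of \<theta> n] by metis
        then have "cis (- real n * \<theta>) = 1 / cis \<theta> ^ n" by (simp add: eq_divide_eq)
        then show "p (of_real \<rho> * cis \<theta>) / (of_real \<rho> * cis \<theta>) ^ Suc n * of_real \<rho> * \<i> * cis \<theta> =
                \<i> / of_real \<rho> ^ n * (p (of_real \<rho> * cis \<theta>) * cis (- real n * \<theta>))"
          using \<rho> r by (simp add: field_simps power_mult_distrib)
      qed
      also have "\<dots> = (\<i> / of_real \<rho> ^ n) * integral {0..2*pi} (\<lambda>\<theta>. p (of_real \<rho> * cis \<theta>) * cis (- real n * \<theta>))"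
        by (rule integral_mult_right)
      finally show "integral {0..2*pi} (\<lambda>\<theta>. p (of_real \<rho> * cis \<theta>) * cis (- real n * \<theta>)) = 2 * of_real pi * (c n * of_real \<rho> ^ n)"
        using \<rho> r by (simp add: field_simps)
    qed
    moreover have "(cmod (c n * of_real \<rho> ^ n))\<^sup>2 = (cmod (c n))\<^sup>2 * \<rho> ^ (2 * n)" for n
      using \<rho> r by (simp add: norm_mult norm_power power_mult_distrib power_mult mult.commute flip: power_mult)
    ultimately show ?thesis by simp
  qed
  have bound: "pi * (1 - t\<^sup>2) * (\<Sum>n\<le>N. (cmod (c n))\<^sup>2 / real (Suc n)) \<le> E" for N
  proof -
    \<comment> \<open>Bessel's lower bound on the circle of radius exp(\<tau>), multiplied by the
      area factor exp(2 \<tau>).\<close>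
    define K where "K = (\<lambda>\<tau>. 2 * pi * (\<Sum>n\<le>N. (cmod (c n))\<^sup>2 * exp (real (2 * n + 2) * \<tau>)))"
    have K: "(K has_integral (2 * pi * (\<Sum>n\<le>N. (cmod (c n))\<^sup>2 * ((1 - t ^ (2 * n + 2)) / real (2 * n + 2))))) {ln t..0}"
      unfolding K_def
    proof (intro has_integral_mult_right has_integral_sum)
      fix n
      have "((\<lambda>\<tau>. exp (real (2 * n + 2) * \<tau>)) has_integral (exp (real (2 * n + 2) * 0) / real (2 * n + 2) - exp (real (2 * n + 2) * ln t) / real (2 * n + 2))) {ln t..0}"
        by (rule fundamental_theorem_of_calculus)
           (use r in \<open>auto intro!: derivative_eq_intros simp flip: has_real_derivative_iff_has_vector_derivative\<close>)
      moreover have "exp (real (2 * n + 2) * ln t) = t ^ (2 * n + 2)"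
        using r by (subst exp_of_nat_mult) simp
      ultimately show "((\<lambda>\<tau>. exp (real (2 * n + 2) * \<tau>)) has_integral (1 - t ^ (2 * n + 2)) / real (2 * n + 2)) {ln t..0}"
        by (simp add: diff_divide_distrib)
    qed simp
    have Kc: "continuous_on {ln t..0} K" unfolding K_def by (intro continuous_intros)
    have K0: "0 \<le> K \<tau>" for \<tau> unfolding K_def by (auto intro!: mult_nonneg_nonneg sum_nonneg)
    have "ennreal (integral {ln t..0} K) = (\<integral>\<^sup>+\<tau>\<in>{ln t<..<0}. ennreal (K \<tau>) \<partial>lborel)"
      by (rule continuous_nn_integral_Icc[symmetric]) (use Kc K0 in auto)
    also have "\<dots> \<le> (\<integral>\<^sup>+\<tau>. (\<integral>\<^sup>+\<theta>\<in>{0<..<0 + 2 * pi}. (g (0 + exp (Complex \<tau> \<theta>)) * ennreal (exp (2 * \<tau>))) \<partial>lborel) \<partial>lborel)"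
    proof (rule nn_integral_mono)
      fix \<tau> :: real
      show "ennreal (K \<tau>) * indicator {ln t<..<0} \<tau> \<le> (\<integral>\<^sup>+\<theta>\<in>{0<..<0 + 2 * pi}. (g (0 + exp (Complex \<tau> \<theta>)) * ennreal (exp (2 * \<tau>))) \<partial>lborel)"
      proof (cases "\<tau> \<in> {ln t<..<0}")
        case True
        then have \<rho>: "t < exp \<tau>" "exp \<tau> < 1"
          using r exp_less_mono[of "ln t" \<tau>] by auto
        have e: "exp (Complex \<tau> \<theta>) = of_real (exp \<tau>) * cis \<theta>" for \<theta>
          by (simp add: exp_eq_polar)
        have "(\<integral>\<^sup>+\<theta>\<in>{0<..<0 + 2 * pi}. (g (0 + exp (Complex \<tau> \<theta>)) * ennreal (exp (2 * \<tau>))) \<partial>lborel)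
           = (\<integral>\<^sup>+\<theta>\<in>{0<..<2 * pi}. ennreal (exp (2 * \<tau>) * (cmod (p (of_real (exp \<tau>) * cis \<theta>)))\<^sup>2) \<partial>lborel)"
          unfolding e g_def using \<rho>
          by (intro nn_integral_cong) (auto simp: indicator_def norm_mult ennreal_mult' mult.commute)
        also have "\<dots> = ennreal (integral {0..2*pi} (\<lambda>\<theta>. exp (2 * \<tau>) * (cmod (p (of_real (exp \<tau>) * cis \<theta>)))\<^sup>2))"
          by (rule continuous_nn_integral_Icc)
             (use \<rho> r in \<open>auto intro!: continuous_intros circle_continuous[OF contp]\<close>)
        also have "\<dots> = ennreal (exp (2 * \<tau>) * integral {0..2*pi} (\<lambda>\<theta>. (cmod (p (of_real (exp \<tau>) * cis \<theta>)))\<^sup>2))"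
          by simp
        also have "\<dots> \<ge> ennreal (exp (2 * \<tau>) * (2 * pi * (\<Sum>n\<le>N. (cmod (c n))\<^sup>2 * exp \<tau> ^ (2 * n))))"
          by (intro ennreal_leI mult_left_mono circ \<rho>) auto
        also have "exp (2 * \<tau>) * (2 * pi * (\<Sum>n\<le>N. (cmod (c n))\<^sup>2 * exp \<tau> ^ (2 * n))) = K \<tau>"
          unfolding K_def sum_distrib_left
          by (intro sum.cong refl) (simp add: exp_of_nat_mult[symmetric] exp_add[symmetric] algebra_simps)
        finally show ?thesis using True by simp
      qed simp
    qed
    also have "\<dots> \<le> (\<integral>\<^sup>+z. g z \<partial>lborel)" by (rule nn_integral_log_polar_le) measurable
    finally have "ennreal (integral {ln t..0} K) \<le> ennreal E" using E by simp
    then have "integral {ln t..0} K \<le> E" unfolding E_def by (simp add: ennreal_le_iff)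
    then have A: "2 * pi * (\<Sum>n\<le>N. (cmod (c n))\<^sup>2 * ((1 - t ^ (2 * n + 2)) / real (2 * n + 2))) \<le> E"
      using integral_unique[OF K] by simp
    \<comment> \<open>Of the energy that the n-th term has on the whole disc, the annulus retains
      the share 1 - t^(2n+2), which is at least 1 - t^2 uniformly in n.\<close>
    have "pi * (1 - t\<^sup>2) * (\<Sum>n\<le>N. (cmod (c n))\<^sup>2 / real (Suc n)) \<le> 2 * pi * (\<Sum>n\<le>N. (cmod (c n))\<^sup>2 * ((1 - t ^ (2 * n + 2)) / real (2 * n + 2)))"
      unfolding sum_distrib_left
    proof (rule sum_mono)
      fix n
      have "t ^ (2 * n + 2) \<le> t ^ 2" using r by (intro power_decreasing) auto
      then have "pi * (1 - t\<^sup>2) * ((cmod (c n))\<^sup>2 / real (Suc n)) \<le> pi * (1 - t ^ (2 * n + 2)) * ((cmod (c n))\<^sup>2 / real (Suc n))"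
        by (intro mult_right_mono mult_left_mono) auto
      also have "\<dots> = 2 * pi * ((cmod (c n))\<^sup>2 * ((1 - t ^ (2 * n + 2)) / real (2 * n + 2)))"
        by (simp add: field_simps)
      finally show "pi * (1 - t\<^sup>2) * ((cmod (c n))\<^sup>2 / real (Suc n)) \<le> 2 * pi * ((cmod (c n))\<^sup>2 * ((1 - t ^ (2 * n + 2)) / real (2 * n + 2)))" .
    qed
    then show ?thesis using A by linarith
  qed
  have tp: "0 < pi * (1 - t\<^sup>2)" using r by (simp add: power_less_one_iff abs_square_less_1)
  have "summable (\<lambda>n. (cmod (c n))\<^sup>2 / real (Suc n))"
  proof (rule summableI_nonneg_bounded)
    fix n
    have "(\<Sum>i<n. (cmod (c i))\<^sup>2 / real (Suc i)) \<le> (\<Sum>i\<le>n. (cmod (c i))\<^sup>2 / real (Suc i))"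
      by (intro sum_mono2) auto
    also have "\<dots> \<le> E / (pi * (1 - t\<^sup>2))"
      using bound[of n] tp by (simp add: field_simps)
    finally show "(\<Sum>i<n. (cmod (c i))\<^sup>2 / real (Suc i)) \<le> E / (pi * (1 - t\<^sup>2))" .
  qed auto
  then show ?thesis unfolding c_def .
qed

subsection \<open>Dirichlet series coefficients\<close>

text \<open>For G(z) = sum a_n z^n the area integral of |G'|^2 over the disc is pi times this sum;
  the constant term has weight 0.\<close>

definition dirichlet_coeffs :: "(nat \<Rightarrow> complex) \<Rightarrow> bool" where
  "dirichlet_coeffs a \<longleftrightarrow> summable (\<lambda>n. real n * (cmod (a n))\<^sup>2)"

definition power_series :: "(nat \<Rightarrow> complex) \<Rightarrow> complex \<Rightarrow> complex" where
  "power_series a z = (\<Sum>n. a n * z ^ n)"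

lemma dirichlet_coeffs_bounded:
  assumes "dirichlet_coeffs a"
  obtains K where "\<And>n. cmod (a n) \<le> K"
proof -
  have "(\<lambda>n. real n * (cmod (a n))\<^sup>2) \<longlonglongrightarrow> 0"
    using assms summable_LIMSEQ_zero unfolding dirichlet_coeffs_def by blast
  then have "Bseq (\<lambda>n. real n * (cmod (a n))\<^sup>2)"
    using convergent_imp_Bseq convergentI by blast
  then obtain B where B: "\<And>n. norm (real n * (cmod (a n))\<^sup>2) \<le> B"
    unfolding Bseq_def by blast
  have B0: "0 \<le> B" using B[of 0] by simp
  have "cmod (a n) \<le> max (cmod (a 0)) (B + 1)" for n
  proof (cases "n = 0")
    case False
    have "(cmod (a n))\<^sup>2 \<le> real n * (cmod (a n))\<^sup>2"
      using False by (simp add: mult_le_cancel_right1)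
    also have "\<dots> \<le> B" using B[of n] by simp
    also have "\<dots> \<le> (B + 1)\<^sup>2" using B0 by (simp add: power2_eq_square algebra_simps)
    finally have "cmod (a n) \<le> B + 1" by (rule power2_le_imp_le) (use B0 in auto)
    then show ?thesis by simp
  qed simp
  then show ?thesis using that by blast
qed

lemma dirichlet_coeffs_summable:
  assumes "dirichlet_coeffs a" "cmod z < 1"
  shows "summable (\<lambda>n. cmod (a n * z ^ n))"
proof -
  obtain K where K: "\<And>n. cmod (a n) \<le> K" using dirichlet_coeffs_bounded[OF assms(1)] by blast
  have "summable (\<lambda>n. K * cmod z ^ n)" using assms(2) by (intro summable_mult summable_geometric) auto
  then show ?thesis
  proof (rule summable_comparison_test')
    fix n
    show "norm (cmod (a n * z ^ n)) \<le> K * cmod z ^ n"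
      using K[of n] by (simp add: norm_mult norm_power mult_right_mono)
  qed
qed

lemma dirichlet_coeffs_sums:
  assumes "dirichlet_coeffs a" "cmod z < 1"
  shows "(\<lambda>n. a n * z ^ n) sums power_series a z"
  unfolding power_series_def
  by (rule summable_sums[OF summable_norm_cancel[OF dirichlet_coeffs_summable[OF assms]]])

lemma dirichlet_coeffs_DERIV:
  assumes "dirichlet_coeffs a" "cmod z < 1"
  shows "(power_series a has_field_derivative power_series (diffs a) z) (at z)"
proof -
  define K where "K = complex_of_real ((cmod z + 1) / 2)"
  have K: "cmod K = (cmod z + 1) / 2" unfolding K_def using assms by (simp only: norm_of_real) simp
  have "summable (\<lambda>n. a n * K ^ n)"
    using dirichlet_coeffs_sums[OF assms(1), of K] K assms sums_summable by auto
  then show ?thesis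
    unfolding power_series_def by (rule termdiffs_strong) (use K assms in auto)
qed

lemma power_series_deriv_sums:
  assumes "dirichlet_coeffs a" "cmod z < 1"
  shows "(\<lambda>n. diffs a n * z ^ n) sums power_series (diffs a) z"
proof -
  have "summable (\<lambda>n. diffs a n * z ^ n)"
    by (rule termdiff_converges[of z 1 a])
       (use assms dirichlet_coeffs_sums sums_summable in \<open>auto\<close>)
  then show ?thesis unfolding power_series_def by (rule summable_sums)
qed

lemma cauchy_schwarz_series:
  fixes x y :: "nat \<Rightarrow> real"
  assumes "summable (\<lambda>n. (x n)\<^sup>2)" "summable (\<lambda>n. (y n)\<^sup>2)"
  shows "summable (\<lambda>n. \<bar>x n * y n\<bar>)" "(\<Sum>n. \<bar>x n * y n\<bar>) \<le> sqrt (\<Sum>n. (x n)\<^sup>2) * sqrt (\<Sum>n. (y n)\<^sup>2)"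
proof -
  have b: "(\<Sum>n<N. \<bar>x n * y n\<bar>) \<le> sqrt (\<Sum>n. (x n)\<^sup>2) * sqrt (\<Sum>n. (y n)\<^sup>2)" for N
  proof -
    have "(\<Sum>n<N. \<bar>x n * y n\<bar>) \<le> L2_set x {..<N} * L2_set y {..<N}"
      using L2_set_mult_ineq[of x y "{..<N}"] by (simp add: abs_mult)
    also have "\<dots> \<le> sqrt (\<Sum>n. (x n)\<^sup>2) * sqrt (\<Sum>n. (y n)\<^sup>2)"
      unfolding L2_set_def
      by (intro mult_mono real_sqrt_le_mono sum_le_suminf assms) (auto intro!: real_sqrt_ge_zero sum_nonneg suminf_nonneg assms)
    finally show ?thesis .
  qed
  show s: "summable (\<lambda>n. \<bar>x n * y n\<bar>)"
    by (rule summableI_nonneg_bounded[OF _ b]) auto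
  show "(\<Sum>n. \<bar>x n * y n\<bar>) \<le> sqrt (\<Sum>n. (x n)\<^sup>2) * sqrt (\<Sum>n. (y n)\<^sup>2)"
    by (rule suminf_le_const[OF s b])
qed

lemma sums_diffs_geometric:
  fixes x :: real
  assumes "0 \<le> x" "x < 1"
  shows "(\<lambda>n. real (Suc n) * x ^ n) sums (1 / (1 - x)\<^sup>2)"
proof -
  have "norm x < 1" using assms by simp
  from geometric_deriv_sums[OF this] show ?thesis .
qed

text \<open>Cauchy-Schwarz with weights sqrt(n+1), together with sum (n+1) |z|^(2n) = 1/(1 -
  |z|^2)^2, bounds |G'| by the Dirichlet norm divided by 1 - |z|^2.\<close>

lemma little_bloch_tail:
  assumes "dirichlet_coeffs a" "cmod z < 1"
  shows "(1 - cmod z) * cmod (power_series (diffs a) z) \<le> sqrt (\<Sum>n. real n * (cmod (a n))\<^sup>2)"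
proof -
  define x where "x = (\<lambda>n. sqrt (real (Suc n)) * cmod (a (Suc n)))"
  define y where "y = (\<lambda>n. sqrt (real (Suc n)) * cmod z ^ n)"
  have x2: "(x n)\<^sup>2 = real (Suc n) * (cmod (a (Suc n)))\<^sup>2" for n
    by (simp add: x_def power_mult_distrib)
  have y2: "(y n)\<^sup>2 = real (Suc n) * ((cmod z)\<^sup>2) ^ n" for n
    unfolding y_def power_mult_distrib by (simp add: power_even_eq flip: power_mult)
  have z2: "(cmod z)\<^sup>2 < 1" using assms by (simp add: power_less_one_iff abs_square_less_1)
  have sy: "(\<lambda>n. (y n)\<^sup>2) sums (1 / (1 - (cmod z)\<^sup>2)\<^sup>2)"
    unfolding y2 by (rule sums_diffs_geometric) (use z2 in auto)
  have sx: "summable (\<lambda>n. (x n)\<^sup>2)"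
    using assms(1) unfolding x2 dirichlet_coeffs_def by (subst summable_Suc_iff)
  have Sx: "(\<Sum>n. (x n)\<^sup>2) = (\<Sum>n. real n * (cmod (a n))\<^sup>2)"
    unfolding x2 using assms(1) unfolding dirichlet_coeffs_def
    by (subst suminf_split_head) auto
  have eq: "cmod (diffs a n * z ^ n) = \<bar>x n * y n\<bar>" for n
  proof -
    have "\<bar>x n * y n\<bar> = (sqrt (real (Suc n)) * sqrt (real (Suc n))) * (cmod (a (Suc n)) * cmod z ^ n)"
      unfolding x_def y_def by (simp add: abs_mult)
    then show ?thesis by (simp only: diffs_def norm_mult norm_power norm_of_nat mult.assoc real_sqrt_mult_self abs_of_nat)
  qed
  note cs = cauchy_schwarz_series[OF sx sums_summable[OF sy]]
  have "cmod (power_series (diffs a) z) \<le> (\<Sum>n. \<bar>x n * y n\<bar>)"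
    unfolding power_series_def using summable_norm[of "\<lambda>n. diffs a n * z ^ n"] cs(1) by (simp add: eq)
  also have "\<dots> \<le> sqrt (\<Sum>n. (x n)\<^sup>2) * sqrt (\<Sum>n. (y n)\<^sup>2)" by (rule cs)
  also have "sqrt (\<Sum>n. (y n)\<^sup>2) = 1 / (1 - (cmod z)\<^sup>2)"
    unfolding sums_unique[OF sy, symmetric] using z2 by (simp add: real_sqrt_divide)
  finally have "cmod (power_series (diffs a) z) \<le> sqrt (\<Sum>n. real n * (cmod (a n))\<^sup>2) * (1 / (1 - (cmod z)\<^sup>2))"
    unfolding Sx .
  then have "(1 - cmod z) * cmod (power_series (diffs a) z) \<le> (1 - cmod z) * (sqrt (\<Sum>n. real n * (cmod (a n))\<^sup>2) * (1 / (1 - (cmod z)\<^sup>2)))"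
    using assms by (intro mult_left_mono) auto
  also have "\<dots> = sqrt (\<Sum>n. real n * (cmod (a n))\<^sup>2) * ((1 - cmod z) / (1 - (cmod z)\<^sup>2))" by simp
  also have "\<dots> \<le> sqrt (\<Sum>n. real n * (cmod (a n))\<^sup>2) * 1"
  proof (intro mult_left_mono)
    have "(cmod z)\<^sup>2 \<le> cmod z" using assms by (simp add: power2_eq_square mult_left_le_one_le)
    then show "(1 - cmod z) / (1 - (cmod z)\<^sup>2) \<le> 1" using z2 by simp
  qed (use assms in \<open>auto simp: dirichlet_coeffs_def intro!: suminf_nonneg\<close>)
  finally show ?thesis by simp
qed

definition tail_coeffs :: "nat \<Rightarrow> (nat \<Rightarrow> complex) \<Rightarrow> nat \<Rightarrow> complex" where
  "tail_coeffs N a n = (if n < N then 0 else a n)"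

lemma dirichlet_coeffs_tail:
  assumes "dirichlet_coeffs a"
  shows "dirichlet_coeffs (tail_coeffs N a)"
    and "(\<lambda>N. \<Sum>n. real n * (cmod (tail_coeffs N a n))\<^sup>2) \<longlonglongrightarrow> 0"
proof -
  let ?f = "\<lambda>n. real n * (cmod (a n))\<^sup>2"
  have sf: "summable ?f" using assms by (simp add: dirichlet_coeffs_def)
  have fin: "(\<lambda>n. if n < N then ?f n else 0) sums (\<Sum>n<N. ?f n)" for N
    using sums_If_finite_set[of "{..<N}" ?f] by simp
  have eq: "real n * (cmod (tail_coeffs N a n))\<^sup>2 = ?f n - (if n < N then ?f n else 0)" for n N
    by (simp add: tail_coeffs_def)
  have S: "(\<lambda>n. real n * (cmod (tail_coeffs N a n))\<^sup>2) sums (suminf ?f - (\<Sum>n<N. ?f n))" for N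
    unfolding eq by (intro sums_diff fin summable_sums sf)
  show "dirichlet_coeffs (tail_coeffs N a)"
    using S sums_summable unfolding dirichlet_coeffs_def by blast
  have "(\<lambda>N. suminf ?f - (\<Sum>n<N. ?f n)) \<longlonglongrightarrow> suminf ?f - suminf ?f"
    by (intro tendsto_diff tendsto_const summable_LIMSEQ sf)
  then show "(\<lambda>N. \<Sum>n. real n * (cmod (tail_coeffs N a n))\<^sup>2) \<longlonglongrightarrow> 0"
    using sums_unique[OF S] by simp
qed

lemma power_series_tail:
  assumes "dirichlet_coeffs a" "cmod z < 1"
  shows "power_series a z = (\<Sum>n<N. a n * z ^ n) + power_series (tail_coeffs N a) z"
proof -
  have "(\<lambda>n. (if n < N then a n * z ^ n else 0) + tail_coeffs N a n * z ^ n) sums ((\<Sum>n<N. a n * z ^ n) + power_series (tail_coeffs N a) z)"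
    using sums_If_finite_set[of "{..<N}" "\<lambda>n. a n * z ^ n"]
    by (intro sums_add dirichlet_coeffs_sums dirichlet_coeffs_tail assms) auto
  moreover have "(\<lambda>n. (if n < N then a n * z ^ n else 0) + tail_coeffs N a n * z ^ n) = (\<lambda>n. a n * z ^ n)"
    by (auto simp: tail_coeffs_def)
  ultimately show ?thesis using dirichlet_coeffs_sums[OF assms] sums_unique2 by metis
qed

text \<open>A high tail has small Dirichlet norm, which controls its derivative against 1 - |z|
  everywhere; the remaining polynomial has a bounded derivative, so near the circle the factor 1 -
  |z| makes its share small.\<close>

lemma little_bloch:
  assumes a: "dirichlet_coeffs a" and e: "e > 0"
  obtains d where "d > 0" "\<And>z. 1 - d < cmod z \<Longrightarrow> cmod z < 1 \<Longrightarrow> (1 - cmod z) * cmod (power_series (diffs a) z) < e"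
proof -
  have "(\<lambda>N. sqrt (\<Sum>n. real n * (cmod (tail_coeffs N a n))\<^sup>2)) \<longlonglongrightarrow> sqrt 0"
    by (intro tendsto_real_sqrt dirichlet_coeffs_tail a)
  then have "\<forall>\<^sub>F N in sequentially. sqrt (\<Sum>n. real n * (cmod (tail_coeffs N a n))\<^sup>2) < e / 2"
    using e by (intro order_tendstoD) auto
  then obtain N where N: "sqrt (\<Sum>n. real n * (cmod (tail_coeffs N a n))\<^sup>2) < e / 2"
    by (auto simp: eventually_sequentially)
  define B where "B = (\<Sum>n<N. real n * cmod (a n))"
  have B0: "0 \<le> B" unfolding B_def by (auto intro!: sum_nonneg)
  have bd: "cmod (power_series (diffs a) z) \<le> B + cmod (power_series (diffs (tail_coeffs N a)) z)" if z: "cmod z < 1" for z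
  proof -
    \<comment> \<open>Differentiation shifts the index: a polynomial of degree below N contributes
      only the indices n < N - 1, so the summand n = N - 1 is set to 0 and belongs to the
      tail.\<close>
    have eq: "diffs a n * z ^ n = (if n \<in> {..<N} then (if n = N - 1 then 0 else of_nat (Suc n) * a (Suc n) * z ^ n) else 0) + diffs (tail_coeffs N a) n * z ^ n" for n
      by (auto simp: diffs_def tail_coeffs_def)
    have "(\<lambda>n. diffs a n * z ^ n) sums ((\<Sum>n<N. if n = N - 1 then 0 else of_nat (Suc n) * a (Suc n) * z ^ n) + power_series (diffs (tail_coeffs N a)) z)"
      unfolding eq by (intro sums_add sums_If_finite_set power_series_deriv_sums dirichlet_coeffs_tail a z) auto
    then have "power_series (diffs a) z = (\<Sum>n<N. if n = N - 1 then 0 else of_nat (Suc n) * a (Suc n) * z ^ n) + power_series (diffs (tail_coeffs N a)) z"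
      using power_series_deriv_sums[OF a z] sums_unique2 by blast
    moreover have "cmod (\<Sum>n<N. if n = N - 1 then 0 else of_nat (Suc n) * a (Suc n) * z ^ n) \<le> B"
    proof -
      have "cmod (\<Sum>n<N. if n = N - 1 then 0 else of_nat (Suc n) * a (Suc n) * z ^ n) \<le> (\<Sum>n<N. if n = N - 1 then 0 else real (Suc n) * cmod (a (Suc n)))"
      proof (rule order_trans[OF norm_sum sum_mono])
        fix n
        have "cmod z ^ n \<le> 1" using z by (simp add: power_le_one)
        then have "real (Suc n) * cmod (a (Suc n)) * cmod z ^ n \<le> real (Suc n) * cmod (a (Suc n)) * 1"
          by (intro mult_left_mono) auto
        moreover have "cmod (of_nat (Suc n) * a (Suc n) * z ^ n) = real (Suc n) * cmod (a (Suc n)) * cmod z ^ n"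
          by (simp only: norm_mult norm_power norm_of_nat)
        ultimately show "cmod (if n = N - 1 then 0 else of_nat (Suc n) * a (Suc n) * z ^ n) \<le> (if n = N - 1 then 0 else real (Suc n) * cmod (a (Suc n)))"
          by simp
      qed
      also have "\<dots> \<le> B"
      proof (cases N)
        case (Suc M)
        have "(\<Sum>n<N. if n = N - 1 then 0 else real (Suc n) * cmod (a (Suc n))) = (\<Sum>n<M. real (Suc n) * cmod (a (Suc n)))"
          unfolding Suc by (simp add: sum.lessThan_Suc)
        also have "\<dots> = B" unfolding B_def Suc sum.lessThan_Suc_shift by simp
        finally show ?thesis by simp
      qed (simp add: B0)
      finally show ?thesis .
    qed
    moreover have "cmod x \<le> B + cmod y" if "x = s + y" "cmod s \<le> B" for x s y
      using norm_triangle_ineq[of s y] that by simp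
    ultimately show ?thesis by blast
  qed
  show ?thesis
  proof (rule that[of "e / (2 * (B + 1))"])
    show "0 < e / (2 * (B + 1))" using e B0 by simp
    fix z assume z: "1 - e / (2 * (B + 1)) < cmod z" "cmod z < 1"
    have "(1 - cmod z) * cmod (power_series (diffs a) z) \<le> (1 - cmod z) * (B + cmod (power_series (diffs (tail_coeffs N a)) z))"
      using z bd by (intro mult_left_mono) auto
    also have "\<dots> \<le> (1 - cmod z) * (B + 1) + (1 - cmod z) * cmod (power_series (diffs (tail_coeffs N a)) z)"
      using z by (simp add: algebra_simps)
    also have "\<dots> < e / 2 + e / 2"
    proof (rule add_strict_mono)
      have "1 - cmod z < e / (2 * (B + 1))" using z by simp
      then show "(1 - cmod z) * (B + 1) < e / 2" using B0 by (simp add: field_simps)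
      show "(1 - cmod z) * cmod (power_series (diffs (tail_coeffs N a)) z) < e / 2"
        using little_bloch_tail[OF dirichlet_coeffs_tail(1)[OF a] z(2), of N] N by simp
    qed
    finally show "(1 - cmod z) * cmod (power_series (diffs a) z) < e" by simp
  qed
qed

subsection \<open>The logarithmic kernel and the maximal inequality\<close>

text \<open>Moving a point of the circle radially inwards at most halves its distance to another
  point of the circle, so the real part of the logarithm is at most ln 2 plus the positive part of
  the kernel; the imaginary part is at most pi. On the diagonal the right-hand side is
  infinite.\<close>

lemma norm_Ln_kernel_le:
  fixes p q :: complex and s :: real
  assumes p: "cmod p = 1" and q: "cmod q = 1" and s: "0 \<le> s" "s < 1"
  shows "ennreal (cmod (Ln (1 - of_real s * (p * cnj q)))) \<le> ennreal (ln 2 + pi) + e2ennreal (log_kernel p q)"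
proof (cases "p = q")
  case True
  then show ?thesis by (simp add: log_kernel_def)
next
  case False
  define u where "u = p * cnj q"
  define w where "w = 1 - of_real s * u"
  have u: "cmod u = 1" using p q by (simp add: u_def norm_mult)
  have d: "cmod (1 - u) = dist p q"
  proof -
    have "q * cnj q = 1" using q by (simp add: complex_norm_square[symmetric])
    then have "1 - u = (q - p) * cnj q" by (simp add: u_def algebra_simps)
    then show ?thesis using q by (simp add: norm_mult dist_norm norm_minus_commute)
  qed
  have su: "cmod (of_real s * u) = s" using u s by (simp add: norm_mult)
  have w0: "w \<noteq> 0" using su s unfolding w_def by auto
  \<comment> \<open>The displacement from \<open>u\<close> to its multiple by s has length 1 - s,
    and 1 - s is itself at most |w|; hence |1 - u| <= 2 |w|.\<close>
  have "cmod (1 - u) \<le> cmod w + cmod (of_real s * u - u)"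
    unfolding w_def by (metis diff_add_cancel add_diff_eq norm_triangle_ineq add.commute diff_diff_eq2)
  also have "of_real s * u - u = - (of_real (1 - s) * u)" by (simp add: algebra_simps)
  also have "cmod \<dots> = 1 - s" using u s by (simp add: norm_mult del: of_real_diff)
  also have "1 - s \<le> cmod w" unfolding w_def using su norm_triangle_ineq2[of 1 "of_real s * u"] by simp
  finally have low: "dist p q \<le> 2 * cmod w" using d by simp
  have up: "cmod w \<le> 2" unfolding w_def using su s norm_triangle_ineq4[of 1 "of_real s * u"] by simp
  have dpos: "0 < dist p q" using False by simp
  have "\<bar>ln (cmod w)\<bar> \<le> ln 2 + max 0 (- ln (dist p q))"
  proof (cases "cmod w \<ge> 1")
    case True
    then have "0 \<le> ln (cmod w)" "ln (cmod w) \<le> ln 2" using up by (auto intro!: ln_mono)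
    moreover have "0 \<le> max 0 (- ln (dist p q))" by simp
    ultimately show ?thesis by linarith
  next
    case False
    have "ln (dist p q) \<le> ln (2 * cmod w)" using low dpos by (intro ln_mono) auto
    also have "\<dots> = ln 2 + ln (cmod w)" using w0 by (simp add: ln_mult)
    finally show ?thesis using False w0 by simp
  qed
  moreover have "cmod (Ln w) \<le> \<bar>Re (Ln w)\<bar> + \<bar>Im (Ln w)\<bar>" by (rule cmod_le)
  moreover have "\<bar>Im (Ln w)\<bar> \<le> pi" using mpi_less_Im_Ln[OF w0] Im_Ln_le_pi[OF w0] by auto
  ultimately have "cmod (Ln w) \<le> (ln 2 + pi) + max 0 (- ln (dist p q))"
    using w0 by simp
  then have "ennreal (cmod (Ln w)) \<le> ennreal ((ln 2 + pi) + max 0 (- ln (dist p q)))"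
    by (rule ennreal_leI)
  also have "\<dots> = ennreal (ln 2 + pi) + ennreal (max 0 (- ln (dist p q)))"
    by (rule ennreal_plus) auto
  also have "ennreal (max 0 (- ln (dist p q))) = e2ennreal (log_kernel p q)"
    using False by (cases "0 \<le> - ln (dist p q)") (auto simp: log_kernel_def ennreal_neg)
  finally show ?thesis unfolding w_def u_def .
qed

text \<open>The tail of the logarithmic series is dominated by a geometric series, uniformly for |w|
  <= R.\<close>

lemma partial_Ln_bound:
  fixes w :: complex
  assumes "cmod w \<le> R" "R < 1"
  shows "cmod ((\<Sum>n=1..N. w ^ n / of_nat n) + Ln (1 - w)) \<le> R ^ Suc N / (1 - R)"
proof -
  have w: "cmod (- w) < 1" using assms by simp
  have R0: "0 \<le> R" using assms norm_ge_zero order_trans by blast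
  have S: "(\<lambda>n. - (w ^ n) / of_nat n) sums Ln (1 - w)"
    using Ln_series'[OF w] by simp
  have "(\<lambda>n. - (w ^ (n + Suc N)) / of_nat (n + Suc N)) sums (Ln (1 - w) - (\<Sum>n<Suc N. - (w ^ n) / of_nat n))"
    using sums_split_initial_segment[OF S, of "Suc N"] by simp
  moreover have "(\<Sum>n<Suc N. - (w ^ n) / of_nat n) = - (\<Sum>n=1..N. w ^ n / of_nat n)"
    by (simp add: lessThan_Suc_atMost atMost_atLeast0 sum.atLeast_Suc_atMost sum_negf)
  ultimately have T: "(\<lambda>n. - (w ^ (n + Suc N)) / of_nat (n + Suc N)) sums ((\<Sum>n=1..N. w ^ n / of_nat n) + Ln (1 - w))"
    by (simp add: add.commute)
  have G: "(\<lambda>n. R ^ Suc N * R ^ n) sums (R ^ Suc N * (1 / (1 - R)))"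
    using R0 assms by (intro sums_mult geometric_sums) auto
  have "cmod (\<Sum>n. - (w ^ (n + Suc N)) / of_nat (n + Suc N)) \<le> (\<Sum>n. R ^ Suc N * R ^ n)"
  proof (rule norm_suminf_le[OF _ sums_summable[OF G]])
    fix n
    have "cmod (- (w ^ (n + Suc N)) / of_nat (n + Suc N)) = cmod w ^ (n + Suc N) / real (n + Suc N)"
      by (simp only: norm_divide norm_minus_cancel norm_power norm_of_nat)
    also have "\<dots> \<le> cmod w ^ (n + Suc N) / 1"
      by (intro divide_left_mono) auto
    also have "\<dots> \<le> R ^ (n + Suc N)" using assms power_mono[of "cmod w" R "n + Suc N"] by simp
    also have "\<dots> = R ^ Suc N * R ^ n" by (simp add: power_add mult.commute)
    finally show "cmod (- (w ^ (n + Suc N)) / of_nat (n + Suc N)) \<le> R ^ Suc N * R ^ n" .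
  qed
  then show ?thesis unfolding sums_unique[OF T, symmetric] sums_unique[OF G, symmetric] by simp
qed

text \<open>Makes functions of a point of the circle total on the plane. The measures considered
  live on the circle up to a null set, so the default value 1 carries no mass.\<close>

definition unimod :: "complex \<Rightarrow> complex" where
  "unimod q = (if cmod q = 1 then q else 1)"

lemma norm_unimod [simp]: "cmod (unimod q) = 1"
  by (simp add: unimod_def)

lemma unimod_measurable [measurable]: "unimod \<in> borel_measurable borel"
  unfolding unimod_def by measurable

lemma log_kernel_measurable [measurable]:
  assumes [measurable]: "f \<in> borel_measurable M" "g \<in> borel_measurable M"
  shows "(\<lambda>x. log_kernel (f x) (g x)) \<in> borel_measurable M"
  unfolding log_kernel_def by measurable

lemma cnj_measurable [measurable]: "cnj \<in> borel_measurable borel"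
  by (intro borel_measurable_continuous_onI continuous_intros)

lemma power_series_measurable [measurable]:
  assumes [measurable]: "f \<in> borel_measurable M"
  shows "(\<lambda>x. power_series a (f x)) \<in> borel_measurable M"
  unfolding power_series_def by measurable

text \<open>The energy condition concerns the positive part of the kernel, since
  \<open>e2ennreal\<close> truncates at 0; on the unit circle the negative part is at most ln
  2.\<close>

locale energy_measure = prob_space \<mu> for \<mu> :: "complex measure" +
  assumes sets_mu [measurable_cong]: "sets \<mu> = sets borel"
    and AE_circle: "AE q in \<mu>. cmod q = 1"
    and finite_energy: "(\<integral>\<^sup>+z. (\<integral>\<^sup>+w. e2ennreal (log_kernel z w) \<partial>\<mu>) \<partial>\<mu>) < \<infinity>"
begin

text \<open>The summand ln 2 + pi is the additive constant of
  \<open>norm_Ln_kernel_le\<close>.\<close>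

definition energy_bound :: real where
  "energy_bound = ln 2 + pi + enn2real (\<integral>\<^sup>+z. (\<integral>\<^sup>+w. e2ennreal (log_kernel z w) \<partial>\<mu>) \<partial>\<mu>)"

lemma space_mu [simp]: "space \<mu> = UNIV"
  using sets_eq_imp_space_eq[OF sets_mu] by simp

lemma energy_bound_nonneg: "0 \<le> energy_bound"
  unfolding energy_bound_def by simp

lemma nn_integral_kernel:
  "(\<integral>\<^sup>+z. (\<integral>\<^sup>+w. ennreal (ln 2 + pi) + e2ennreal (log_kernel z w) \<partial>\<mu>) \<partial>\<mu>) = ennreal energy_bound"
proof -
  have "(\<integral>\<^sup>+z. (\<integral>\<^sup>+w. ennreal (ln 2 + pi) + e2ennreal (log_kernel z w) \<partial>\<mu>) \<partial>\<mu>)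
      = (\<integral>\<^sup>+z. ennreal (ln 2 + pi) + (\<integral>\<^sup>+w. e2ennreal (log_kernel z w) \<partial>\<mu>) \<partial>\<mu>)"
    by (intro nn_integral_cong) (simp add: nn_integral_add emeasure_space_1[simplified] del: ennreal_plus)
  also have "\<dots> = ennreal (ln 2 + pi) + (\<integral>\<^sup>+z. (\<integral>\<^sup>+w. e2ennreal (log_kernel z w) \<partial>\<mu>) \<partial>\<mu>)"
    by (subst nn_integral_add) (simp_all add: emeasure_space_1[simplified] del: ennreal_plus)
  also have "(\<integral>\<^sup>+z. (\<integral>\<^sup>+w. e2ennreal (log_kernel z w) \<partial>\<mu>) \<partial>\<mu>) = ennreal (enn2real (\<integral>\<^sup>+z. (\<integral>\<^sup>+w. e2ennreal (log_kernel z w) \<partial>\<mu>) \<partial>\<mu>))"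
    using finite_energy by simp
  finally show ?thesis
    unfolding energy_bound_def by (subst (2) ennreal_plus) auto
qed

lemma integrable_bounded:
  fixes g :: "complex \<Rightarrow> complex"
  assumes [measurable]: "g \<in> borel_measurable borel" and "\<And>q. cmod (g q) \<le> B"
  shows "integrable \<mu> g"
  by (rule integrable_const_bound[where B = B]) (use assms in auto)

text \<open>The dual form of the maximal inequality. The sum of |x_n|^2 / n is a double integral of
  the two phases against sum (Z(p) cnj Z(q))^n / n, a truncation of -Ln(1 - Z(p) cnj Z(q)), and this
  logarithm is dominated by the energy kernel whatever the radii are. The bound R < 1 makes the
  truncation error uniform.\<close>

lemma moments_bound:
  assumes [measurable]: "\<rho> \<in> borel_measurable borel" "\<phi> \<in> borel_measurable borel"
    and \<rho>: "\<And>q. 0 \<le> \<rho> q" "\<And>q. \<rho> q \<le> R" and R: "R < 1" and \<phi>: "\<And>q. cmod (\<phi> q) \<le> 1"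
    and x: "\<And>n. x n = (\<integral>q. \<phi> q * (of_real (\<rho> q) * unimod q) ^ n \<partial>\<mu>)"
  shows "(\<Sum>n=1..N. (cmod (x n))\<^sup>2 / real n) \<le> energy_bound"
proof -
  define Z where "Z = (\<lambda>q. of_real (\<rho> q) * unimod q)"
  have [measurable]: "Z \<in> borel_measurable borel" unfolding Z_def by measurable
  have R0: "0 \<le> R" using \<rho>(1)[of 0] \<rho>(2)[of 0] by linarith
  have Zn: "cmod (Z q) = \<rho> q" for q using \<rho>(1)[of q] by (simp add: Z_def norm_mult)
  have ZR: "cmod (Z q) \<le> R" for q using \<rho> Zn by simp
  have R2: "R * R < 1" using R R0 by (metis mult_less_cancel_right2 less_eq_real_def mult_strict_mono' mult_1 zero_less_one)
  have Zpow: "cmod (Z q ^ n) \<le> 1" for q n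
    using ZR[of q] R by (simp add: norm_power power_le_one)
  have xZ: "x n = (\<integral>q. \<phi> q * Z q ^ n \<partial>\<mu>)" for n by (simp add: x Z_def)
  have pq1: "cmod (u * v) \<le> 1" if "cmod u \<le> 1" "cmod v \<le> 1" for u v :: complex
    using that by (simp add: norm_mult mult_le_one)
  have int1: "integrable \<mu> (\<lambda>q. \<phi> q * Z q ^ n)" for n
    by (rule integrable_bounded[where B = 1]) (use pq1 \<phi> Zpow in auto)
  have int2: "integrable \<mu> (\<lambda>q. cnj (\<phi> q) * cnj (Z q) ^ n)" for n
    by (rule integrable_bounded[where B = 1]) (use pq1 \<phi> Zpow in \<open>auto simp flip: complex_cnj_power\<close>)
  have cnjx: "cnj (x n) = (\<integral>q. cnj (\<phi> q) * cnj (Z q) ^ n \<partial>\<mu>)" for n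
    unfolding xZ using integral_bounded_linear[OF bounded_linear_cnj int1[of n]] by simp
  define S where "S = (\<lambda>M p q. \<Sum>n=1..M. (Z p * cnj (Z q)) ^ n / of_nat n)"
  have inner: "(\<integral>q. cnj (\<phi> q) * S M p q \<partial>\<mu>) = (\<Sum>n=1..M. Z p ^ n / of_nat n * cnj (x n))" for M p
  proof -
    have "(\<integral>q. cnj (\<phi> q) * S M p q \<partial>\<mu>) = (\<integral>q. (\<Sum>n=1..M. Z p ^ n / of_nat n * (cnj (\<phi> q) * cnj (Z q) ^ n)) \<partial>\<mu>)"
      unfolding S_def sum_distrib_left
      by (intro Bochner_Integration.integral_cong sum.cong refl) (simp add: power_mult_distrib)
    also have "\<dots> = (\<Sum>n=1..M. \<integral>q. Z p ^ n / of_nat n * (cnj (\<phi> q) * cnj (Z q) ^ n) \<partial>\<mu>)"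
      by (rule Bochner_Integration.integral_sum) (intro integrable_mult_right int2)
    finally show ?thesis by (simp add: cnjx)
  qed
  have intp: "integrable \<mu> (\<lambda>p. \<phi> p * (\<integral>q. cnj (\<phi> q) * S M p q \<partial>\<mu>))" for M
  proof -
    have "integrable \<mu> (\<lambda>p. \<Sum>n=1..M. cnj (x n) / of_nat n * (\<phi> p * Z p ^ n))"
      by (intro Bochner_Integration.integrable_sum integrable_mult_right int1)
    moreover have "(\<lambda>p. \<phi> p * (\<integral>q. cnj (\<phi> q) * S M p q \<partial>\<mu>)) = (\<lambda>p. \<Sum>n=1..M. cnj (x n) / of_nat n * (\<phi> p * Z p ^ n))"
      unfolding inner sum_distrib_left by (intro ext sum.cong refl) simp
    ultimately show ?thesis by simp
  qed
  have outer: "(\<integral>p. \<phi> p * (\<integral>q. cnj (\<phi> q) * S M p q \<partial>\<mu>) \<partial>\<mu>) = of_real (\<Sum>n=1..M. (cmod (x n))\<^sup>2 / real n)" for M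
  proof -
    have "(\<integral>p. \<phi> p * (\<integral>q. cnj (\<phi> q) * S M p q \<partial>\<mu>) \<partial>\<mu>) = (\<integral>p. (\<Sum>n=1..M. cnj (x n) / of_nat n * (\<phi> p * Z p ^ n)) \<partial>\<mu>)"
      unfolding inner sum_distrib_left
      by (intro Bochner_Integration.integral_cong sum.cong refl) simp
    also have "\<dots> = (\<Sum>n=1..M. \<integral>p. cnj (x n) / of_nat n * (\<phi> p * Z p ^ n) \<partial>\<mu>)"
      by (rule Bochner_Integration.integral_sum) (intro integrable_mult_right int1)
    also have "\<dots> = (\<Sum>n=1..M. cnj (x n) / of_nat n * x n)"
      by (simp add: xZ)
    also have "\<dots> = of_real (\<Sum>n=1..M. (cmod (x n))\<^sup>2 / real n)"
      unfolding of_real_sum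
    proof (intro sum.cong refl)
      fix n
      have "complex_of_real ((cmod (x n))\<^sup>2 / real n) = of_real ((cmod (x n))\<^sup>2) / of_nat n" by simp
      also have "of_real ((cmod (x n))\<^sup>2) = x n * cnj (x n)" by (rule complex_norm_square)
      finally show "cnj (x n) / of_nat n * x n = complex_of_real ((cmod (x n))\<^sup>2 / real n)"
        by (metis mult.commute times_divide_eq_left)
    qed
    finally show ?thesis .
  qed
  have main: "(\<Sum>n=1..M. (cmod (x n))\<^sup>2 / real n) \<le> energy_bound + (R * R) ^ Suc M / (1 - R * R)" for M
  proof -
    define e where "e = (R * R) ^ Suc M / (1 - R * R)"
    have e0: "0 \<le> e" unfolding e_def using R2 R0 by simp
    have Sb: "ennreal (cmod (S M p q)) \<le> ennreal e + (ennreal (ln 2 + pi) + e2ennreal (log_kernel p q))"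
      if p: "cmod p = 1" and q: "cmod q = 1" for p q
    proof -
      define w where "w = Z p * cnj (Z q)"
      have wR: "cmod w \<le> R * R"
        unfolding w_def norm_mult complex_mod_cnj by (intro mult_mono ZR) (use R0 in auto)
      have weq: "w = of_real (\<rho> p * \<rho> q) * (p * cnj q)"
        using p q by (simp add: w_def Z_def unimod_def)
      have rr: "\<rho> p * \<rho> q < 1"
        using wR R2 Zn unfolding w_def norm_mult complex_mod_cnj by simp
      have "cmod (S M p q) \<le> cmod (S M p q + Ln (1 - w)) + cmod (Ln (1 - w))"
        by (metis add_diff_cancel_right' norm_triangle_ineq4)
      also have "cmod (S M p q + Ln (1 - w)) \<le> e"
        unfolding S_def e_def w_def[symmetric] by (rule partial_Ln_bound[OF wR R2])
      finally have "ennreal (cmod (S M p q)) \<le> ennreal (e + cmod (Ln (1 - w)))"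
        by (intro ennreal_leI) simp
      also have "\<dots> = ennreal e + ennreal (cmod (Ln (1 - w)))" using e0 by (simp add: ennreal_plus)
      also have "ennreal (cmod (Ln (1 - w))) \<le> ennreal (ln 2 + pi) + e2ennreal (log_kernel p q)"
        unfolding weq by (rule norm_Ln_kernel_le[OF p q]) (use \<rho> rr in auto)
      finally show ?thesis by (simp add: add_left_mono)
    qed
    have Sm [measurable]: "(\<lambda>q. S M p q) \<in> borel_measurable borel" for p
      unfolding S_def by measurable
    have intS: "integrable \<mu> (\<lambda>q. cnj (\<phi> q) * S M p q)" for p
    proof -
      have "integrable \<mu> (\<lambda>q. \<Sum>n=1..M. Z p ^ n / of_nat n * (cnj (\<phi> q) * cnj (Z q) ^ n))"
        by (intro Bochner_Integration.integrable_sum integrable_mult_right int2)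
      moreover have "(\<lambda>q. cnj (\<phi> q) * S M p q) = (\<lambda>q. \<Sum>n=1..M. Z p ^ n / of_nat n * (cnj (\<phi> q) * cnj (Z q) ^ n))"
        unfolding S_def sum_distrib_left by (intro ext sum.cong refl) (simp add: power_mult_distrib)
      ultimately show ?thesis by simp
    qed
    have "ennreal (\<Sum>n=1..M. (cmod (x n))\<^sup>2 / real n) = ennreal (cmod (\<integral>p. \<phi> p * (\<integral>q. cnj (\<phi> q) * S M p q \<partial>\<mu>) \<partial>\<mu>))"
      unfolding outer norm_of_real by (intro arg_cong[where f = ennreal] abs_of_nonneg[symmetric] sum_nonneg) auto
    also have "\<dots> \<le> (\<integral>\<^sup>+p. ennreal (cmod (\<phi> p * (\<integral>q. cnj (\<phi> q) * S M p q \<partial>\<mu>))) \<partial>\<mu>)"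
      by (rule integral_norm_bound_ennreal[OF intp])
    also have "\<dots> \<le> (\<integral>\<^sup>+p. (\<integral>\<^sup>+q. ennreal e + (ennreal (ln 2 + pi) + e2ennreal (log_kernel p q)) \<partial>\<mu>) \<partial>\<mu>)"
    proof (rule nn_integral_mono_AE)
      show "AE p in \<mu>. ennreal (cmod (\<phi> p * (\<integral>q. cnj (\<phi> q) * S M p q \<partial>\<mu>))) \<le> (\<integral>\<^sup>+q. ennreal e + (ennreal (ln 2 + pi) + e2ennreal (log_kernel p q)) \<partial>\<mu>)"
        using AE_circle
      proof eventually_elim
        fix p :: complex assume p: "cmod p = 1"
        have "ennreal (cmod (\<phi> p * (\<integral>q. cnj (\<phi> q) * S M p q \<partial>\<mu>))) \<le> ennreal (cmod (\<integral>q. cnj (\<phi> q) * S M p q \<partial>\<mu>))"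
          using \<phi>[of p] by (intro ennreal_leI) (simp add: norm_mult mult_left_le_one_le)
        also have "\<dots> \<le> (\<integral>\<^sup>+q. ennreal (cmod (cnj (\<phi> q) * S M p q)) \<partial>\<mu>)"
          by (rule integral_norm_bound_ennreal[OF intS])
        also have "\<dots> \<le> (\<integral>\<^sup>+q. ennreal e + (ennreal (ln 2 + pi) + e2ennreal (log_kernel p q)) \<partial>\<mu>)"
        proof (rule nn_integral_mono_AE)
          show "AE q in \<mu>. ennreal (cmod (cnj (\<phi> q) * S M p q)) \<le> ennreal e + (ennreal (ln 2 + pi) + e2ennreal (log_kernel p q))"
            using AE_circle
          proof eventually_elim
            fix q :: complex assume q: "cmod q = 1"
            have "ennreal (cmod (cnj (\<phi> q) * S M p q)) \<le> ennreal (cmod (S M p q))"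
              using \<phi>[of q] by (intro ennreal_leI) (simp add: norm_mult mult_left_le_one_le)
            then show "ennreal (cmod (cnj (\<phi> q) * S M p q)) \<le> ennreal e + (ennreal (ln 2 + pi) + e2ennreal (log_kernel p q))"
              using Sb[OF p q] by (rule order_trans)
          qed
        qed
        finally show "ennreal (cmod (\<phi> p * (\<integral>q. cnj (\<phi> q) * S M p q \<partial>\<mu>))) \<le> (\<integral>\<^sup>+q. ennreal e + (ennreal (ln 2 + pi) + e2ennreal (log_kernel p q)) \<partial>\<mu>)" .
      qed
    qed
    also have "\<dots> = (\<integral>\<^sup>+p. ennreal e + (\<integral>\<^sup>+q. ennreal (ln 2 + pi) + e2ennreal (log_kernel p q) \<partial>\<mu>) \<partial>\<mu>)"
      by (intro nn_integral_cong, subst nn_integral_add) (simp_all add: emeasure_space_1[simplified] del: ennreal_plus)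
    also have "\<dots> = ennreal e + ennreal energy_bound"
      by (subst nn_integral_add) (simp_all add: nn_integral_kernel emeasure_space_1[simplified] del: ennreal_plus)
    also have "\<dots> = ennreal (energy_bound + e)"
      using e0 energy_bound_nonneg by (simp add: ennreal_plus add.commute)
    finally show ?thesis
      unfolding e_def[symmetric] using e0 energy_bound_nonneg by (subst (asm) ennreal_le_iff) auto
  qed
  \<comment> \<open>The terms are nonnegative, so N can stay fixed while the truncation index M
    tends to infinity and the error term disappears.\<close>
  have mono: "(\<Sum>n=1..N. (cmod (x n))\<^sup>2 / real n) \<le> energy_bound + (R * R) ^ Suc M / (1 - R * R)" if "M \<ge> N" for M
  proof -
    have "(\<Sum>n=1..N. (cmod (x n))\<^sup>2 / real n) \<le> (\<Sum>n=1..M. (cmod (x n))\<^sup>2 / real n)"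
      by (rule sum_mono2) (use that in auto)
    then show ?thesis using main[of M] by linarith
  qed
  have "(\<lambda>M. energy_bound + (R * R) ^ Suc M / (1 - R * R)) \<longlonglongrightarrow> energy_bound + 0 / (1 - R * R)"
    using R2 R0 by (intro tendsto_intros LIMSEQ_Suc LIMSEQ_power_zero) auto
  then have "(\<Sum>n=1..N. (cmod (x n))\<^sup>2 / real n) \<le> energy_bound + 0 / (1 - R * R)"
    by (rule LIMSEQ_le_const) (use mono in blast)
  then show ?thesis by simp
qed

text \<open>The measurable radius \<open>\<rho>\<close> linearises the supremum over radii.\<close>

lemma polynomial_maximal:
  assumes [measurable]: "\<rho> \<in> borel_measurable borel"
    and \<rho>: "\<And>q. 0 \<le> \<rho> q" "\<And>q. \<rho> q \<le> R" and R: "R < 1"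
  shows "(\<integral>\<^sup>+q. ennreal (cmod (\<Sum>n=1..N. a n * (of_real (\<rho> q) * unimod q) ^ n)) \<partial>\<mu>)
           \<le> ennreal (sqrt (\<Sum>n=1..N. real n * (cmod (a n))\<^sup>2) * sqrt energy_bound)"
proof -
  define Z where "Z = (\<lambda>q. of_real (\<rho> q) * unimod q)"
  have [measurable]: "Z \<in> borel_measurable borel" unfolding Z_def by measurable
  have Zn: "cmod (Z q) = \<rho> q" for q using \<rho>(1)[of q] by (simp add: Z_def norm_mult)
  have Zpow: "cmod (Z q ^ n) \<le> 1" for q n
    using Zn[of q] \<rho>(1)[of q] \<rho>(2)[of q] R by (simp add: norm_power power_le_one)
  define P where "P = (\<lambda>q. \<Sum>n=1..N. a n * Z q ^ n)"
  have [measurable]: "P \<in> borel_measurable borel" unfolding P_def by measurable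
  \<comment> \<open>The conjugate phase of \<open>P\<close> turns |P| into \<phi> P, whose integral
    is sum a_n x_n with the moments x_n of the dual bound. Cauchy-Schwarz with weights sqrt n and 1
    / sqrt n then separates the Dirichlet norm from the energy.\<close>
  define \<phi> where "\<phi> = (\<lambda>q. cnj (sgn (P q)))"
  have [measurable]: "(sgn :: complex \<Rightarrow> complex) \<in> borel_measurable borel"
    unfolding sgn_div_norm[abs_def] by measurable
  have [measurable]: "\<phi> \<in> borel_measurable borel"
    unfolding \<phi>_def by measurable
  have \<phi>1: "cmod (\<phi> q) \<le> 1" for q by (simp add: \<phi>_def norm_sgn)
  have \<phi>P: "\<phi> q * P q = of_real (cmod (P q))" for q
  proof (cases "P q = 0")
    case False
    have "\<phi> q * P q = (P q * cnj (P q)) / of_real (cmod (P q))"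
      by (simp add: \<phi>_def sgn_div_norm scaleR_conv_of_real field_simps)
    also have "\<dots> = of_real ((cmod (P q))\<^sup>2) / of_real (cmod (P q))" by (simp only: complex_norm_square)
    also have "\<dots> = of_real (cmod (P q))" using False by (simp add: power2_eq_square)
    finally show ?thesis .
  qed simp
  define x where "x = (\<lambda>n. \<integral>q. \<phi> q * (of_real (\<rho> q) * unimod q) ^ n \<partial>\<mu>)"
  have xb: "(\<Sum>n=1..N. (cmod (x n))\<^sup>2 / real n) \<le> energy_bound"
    by (rule moments_bound[OF _ _ \<rho> R \<phi>1]) (auto simp: x_def)
  have pq1: "cmod (u * v) \<le> 1" if "cmod u \<le> 1" "cmod v \<le> 1" for u v :: complex
    using that by (simp add: norm_mult mult_le_one)
  have int1: "integrable \<mu> (\<lambda>q. \<phi> q * Z q ^ n)" for n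
    by (rule integrable_bounded[where B = 1]) (use pq1 \<phi>1 Zpow in auto)
  have \<phi>Ps: "\<phi> q * P q = (\<Sum>n=1..N. a n * (\<phi> q * Z q ^ n))" for q
    unfolding P_def sum_distrib_left by (intro sum.cong refl) simp
  have "(\<integral>q. \<phi> q * P q \<partial>\<mu>) = (\<Sum>n=1..N. \<integral>q. a n * (\<phi> q * Z q ^ n) \<partial>\<mu>)"
    unfolding \<phi>Ps by (rule Bochner_Integration.integral_sum) (intro integrable_mult_right int1)
  also have "\<dots> = (\<Sum>n=1..N. a n * x n)" by (simp add: x_def Z_def)
  finally have I: "(\<integral>q. \<phi> q * P q \<partial>\<mu>) = (\<Sum>n=1..N. a n * x n)" .
  have intP: "integrable \<mu> (\<lambda>q. \<phi> q * P q)"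
    unfolding \<phi>Ps by (intro Bochner_Integration.integrable_sum integrable_mult_right int1)
  then have intPr: "integrable \<mu> (\<lambda>q. cmod (P q))"
    using integrable_norm[OF intP] unfolding \<phi>P by simp
  have "(\<integral>\<^sup>+q. ennreal (cmod (P q)) \<partial>\<mu>) = ennreal (\<integral>q. cmod (P q) \<partial>\<mu>)"
    by (rule nn_integral_eq_integral[OF intPr]) auto
  also have "(\<integral>q. cmod (P q) \<partial>\<mu>) \<le> cmod (\<Sum>n=1..N. a n * x n)"
  proof -
    have "of_real (\<integral>q. cmod (P q) \<partial>\<mu>) = (\<Sum>n=1..N. a n * x n)"
      using I unfolding \<phi>P by simp
    then show ?thesis by (metis abs_ge_self norm_of_real)
  qed
  also have "cmod (\<Sum>n=1..N. a n * x n) \<le> (\<Sum>n=1..N. \<bar>sqrt (real n) * cmod (a n)\<bar> * \<bar>cmod (x n) / sqrt (real n)\<bar>)"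
  proof (rule order_trans[OF norm_sum sum_mono])
    fix n assume "n \<in> {1..N}"
    then show "cmod (a n * x n) \<le> \<bar>sqrt (real n) * cmod (a n)\<bar> * \<bar>cmod (x n) / sqrt (real n)\<bar>"
      by (simp add: norm_mult abs_mult)
  qed
  also have "\<dots> \<le> L2_set (\<lambda>n. sqrt (real n) * cmod (a n)) {1..N} * L2_set (\<lambda>n. cmod (x n) / sqrt (real n)) {1..N}"
    by (rule L2_set_mult_ineq)
  also have "\<dots> \<le> sqrt (\<Sum>n=1..N. real n * (cmod (a n))\<^sup>2) * sqrt energy_bound"
    unfolding L2_set_def
    using xb by (intro mult_mono real_sqrt_le_mono) (auto simp: power_mult_distrib power_divide intro!: sum_nonneg real_sqrt_ge_zero)
  finally show ?thesis unfolding P_def Z_def by (simp add: ennreal_leI)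
qed

text \<open>Fatou's lemma passes from partial sums to the series. The constant term vanishes because
  the weights sqrt n give no control over it.\<close>

lemma power_series_maximal:
  assumes a: "dirichlet_coeffs a" "a 0 = 0"
    and [measurable]: "\<rho> \<in> borel_measurable borel"
    and \<rho>: "\<And>q. 0 \<le> \<rho> q" "\<And>q. \<rho> q \<le> R" and R: "R < 1"
  shows "(\<integral>\<^sup>+q. ennreal (cmod (power_series a (of_real (\<rho> q) * unimod q))) \<partial>\<mu>)
           \<le> ennreal (sqrt (\<Sum>n. real n * (cmod (a n))\<^sup>2) * sqrt energy_bound)"
proof -
  let ?Z = "\<lambda>q. of_real (\<rho> q) * unimod q"
  let ?P = "\<lambda>N q. \<Sum>n=1..N. a n * ?Z q ^ n"
  let ?B = "ennreal (sqrt (\<Sum>n. real n * (cmod (a n))\<^sup>2) * sqrt energy_bound)"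
  have Zn: "cmod (?Z q) < 1" for q using \<rho>(1)[of q] \<rho>(2)[of q] R by (simp add: norm_mult)
  have lim: "(\<lambda>N. ?P N q) \<longlonglongrightarrow> power_series a (?Z q)" for q
  proof -
    have "(\<lambda>N. \<Sum>n<Suc N. a n * ?Z q ^ n) \<longlonglongrightarrow> power_series a (?Z q)"
      using dirichlet_coeffs_sums[OF a(1) Zn] unfolding sums_def by (rule LIMSEQ_Suc)
    moreover have "(\<Sum>n<Suc N. a n * ?Z q ^ n) = ?P N q" for N
      using a(2) by (simp only: lessThan_Suc_atMost atMost_atLeast0 sum.atLeast_Suc_atMost[of 0 N]) simp
    ultimately show ?thesis by simp
  qed
  have "(\<integral>\<^sup>+q. ennreal (cmod (power_series a (?Z q))) \<partial>\<mu>) = (\<integral>\<^sup>+q. liminf (\<lambda>N. ennreal (cmod (?P N q))) \<partial>\<mu>)"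
  proof (rule nn_integral_cong)
    fix q
    have "(\<lambda>N. ennreal (cmod (?P N q))) \<longlonglongrightarrow> ennreal (cmod (power_series a (?Z q)))"
      by (intro tendsto_ennrealI tendsto_norm lim)
    then show "ennreal (cmod (power_series a (?Z q))) = liminf (\<lambda>N. ennreal (cmod (?P N q)))"
      using lim_imp_Liminf by (metis trivial_limit_sequentially)
  qed
  also have "\<dots> \<le> liminf (\<lambda>N. \<integral>\<^sup>+q. ennreal (cmod (?P N q)) \<partial>\<mu>)"
    by (rule nn_integral_liminf) measurable
  also have "\<dots> \<le> ?B"
  proof (rule Liminf_le)
    show "\<forall>\<^sub>F N in sequentially. (\<integral>\<^sup>+q. ennreal (cmod (?P N q)) \<partial>\<mu>) \<le> ?B"
    proof (rule always_eventually, rule allI)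
      fix N
      have "(\<Sum>n=1..N. real n * (cmod (a n))\<^sup>2) \<le> (\<Sum>n. real n * (cmod (a n))\<^sup>2)"
        using a(1) unfolding dirichlet_coeffs_def by (intro sum_le_suminf) auto
      then have "ennreal (sqrt (\<Sum>n=1..N. real n * (cmod (a n))\<^sup>2) * sqrt energy_bound) \<le> ?B"
        by (intro ennreal_leI mult_right_mono real_sqrt_le_mono) (auto simp: energy_bound_nonneg)
      then show "(\<integral>\<^sup>+q. ennreal (cmod (?P N q)) \<partial>\<mu>) \<le> ?B"
        using polynomial_maximal[of \<rho> R a N] \<rho> R by (auto intro: order_trans)
    qed
  qed simp
  finally show ?thesis .
qed

text \<open>For finitely many radii the supremum is attained at an index depending measurably on q,
  the least maximising one, so the bound for measurable radii applies; monotone convergence covers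
  the whole sequence.\<close>

lemma maximal_inequality:
  assumes a: "dirichlet_coeffs a" "a 0 = 0" and r: "\<And>k. 0 \<le> r k" "\<And>k::nat. r k < 1"
  shows "(\<integral>\<^sup>+q. (SUP k. ennreal (cmod (power_series a (of_real (r k) * unimod q)))) \<partial>\<mu>)
           \<le> ennreal (sqrt (\<Sum>n. real n * (cmod (a n))\<^sup>2) * sqrt energy_bound)"
proof -
  let ?B = "ennreal (sqrt (\<Sum>n. real n * (cmod (a n))\<^sup>2) * sqrt energy_bound)"
  define f where "f = (\<lambda>k q. cmod (power_series a (of_real (r k) * unimod q)))"
  have [measurable]: "f k \<in> borel_measurable borel" for k unfolding f_def by measurable
  have J: "(\<integral>\<^sup>+q. (SUP k\<in>{..J}. ennreal (f k q)) \<partial>\<mu>) \<le> ?B" for J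
  proof -
    define j where "j = (\<lambda>q. LEAST j. j \<le> J \<and> (\<forall>i\<le>J. f i q \<le> f j q))"
    have jex: "j q \<le> J \<and> (\<forall>i\<le>J. f i q \<le> f (j q) q)" for q
      unfolding j_def
    proof (rule LeastI_ex)
      have "Max ((\<lambda>i. f i q) ` {..J}) \<in> (\<lambda>i. f i q) ` {..J}" by (rule Max_in) auto
      then obtain i where i: "Max ((\<lambda>i. f i q) ` {..J}) = f i q" "i \<in> {..J}" by (rule imageE)
      then have "\<forall>i'\<le>J. f i' q \<le> f i q" by (auto simp flip: i(1) intro!: Max_ge)
      then show "\<exists>j\<le>J. \<forall>i\<le>J. f i q \<le> f j q" using i(2) by auto
    qed
    have jm [measurable]: "j \<in> borel \<rightarrow>\<^sub>M count_space UNIV" unfolding j_def by measurable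
    have "(\<lambda>q. r (j q)) \<in> borel_measurable borel"
      by (rule measurable_compose[OF jm]) simp
    then have "(\<integral>\<^sup>+q. ennreal (cmod (power_series a (of_real (r (j q)) * unimod q))) \<partial>\<mu>) \<le> ?B"
      using jex r by (intro power_series_maximal[OF a, of _ "Max (r ` {..J})"]) auto
    moreover have "(\<integral>\<^sup>+q. (SUP k\<in>{..J}. ennreal (f k q)) \<partial>\<mu>) \<le> (\<integral>\<^sup>+q. ennreal (cmod (power_series a (of_real (r (j q)) * unimod q))) \<partial>\<mu>)"
    proof (rule nn_integral_mono)
      fix q
      have "ennreal (cmod (power_series a (of_real (r (j q)) * unimod q))) = ennreal (f (j q) q)" by (simp add: f_def)
      then show "(SUP k\<in>{..J}. ennreal (f k q)) \<le> ennreal (cmod (power_series a (of_real (r (j q)) * unimod q)))"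
        using jex[of q] by (auto intro!: SUP_least ennreal_leI)
    qed
    ultimately show ?thesis by (rule order_trans[rotated])
  qed
  have "(SUP k. ennreal (f k q)) = (SUP J. SUP k\<in>{..J}. ennreal (f k q))" for q
    by (intro antisym SUP_least) (auto intro: SUP_upper2 SUP_upper)
  then have "(\<integral>\<^sup>+q. (SUP k. ennreal (f k q)) \<partial>\<mu>) = (\<integral>\<^sup>+q. (SUP J. SUP k\<in>{..J}. ennreal (f k q)) \<partial>\<mu>)"
    by simp
  also have "\<dots> = (SUP J. \<integral>\<^sup>+q. (SUP k\<in>{..J}. ennreal (f k q)) \<partial>\<mu>)"
    by (rule nn_integral_monotone_convergence_SUP) (auto simp: incseq_def le_fun_def intro!: SUP_subset_mono)
  also have "\<dots> \<le> ?B" by (intro SUP_least J)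
  finally show ?thesis unfolding f_def .
qed

lemma maximal_function_finite:
  assumes a: "dirichlet_coeffs a" and r: "\<And>k. 0 \<le> r k" "\<And>k::nat. r k < 1"
  shows "(\<integral>\<^sup>+q. (SUP k. ennreal (cmod (power_series a (of_real (r k) * unimod q)))) \<partial>\<mu>) < \<infinity>"
proof -
  let ?t = "tail_coeffs 1 a"
  have "(\<integral>\<^sup>+q. (SUP k. ennreal (cmod (power_series a (of_real (r k) * unimod q)))) \<partial>\<mu>)
     \<le> (\<integral>\<^sup>+q. ennreal (cmod (a 0)) + (SUP k. ennreal (cmod (power_series ?t (of_real (r k) * unimod q)))) \<partial>\<mu>)"
  proof (intro nn_integral_mono SUP_least)
    fix q k
    have "power_series a (of_real (r k) * unimod q) = a 0 + power_series ?t (of_real (r k) * unimod q)"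
      using power_series_tail[OF a, of "of_real (r k) * unimod q" 1] r by (simp add: norm_mult)
    then have "ennreal (cmod (power_series a (of_real (r k) * unimod q))) \<le> ennreal (cmod (a 0) + cmod (power_series ?t (of_real (r k) * unimod q)))"
      by (intro ennreal_leI) (simp add: norm_triangle_ineq)
    also have "\<dots> = ennreal (cmod (a 0)) + ennreal (cmod (power_series ?t (of_real (r k) * unimod q)))"
      by (simp add: ennreal_plus)
    also have "\<dots> \<le> ennreal (cmod (a 0)) + (SUP k. ennreal (cmod (power_series ?t (of_real (r k) * unimod q))))"
      by (intro add_left_mono SUP_upper) auto
    finally show "ennreal (cmod (power_series a (of_real (r k) * unimod q))) \<le> \<dots>" .
  qed
  also have "\<dots> = ennreal (cmod (a 0)) + (\<integral>\<^sup>+q. (SUP k. ennreal (cmod (power_series ?t (of_real (r k) * unimod q)))) \<partial>\<mu>)"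
    by (subst nn_integral_add) (simp_all add: emeasure_space_1[simplified])
  also have "\<dots> \<le> ennreal (cmod (a 0)) + ennreal (sqrt (\<Sum>n. real n * (cmod (?t n))\<^sup>2) * sqrt energy_bound)"
    by (intro add_left_mono maximal_inequality dirichlet_coeffs_tail a r) (simp add: tail_coeffs_def)
  also have "\<dots> < \<infinity>" by simp
  finally show ?thesis .
qed

text \<open>Polynomials converge along every radius, so an oscillation of size e persists in every
  tail of the series. By Markov's inequality and the maximal inequality the set where it occurs has
  measure at most a constant times the Dirichlet norm of the tail, which tends to 0.\<close>

lemma AE_Cauchy_radial:
  assumes a: "dirichlet_coeffs a" and r: "\<And>k. 0 \<le> r k" "\<And>k::nat. r k < 1" and lim: "r \<longlonglongrightarrow> 1"
  shows "AE q in \<mu>. Cauchy (\<lambda>k. power_series a (of_real (r k) * unimod q))"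
proof -
  let ?G = "\<lambda>k q. power_series a (of_real (r k) * unimod q)"
  define B where "B = (\<lambda>e q. \<forall>K. \<exists>k\<ge>K. \<exists>l\<ge>K. dist (?G k q) (?G l q) \<ge> e)"
  have Bnull: "AE q in \<mu>. \<not> B e q" if e: "e > 0" for e :: real
  proof -
    have meas [measurable]: "Measurable.pred borel (B e)" unfolding B_def by measurable
    have bound: "ennreal (e / 4) * emeasure \<mu> {q. B e q} \<le> ennreal (sqrt (\<Sum>n. real n * (cmod (tail_coeffs (Suc N) a n))\<^sup>2) * sqrt energy_bound)" for N
    proof -
      let ?t = "tail_coeffs (Suc N) a"
      have "ennreal (e / 4) * emeasure \<mu> {q. B e q} = (\<integral>\<^sup>+q. ennreal (e / 4) * indicator {q. B e q} q \<partial>\<mu>)"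
        by (subst nn_integral_cmult_indicator) auto
      also have "\<dots> \<le> (\<integral>\<^sup>+q. (SUP k. ennreal (cmod (power_series ?t (of_real (r k) * unimod q)))) \<partial>\<mu>)"
      proof (rule nn_integral_mono)
        fix q
        show "ennreal (e / 4) * indicator {q. B e q} q \<le> (SUP k. ennreal (cmod (power_series ?t (of_real (r k) * unimod q))))"
        proof (cases "B e q")
          case True
          let ?P = "\<lambda>k. \<Sum>n<Suc N. a n * (of_real (r k) * unimod q) ^ n"
          have "?P \<longlonglongrightarrow> (\<Sum>n<Suc N. a n * (of_real 1 * unimod q) ^ n)"
            by (intro tendsto_intros lim)
          then have "Cauchy ?P" using LIMSEQ_imp_Cauchy by blast
          then obtain K where K: "\<And>k l. k \<ge> K \<Longrightarrow> l \<ge> K \<Longrightarrow> dist (?P k) (?P l) < e / 2"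
            using e unfolding Cauchy_def by (meson half_gt_zero)
          obtain k l where kl: "k \<ge> K" "l \<ge> K" "dist (?G k q) (?G l q) \<ge> e"
            using True unfolding B_def by blast
          have G: "?G k q = ?P k + power_series ?t (of_real (r k) * unimod q)" for k
            by (rule power_series_tail[OF a]) (use r in \<open>simp add: norm_mult\<close>)
          have "e \<le> dist (?P k) (?P l) + (cmod (power_series ?t (of_real (r k) * unimod q)) + cmod (power_series ?t (of_real (r l) * unimod q)))"
          proof -
            have "e \<le> cmod ((?P k - ?P l) + (power_series ?t (of_real (r k) * unimod q) - power_series ?t (of_real (r l) * unimod q)))"
              using kl(3) unfolding G dist_norm by (simp add: algebra_simps)
            also have "\<dots> \<le> dist (?P k) (?P l) + cmod (power_series ?t (of_real (r k) * unimod q) - power_series ?t (of_real (r l) * unimod q))"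
              unfolding dist_norm by (rule norm_triangle_ineq)
            also have "\<dots> \<le> dist (?P k) (?P l) + (cmod (power_series ?t (of_real (r k) * unimod q)) + cmod (power_series ?t (of_real (r l) * unimod q)))"
              by (intro add_left_mono norm_triangle_ineq4)
            finally show ?thesis .
          qed
          \<comment> \<open>The polynomial part accounts for less than e/2 of the oscillation, so
            one of the two tail values is at least e/4.\<close>
          with K[OF kl(1,2)] have "e / 4 \<le> cmod (power_series ?t (of_real (r k) * unimod q)) \<or> e / 4 \<le> cmod (power_series ?t (of_real (r l) * unimod q))"
            by linarith
          then obtain i where "e / 4 \<le> cmod (power_series ?t (of_real (r i) * unimod q))" by blast
          then have "ennreal (e / 4) \<le> (SUP k. ennreal (cmod (power_series ?t (of_real (r k) * unimod q))))"
            by (intro SUP_upper2[of i] ennreal_leI) auto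
          then show ?thesis using True by simp
        qed simp
      qed
      also have "\<dots> \<le> ennreal (sqrt (\<Sum>n. real n * (cmod (?t n))\<^sup>2) * sqrt energy_bound)"
        by (intro maximal_inequality dirichlet_coeffs_tail a r) (simp add: tail_coeffs_def)
      finally show ?thesis .
    qed
    have "(\<lambda>N. ennreal (sqrt (\<Sum>n. real n * (cmod (tail_coeffs (Suc N) a n))\<^sup>2) * sqrt energy_bound)) \<longlonglongrightarrow> ennreal (sqrt 0 * sqrt energy_bound)"
      by (intro tendsto_ennrealI tendsto_mult tendsto_real_sqrt tendsto_const LIMSEQ_Suc dirichlet_coeffs_tail a)
    then have "ennreal (e / 4) * emeasure \<mu> {q. B e q} \<le> ennreal (sqrt 0 * sqrt energy_bound)"
      by (rule LIMSEQ_le_const) (use bound in blast)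
    then have "ennreal (e / 4) * emeasure \<mu> {q. B e q} = 0" by simp
    then have "emeasure \<mu> {q. B e q} = 0" using e by simp
    moreover have "{q. B e q} \<in> sets \<mu>" using meas by (simp add: sets_mu pred_def)
    ultimately show ?thesis by (intro AE_I[of _ _ "{q. B e q}"]) auto
  qed
  have "AE q in \<mu>. \<forall>m. \<not> B (1 / real (Suc m)) q"
    unfolding AE_all_countable using Bnull by simp
  then show ?thesis
  proof eventually_elim
    fix q assume q: "\<forall>m. \<not> B (1 / real (Suc m)) q"
    show "Cauchy (\<lambda>k. ?G k q)"
      unfolding Cauchy_def
    proof (intro allI impI)
      fix e :: real assume "e > 0"
      then obtain m where "1 / real (Suc m) < e" using nat_approx_posE by blast
      moreover obtain K where "\<And>k l. k \<ge> K \<Longrightarrow> l \<ge> K \<Longrightarrow> dist (?G k q) (?G l q) < 1 / real (Suc m)"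
        using q unfolding B_def by (meson not_le)
      ultimately show "\<exists>M. \<forall>m\<ge>M. \<forall>n\<ge>M. dist (?G m q) (?G n q) < e"
        by (meson less_trans)
    qed
  qed
qed

end

subsection \<open>Capacity zero and arc length\<close>

lemma log_capacity_eq_0_iff:
  "log_capacity E = 0 \<longleftrightarrow> (\<forall>\<mu>\<in>compactly_supported_probs E. log_energy \<mu> = \<infinity>)"
proof -
  have "log_capacity E = bot \<longleftrightarrow> (\<forall>\<mu>\<in>compactly_supported_probs E.
     (if log_energy \<mu> = \<infinity> then 0 else ennreal (exp (- real_of_ereal (log_energy \<mu>)))) = bot)"
    unfolding log_capacity_def by (rule SUP_bot_conv)
  also have "\<dots> \<longleftrightarrow> (\<forall>\<mu>\<in>compactly_supported_probs E. log_energy \<mu> = \<infinity>)"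
    by (intro ball_cong refl) (simp add: bot_ennreal ennreal_eq_0_iff not_le)
  finally show ?thesis by (simp add: bot_ennreal)
qed

lemma log_energy_finite:
  assumes "(\<integral>\<^sup>+z. (\<integral>\<^sup>+w. e2ennreal (log_kernel z w) \<partial>\<mu>) \<partial>\<mu>) < \<infinity>"
  shows "log_energy \<mu> \<noteq> \<infinity>"
proof -
  define P where "P = (\<integral>\<^sup>+z. (\<integral>\<^sup>+w. e2ennreal (log_kernel z w) \<partial>\<mu>) \<partial>\<mu>)"
  define Q where "Q = (\<integral>\<^sup>+z. (\<integral>\<^sup>+w. e2ennreal (- log_kernel z w) \<partial>\<mu>) \<partial>\<mu>)"
  have "enn2ereal P - enn2ereal Q \<le> enn2ereal P"
    using enn2ereal_nonneg[of Q] by (cases "enn2ereal P"; cases "enn2ereal Q") auto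
  moreover have "enn2ereal P \<noteq> \<infinity>" using assms unfolding P_def[symmetric] by auto
  ultimately show ?thesis unfolding log_energy_def P_def[symmetric] Q_def[symmetric] by auto
qed

text \<open>Points of the unit circle are at distance at most 2, so the negative part of the energy
  is at most ln 2 and finiteness of the difference forces finiteness of the positive part.\<close>

lemma finite_log_energyD:
  assumes "prob_space \<mu>" and sets: "sets \<mu> = sets borel" and AE: "AE q in \<mu>. cmod q = 1"
    and fin: "log_energy \<mu> \<noteq> \<infinity>"
  shows "(\<integral>\<^sup>+z. (\<integral>\<^sup>+w. e2ennreal (log_kernel z w) \<partial>\<mu>) \<partial>\<mu>) < \<infinity>"
proof -
  interpret prob_space \<mu> by fact
  define P where "P = (\<integral>\<^sup>+z. (\<integral>\<^sup>+w. e2ennreal (log_kernel z w) \<partial>\<mu>) \<partial>\<mu>)"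
  define Q where "Q = (\<integral>\<^sup>+z. (\<integral>\<^sup>+w. e2ennreal (- log_kernel z w) \<partial>\<mu>) \<partial>\<mu>)"
  have k: "e2ennreal (- log_kernel z w) \<le> ennreal (ln 2)" if "cmod z = 1" "cmod w = 1" for z w
  proof (cases "z = w")
    case False
    have "dist z w \<le> 2" using that norm_triangle_ineq4[of z w] by (simp add: dist_norm)
    then have "ln (dist z w) \<le> ln 2" using False by (intro ln_mono) auto
    then show ?thesis using False by (simp add: log_kernel_def ennreal_leI)
  qed (simp add: log_kernel_def e2ennreal_neg)
  have sp: "emeasure \<mu> (space \<mu>) = 1" by (rule emeasure_space_1)
  have "Q \<le> (\<integral>\<^sup>+z. (\<integral>\<^sup>+w. ennreal (ln 2) \<partial>\<mu>) \<partial>\<mu>)"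
    unfolding Q_def
  proof (intro nn_integral_mono_AE)
    show "AE z in \<mu>. (\<integral>\<^sup>+w. e2ennreal (- log_kernel z w) \<partial>\<mu>) \<le> (\<integral>\<^sup>+w. ennreal (ln 2) \<partial>\<mu>)"
      using AE
    proof eventually_elim
      fix z :: complex assume z: "cmod z = 1"
      show "(\<integral>\<^sup>+w. e2ennreal (- log_kernel z w) \<partial>\<mu>) \<le> (\<integral>\<^sup>+w. ennreal (ln 2) \<partial>\<mu>)"
        by (rule nn_integral_mono_AE) (use AE in \<open>eventually_elim, use k z in auto\<close>)
    qed
  qed
  then have "Q \<le> ennreal (ln 2)" by (simp add: sp)
  then have "enn2ereal Q \<noteq> \<infinity>" using less_eq_ennreal.rep_eq by fastforce
  then have "enn2ereal P \<noteq> \<infinity>"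
    using fin unfolding log_energy_def P_def[symmetric] Q_def[symmetric]
    by (cases "enn2ereal Q") auto
  then show ?thesis unfolding P_def[symmetric]
    by (metis infinity_ennreal_def enn2ereal_top less_top)
qed

text \<open>The chord is 2 sin x with x half the angle, and sin x >= x/2 for x <= 1/2 because the
  cosine is at least 1/2 up to pi/3.\<close>

lemma dist_cis_ge:
  assumes "\<bar>\<theta> - \<theta>'\<bar> \<le> 1"
  shows "\<bar>\<theta> - \<theta>'\<bar> / 2 \<le> dist (cis \<theta>) (cis \<theta>')"
proof -
  define x where "x = \<bar>\<theta> - \<theta>'\<bar> / 2"
  have x: "0 \<le> x" "x \<le> 1 / 2" using assms by (auto simp: x_def)
  have pi3: "1 / 2 < pi / 3" using pi_gt3 by simp
  have "sin 0 - 0 / 2 \<le> sin x - x / 2"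
  proof (rule DERIV_nonneg_imp_nondecreasing[OF x(1), of "\<lambda>x. sin x - x / 2"])
    fix t assume t: "0 \<le> t" "t \<le> x"
    have "cos (pi / 3) \<le> cos t" using t x pi3 by (intro cos_monotone_0_pi_le) auto
    then have "0 \<le> cos t - 1 / 2" by (simp add: cos_60)
    moreover have "((\<lambda>x. sin x - x / 2) has_real_derivative (cos t - 1 / 2)) (at t)"
      by (auto intro!: derivative_eq_intros)
    ultimately show "\<exists>y. ((\<lambda>x. sin x - x / 2) has_real_derivative y) (at t) \<and> 0 \<le> y" by blast
  qed
  then have s: "x / 2 \<le> sin x" by simp
  have "(dist (cis \<theta>) (cis \<theta>'))\<^sup>2 = (cos \<theta> - cos \<theta>')\<^sup>2 + (sin \<theta> - sin \<theta>')\<^sup>2"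
    by (simp add: dist_norm cmod_power2)
  also have "\<dots> = ((sin \<theta>)\<^sup>2 + (cos \<theta>)\<^sup>2) + ((sin \<theta>')\<^sup>2 + (cos \<theta>')\<^sup>2) - 2 * (cos \<theta> * cos \<theta>' + sin \<theta> * sin \<theta>')"
    by (simp only: power2_diff) (simp add: algebra_simps)
  also have "\<dots> = 2 - 2 * cos (\<theta> - \<theta>')" by (simp add: cos_diff)
  also have "cos (\<theta> - \<theta>') = cos (2 * x)" unfolding x_def by (simp add: abs_if cos_diff)
  also have "cos (2 * x) = 1 - 2 * (sin x)\<^sup>2" by (rule cos_double_sin)
  finally have "(dist (cis \<theta>) (cis \<theta>'))\<^sup>2 = (2 * sin x)\<^sup>2" by (simp add: power_mult_distrib)
  then have "dist (cis \<theta>) (cis \<theta>') = 2 * sin x"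
    by (rule power2_eq_imp_eq) (use s x in auto)
  then show ?thesis using s by (simp add: x_def)
qed

text \<open>The power |u|^(-1/2) dominates the logarithmic singularity up to a constant and is still
  integrable at 0; the value at u = 0 is infinite to match the diagonal of
  \<open>log_kernel\<close>.\<close>

lemma arc_energy_kernel_finite:
  fixes c :: real
  assumes c: "c > 0"
  shows "(\<integral>\<^sup>+u\<in>{-1..1}. (if u = 0 then \<infinity> else ennreal (2 * c * \<bar>u\<bar> powr (-1/2))) \<partial>lborel) < \<infinity>"
proof -
  define h where "h = (\<lambda>u::real. (if u = 0 then \<infinity> else ennreal (2 * c * \<bar>u\<bar> powr (-1/2))))"
  have [measurable]: "h \<in> borel_measurable borel" unfolding h_def by measurable
  have I: "((\<lambda>x. x powr (-1/2)) has_integral (1 powr (-1/2+1) / (-1/2+1))) {0..1::real}"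
    by (rule has_integral_powr_from_0) auto
  have "(\<integral>\<^sup>+u. h u * indicator {0..1} u \<partial>lborel) = (\<integral>\<^sup>+u. ennreal (2 * c * (u powr (-1/2))) * indicator {0..1} u \<partial>lborel)"
    by (rule nn_integral_cong_AE, use AE_lborel_singleton[of 0] in eventually_elim) (auto simp: h_def indicator_def)
  also have "\<dots> = ennreal (2 * c * (1 powr (-1/2+1) / (-1/2+1)))"
    by (rule nn_integral_has_integral_lebesgue'[OF _ has_integral_mult_right[OF I]]) (use c in auto)
  finally have A: "(\<integral>\<^sup>+u. h u * indicator {0..1} u \<partial>lborel) < \<infinity>" by simp
  have "(\<integral>\<^sup>+u. h u * indicator {0..1} u \<partial>lborel) = ennreal \<bar>-1\<bar> * (\<integral>\<^sup>+u. h (0 + (-1) * u) * indicator {0..1} (0 + (-1) * u) \<partial>lborel)"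
    by (rule nn_integral_real_affine) auto
  also have "\<dots> = (\<integral>\<^sup>+u. h u * indicator {-1..0} u \<partial>lborel)"
    by (simp, intro nn_integral_cong) (auto simp: h_def indicator_def)
  finally have B: "(\<integral>\<^sup>+u. h u * indicator {-1..0} u \<partial>lborel) < \<infinity>" using A by simp
  have "(\<integral>\<^sup>+u. h u * indicator {-1..1} u \<partial>lborel) \<le> (\<integral>\<^sup>+u. h u * indicator {0..1} u + h u * indicator {-1..0} u \<partial>lborel)"
    by (intro nn_integral_mono) (auto simp: indicator_def)
  also have "\<dots> = (\<integral>\<^sup>+u. h u * indicator {0..1} u \<partial>lborel) + (\<integral>\<^sup>+u. h u * indicator {-1..0} u \<partial>lborel)"
    by (rule nn_integral_add) auto
  also have "\<dots> < \<infinity>" using A B by simp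
  finally show ?thesis unfolding h_def .
qed

text \<open>Normalised length on a set of positive length keeps finite logarithmic energy after a
  map that contracts distances by at most a fixed factor. \<open>k\<close> will be the identity or a
  disc automorphism.\<close>

lemma arc_energy_finite:
  fixes k :: "complex \<Rightarrow> complex"
  assumes T: "T \<in> sets borel" "T \<subseteq> {x..x + 1}" "emeasure lborel T > 0"
    and cont: "continuous_on (sphere 0 1) k"
    and c: "c > 0" and low: "\<And>p q. cmod p = 1 \<Longrightarrow> cmod q = 1 \<Longrightarrow> c * dist p q \<le> dist (k p) (k q)"
  defines "\<mu> \<equiv> distr (uniform_measure lborel T) borel (\<lambda>\<theta>. k (cis \<theta>))"
  shows "prob_space \<mu>" "(\<integral>\<^sup>+z. (\<integral>\<^sup>+w. e2ennreal (log_kernel z w) \<partial>\<mu>) \<partial>\<mu>) < \<infinity>"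
    "(\<lambda>\<theta>. k (cis \<theta>)) \<in> borel_measurable borel"
proof -
  have "continuous_on UNIV (\<lambda>\<theta>. k (cis \<theta>))"
    by (rule continuous_on_compose2[OF cont]) (auto intro!: continuous_intros)
  then show g [measurable]: "(\<lambda>\<theta>. k (cis \<theta>)) \<in> borel_measurable borel"
    by (rule borel_measurable_continuous_onI)
  have [measurable]: "T \<in> sets borel" by fact
  have "emeasure lborel T \<le> emeasure lborel {x..x + 1}" by (rule emeasure_mono) (use T in auto)
  then have fin: "emeasure lborel T \<noteq> \<infinity>" by (auto simp: top_unique)
  have nz: "emeasure lborel T \<noteq> 0" using T by simp
  interpret U: prob_space "uniform_measure lborel T"
    by (rule prob_space_uniform_measure) (use nz fin in auto)
  have gU: "(\<lambda>\<theta>. k (cis \<theta>)) \<in> measurable (uniform_measure lborel T) borel" by simp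
  show "prob_space \<mu>" unfolding \<mu>_def by (rule U.prob_space_distr[OF gU])
  \<comment> \<open>c/2 is the lower bound c for \<open>k\<close> combined with the lower bound 1/2
    for chords; the exponent -1/2 is that of the majorant.\<close>
  define C where "C = (c / 2) powr (-1/2)"
  have C: "C > 0" using c by (simp add: C_def)
  define h where "h = (\<lambda>u::real. (if u = 0 then \<infinity> else ennreal (2 * C * \<bar>u\<bar> powr (-1/2))) * indicator {-1..1} u)"
  have [measurable]: "h \<in> borel_measurable borel" unfolding h_def by measurable
  define H where "H = (\<integral>\<^sup>+u. h u \<partial>lborel)"
  have H: "H < \<infinity>" unfolding H_def h_def by (rule arc_energy_kernel_finite[OF C])
  have kb: "e2ennreal (log_kernel (k (cis \<theta>)) (k (cis \<theta>'))) \<le> h (\<theta> - \<theta>')" if "\<theta> \<in> T" "\<theta>' \<in> T" for \<theta> \<theta>'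
  proof (cases "\<theta> = \<theta>'")
    case True
    then show ?thesis by (simp add: h_def)
  next
    case False
    have d1: "\<bar>\<theta> - \<theta>'\<bar> \<le> 1" using T(2) that by (auto simp: subset_eq)  (smt (verit) that)
    define y where "y = c / 2 * \<bar>\<theta> - \<theta>'\<bar>"
    have y: "y > 0" using c False by (simp add: y_def)
    have "y \<le> c * dist (cis \<theta>) (cis \<theta>')" using dist_cis_ge[OF d1] c by (simp add: y_def)
    also have "\<dots> \<le> dist (k (cis \<theta>)) (k (cis \<theta>'))" by (rule low) auto
    finally have yd: "y \<le> dist (k (cis \<theta>)) (k (cis \<theta>'))" .
    then have ne: "k (cis \<theta>) \<noteq> k (cis \<theta>')" using y by auto
    have "- ln (dist (k (cis \<theta>)) (k (cis \<theta>'))) \<le> - ln y" using ln_mono[OF yd y] by simp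
    \<comment> \<open>Writing the logarithm through y^(-1/2) and using ln x <= x - 1 gives -ln y <=
      2 y^(-1/2).\<close>
    also have "- ln y = 2 * ln (y powr (-1/2))" using y by (simp add: ln_powr)
    also have "\<dots> \<le> 2 * y powr (-1/2)" using ln_le_minus_one[of "y powr (-1/2)"] y by simp
    also have "y powr (-1/2) = C * \<bar>\<theta> - \<theta>'\<bar> powr (-1/2)"
      unfolding y_def C_def using c by (subst powr_mult) auto
    finally have "e2ennreal (log_kernel (k (cis \<theta>)) (k (cis \<theta>'))) \<le> ennreal (2 * C * \<bar>\<theta> - \<theta>'\<bar> powr (-1/2))"
      using ne by (simp add: log_kernel_def ennreal_leI mult.assoc)
    moreover have "\<theta> - \<theta>' \<in> {-1..1}" using d1 by auto
    ultimately show ?thesis using False by (simp add: h_def)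
  qed
  have inner: "(\<integral>\<^sup>+\<theta>'. e2ennreal (log_kernel (k (cis \<theta>)) (k (cis \<theta>'))) \<partial>uniform_measure lborel T) \<le> H / emeasure lborel T" if "\<theta> \<in> T" for \<theta>
  proof -
    have "(\<integral>\<^sup>+\<theta>'. e2ennreal (log_kernel (k (cis \<theta>)) (k (cis \<theta>'))) \<partial>uniform_measure lborel T)
       = (\<integral>\<^sup>+\<theta>'. e2ennreal (log_kernel (k (cis \<theta>)) (k (cis \<theta>'))) * indicator T \<theta>' \<partial>lborel) / emeasure lborel T"
      by (rule nn_integral_uniform_measure) auto
    also have "\<dots> \<le> (\<integral>\<^sup>+\<theta>'. h (\<theta> + (-1) * \<theta>') \<partial>lborel) / emeasure lborel T"
      by (intro divide_right_mono_ennreal nn_integral_mono) (use kb that in \<open>auto simp: indicator_def\<close>)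
    also have "(\<integral>\<^sup>+\<theta>'. h (\<theta> + (-1) * \<theta>') \<partial>lborel) = H"
      unfolding H_def using nn_integral_real_affine[of h "-1" \<theta>] by simp
    finally show ?thesis .
  qed
  have "(\<integral>\<^sup>+z. (\<integral>\<^sup>+w. e2ennreal (log_kernel z w) \<partial>\<mu>) \<partial>\<mu>)
     = (\<integral>\<^sup>+\<theta>. (\<integral>\<^sup>+\<theta>'. e2ennreal (log_kernel (k (cis \<theta>)) (k (cis \<theta>'))) \<partial>uniform_measure lborel T) \<partial>uniform_measure lborel T)"
  proof -
    have 1: "(\<integral>\<^sup>+w. e2ennreal (log_kernel z w) \<partial>\<mu>) = (\<integral>\<^sup>+\<theta>'. e2ennreal (log_kernel z (k (cis \<theta>'))) \<partial>uniform_measure lborel T)" for z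
      unfolding \<mu>_def by (rule nn_integral_distr) auto
    have "(\<lambda>z. \<integral>\<^sup>+\<theta>'. e2ennreal (log_kernel z (k (cis \<theta>'))) \<partial>uniform_measure lborel T) \<in> borel_measurable borel"
      by measurable
    then show ?thesis unfolding 1 unfolding \<mu>_def by (subst nn_integral_distr) auto
  qed
  also have "\<dots> \<le> (\<integral>\<^sup>+\<theta>. H / emeasure lborel T \<partial>uniform_measure lborel T)"
  proof (rule nn_integral_mono_AE)
    have "AE \<theta> in uniform_measure lborel T. \<theta> \<in> T"
      by (rule AE_uniform_measureI) auto
    then show "AE \<theta> in uniform_measure lborel T. (\<integral>\<^sup>+\<theta>'. e2ennreal (log_kernel (k (cis \<theta>)) (k (cis \<theta>'))) \<partial>uniform_measure lborel T) \<le> H / emeasure lborel T"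
      by eventually_elim (rule inner)
  qed
  also have "\<dots> = H / emeasure lborel T" using U.emeasure_space_1 by simp
  also have "\<dots> < \<infinity>"
    using H nz fin by (simp add: ennreal_divide_eq_top_iff less_top[symmetric])
  finally show "(\<integral>\<^sup>+z. (\<integral>\<^sup>+w. e2ennreal (log_kernel z w) \<partial>\<mu>) \<partial>\<mu>) < \<infinity>" .
qed

text \<open>Arc length on an arc of one radian is admissible in the maximal inequality, which
  therefore also gives estimates with respect to arc length.\<close>

lemma arc_energy_measure:
  "energy_measure (distr (uniform_measure lborel {x..x + 1}) borel cis)"
proof -
  have pre: "{x..x + 1} \<in> sets borel" "{x..x + 1} \<subseteq> {x..x + 1}" "emeasure lborel {x..x + 1} > 0"
    by auto
  have low: "1 * dist p q \<le> dist p q" for p q :: complex by simp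
  note A = arc_energy_finite[OF pre continuous_on_id zero_less_one low]
  interpret prob_space "distr (uniform_measure lborel {x..x + 1}) borel cis"
    by (rule A(1))
  have cm: "cis \<in> measurable (uniform_measure lborel {x..x + 1}) borel" using A(3) by simp
  show ?thesis
  proof unfold_locales
    show "AE q in distr (uniform_measure lborel {x..x + 1}) borel cis. cmod q = 1"
      by (subst AE_distr_iff[OF cm]) auto
    show "(\<integral>\<^sup>+z. (\<integral>\<^sup>+w. e2ennreal (log_kernel z w) \<partial>distr (uniform_measure lborel {x..x + 1}) borel cis) \<partial>distr (uniform_measure lborel {x..x + 1}) borel cis) < \<infinity>"
      by (rule A(2))
  qed simp
qed

text \<open>If the set of angles had positive measure, it would contain a compact set of positive
  length inside some unit interval, whose normalised length is carried by \<open>k\<close> to a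
  probability measure of finite energy on a compact subset of E. The map \<open>k\<close> lets E
  live in another parametrization of the boundary than F.\<close>

lemma capacity_zero_imp_arc_null:
  assumes cap: "log_capacity E = 0" and F: "F \<in> sets borel"
    and cont: "continuous_on (sphere 0 1) k"
    and c: "c > 0" and low: "\<And>p q. cmod p = 1 \<Longrightarrow> cmod q = 1 \<Longrightarrow> c * dist p q \<le> dist (k p) (k q)"
    and sub: "\<And>q. q \<in> F \<Longrightarrow> cmod q = 1 \<Longrightarrow> k q \<in> E"
  shows "AE \<theta> in lborel. cis \<theta> \<notin> F"
proof -
  define \<Theta> where "\<Theta> = cis -` F"
  have cm: "cis \<in> borel_measurable borel" by (intro borel_measurable_continuous_onI continuous_intros)
  have \<Theta>: "\<Theta> \<in> sets borel" unfolding \<Theta>_def using measurable_sets_borel[OF cm F] .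
  have pieces: "emeasure lborel (\<Theta> \<inter> {of_int j..of_int j + 1}) = 0" for j :: int
  proof (rule ccontr)
    define T where "T = \<Theta> \<inter> {of_int j..of_int j + 1 :: real}"
    assume "emeasure lborel (\<Theta> \<inter> {of_int j..of_int j + 1}) \<noteq> 0"
    then have T0: "emeasure lborel T \<noteq> 0" by (simp add: T_def)
    have Tb: "T \<in> sets borel" using \<Theta> by (simp add: T_def)
    have "emeasure lborel T \<le> emeasure lborel {of_int j..of_int j + 1 :: real}" by (rule emeasure_mono) (auto simp: T_def)
    then have fin: "emeasure lborel T \<noteq> \<infinity>" by (auto simp: top_unique)
    define e where "e = enn2real (emeasure lborel T)"
    have e: "emeasure lborel T = ennreal e" "e > 0"
      using T0 fin by (auto simp: e_def enn2real_positive_iff less_top[symmetric] zero_less_iff_neq_zero)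
    have Tl: "T \<in> sets lebesgue" using Tb by simp
    obtain K where K: "closed K" "K \<subseteq> T" "T - K \<in> lmeasurable" "emeasure lebesgue (T - K) < ennreal e"
      by (rule sets_lebesgue_inner_closed[OF Tl e(2)])
    have Kc: "compact K"
    proof -
      have "K \<subseteq> {of_int j..of_int j + 1}" using K(2) unfolding T_def by blast
      then have "bounded K" by (rule bounded_subset[OF bounded_closed_interval])
      then show ?thesis using K(1) by (simp add: compact_eq_bounded_closed)
    qed
    have Kb: "K \<in> sets borel" using K(1) by (rule borel_closed)
    have "emeasure lborel K \<noteq> 0"
    proof
      assume K0: "emeasure lborel K = 0"
      have "emeasure lborel T \<le> emeasure lborel (T - K) + emeasure lborel K"
        using emeasure_subadditive[of "T - K" lborel K] Tb Kb K(2) by (simp add: Un_absorb2)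
      moreover have "emeasure lebesgue (T - K) = emeasure lborel (T - K)" using Tb Kb by simp
      ultimately show False using K(4) K0 e(1) by simp
    qed
    then have Kpos: "emeasure lborel K > 0" by (simp add: zero_less_iff_neq_zero)
    have Ksub: "K \<subseteq> {of_int j..of_int j + 1}" using K(2) unfolding T_def by blast
    define \<mu> where "\<mu> = distr (uniform_measure lborel K) borel (\<lambda>\<theta>. k (cis \<theta>))"
    note A = arc_energy_finite[OF Kb Ksub Kpos cont c low, folded \<mu>_def]
    have "\<mu> \<in> compactly_supported_probs E"
      unfolding compactly_supported_probs_def
    proof (intro CollectI conjI exI)
      show "prob_space \<mu>" by (rule A)
      show "sets \<mu> = sets borel" by (simp add: \<mu>_def)
      have cc: "continuous_on UNIV (\<lambda>\<theta>. k (cis \<theta>))"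
        by (rule continuous_on_compose2[OF cont]) (auto intro!: continuous_intros)
      show comp: "compact ((\<lambda>\<theta>. k (cis \<theta>)) ` K)"
        by (rule compact_continuous_image[OF continuous_on_subset[OF cc] Kc]) simp
      show "(\<lambda>\<theta>. k (cis \<theta>)) ` K \<subseteq> E"
        using K(2) sub unfolding T_def \<Theta>_def by auto
      have Km: "(\<lambda>\<theta>. k (cis \<theta>)) ` K \<in> sets borel"
        by (rule borel_closed[OF compact_imp_closed[OF comp]])
      have U: "prob_space (uniform_measure lborel K)"
      proof (rule prob_space_uniform_measure)
        show "emeasure lborel K \<noteq> 0" using Kpos by simp
        have "emeasure lborel K \<le> emeasure lborel T" using K(2) Tb by (intro emeasure_mono) auto
        then show "emeasure lborel K \<noteq> \<infinity>" using fin by (metis infinity_ennreal_def top_unique)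
      qed
      have "emeasure \<mu> ((\<lambda>\<theta>. k (cis \<theta>)) ` K) = emeasure (uniform_measure lborel K) ((\<lambda>\<theta>. k (cis \<theta>)) -` ((\<lambda>\<theta>. k (cis \<theta>)) ` K))"
      proof -
        note A(3)[measurable]
        have gm: "(\<lambda>\<theta>. k (cis \<theta>)) \<in> measurable (uniform_measure lborel K) borel" by measurable
        show ?thesis unfolding \<mu>_def emeasure_distr[OF gm Km] by simp
      qed
      also have "\<dots> = 1"
      proof (rule prob_space.emeasure_eq_1_AE[OF U])
        show "(\<lambda>\<theta>. k (cis \<theta>)) -` ((\<lambda>\<theta>. k (cis \<theta>)) ` K) \<in> sets (uniform_measure lborel K)"
          unfolding sets_uniform_measure sets_lborel by (rule measurable_sets_borel[OF A(3) Km])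
        show "AE \<theta> in uniform_measure lborel K. \<theta> \<in> (\<lambda>\<theta>. k (cis \<theta>)) -` ((\<lambda>\<theta>. k (cis \<theta>)) ` K)"
          by (rule AE_uniform_measureI) (use Kb in simp, rule AE_I2, blast)
      qed
      finally show "emeasure \<mu> ((\<lambda>\<theta>. k (cis \<theta>)) ` K) = 1" .
    qed
    then have "log_energy \<mu> = \<infinity>" using cap log_capacity_eq_0_iff by blast
    with log_energy_finite[OF A(2)] show False by (rule notE)
  qed
  have "AE \<theta> in lborel. \<forall>j::int. \<theta> \<notin> \<Theta> \<inter> {of_int j..of_int j + 1}"
    unfolding AE_all_countable
  proof
    fix j :: int
    have "\<Theta> \<inter> {of_int j..of_int j + 1} \<in> null_sets lborel"
      by (rule null_setsI[OF pieces]) (use \<Theta> in auto)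
    then show "AE \<theta> in lborel. \<theta> \<notin> \<Theta> \<inter> {of_int j..of_int j + 1}" by (rule AE_not_in)
  qed
  then show ?thesis
  proof eventually_elim
    fix \<theta> :: real assume "\<forall>j::int. \<theta> \<notin> \<Theta> \<inter> {of_int j..of_int j + 1}"
    then have "\<theta> \<notin> \<Theta> \<inter> {of_int \<lfloor>\<theta>\<rfloor>..of_int \<lfloor>\<theta>\<rfloor> + 1}" by blast
    then have "\<theta> \<notin> \<Theta>" by (auto simp: floor_correct less_imp_le)
    then show "cis \<theta> \<notin> F" by (simp add: \<Theta>_def)
  qed
qed

text \<open>Beurling's theorem for two series at once: a probability measure of finite energy on a
  compact subset of E would see convergence almost everywhere, although no point of E has
  it.\<close>

lemma capacity_zero_of_not_Cauchy:
  assumes a: "dirichlet_coeffs a" and b: "dirichlet_coeffs b"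
    and r: "\<And>k. 0 \<le> r k" "\<And>k::nat. r k < 1" and lim: "r \<longlonglongrightarrow> 1"
    and E: "\<And>q. q \<in> E \<Longrightarrow> cmod q = 1"
      "\<And>q. q \<in> E \<Longrightarrow> \<not> Cauchy (\<lambda>k. power_series a (of_real (r k) * q)) \<or> \<not> Cauchy (\<lambda>k. power_series b (of_real (r k) * q))"
  shows "log_capacity E = 0"
  unfolding log_capacity_eq_0_iff
proof (intro ballI)
  fix \<mu> assume "\<mu> \<in> compactly_supported_probs E"
  then obtain K where mu: "prob_space \<mu>" "sets \<mu> = sets borel" and K: "compact K" "K \<subseteq> E" "emeasure \<mu> K = 1"
    unfolding compactly_supported_probs_def by blast
  interpret prob_space \<mu> by fact
  have "K \<in> sets \<mu>" using compact_imp_closed[OF K(1)] mu by auto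
  then have AEK: "AE q in \<mu>. q \<in> K"
    using K(3) prob_eq_1[of K] by (simp add: emeasure_eq_measure)
  have AEc: "AE q in \<mu>. cmod q = 1"
    using AEK by eventually_elim (use K E in auto)
  show "log_energy \<mu> = \<infinity>"
  proof (rule ccontr)
    assume "log_energy \<mu> \<noteq> \<infinity>"
    then have "(\<integral>\<^sup>+z. (\<integral>\<^sup>+w. e2ennreal (log_kernel z w) \<partial>\<mu>) \<partial>\<mu>) < \<infinity>"
      by (rule finite_log_energyD[OF mu AEc])
    then interpret energy_measure \<mu> by unfold_locales (use mu AEc in auto)
    have "AE q in \<mu>. False"
      using AE_Cauchy_radial[OF a r lim] AE_Cauchy_radial[OF b r lim] AEK
    proof eventually_elim
      fix q
      assume q: "Cauchy (\<lambda>k. power_series a (of_real (r k) * unimod q))" "Cauchy (\<lambda>k. power_series b (of_real (r k) * unimod q))" "q \<in> K"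
      have "q \<in> E" using q K by auto
      moreover from E(1)[OF this] have "unimod q = q" by (simp add: unimod_def)
      ultimately show False using E(2)[of q] q by simp
    qed
    then show False by simp
  qed
qed

subsection \<open>Boundary behaviour of conformal maps onto Jordan domains\<close>

lemma norm_one_minus_cis_less_1_iff:
  assumes "0 < \<rho>"
  shows "cmod (1 - of_real \<rho> * cis \<phi>) < 1 \<longleftrightarrow> \<rho> / 2 < cos \<phi>"
proof -
  have "(cmod (1 - of_real \<rho> * cis \<phi>))\<^sup>2 = (1 - \<rho> * cos \<phi>)\<^sup>2 + (\<rho> * sin \<phi>)\<^sup>2"
    by (simp add: cmod_power2)
  also have "\<dots> = 1 - 2 * \<rho> * cos \<phi> + \<rho>\<^sup>2 * ((sin \<phi>)\<^sup>2 + (cos \<phi>)\<^sup>2)"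
    by (simp only: power2_eq_square) (simp only: algebra_simps)
  finally have eq: "(cmod (1 - of_real \<rho> * cis \<phi>))\<^sup>2 = 1 - 2 * \<rho> * cos \<phi> + \<rho>\<^sup>2" by simp
  have "cmod (1 - of_real \<rho> * cis \<phi>) < 1 \<longleftrightarrow> (cmod (1 - of_real \<rho> * cis \<phi>))\<^sup>2 < 1"
    using abs_square_less_1[of "cmod (1 - of_real \<rho> * cis \<phi>)"] by simp
  also have "\<dots> \<longleftrightarrow> \<rho> * \<rho> < \<rho> * (2 * cos \<phi>)" unfolding eq by (simp add: power2_eq_square algebra_simps)
  also have "\<dots> \<longleftrightarrow> \<rho> < 2 * cos \<phi>" using assms by simp
  finally show ?thesis by linarith
qed

text \<open>The angle is measured from the direction of -q, towards the centre of the disc. In this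
  coordinate the part of the circle inside the disc is the interval cos \<phi> > \<rho>/2, symmetric
  about 0.\<close>

lemma circle_polar_point:
  assumes q: "cmod q = 1" and \<rho>: "0 < \<rho>" and z: "cmod z < 1" "cmod (z - q) = \<rho>"
  obtains \<phi> where "z = q - of_real \<rho> * q * cis \<phi>" "\<bar>\<phi>\<bar> < pi / 2" "\<rho> / 2 < cos \<phi>"
proof -
  define u where "u = (1 - z / q) / of_real \<rho>"
  have q0: "q \<noteq> 0" using q by auto
  have "u = (q - z) / (q * of_real \<rho>)" using q0 by (simp add: u_def field_simps)
  then have u: "cmod u = 1" using q \<rho> z by (simp add: norm_divide norm_mult norm_minus_commute)
  define \<phi> where "\<phi> = Arg u"
  have cu: "cis \<phi> = u" using u cis_Arg[of u] by (metis \<phi>_def norm_zero sgn_eq u div_by_1 of_real_1 zero_neq_one)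
  have zq: "z = q * (1 - of_real \<rho> * cis \<phi>)"
    unfolding cu u_def using q0 \<rho> by (simp add: field_simps)
  then have "cmod (1 - of_real \<rho> * cis \<phi>) < 1" using z q by (simp add: norm_mult)
  then have c: "\<rho> / 2 < cos \<phi>" using norm_one_minus_cis_less_1_iff[OF \<rho>] by blast
  have \<phi>: "- pi < \<phi>" "\<phi> \<le> pi" using Arg_bounded[of u] by (auto simp: \<phi>_def)
  have "\<bar>\<phi>\<bar> < pi / 2"
  proof (rule ccontr)
    assume "\<not> \<bar>\<phi>\<bar> < pi / 2"
    then have "cos \<bar>\<phi>\<bar> \<le> cos (pi / 2)" using \<phi> by (intro cos_monotone_0_pi_le) auto
    then show False using c \<rho> by simp
  qed
  then show ?thesis using that[of \<phi>] zq c by (simp add: algebra_simps)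
qed

text \<open>The energy of F on the circle of radius exp(\<tau>) about q, integrated over all \<tau>,
  is at most the area of the bounded image. Since \<tau> ranges over a half line, arbitrarily small
  circles have energy below any given bound, and small energy on an arc means a short image.\<close>

lemma short_crosscut:
  assumes hol: "F holomorphic_on ball 0 1" and inj: "inj_on F (ball 0 1)" and bd: "bounded (F ` ball 0 1)"
    and q: "cmod q = 1" and \<epsilon>: "\<epsilon> > 0" and \<delta>: "\<delta> > 0"
  obtains \<rho> where "0 < \<rho>" "\<rho> < \<delta>"
    "\<And>z w. \<lbrakk>cmod z < 1; cmod w < 1; cmod (z - q) = \<rho>; cmod (w - q) = \<rho>\<rbrakk> \<Longrightarrow> cmod (F z - F w) \<le> \<epsilon>"
proof -
  define g where "g = (\<lambda>z. ennreal ((cmod (indicator (ball 0 1) z *\<^sub>R deriv F z))\<^sup>2))"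
  have contd: "continuous_on (ball 0 1) (deriv F)"
    by (rule continuous_on_deriv_holomorphic[OF hol]) auto
  have "(\<lambda>z. indicator (ball 0 1) z *\<^sub>R deriv F z) \<in> borel_measurable borel"
    by (rule borel_measurable_continuous_on_indicator) (use contd in auto)
  then have [measurable]: "g \<in> borel_measurable borel" unfolding g_def by measurable
  have "(\<integral>\<^sup>+z. g z \<partial>lborel) = (\<integral>\<^sup>+z\<in>ball 0 1. 1 * ennreal ((cmod (deriv F z))\<^sup>2) \<partial>lborel)"
    unfolding g_def by (intro nn_integral_cong) (auto simp: indicator_def)
  also have "\<dots> = (\<integral>\<^sup>+w\<in>F ` ball 0 1. 1 \<partial>lborel)"
    by (rule nn_integral_conformal[symmetric, OF _ hol inj]) auto
  also have "\<dots> = emeasure lborel (F ` ball 0 1)"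
  proof -
    have "F ` ball 0 1 \<in> sets borel" using open_mapping_thm3[OF hol _ inj] by auto
    then show ?thesis by simp
  qed
  also have "\<dots> < \<infinity>" by (rule emeasure_bounded_finite[OF bd])
  finally have E: "(\<integral>\<^sup>+z. g z \<partial>lborel) < \<infinity>" .
  \<comment> \<open>The angular window is centred at the argument of -q, so the cut of the polar
    coordinates lies opposite to the arc inside the disc.\<close>
  define b where "b = Arg (- q) - pi"
  have cb: "cis (b + pi + \<phi>) = - q * cis \<phi>" for \<phi>
  proof -
    have "cis (Arg (- q)) = - q" using cis_Arg[of "- q"] q by (metis norm_minus_cancel norm_zero sgn_eq div_by_1 of_real_1 zero_neq_one)
    then show ?thesis by (simp add: b_def flip: cis_mult)
  qed
  define A where "A = (\<lambda>\<tau>. (\<integral>\<^sup>+\<theta>\<in>{b<..<b + 2 * pi}. (g (q + exp (Complex \<tau> \<theta>)) * ennreal (exp (2 * \<tau>))) \<partial>lborel))"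
  have intA: "(\<integral>\<^sup>+\<tau>. A \<tau> \<partial>lborel) < \<infinity>"
    unfolding A_def by (rule le_less_trans[OF nn_integral_log_polar_le E]) measurable
  \<comment> \<open>From |D| <= |D|^2/(2\<kappa>) + \<kappa>/2 on an interval of length at most 2
    pi, energy at most \<eta> gives length at most \<eta>/(2\<kappa>) + \<kappa> pi. The choices of
    \<kappa> and \<eta> make both summands \<epsilon>/2.\<close>
  define \<kappa> where "\<kappa> = \<epsilon> / (2 * pi)"
  have \<kappa>: "\<kappa> > 0" using \<epsilon> by (simp add: \<kappa>_def)
  define \<eta> where "\<eta> = \<epsilon> * \<kappa>"
  have \<eta>: "\<eta> > 0" using \<epsilon> \<kappa> by (simp add: \<eta>_def)
  have "\<exists>\<tau>. \<tau> < min (ln \<delta>) 0 \<and> A \<tau> \<le> ennreal \<eta>"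
  proof (rule ccontr)
    assume "\<not> ?thesis"
    then have *: "\<And>\<tau>. \<tau> < min (ln \<delta>) 0 \<Longrightarrow> ennreal \<eta> \<le> A \<tau>" by (meson le_cases)
    define m where "m = min (ln \<delta>) 0"
    define e where "e = enn2real (\<integral>\<^sup>+\<tau>. A \<tau> \<partial>lborel)"
    have e: "(\<integral>\<^sup>+\<tau>. A \<tau> \<partial>lborel) = ennreal e" "0 \<le> e" using intA by (auto simp: e_def)
    \<comment> \<open>An interval of this length on which \<open>A\<close> stays above \<eta> would
      contribute \<eta> L = e + \<eta>, more than the total \<open>e\<close>.\<close>
    define L where "L = e / \<eta> + 1"
    have L: "0 \<le> L" "\<eta> * L = e + \<eta>" using e \<eta> by (auto simp: L_def field_simps)
    have "ennreal (\<eta> * L) = ennreal \<eta> * emeasure lborel {m - L..<m}"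
      using L(1) \<eta> by (subst ennreal_mult) auto
    also have "\<dots> = (\<integral>\<^sup>+\<tau>. ennreal \<eta> * indicator {m - L..<m} \<tau> \<partial>lborel)"
      by (subst nn_integral_cmult_indicator) auto
    also have "\<dots> \<le> (\<integral>\<^sup>+\<tau>. A \<tau> \<partial>lborel)"
      by (intro nn_integral_mono) (use * in \<open>auto simp: indicator_def m_def\<close>)
    finally have "ennreal (e + \<eta>) \<le> ennreal e" using e L by simp
    then show False using e(2) \<eta> by (simp add: ennreal_le_iff)
  qed
  then obtain \<tau> where \<tau>: "\<tau> < ln \<delta>" "\<tau> < 0" "A \<tau> \<le> ennreal \<eta>" by auto
  define \<rho> where "\<rho> = exp \<tau>"
  have \<rho>: "0 < \<rho>" "\<rho> < \<delta>" "\<rho> < 1" using \<tau> \<delta> by (auto simp: \<rho>_def) (metis exp_less_mono exp_ln)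
  define Z where "Z = (\<lambda>\<phi>. q - of_real \<rho> * q * cis \<phi>)"
  have Zball: "Z \<phi> \<in> ball 0 1" if "\<rho> / 2 < cos \<phi>" for \<phi>
  proof -
    have "Z \<phi> = q * (1 - of_real \<rho> * cis \<phi>)" by (simp add: Z_def algebra_simps)
    then show ?thesis using that norm_one_minus_cis_less_1_iff[OF \<rho>(1)] q by (simp add: norm_mult)
  qed
  have Zexp: "q + exp (Complex \<tau> (b + pi + \<phi>)) = Z \<phi>" for \<phi>
    by (simp add: exp_eq_polar cb Z_def \<rho>_def del: cis_mult)
  have ord: "cmod (F (Z y) - F (Z x)) \<le> \<epsilon>"
    if xy: "x \<le> y" "\<bar>x\<bar> < pi / 2" "\<bar>y\<bar> < pi / 2" "\<rho> / 2 < cos x" "\<rho> / 2 < cos y" for x y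
  proof -
    have cosm: "\<rho> / 2 < cos \<phi>" if "\<phi> \<in> {x..y}" for \<phi>
    proof -
      have "\<bar>\<phi>\<bar> \<le> \<bar>x\<bar> \<or> \<bar>\<phi>\<bar> \<le> \<bar>y\<bar>" using that by auto
      then have "cos \<bar>x\<bar> \<le> cos \<bar>\<phi>\<bar> \<or> cos \<bar>y\<bar> \<le> cos \<bar>\<phi>\<bar>"
        using xy cos_monotone_0_pi_le[of "\<bar>\<phi>\<bar>" "\<bar>x\<bar>"] cos_monotone_0_pi_le[of "\<bar>\<phi>\<bar>" "\<bar>y\<bar>"] by linarith
      then show ?thesis using xy by auto
    qed
    define D where "D = (\<lambda>\<phi>. (of_real \<rho> * q * (- \<i> * cis \<phi>)) * deriv F (Z \<phi>))"
    have der: "((\<lambda>\<phi>. F (Z \<phi>)) has_vector_derivative D \<phi>) (at \<phi> within {x..y})" if "\<phi> \<in> {x..y}" for \<phi>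
    proof -
      have "(Z has_vector_derivative (of_real \<rho> * q * (- \<i> * cis \<phi>))) (at \<phi> within {x..y})"
        unfolding Z_def cis_conv_exp
        by (auto intro!: derivative_eq_intros has_vector_derivative_real_field simp: field_simps)
      moreover have "(F has_field_derivative deriv F (Z \<phi>)) (at (Z \<phi>) within Z ` {x..y})"
        by (rule has_field_derivative_at_within, rule holomorphic_derivI[OF hol]) (use Zball cosm that in auto)
      ultimately have "(F \<circ> Z has_vector_derivative (of_real \<rho> * q * (- \<i> * cis \<phi>)) * deriv F (Z \<phi>)) (at \<phi> within {x..y})"
        by (rule field_vector_diff_chain_within)
      then show ?thesis unfolding D_def o_def .
    qed
    have I: "(D has_integral (F (Z y) - F (Z x))) {x..y}"
      by (rule fundamental_theorem_of_calculus[OF xy(1) der])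
    have contZ: "continuous_on {x..y} (\<lambda>\<phi>. deriv F (Z \<phi>))"
      by (rule continuous_on_compose2[OF contd]) (use Zball cosm in \<open>auto simp: Z_def intro!: continuous_intros\<close>)
    have contD: "continuous_on {x..y} D" unfolding D_def by (intro continuous_intros contZ)
    have nD: "(cmod (D \<phi>))\<^sup>2 = (cmod (deriv F (Z \<phi>)))\<^sup>2 * \<rho>\<^sup>2" for \<phi>
      using q \<rho> by (simp add: D_def norm_mult power_mult_distrib)
    have pre: "(\<integral>\<^sup>+\<phi>\<in>{x<..<y}. ennreal ((cmod (D \<phi>))\<^sup>2) \<partial>lborel) \<le> A \<tau>"
    proof -
      have meas: "(\<lambda>\<theta>. (g (q + exp (Complex \<tau> \<theta>)) * ennreal (exp (2 * \<tau>))) * indicator {b<..<b + 2 * pi} \<theta>) \<in> borel_measurable borel"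
      proof -
        have [measurable]: "(\<lambda>\<theta>. exp (Complex \<tau> \<theta>)) \<in> borel_measurable borel"
          unfolding Complex_eq by (intro borel_measurable_continuous_onI continuous_intros)
        show ?thesis by measurable
      qed
      have "A \<tau> = (\<integral>\<^sup>+\<phi>. (g (q + exp (Complex \<tau> (b + pi + 1 * \<phi>))) * ennreal (exp (2 * \<tau>))) * indicator {b<..<b + 2 * pi} (b + pi + 1 * \<phi>) \<partial>lborel)"
        unfolding A_def using nn_integral_real_affine[OF meas, of 1 "b + pi"] by simp
      also have "\<dots> \<ge> (\<integral>\<^sup>+\<phi>\<in>{x<..<y}. ennreal ((cmod (D \<phi>))\<^sup>2) \<partial>lborel)"
      proof (rule nn_integral_mono)
        fix \<phi>
        show "ennreal ((cmod (D \<phi>))\<^sup>2) * indicator {x<..<y} \<phi> \<le> (g (q + exp (Complex \<tau> (b + pi + 1 * \<phi>))) * ennreal (exp (2 * \<tau>))) * indicator {b<..<b + 2 * pi} (b + pi + 1 * \<phi>)"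
        proof (cases "\<phi> \<in> {x<..<y}")
          case True
          then have "Z \<phi> \<in> ball 0 1" using cosm Zball by auto
          moreover have "\<bar>\<phi>\<bar> < pi" using True xy by auto
          moreover from this have "b + pi + \<phi> \<in> {b<..<b + 2 * pi}" by auto
          moreover have "exp (2 * \<tau>) = \<rho>\<^sup>2" by (simp add: \<rho>_def exp_double)
          ultimately show ?thesis using True
            by (auto simp: Zexp g_def nD ennreal_mult')
        qed simp
      qed
      finally show ?thesis .
    qed
    have "ennreal (integral {x..y} (\<lambda>\<phi>. (cmod (D \<phi>))\<^sup>2)) \<le> A \<tau>"
    proof -
      have "continuous_on {x..y} (\<lambda>\<phi>. (cmod (D \<phi>))\<^sup>2)" by (intro continuous_intros contD)
      from continuous_nn_integral_Icc[OF this] show ?thesis using pre by simp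
    qed
    then have small: "integral {x..y} (\<lambda>\<phi>. (cmod (D \<phi>))\<^sup>2) \<le> \<eta>"
      using \<tau>(3) \<eta> by (meson ennreal_le_iff less_imp_le order_trans)
    have "cmod (F (Z y) - F (Z x)) = cmod (integral {x..y} D)" using I by (simp add: integral_unique)
    also have "\<dots> \<le> integral {x..y} (\<lambda>\<phi>. (cmod (D \<phi>))\<^sup>2 / (2 * \<kappa>) + \<kappa> / 2)"
    proof (rule integral_norm_bound_integral)
      show "D integrable_on {x..y}" using I by blast
      show "(\<lambda>\<phi>. (cmod (D \<phi>))\<^sup>2 / (2 * \<kappa>) + \<kappa> / 2) integrable_on {x..y}"
        by (intro integrable_continuous_interval continuous_intros contD) (use \<kappa> in auto)
      fix \<phi>
      have "0 \<le> (cmod (D \<phi>) - \<kappa>)\<^sup>2" by simp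
      then have "2 * \<kappa> * cmod (D \<phi>) \<le> (cmod (D \<phi>))\<^sup>2 + \<kappa> * \<kappa>" by (simp add: power2_eq_square algebra_simps)
      then show "cmod (D \<phi>) \<le> (cmod (D \<phi>))\<^sup>2 / (2 * \<kappa>) + \<kappa> / 2" using \<kappa> by (simp add: field_simps)
    qed
    also have "\<dots> = integral {x..y} (\<lambda>\<phi>. (cmod (D \<phi>))\<^sup>2) / (2 * \<kappa>) + \<kappa> / 2 * (y - x)"
    proof -
      have "integral {x..y} (\<lambda>\<phi>. (cmod (D \<phi>))\<^sup>2 / (2 * \<kappa>) + \<kappa> / 2) = integral {x..y} (\<lambda>\<phi>. (cmod (D \<phi>))\<^sup>2 / (2 * \<kappa>)) + integral {x..y} (\<lambda>\<phi>. \<kappa> / 2)"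
        by (rule Henstock_Kurzweil_Integration.integral_add) (intro integrable_continuous_interval continuous_intros contD; use \<kappa> in auto)+
      then show ?thesis using xy(1) by simp
    qed
    also have "\<dots> \<le> \<eta> / (2 * \<kappa>) + \<kappa> / 2 * (2 * pi)"
      using small \<kappa> xy by (intro add_mono divide_right_mono mult_left_mono) auto
    also have "\<dots> = \<epsilon>" using \<kappa> unfolding \<eta>_def by (simp add: \<kappa>_def)
    finally show ?thesis .
  qed
  show ?thesis
  proof (rule that[OF \<rho>(1,2)])
    fix z w assume zw: "cmod z < 1" "cmod w < 1" "cmod (z - q) = \<rho>" "cmod (w - q) = \<rho>"
    obtain x where x: "z = Z x" "\<bar>x\<bar> < pi / 2" "\<rho> / 2 < cos x"
      using circle_polar_point[OF q \<rho>(1) zw(1,3)] unfolding Z_def by metis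
    obtain y where y: "w = Z y" "\<bar>y\<bar> < pi / 2" "\<rho> / 2 < cos y"
      using circle_polar_point[OF q \<rho>(1) zw(2,4)] unfolding Z_def by metis
    show "cmod (F z - F w) \<le> \<epsilon>"
    proof (cases "x \<le> y")
      case True
      then show ?thesis using ord[of x y] x y by (simp add: norm_minus_commute)
    next
      case False
      then show ?thesis using ord[of y x] x y by simp
    qed
  qed
qed

text \<open>Throughout, \<open>F\<close> maps the unit disc conformally onto a bounded complementary component of
  the Jordan curve \<open>J\<close>.\<close>

locale jordan_conformal =
  fixes F :: "complex \<Rightarrow> complex" and J :: "complex set" and g :: "complex \<Rightarrow> complex"
  assumes hol: "F holomorphic_on ball 0 1" and inj: "inj_on F (ball 0 1)"
    and bd: "bounded (F ` ball 0 1)"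
    and comp: "F ` ball 0 1 \<in> components (- J)"
    and contg: "continuous_on (sphere 0 1) g" and injg: "inj_on g (sphere 0 1)"
    and J: "J = g ` sphere 0 1"
begin

abbreviation "W \<equiv> F ` ball 0 1"

lemma compact_J: "compact J"
  unfolding J by (rule compact_continuous_image[OF contg]) simp

lemma open_W: "open W"
  by (rule open_mapping_thm3[OF hol _ inj]) simp

lemma J_homeomorphic: "J homeomorphic sphere (0::complex) 1"
  unfolding J using homeomorphic_compact[OF _ contg _ injg] homeomorphic_sym by auto

lemma frontier_W: "frontier W = J"
  by (rule Jordan_Brouwer_frontier[OF J_homeomorphic comp]) simp

lemma W_J: "W \<inter> J = {}"
  using in_components_subset[OF comp] by auto

lemma closure_W: "closure W = W \<union> J"
  using frontier_W open_W by (metis closure_Un_frontier)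

lemma J_nonempty: "J \<noteq> {}"
  unfolding J by simp

lemma W_connected_component:
  assumes "connected C" "C \<subseteq> - J" "C \<inter> W \<noteq> {}"
  shows "C \<subseteq> W"
  using assms components_maximal[OF comp] by blast

text \<open>The inverse of the parametrization is uniformly continuous, so a set of small diameter
  on J comes from a short arc of the circle, and the image of that arc is a small continuum. This is
  the only metric information about the Jordan curve that is used.\<close>

lemma small_set_in_small_continuum:
  assumes "e > 0"
  obtains d where "d > 0"
    "\<And>C. \<lbrakk>C \<subseteq> J; C \<noteq> {}; \<And>x y. x \<in> C \<Longrightarrow> y \<in> C \<Longrightarrow> dist x y \<le> d\<rbrakk> \<Longrightarrow>
       \<exists>K. C \<subseteq> K \<and> K \<subseteq> J \<and> compact K \<and> connected K \<and> (\<forall>x\<in>K. \<forall>y\<in>C. dist x y \<le> e)"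
proof -
  have "uniformly_continuous_on (sphere 0 1) g"
    by (rule compact_uniformly_continuous[OF contg]) simp
  then obtain \<eta> where \<eta>: "\<eta> > 0" "\<And>x y. x \<in> sphere 0 1 \<Longrightarrow> y \<in> sphere 0 1 \<Longrightarrow> dist y x < \<eta> \<Longrightarrow> dist (g y) (g x) < e / 2"
    unfolding uniformly_continuous_on_def using assms by (metis half_gt_zero)
  obtain g' where hom: "homeomorphism (sphere 0 1) J g g'"
    using homeomorphism_compact[OF _ contg _ injg] J by (metis compact_sphere)
  have cg': "continuous_on J g'" using hom by (simp add: homeomorphism_def)
  \<comment> \<open>Two points of the arc are at distance at most 2r, which has to be below \<eta>;
    the bound 1/4 makes the arccosine below well defined.\<close>
  define r where "r = min (\<eta> / 4) (1 / 4)"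
  have r: "0 < r" "r \<le> 1 / 4" "4 * r \<le> \<eta>" using \<eta>(1) by (auto simp: r_def)
  have "uniformly_continuous_on J g'"
    by (rule compact_uniformly_continuous[OF cg' compact_J])
  then obtain d where d: "d > 0" "\<And>x y. x \<in> J \<Longrightarrow> y \<in> J \<Longrightarrow> dist y x < d \<Longrightarrow> dist (g' y) (g' x) < r"
    unfolding uniformly_continuous_on_def using r(1) by metis
  show ?thesis
  proof (rule that[of "d / 2"])
    show "d / 2 > 0" using d by simp
    fix C assume C: "C \<subseteq> J" "C \<noteq> {}" "\<And>x y. x \<in> C \<Longrightarrow> y \<in> C \<Longrightarrow> dist x y \<le> d / 2"
    obtain c where c: "c \<in> C" using C by blast
    define q where "q = g' c"
    have q: "cmod q = 1" using hom c C(1) unfolding q_def homeomorphism_def by force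
    define arc where "arc = sphere 0 1 \<inter> cball q r"
    have arc_conn: "connected arc"
    proof -
      \<comment> \<open>Half the opening angle of the arc: |1 - cis \<phi>|^2 = 2 - 2 cos \<phi>, so
        chords of length at most r correspond to |\<phi>| <= t.\<close>
      define t where "t = arccos (1 - r\<^sup>2 / 2)"
      have r2: "r\<^sup>2 \<le> 1" using r by (simp add: power_le_one)
      have t: "0 \<le> t" "t \<le> pi" "cos t = 1 - r\<^sup>2 / 2"
        using r2 by (auto simp: t_def intro!: arccos_lbound arccos_ubound cos_arccos)
      have ineq: "dist q (q * cis \<phi>) \<le> r \<longleftrightarrow> cos t \<le> cos \<phi>" for \<phi>
      proof -
        have "dist q (q * cis \<phi>) = cmod (1 - cis \<phi>)"
        proof -
          have "q - q * cis \<phi> = q * (1 - cis \<phi>)" by (simp add: algebra_simps)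
          then show ?thesis using q by (simp add: dist_norm norm_mult)
        qed
        moreover have "(cmod (1 - cis \<phi>))\<^sup>2 = 2 - 2 * cos \<phi>"
        proof -
          have "(cmod (1 - cis \<phi>))\<^sup>2 = (1 - cos \<phi>)\<^sup>2 + (sin \<phi>)\<^sup>2" by (simp add: cmod_power2)
          also have "\<dots> = 1 - 2 * cos \<phi> + ((sin \<phi>)\<^sup>2 + (cos \<phi>)\<^sup>2)" by (simp add: power2_diff)
          finally show ?thesis by simp
        qed
        moreover have "cmod (1 - cis \<phi>) \<le> r \<longleftrightarrow> (cmod (1 - cis \<phi>))\<^sup>2 \<le> r\<^sup>2"
          using r by (metis abs_le_square_iff abs_norm_cancel abs_of_pos)
        ultimately show ?thesis using t by auto
      qed
      have "arc = (\<lambda>\<phi>. q * cis \<phi>) ` {-t..t}"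
      proof (rule set_eqI, rule iffI)
        fix z assume z: "z \<in> arc"
        define \<phi> where "\<phi> = Arg (z / q)"
        have "cmod (z / q) = 1" using z q by (auto simp: arc_def norm_divide)
        then have "cis \<phi> = z / q" unfolding \<phi>_def
          by (metis cis_Arg div_by_1 norm_zero of_real_1 sgn_eq zero_neq_one)
        then have zq: "z = q * cis \<phi>" using q by auto
        have "cos t \<le> cos \<phi>" using z zq ineq[of \<phi>] by (simp add: arc_def)
        then have "cos t \<le> cos \<bar>\<phi>\<bar>" by simp
        moreover have "\<bar>\<phi>\<bar> \<le> pi" using Arg_bounded[of "z / q"] by (auto simp: \<phi>_def)
        ultimately have "\<bar>\<phi>\<bar> \<le> t" using cos_monotone_0_pi[of t "\<bar>\<phi>\<bar>"] t by linarith
        then show "z \<in> (\<lambda>\<phi>. q * cis \<phi>) ` {-t..t}" using zq by (auto simp: abs_le_iff)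
      next
        fix z assume "z \<in> (\<lambda>\<phi>. q * cis \<phi>) ` {-t..t}"
        then obtain \<phi> where "\<phi> \<in> {-t..t}" and zq: "z = q * cis \<phi>" by (rule imageE)
        then have \<phi>: "\<bar>\<phi>\<bar> \<le> t" "z = q * cis \<phi>" by auto
        then have "cos t \<le> cos \<bar>\<phi>\<bar>" using t by (intro cos_monotone_0_pi_le) auto
        then show "z \<in> arc" using ineq[of \<phi>] \<phi> q by (simp add: arc_def norm_mult)
      qed
      then show ?thesis
        by (simp only:) (intro connected_continuous_image continuous_intros; simp)
    qed
    have comparc: "compact arc" unfolding arc_def by (intro compact_Int_closed) auto
    have sub: "arc \<subseteq> sphere 0 1" by (auto simp: arc_def)
    show "\<exists>K. C \<subseteq> K \<and> K \<subseteq> J \<and> compact K \<and> connected K \<and> (\<forall>x\<in>K. \<forall>y\<in>C. dist x y \<le> e)"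
    proof (intro exI[of _ "g ` arc"] conjI ballI)
      show CK: "C \<subseteq> g ` arc"
      proof
        fix y assume y: "y \<in> C"
        have "dist y c < d" using C(3)[OF y c] d(1) by simp
        moreover have "c \<in> J" "y \<in> J" using C(1) c y by auto
        ultimately have "dist (g' y) q < r" unfolding q_def using d(2) by blast
        moreover have "g' y \<in> sphere 0 1" "g (g' y) = y" using hom y C(1) unfolding homeomorphism_def by auto
        ultimately show "y \<in> g ` arc" unfolding arc_def by (intro image_eqI[of _ _ "g' y"]) (auto simp: dist_commute)
      qed
      show "g ` arc \<subseteq> J" using sub unfolding J by auto
      show "compact (g ` arc)" by (rule compact_continuous_image[OF continuous_on_subset[OF contg sub] comparc])
      show "connected (g ` arc)" by (rule connected_continuous_image[OF continuous_on_subset[OF contg sub] arc_conn])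
      fix x y assume x: "x \<in> g ` arc" and "y \<in> C"
      then have "y \<in> g ` arc" using CK by blast
      then obtain x' y' where xy: "x' \<in> arc" "y' \<in> arc" "x = g x'" "y = g y'" using x by blast
      have "dist x' y' \<le> dist q x' + dist q y'" by (metis dist_commute dist_triangle)
      also have "\<dots> < \<eta>" using xy r unfolding arc_def by simp
      finally have "dist (g x') (g y') < e / 2" using xy sub by (intro \<eta>(2)) auto
      then show "dist x y \<le> e" using xy assms by simp
    qed
  qed
qed

text \<open>The points of the image at distance at least e from J form a compact subset of W, so
  their preimages stay in a smaller concentric disc.\<close>

lemma near_boundary:
  assumes "e > 0"
  obtains s where "s < 1" "0 < s" "\<And>z. s < cmod z \<Longrightarrow> cmod z < 1 \<Longrightarrow> infdist (F z) J < e"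
proof -
  define K where "K = closure W \<inter> {w. e \<le> infdist w J}"
  have "closed {w. e \<le> infdist w J}"
    by (intro closed_Collect_le continuous_intros)
  then have cK: "compact K" unfolding K_def
    using bd by (intro compact_Int_closed) (auto simp: compact_closure)
  have KW: "K \<subseteq> W"
  proof
    fix w assume "w \<in> K"
    then have "w \<in> W \<union> J" "e \<le> infdist w J" using closure_W by (auto simp: K_def)
    then show "w \<in> W" using assms infdist_zero[of w J] by auto
  qed
  obtain G where G: "G holomorphic_on W" "\<And>z. z \<in> ball 0 1 \<Longrightarrow> G (F z) = z"
    using holomorphic_has_inverse[OF hol open_ball inj] by metis
  have "compact (G ` K)"
    by (rule compact_continuous_image[OF continuous_on_subset[OF holomorphic_on_imp_continuous_on[OF G(1)] KW] cK])
  moreover have GK: "G ` K \<subseteq> ball 0 1" using KW G(2) by auto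
  ultimately obtain s where s: "s < 1" "\<And>z. z \<in> G ` K \<Longrightarrow> cmod z \<le> s" "0 < s"
  proof (cases "G ` K = {}")
    case False
    then obtain m where m: "m \<in> G ` K" "\<And>z. z \<in> G ` K \<Longrightarrow> cmod z \<le> cmod m"
      using continuous_attains_sup[OF \<open>compact (G ` K)\<close> False, of cmod] by (auto intro: continuous_intros)
    have "cmod m < 1" using m GK by auto
    then show ?thesis using that[of "max (cmod m) (1/2)"] m by (auto simp: le_max_iff_disj)
  qed (use that[of "1/2"] in auto)
  show ?thesis
  proof (rule that[OF s(1,3)])
    fix z assume z: "s < cmod z" "cmod z < 1"
    show "infdist (F z) J < e"
    proof (rule ccontr)
      assume "\<not> ?thesis"
      then have "F z \<in> K" using z closure_subset[of W] by (auto simp: K_def)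
      then have "z \<in> G ` K" using G(2)[of z] z by force
      then show False using s z by force
    qed
  qed
qed

text \<open>A short crosscut together with a small continuum of J containing its limit points on J
  forms a compact set S in a small ball that misses F(0). If some point cut off by the crosscut were
  mapped outside that ball, it could be joined to F(0) off S and off J, hence off their union by
  Janiszewski's theorem, S and J meeting in a connected set. The preimage of the join would cross
  the crosscut.\<close>

lemma local_oscillation:
  assumes q: "cmod q = 1" and e: "e > 0"
  obtains \<rho> where "\<rho> > 0" "\<And>z w. \<lbrakk>cmod z < 1; cmod w < 1; cmod (z - q) < \<rho>; cmod (w - q) < \<rho>\<rbrakk> \<Longrightarrow> dist (F z) (F w) \<le> e"
proof -
  define d0 where "d0 = infdist (F 0) J"
  have "F 0 \<in> W" by simp
  then have "F 0 \<notin> J" using W_J by blast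
  then have d0: "d0 > 0" unfolding d0_def
    using compact_imp_closed[OF compact_J] J_nonempty infdist_pos_not_in_closed by blast
  \<comment> \<open>The ball around \<open>p\<close> has radius 2 e1, hence e1 <= e/4 for the
    oscillation. As \<open>p\<close> is within e1 of J, a distance of F(0) to J of at least 4 e1
    keeps F(0) outside the ball.\<close>
  define e1 where "e1 = min (e / 4) (d0 / 4)"
  have e1: "e1 > 0" "4 * e1 \<le> e" "4 * e1 \<le> d0" using e d0 by (auto simp: e1_def)
  obtain d where d: "d > 0" "\<And>C. \<lbrakk>C \<subseteq> J; C \<noteq> {}; \<And>x y. x \<in> C \<Longrightarrow> y \<in> C \<Longrightarrow> dist x y \<le> d\<rbrakk> \<Longrightarrow>
       \<exists>K. C \<subseteq> K \<and> K \<subseteq> J \<and> compact K \<and> connected K \<and> (\<forall>x\<in>K. \<forall>y\<in>C. dist x y \<le> e1)"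
    using small_set_in_small_continuum[OF e1(1)] by blast
  define e2 where "e2 = min d e1"
  have e2: "e2 > 0" "e2 \<le> d" "e2 \<le> e1" using d e1 by (auto simp: e2_def)
  obtain s where s: "s < 1" "0 < s" "\<And>z. s < cmod z \<Longrightarrow> cmod z < 1 \<Longrightarrow> infdist (F z) J < e1"
    using near_boundary[OF e1(1)] by blast
  have s1: "0 < 1 - s" using s by simp
  obtain \<rho> where \<rho>: "0 < \<rho>" "\<rho> < 1 - s"
    "\<And>z w. \<lbrakk>cmod z < 1; cmod w < 1; cmod (z - q) = \<rho>; cmod (w - q) = \<rho>\<rbrakk> \<Longrightarrow> cmod (F z - F w) \<le> e2"
    using short_crosscut[OF hol inj bd q e2(1) s1] by blast
  define \<gamma> where "\<gamma> = ball 0 1 \<inter> sphere q \<rho>"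
  define z0 where "z0 = of_real (1 - \<rho>) * q"
  have z0: "cmod z0 = 1 - \<rho>" "cmod (z0 - q) = \<rho>"
  proof -
    show "cmod z0 = 1 - \<rho>" using q \<rho> s by (simp add: z0_def norm_mult del: of_real_diff)
    have "z0 - q = - (of_real \<rho> * q)" by (simp add: z0_def algebra_simps)
    then show "cmod (z0 - q) = \<rho>" using q \<rho> by (simp add: norm_mult)
  qed
  have z0\<gamma>: "z0 \<in> \<gamma>" using z0 \<rho> by (auto simp: \<gamma>_def dist_norm norm_minus_commute)
  define p where "p = F z0"
  have S0: "closure (F ` \<gamma>) \<subseteq> cball x e2" if "x \<in> F ` \<gamma>" for x
    by (rule closure_minimal) (use that \<rho>(3) in \<open>auto simp: \<gamma>_def dist_norm norm_minus_commute\<close>)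
  have S0d: "dist x y \<le> e2" if "x \<in> closure (F ` \<gamma>)" "y \<in> closure (F ` \<gamma>)" for x y
  proof -
    have "F ` \<gamma> \<subseteq> cball y e2"
    proof
      fix u assume "u \<in> F ` \<gamma>"
      then show "u \<in> cball y e2" using S0[of u] that(2) by (auto simp: dist_commute subset_eq)
    qed
    then have "closure (F ` \<gamma>) \<subseteq> cball y e2" by (rule closure_minimal) simp
    then show ?thesis using that(1) by (auto simp: dist_commute)
  qed
  define C where "C = closure (F ` \<gamma>) \<inter> J"
  \<comment> \<open>The crosscut may have no limit point on J; then the continuum is taken empty, so
    that S consists of the crosscut alone and still lies in the ball.\<close>
  have "\<exists>K. C \<subseteq> K \<and> K \<subseteq> J \<and> compact K \<and> connected K \<and> (\<forall>x\<in>K. \<forall>y\<in>C. dist x y \<le> e1) \<and> (C = {} \<longrightarrow> K = {})"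
  proof (cases "C = {}")
    case False
    have "dist x y \<le> d" if "x \<in> C" "y \<in> C" for x y
      using S0d[of x y] that e2 by (auto simp: C_def)
    then show ?thesis using d(2)[of C] False by (auto simp: C_def)
  qed (auto intro!: exI[of _ "{}"])
  then obtain K where K: "C \<subseteq> K" "K \<subseteq> J" "compact K" "connected K" "\<And>x y. x \<in> K \<Longrightarrow> y \<in> C \<Longrightarrow> dist x y \<le> e1" "C = {} \<Longrightarrow> K = {}"
    by blast
  define S where "S = closure (F ` \<gamma>) \<union> K"
  have pcl: "p \<in> closure (F ` \<gamma>)" unfolding p_def
    by (rule subsetD[OF closure_subset imageI[OF z0\<gamma>]])
  have Sp: "S \<subseteq> cball p (2 * e1)"
  proof
    fix x assume "x \<in> S"
    then consider "x \<in> closure (F ` \<gamma>)" | "x \<in> K" "C \<noteq> {}" using K(6) by (auto simp: S_def)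
    then show "x \<in> cball p (2 * e1)"
    proof cases
      case 1
      then show ?thesis using S0d[OF pcl 1] e2 e1 by simp
    next
      case 2
      then obtain y where y: "y \<in> C" by blast
      have "dist p x \<le> dist p y + dist y x" by (rule dist_triangle)
      also have "\<dots> \<le> e2 + e1" using S0d[of p y] pcl y K(5)[OF 2(1) y] by (auto simp: C_def dist_commute intro!: add_mono)
      finally show ?thesis using e2 by simp
    qed
  qed
  have cS: "compact S" unfolding S_def
  proof (rule compact_Un[OF _ K(3)])
    have "bounded (F ` \<gamma>)" by (rule bounded_subset[OF bd]) (auto simp: \<gamma>_def)
    then show "compact (closure (F ` \<gamma>))" by (simp add: compact_closure)
  qed
  have SJ: "S \<inter> J = K" using K(1,2) by (auto simp: S_def C_def)
  have far: "F 0 \<notin> cball p (2 * e1)"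
  proof
    assume "F 0 \<in> cball p (2 * e1)"
    then have "dist (F 0) p \<le> 2 * e1" by (simp add: dist_commute)
    moreover have "infdist p J < e1" unfolding p_def by (rule s(3)) (use z0 \<rho> s in auto)
    moreover have "infdist (F 0) J \<le> infdist p J + dist (F 0) p" by (rule infdist_triangle)
    ultimately show False using e1 unfolding d0_def[symmetric] by linarith
  qed
  have inside: "F z \<in> cball p (2 * e1)" if z: "cmod z < 1" "cmod (z - q) < \<rho>" for z
  proof (rule ccontr)
    assume nz: "F z \<notin> cball p (2 * e1)"
    have "connected (- cball p (2 * e1))"
      by (rule connected_complement_bounded_convex) auto
    then have "connected_component (- cball p (2 * e1)) (F z) (F 0)"
      using nz far by (auto simp: connected_component_def intro!: exI[of _ "- cball p (2 * e1)"])
    then have c1: "connected_component (- S) (F z) (F 0)"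
      by (rule connected_component_of_subset) (use Sp in auto)
    have "connected W" using comp in_components_connected by blast
    then have c2: "connected_component (- J) (F z) (F 0)"
      unfolding connected_component_def using W_J z by (intro exI[of _ W]) auto
    have "connected_component (- (S \<union> J)) (F z) (F 0)"
      by (rule Janiszewski[OF cS compact_imp_closed[OF compact_J] _ c1 c2]) (simp add: SJ K(4))
    then obtain V where V: "connected V" "V \<subseteq> - (S \<union> J)" "F z \<in> V" "F 0 \<in> V"
      unfolding connected_component_def by blast
    have VW: "V \<subseteq> W" by (rule W_connected_component[OF V(1)]) (use V in auto)
    obtain G where G: "G holomorphic_on W" "\<And>z. z \<in> ball 0 1 \<Longrightarrow> G (F z) = z"
      using holomorphic_has_inverse[OF hol open_ball inj] by metis
    have conn: "connected (G ` V)"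
      by (rule connected_continuous_image[OF continuous_on_subset[OF holomorphic_on_imp_continuous_on[OF G(1)] VW] V(1)])
    then have "connected ((\<lambda>w. cmod (w - q)) ` (G ` V))"
      by (rule connected_continuous_image[rotated]) (intro continuous_intros)
    moreover have "cmod (z - q) \<in> (\<lambda>w. cmod (w - q)) ` (G ` V)" using V(3) G(2)[of z] z by force
    moreover have "1 \<in> (\<lambda>w. cmod (w - q)) ` (G ` V)"
    proof -
      have "G (F 0) = 0" using G(2) by simp
      then show ?thesis using V(4) q by (force simp: image_iff)
    qed
    ultimately have "\<rho> \<in> (\<lambda>w. cmod (w - q)) ` (G ` V)"
      using connectedD_interval[of "(\<lambda>w. cmod (w - q)) ` (G ` V)" "cmod (z - q)" 1 \<rho>] z \<rho> s by auto
    then obtain v where v: "v \<in> V" "cmod (G v - q) = \<rho>" by auto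
    obtain u where u: "v = F u" "u \<in> ball 0 1" using v VW by auto
    then have "u \<in> \<gamma>" using v G(2)[of u] by (simp add: \<gamma>_def dist_norm norm_minus_commute)
    then have "v \<in> closure (F ` \<gamma>)" unfolding u(1) by (rule subsetD[OF closure_subset imageI])
    then have "v \<in> S" unfolding S_def by blast
    then show False using V v by blast
  qed
  show ?thesis
  proof (rule that[OF \<rho>(1)])
    fix z w assume zw: "cmod z < 1" "cmod w < 1" "cmod (z - q) < \<rho>" "cmod (w - q) < \<rho>"
    have "dist (F z) (F w) \<le> dist p (F z) + dist p (F w)" by (metis dist_commute dist_triangle)
    also have "\<dots> \<le> 2 * e1 + 2 * e1" using inside[OF zw(1,3)] inside[OF zw(2,4)] by (intro add_mono) auto
    finally show "dist (F z) (F w) \<le> e" using e1 by simp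
  qed
qed

text \<open>The oscillation is small near each point of the closed disc, by
  \<open>local_oscillation\<close> on the circle and by continuity inside; a Lebesgue number of the
  resulting cover makes it uniform.\<close>

lemma uniformly_continuous_F: "uniformly_continuous_on (ball 0 1) F"
  unfolding uniformly_continuous_on_def
proof (intro allI impI)
  fix e :: real assume e: "0 < e"
  have "\<exists>d>0. \<forall>z\<in>ball q d \<inter> ball 0 1. \<forall>w\<in>ball q d \<inter> ball 0 1. dist (F z) (F w) < e" if q: "q \<in> cball 0 1" for q
  proof (cases "cmod q = 1")
    case True
    have "0 < e / 2" using e by simp
    then obtain \<rho> where \<rho>: "\<rho> > 0" "\<And>z w. \<lbrakk>cmod z < 1; cmod w < 1; cmod (z - q) < \<rho>; cmod (w - q) < \<rho>\<rbrakk> \<Longrightarrow> dist (F z) (F w) \<le> e / 2"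
      using local_oscillation[OF True] by blast
    show ?thesis
    proof (intro exI[of _ \<rho>] conjI ballI)
      fix z w assume zw: "z \<in> ball q \<rho> \<inter> ball 0 1" "w \<in> ball q \<rho> \<inter> ball 0 1"
      have "dist (F z) (F w) \<le> e / 2" by (rule \<rho>(2)) (use zw in \<open>auto simp: dist_norm norm_minus_commute\<close>)
      then show "dist (F z) (F w) < e" using e by simp
    qed (rule \<rho>)
  next
    case False
    then have q1: "q \<in> ball 0 1" using q by auto
    have "continuous_on (ball 0 1) F" using hol holomorphic_on_imp_continuous_on by blast
    then obtain d where d: "d > 0" "\<And>z. z \<in> ball 0 1 \<Longrightarrow> dist z q < d \<Longrightarrow> dist (F z) (F q) < e / 2"
      using q1 e unfolding continuous_on_iff by (metis half_gt_zero)
    show ?thesis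
    proof (intro exI[of _ d] conjI ballI)
      fix z w assume zw: "z \<in> ball q d \<inter> ball 0 1" "w \<in> ball q d \<inter> ball 0 1"
      have "dist (F z) (F q) < e / 2" "dist (F w) (F q) < e / 2"
        using d(2)[of z] d(2)[of w] zw by (auto simp: dist_commute)
      then show "dist (F z) (F w) < e" by (metis dist_triangle_half_r dist_commute)
    qed (rule d)
  qed
  then obtain D where D: "\<And>q. q \<in> cball 0 1 \<Longrightarrow> D q > 0"
    "\<And>q z w. q \<in> cball 0 1 \<Longrightarrow> z \<in> ball q (D q) \<inter> ball 0 1 \<Longrightarrow> w \<in> ball q (D q) \<inter> ball 0 1 \<Longrightarrow> dist (F z) (F w) < e"
    by metis
  have "cball (0::complex) 1 \<subseteq> \<Union>((\<lambda>q. ball q (D q)) ` cball 0 1)" using D(1) by force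
  then obtain d where d: "d > 0" "\<And>x. x \<in> cball 0 1 \<Longrightarrow> \<exists>B\<in>(\<lambda>q. ball q (D q)) ` cball 0 1. ball x d \<subseteq> B"
    using Heine_Borel_lemma[of "cball (0::complex) 1" "(\<lambda>q. ball q (D q)) ` cball 0 1"] compact_cball open_ball
    by (metis (no_types, lifting) imageE)
  show "\<exists>d>0. \<forall>x\<in>ball 0 1. \<forall>x'\<in>ball 0 1. dist x' x < d \<longrightarrow> dist (F x') (F x) < e"
  proof (intro exI[of _ d] conjI ballI impI)
    fix x x' :: complex assume x: "x \<in> ball 0 1" "x' \<in> ball 0 1" "dist x' x < d"
    have "x \<in> cball 0 1" using x by auto
    then obtain q where q: "q \<in> cball 0 1" "ball x d \<subseteq> ball q (D q)" using d(2) by blast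
    have "x \<in> ball q (D q)" "x' \<in> ball q (D q)" using q(2) x d(1) by (auto simp: subset_eq dist_commute)
    then show "dist (F x') (F x) < e" using D(2)[OF q(1)] x by blast
  qed (rule d)
qed

text \<open>Boundary values lie on J because the distance to J tends to 0 along radii. Every point
  of J is reached because the image of the closed disc is compact and so contains the closure of
  W.\<close>

lemma boundary_extension:
  obtains Fb where "continuous_on (cball 0 1) Fb" "\<And>z. z \<in> ball 0 1 \<Longrightarrow> Fb z = F z"
    "Fb ` sphere 0 1 = J"
proof -
  obtain Fb where Fb: "uniformly_continuous_on (closure (ball 0 1)) Fb" "\<And>x. x \<in> ball 0 1 \<Longrightarrow> F x = Fb x"
    using uniformly_continuous_on_extension_on_closure[OF uniformly_continuous_F] by metis
  have cont: "continuous_on (cball 0 1) Fb"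
    using uniformly_continuous_imp_continuous[OF Fb(1)] by simp
  have img: "Fb ` ball 0 1 = W" using Fb(2) by (auto simp: image_iff)
  have SJ: "Fb q \<in> J" if q: "cmod q = 1" for q
  proof -
    have clq: "Fb q \<in> closure W"
      using continuous_image_closure_subset[of "cball 0 1" Fb "ball 0 1"] cont img q by auto
    have "infdist (Fb q) J \<le> e" if e: "e > 0" for e
    proof -
      obtain s where s: "s < 1" "0 < s" "\<And>z. s < cmod z \<Longrightarrow> cmod z < 1 \<Longrightarrow> infdist (F z) J < e"
        using near_boundary[OF e] by blast
      have lim: "((\<lambda>t. Fb (of_real t * q)) \<longlongrightarrow> Fb (of_real 1 * q)) (at_left 1)"
      proof -
        have "continuous_on {0..1} (\<lambda>t. Fb (of_real t * q))"
          by (rule continuous_on_compose2[OF cont]) (auto intro!: continuous_intros simp: norm_mult q)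
        then have "((\<lambda>t. Fb (of_real t * q)) \<longlongrightarrow> Fb (of_real 1 * q)) (at 1 within {0..1})"
          unfolding continuous_on_def by (rule bspec) simp
        then show ?thesis by (simp add: at_within_Icc_at_left)
      qed
      then have "((\<lambda>t. infdist (Fb (of_real t * q)) J) \<longlongrightarrow> infdist (Fb (of_real 1 * q)) J) (at_left 1)"
        by (rule tendsto_infdist)
      moreover have "\<forall>\<^sub>F t in at_left 1. infdist (Fb (of_real t * q)) J \<le> e"
      proof (rule eventually_at_leftI[of s])
        fix t assume t: "t \<in> {s<..<1}"
        then have n: "cmod (of_real t * q) = t" using q s by (simp add: norm_mult)
        then have "infdist (F (of_real t * q)) J < e" using s(3)[of "of_real t * q"] t by simp
        then show "infdist (Fb (of_real t * q)) J \<le> e" using Fb(2)[of "of_real t * q"] n t by simp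
      qed (use s in simp)
      ultimately show ?thesis
        by (metis (mono_tags) tendsto_upperbound trivial_limit_at_left_real mult_1 of_real_1)
    qed
    then have "infdist (Fb q) J \<le> 0" by (meson dense_ge)
    then have "infdist (Fb q) J = 0" using infdist_nonneg[of "Fb q" J] by linarith
    then show ?thesis
      using compact_imp_closed[OF compact_J] J_nonempty in_closed_iff_infdist_zero by blast
  qed
  have "J \<subseteq> Fb ` sphere 0 1"
  proof
    fix x assume x: "x \<in> J"
    have "compact (Fb ` cball 0 1)" by (rule compact_continuous_image[OF cont]) simp
    then have "closure W \<subseteq> Fb ` cball 0 1"
    proof (intro closure_minimal)
      show "W \<subseteq> Fb ` cball 0 1" using img ball_subset_cball by blast
    qed (rule compact_imp_closed)
    then obtain z where z: "z \<in> cball 0 1" "x = Fb z" using x closure_W by auto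
    then have "z \<notin> ball 0 1" using x W_J img by blast
    then show "x \<in> Fb ` sphere 0 1" using z by auto
  qed
  then have "Fb ` sphere 0 1 = J" using SJ by auto
  then show ?thesis using that[OF cont _ ] Fb(2) by metis
qed

end

text \<open>A product over n rotations turns vanishing on an arc into vanishing on the whole circle,
  where the maximum principle applies. At z = 0 all rotations coincide, so the conclusion there
  reads H(0) = 0.\<close>

lemma zero_on_arc_imp_has_many_zeros:
  fixes H :: "complex \<Rightarrow> complex"
  assumes cont: "continuous_on (cball 0 1) H" and hol: "H holomorphic_on ball 0 1"
    and uv: "u < v" and zero: "\<And>t. u < t \<Longrightarrow> t < v \<Longrightarrow> H (cis t) = 0"
  obtains n :: nat where "\<And>z. cmod z < 1 \<Longrightarrow> \<exists>k<n. H (z * cis (2 * pi * real k / real n)) = 0"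
proof -
  obtain n :: nat where n: "2 * pi / (v - u) < real n" using reals_Archimedean2 by blast
  have "0 < 2 * pi / (v - u)" using uv by simp
  then have n0: "real n > 0" using n by linarith
  have nw: "2 * pi / real n < v - u" using n n0 uv by (simp add: field_simps)
  \<comment> \<open>The \<open>n\<close> rotated copies of the arc cover the circle, so \<open>P\<close> vanishes on it.\<close>
  define P where "P = (\<lambda>z. \<Prod>k<n. H (z * cis (2 * pi * real k / real n)))"
  have cP: "continuous_on (cball 0 1) P" unfolding P_def
    by (intro continuous_intros continuous_on_compose2[OF cont]) (auto simp: norm_mult)
  have hP: "P holomorphic_on ball 0 1" unfolding P_def
    by (intro holomorphic_intros holomorphic_on_compose_gen[OF _ hol, unfolded o_def]) (auto simp: norm_mult)
  have bdry: "P z = 0" if z: "cmod z = 1" for z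
  proof -
    define t where "t = Arg z"
    have zt: "z = cis t" using z cis_Arg[of z] unfolding t_def by (metis div_by_1 norm_zero of_real_1 sgn_eq zero_neq_one)
    define w where "w = 2 * pi / real n"
    have w: "w > 0" using n0 by (simp add: w_def)
    \<comment> \<open>The step \<open>w\<close> is smaller than the length of the arc, so some
      multiple of it moves the angle t into the arc; \<open>k\<close> is this multiple reduced
      modulo n.\<close>
    define j where "j = \<lfloor>(u - t) / w\<rfloor> + 1"
    have j: "u < t + of_int j * w" "t + of_int j * w < v"
    proof -
      have "(u - t) / w < of_int j" unfolding j_def by linarith
      then show "u < t + of_int j * w" using w by (simp add: field_simps)
      have "of_int j \<le> (u - t) / w + 1" unfolding j_def by linarith
      then have "of_int j * w \<le> ((u - t) / w + 1) * w" using w by (intro mult_right_mono) auto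
      also have "\<dots> = u - t + w" using w by (simp add: field_simps)
      finally show "t + of_int j * w < v" using nw by (simp add: w_def)
    qed
    define k where "k = nat (j mod int n)"
    have k: "k < n" "int k = j mod int n" using n0 by (auto simp: k_def nat_less_iff)
    have "j = int n * (j div int n) + int k" using k by simp
    then have "of_int j = real n * of_int (j div int n) + real k"
      by (metis of_int_add of_int_mult of_int_of_nat_eq)
    then have "t + of_int j * w = t + 2 * pi * real k / real n + 2 * pi * of_int (j div int n)"
      using n0 by (simp add: w_def field_simps)
    then have "cis (t + of_int j * w) = cis t * cis (2 * pi * real k / real n) * cis (2 * pi * of_int (j div int n))"
      by (simp only: cis_mult)
    also have "cis (2 * pi * of_int (j div int n)) = 1" by (rule cis_multiple_2pi) simp
    finally have "H (z * cis (2 * pi * real k / real n)) = 0" using zero[OF j] by (simp add: zt)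
    then show ?thesis unfolding P_def using k(1) by (intro prod_zero) auto
  qed
  have "P z = 0" if z: "cmod z < 1" for z
  proof -
    have "cmod (P z) \<le> 0"
    proof (rule maximum_modulus_frontier[of P "cball 0 1"])
      show "cmod (P w) \<le> 0" if "w \<in> frontier (cball 0 1)" for w
        using that bdry by simp
    qed (use hP cP z in auto)
    then show ?thesis by simp
  qed
  then show ?thesis using that[of n] unfolding P_def by auto
qed

text \<open>A branch of the argument cut along the first ray is continuous on C. Its image is
  connected and contains values on both sides of the angle of the second ray, so C would meet that
  ray.\<close>

lemma connected_avoiding_two_rays:
  assumes conn: "connected C" and t: "t1 < t2"
    and avoid: "\<And>r. 0 \<le> r \<Longrightarrow> of_real r * cis t1 \<notin> C" "\<And>r. 0 \<le> r \<Longrightarrow> of_real r * cis t2 \<notin> C"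
    and s: "t1 < s" "s < t2" "t2 < s'" "s' < t1 + 2 * pi" and r: "0 < r" "0 < r'"
    and inC: "of_real r * cis s \<in> C" "of_real r' * cis s' \<in> C"
  shows False
proof -
  define L where "L = (\<lambda>z. Im (Ln (- z / cis t1)))"
  have nonneg: "- z / cis t1 \<notin> \<real>\<^sub>\<le>\<^sub>0" if "z \<in> C" for z
  proof
    assume "- z / cis t1 \<in> \<real>\<^sub>\<le>\<^sub>0"
    then obtain x where x: "- z / cis t1 = of_real x" "x \<le> 0" by (rule nonpos_Reals_cases)
    then have "- z = of_real x * cis t1" by (simp add: field_simps)
    then have "z = - (of_real x * cis t1)" by (metis minus_minus)
    then have "z = of_real (- x) * cis t1" by simp
    then show False using avoid(1)[of "- x"] x(2) that by simp
  qed
  have "continuous_on C L" unfolding L_def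
    by (intro continuous_intros) (use nonneg in auto)
  then have "connected (L ` C)" using conn by (rule connected_continuous_image)
  have val: "L (of_real x * cis y) = y - t1 - pi" if "x > 0" "t1 < y" "y < t1 + 2 * pi" for x y
  proof -
    have "- (of_real x * cis y) / cis t1 = of_real x * cis (y - t1 - pi)"
      by (simp add: cis_divide[symmetric])
    also have "\<dots> = exp (Complex (ln x) (y - t1 - pi))" using that by (simp add: exp_eq_polar)
    finally have "L (of_real x * cis y) = Im (Ln (exp (Complex (ln x) (y - t1 - pi))))" unfolding L_def by simp
    also have "\<dots> = y - t1 - pi" using that by (subst Ln_exp) auto
    finally show ?thesis .
  qed
  have "s - t1 - pi \<in> L ` C" "s' - t1 - pi \<in> L ` C"
    using inC val[of r s] val[of r' s'] r s by (auto simp: image_iff intro: bexI[rotated])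
  then have "t2 - t1 - pi \<in> L ` C"
    by (rule connectedD_interval[OF \<open>connected (L ` C)\<close>]) (use s in auto)
  then obtain z where z: "z \<in> C" "L z = t2 - t1 - pi" by auto
  have z0: "z \<noteq> 0" using avoid(1)[of 0] z(1) by auto
  define w where "w = - z / cis t1"
  have w0: "w \<noteq> 0" using z0 by (simp add: w_def)
  define E where "E = exp (Re (Ln w))"
  have "w = exp (Ln w)" using w0 by simp
  also have "\<dots> = of_real E * cis (t2 - t1 - pi)"
    using z(2) unfolding L_def w_def[symmetric] E_def by (subst exp_eq_polar) simp
  finally have weq: "w = of_real E * cis (t2 - t1 - pi)" .
  have "- z = w * cis t1" by (simp add: w_def)
  also have "\<dots> = of_real E * cis (t2 - t1 - pi + t1)" unfolding weq by (simp only: mult.assoc cis_mult)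
  also have "cis (t2 - t1 - pi + t1) = - cis t2" by (simp add: complex_eq_iff)
  finally have "z = of_real E * cis t2" by simp
  then show False using avoid(2)[of E] z(1) by (simp add: E_def)
qed

context jordan_conformal
begin

text \<open>If two radii had images ending at the same point \<open>a\<close>, these would form a closed curve with the
  connected set \<open>J - {a}\<close> on one side. On the arc on the other side the extension is constantly
  \<open>a\<close>, which forces \<open>F\<close> to take the value \<open>a\<close> inside the disc.\<close>

lemma boundary_extension_inj:
  assumes cont: "continuous_on (cball 0 1) Fb" and ext: "\<And>z. z \<in> ball 0 1 \<Longrightarrow> Fb z = F z"
    and img: "Fb ` sphere 0 1 = J"
  shows "inj_on Fb (sphere 0 1)"
proof (rule inj_onI, rule ccontr)
  fix q1 q2 assume q: "q1 \<in> sphere 0 1" "q2 \<in> sphere 0 1" "Fb q1 = Fb q2" "q1 \<noteq> q2"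
  define a where "a = Fb q1"
  have polar: "\<exists>t. 0 \<le> t \<and> t < 2 * pi \<and> z = cis t" if "cmod z = 1" for z
    using that complex_unimodular_polar[of z] by (metis complex_eq cis.code that)
  obtain s1 s2 where s12: "0 \<le> s1" "s1 < 2 * pi" "q1 = cis s1" "0 \<le> s2" "s2 < 2 * pi" "q2 = cis s2"
    using polar[of q1] polar[of q2] q by auto
  define t1 where "t1 = min s1 s2"
  define t2 where "t2 = max s1 s2"
  have "s1 \<noteq> s2" using s12 q(4) by auto
  then have t: "0 \<le> t1" "t1 < t2" "t2 < t1 + 2 * pi"
    using s12(1,2,4,5) by (auto simp: t1_def t2_def min_def max_def split: if_splits)
  have Fa: "Fb (cis t1) = a" "Fb (cis t2) = a"
    using s12 q(3) by (auto simp: t1_def t2_def a_def min_def max_def)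
  have aJ: "a \<in> J" using img q(1) by (auto simp: a_def)
  define R where "R = closed_segment 0 (cis t1) \<union> closed_segment 0 (cis t2)"
  have Rsub: "R \<subseteq> cball 0 1" unfolding R_def
    by (intro Un_least closed_segment_subset) auto
  have Rball: "z \<in> ball 0 1 \<or> z = cis t1 \<or> z = cis t2" if "z \<in> R" for z
  proof -
    have "z \<in> ball 0 1 \<or> z = cis y" if zy: "z \<in> closed_segment 0 (cis y)" for y
    proof -
      obtain x where x: "0 \<le> x" "x \<le> 1" "z = of_real x * cis y"
        using zy by (auto simp: closed_segment_def scaleR_conv_of_real)
      show ?thesis using x by (cases "x = 1") (auto simp: norm_mult)
    qed
    then show ?thesis using \<open>z \<in> R\<close> by (auto simp: R_def)
  qed
  have ray: "of_real r * cis y \<in> closed_segment 0 (cis y)" if "0 \<le> r" "r \<le> 1" for r y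
    using that by (auto simp: closed_segment_def scaleR_conv_of_real intro!: exI[of _ r])
  define C where "C = Fb ` R"
  have cR: "continuous_on R Fb" by (rule continuous_on_subset[OF cont Rsub])
  have cC: "compact C" unfolding C_def by (rule compact_continuous_image[OF cR]) (simp add: R_def compact_Un)
  have "closed_segment 0 (cis t1) \<inter> closed_segment 0 (cis t2) \<noteq> {}" by auto
  then have CJ: "C \<inter> J = {a}"
  proof (intro equalityI subsetI)
    fix x assume "x \<in> C \<inter> J"
    then obtain z where z: "z \<in> R" "x = Fb z" "x \<in> J" by (auto simp: C_def)
    have "z \<notin> ball 0 1"
    proof
      assume "z \<in> ball 0 1"
      then have "x \<in> W" using z(2) ext by auto
      then show False using z(3) W_J by blast
    qed
    then show "x \<in> {a}" using Rball[OF z(1)] Fa z by auto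
  next
    fix x assume "x \<in> {a}"
    then show "x \<in> C \<inter> J" using aJ Fa by (auto simp: C_def R_def intro!: image_eqI[of _ _ "cis t1"])
  qed
  have Jconn: "connected (J - {a})"
  proof -
    obtain g' where hom: "homeomorphism (sphere 0 1) J g g'"
      using homeomorphism_compact[OF _ contg _ injg] J by (metis compact_sphere)
    obtain q0 where q0: "q0 \<in> sphere 0 1" "a = g q0" using aJ J by auto
    have "J - {a} = g ` (sphere 0 1 - {q0})"
      using q0 injg unfolding J inj_on_def by blast
    moreover have "connected (sphere 0 1 - {q0})"
    proof -
      have n0: "cmod q0 = 1" "q0 \<noteq> 0" using q0 by auto
      have "sphere 0 1 - {q0} = (\<lambda>y. q0 * cis y) ` {0<..<2 * pi}"
      proof (intro equalityI subsetI)
        fix z assume z: "z \<in> sphere 0 1 - {q0}"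
        then have "cmod (z / q0) = 1" using n0 by (simp add: norm_divide)
        then obtain y where y: "0 \<le> y" "y < 2 * pi" "z / q0 = cis y" using polar by blast
        then have "z = q0 * cis y" using n0 by (simp add: field_simps)
        moreover have "y \<noteq> 0" using y(3) z n0 by auto
        ultimately show "z \<in> (\<lambda>y. q0 * cis y) ` {0<..<2 * pi}" using y by (intro image_eqI[of _ _ y]) auto
      next
        fix z assume "z \<in> (\<lambda>y. q0 * cis y) ` {0<..<2 * pi}"
        then obtain y where "y \<in> {0<..<2 * pi}" and y: "z = q0 * cis y" by (rule imageE)
        then have "0 < y" "y < 2 * pi" by auto
        then have "0 < sin (y / 2)" by (intro sin_gt_zero) auto
        then have "cos y \<noteq> 1" using cos_double_sin[of "y / 2"] by auto
        then have "cis y \<noteq> 1" by (metis cis.simps(1) one_complex.simps(1))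
        then show "z \<in> sphere 0 1 - {q0}" using n0 y by (simp add: norm_mult)
      qed
      then show ?thesis
        by (simp only:) (intro connected_continuous_image continuous_intros; simp)
    qed
    moreover have "continuous_on (sphere 0 1 - {q0}) g"
      by (rule continuous_on_subset[OF contg]) auto
    ultimately show ?thesis by (simp add: connected_continuous_image)
  qed
  obtain G where G: "G holomorphic_on W" "\<And>z. z \<in> ball 0 1 \<Longrightarrow> G (F z) = z"
    using holomorphic_has_inverse[OF hol open_ball inj] by metis
  \<comment> \<open>Of two boundary points on opposite sides of the radii, one has value
    \<open>a\<close>. Otherwise interior points near them have images that are joined off
    \<open>C\<close> by \<open>J - {a}\<close> and two small balls, and off J inside W. Since C and
    J meet only in \<open>a\<close>, Janiszewski's theorem joins them off the union, and the
    preimage of the join would pass between the two sectors without meeting a radius.\<close>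
  have key: "Fb (cis s) = a \<or> Fb (cis s') = a" if s: "t1 < s" "s < t2" "t2 < s'" "s' < t1 + 2 * pi" for s s'
  proof (rule ccontr)
    assume "\<not> ?thesis"
    moreover have "Fb (cis y) \<in> J" for y unfolding img[symmetric] by (rule imageI) simp
    ultimately have ne: "Fb (cis s) \<in> J - {a}" "Fb (cis s') \<in> J - {a}" by auto
    then have nC: "Fb (cis s) \<notin> C" "Fb (cis s') \<notin> C" using CJ by blast+
    have app: "\<exists>r. 0 < r \<and> r < 1 \<and> (\<exists>e. Fb (of_real r * cis y) \<in> ball (Fb (cis y)) e \<and> ball (Fb (cis y)) e \<subseteq> - C)"
      if "Fb (cis y) \<notin> C" for y
    proof -
      have "open (- C)" using compact_imp_closed[OF cC] by (rule open_Compl)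
      moreover have "Fb (cis y) \<in> - C" using that by simp
      ultimately obtain e where e: "e > 0" "ball (Fb (cis y)) e \<subseteq> - C" by (meson open_contains_ball)
      have "cis y \<in> cball 0 1" by simp
      then obtain d where d: "d > 0" "\<And>z. z \<in> cball 0 1 \<Longrightarrow> dist z (cis y) < d \<Longrightarrow> dist (Fb z) (Fb (cis y)) < e"
        using cont e(1) unfolding continuous_on_iff by metis
      define r where "r = max (1/2) (1 - d / 2)"
      have r: "0 < r" "r < 1" "1 - d < r" using d(1) by (auto simp: r_def)
      have "cis y * of_real r - cis y = - (of_real (1 - r) * cis y)" by (simp add: algebra_simps)
      then have "dist (of_real r * cis y) (cis y) = 1 - r"
        using r by (simp add: dist_norm norm_mult mult.commute del: of_real_diff)
      then have "dist (Fb (of_real r * cis y)) (Fb (cis y)) < e"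
        using r by (intro d(2)) (auto simp: norm_mult)
      then show ?thesis using r e by (intro exI[of _ r] conjI exI[of _ e]) (auto simp: dist_commute)
    qed
    obtain r e where r: "0 < r" "r < 1" "Fb (of_real r * cis s) \<in> ball (Fb (cis s)) e" "ball (Fb (cis s)) e \<subseteq> - C"
      using app[OF nC(1)] by blast
    obtain r' e' where r': "0 < r'" "r' < 1" "Fb (of_real r' * cis s') \<in> ball (Fb (cis s')) e'" "ball (Fb (cis s')) e' \<subseteq> - C"
      using app[OF nC(2)] by blast
    define x where "x = F (of_real r * cis s)"
    define y where "y = F (of_real r' * cis s')"
    have xy: "x = Fb (of_real r * cis s)" "y = Fb (of_real r' * cis s')" "x \<in> W" "y \<in> W"
      using ext r r' by (auto simp: x_def y_def norm_mult)
    define U where "U = ball (Fb (cis s)) e \<union> (J - {a}) \<union> ball (Fb (cis s')) e'"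
    have e0: "e > 0" "e' > 0" using r(3) r'(3) by (auto intro: le_less_trans[OF zero_le_dist])
    have "Fb (cis s) \<in> ball (Fb (cis s)) e \<inter> (J - {a})"
      "Fb (cis s') \<in> (ball (Fb (cis s)) e \<union> (J - {a})) \<inter> ball (Fb (cis s')) e'" using ne e0 by auto
    then have "connected U" unfolding U_def
      by (intro connected_Un Jconn connected_ball) blast+
    moreover have "U \<subseteq> - C" using r(4) r'(4) CJ unfolding U_def by blast
    ultimately have c1: "connected_component (- C) x y"
      unfolding connected_component_def using r(3) r'(3) xy by (intro exI[of _ U]) (auto simp: U_def)
    have "connected W" using comp in_components_connected by blast
    then have c2: "connected_component (- J) x y"
      unfolding connected_component_def using W_J xy by (intro exI[of _ W]) auto
    have "connected_component (- (C \<union> J)) x y"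
      by (rule Janiszewski[OF cC compact_imp_closed[OF compact_J] _ c1 c2]) (simp add: CJ)
    then obtain V where V: "connected V" "V \<subseteq> - (C \<union> J)" "x \<in> V" "y \<in> V"
      unfolding connected_component_def by blast
    have VW: "V \<subseteq> W" by (rule W_connected_component[OF V(1)]) (use V xy in auto)
    have conn: "connected (G ` V)"
      by (rule connected_continuous_image[OF continuous_on_subset[OF holomorphic_on_imp_continuous_on[OF G(1)] VW] V(1)])
    have GV: "z \<in> ball 0 1 \<and> z \<notin> R" if zV: "z \<in> G ` V" for z
    proof -
      obtain v where v: "v \<in> V" "z = G v" using zV by auto
      obtain u where u: "u \<in> ball 0 1" "v = F u" using v VW by auto
      have zu: "z = u" using v u G(2) by simp
      have "F u \<notin> C" using v u V(2) by auto
      then show ?thesis using ext[OF u(1)] u(1) unfolding zu C_def by force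
    qed
    have avoid: "of_real x * cis t \<notin> G ` V" if "0 \<le> x" "t = t1 \<or> t = t2" for x t
    proof
      assume "of_real x * cis t \<in> G ` V"
      from GV[OF this] have "x < 1" "of_real x * cis t \<notin> R" using that by (auto simp: norm_mult)
      then show False using ray[of x t] that by (auto simp: R_def)
    qed
    show False
    proof (rule connected_avoiding_two_rays[OF conn t(2) _ _ s r(1) r'(1)])
      show "of_real r * cis s \<in> G ` V" using V(3) G(2)[of "of_real r * cis s"] r by (auto simp: x_def norm_mult image_iff intro!: bexI[of _ x])
      show "of_real r' * cis s' \<in> G ` V" using V(4) G(2)[of "of_real r' * cis s'"] r' by (auto simp: y_def norm_mult image_iff intro!: bexI[of _ y])
    qed (use avoid in auto)
  qed
  have "\<exists>u v. u < v \<and> (\<forall>s. u < s \<and> s < v \<longrightarrow> Fb (cis s) = a)"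
  proof (cases "\<forall>s. t1 < s \<and> s < t2 \<longrightarrow> Fb (cis s) = a")
    case False
    then obtain s where s: "t1 < s" "s < t2" "Fb (cis s) \<noteq> a" by blast
    then have "\<forall>s'. t2 < s' \<and> s' < t1 + 2 * pi \<longrightarrow> Fb (cis s') = a" using key by blast
    then show ?thesis using t(3) by blast
  qed (use t in blast)
  then obtain u v where uv: "u < v" "\<And>s. u < s \<Longrightarrow> s < v \<Longrightarrow> Fb (cis s) - a = 0" by auto
  have holFb: "(\<lambda>z. Fb z - a) holomorphic_on ball 0 1"
    by (intro holomorphic_intros holomorphic_transform[OF hol]) (use ext in auto)
  have cH: "continuous_on (cball 0 1) (\<lambda>z. Fb z - a)" by (intro continuous_intros cont)
  obtain n :: nat where n: "\<And>z. cmod z < 1 \<Longrightarrow> \<exists>k<n. Fb (z * cis (2 * pi * real k / real n)) - a = 0"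
    using zero_on_arc_imp_has_many_zeros[OF cH holFb uv(1) uv(2)] by blast
  obtain k where k: "Fb (0 * cis (2 * pi * real k / real n)) - a = 0" using n[of 0] by auto
  then have "a = F 0" using ext[of 0] by simp
  then have "a \<in> W" by auto
  then show False using aJ W_J by auto
qed

end

subsection \<open>Harmonic functions and their Wirtinger derivatives\<close>

text \<open>\<open>du = p dz + cnj (q dz)\<close> with \<open>p\<close> and \<open>q\<close> holomorphic.\<close>

definition harmonic_pair :: "complex set \<Rightarrow> (complex \<Rightarrow> complex) \<Rightarrow> (complex \<Rightarrow> complex) \<Rightarrow> (complex \<Rightarrow> complex) \<Rightarrow> bool" where
  "harmonic_pair S u p q \<longleftrightarrow> p holomorphic_on S \<and> q holomorphic_on S \<and>
     (\<forall>z\<in>S. (u has_derivative (\<lambda>w. p z * w + cnj (q z * w))) (at z))"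

text \<open>The second difference of h over a square of side t is t^2 times either mixed derivative
  up to an error 3 e t^2: integrate in one coordinate the linear approximation of the partial
  derivative taken in that coordinate.\<close>

lemma mixed_partials_eq:
  fixes h hx hy :: "complex \<Rightarrow> complex"
  assumes S: "open S" "z \<in> S"
    and dh: "\<And>z. z \<in> S \<Longrightarrow> (h has_derivative (\<lambda>w. of_real (Re w) * hx z + of_real (Im w) * hy z)) (at z)"
    and d1: "(hx has_derivative D1) (at z)" and d2: "(hy has_derivative D2) (at z)"
  shows "D1 \<i> = D2 1"
proof -
  interpret D1: bounded_linear D1 using d1 by (rule has_derivative_bounded_linear)
  interpret D2: bounded_linear D2 using d2 by (rule has_derivative_bounded_linear)
  have bound: "cmod (D1 \<i> - D2 1) \<le> 6 * e" if e: "e > 0" for e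
  proof -
    obtain r where r: "r > 0" "ball z r \<subseteq> S" using S open_contains_ball by blast
    obtain r1 where r1: "r1 > 0" "\<And>y. norm (y - z) < r1 \<Longrightarrow> norm (hx y - hx z - D1 (y - z)) \<le> e * norm (y - z)"
      using d1 e unfolding has_derivative_at_alt by blast
    obtain r2 where r2: "r2 > 0" "\<And>y. norm (y - z) < r2 \<Longrightarrow> norm (hy y - hy z - D2 (y - z)) \<le> e * norm (y - z)"
      using d2 e unfolding has_derivative_at_alt by blast
    define t where "t = min r (min r1 r2) / 4"
    have t: "t > 0" "2 * t < r" "2 * t < r1" "2 * t < r2" using r(1) r1(1) r2(1) by (auto simp: t_def)
    define pt where "pt = (\<lambda>a b. z + Complex a b)"
    have nab: "cmod (pt a b - z) \<le> a + b" if "0 \<le> a" "0 \<le> b" for a b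
      using cmod_le[of "Complex a b"] that by (simp add: pt_def)
    have inS: "pt a b \<in> S" if "0 \<le> a" "a \<le> t" "0 \<le> b" "b \<le> t" for a b
    proof -
      have "cmod (pt a b - z) < r" using nab[of a b] that t by linarith
      then show ?thesis using r(2) by (auto simp: dist_norm norm_minus_commute)
    qed
    have ex: "cmod (hx (pt a b) - hx z - D1 (Complex a b)) \<le> e * (a + b)" if "0 \<le> a" "a \<le> t" "0 \<le> b" "b \<le> t" for a b
    proof -
      have "cmod (pt a b - z) < r1" using nab[of a b] that t by linarith
      from r1(2)[OF this] have "cmod (hx (pt a b) - hx z - D1 (Complex a b)) \<le> e * cmod (pt a b - z)" by (simp add: pt_def)
      also have "\<dots> \<le> e * (a + b)" using nab[of a b] that e by (intro mult_left_mono) auto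
      finally show ?thesis .
    qed
    have ey: "cmod (hy (pt a b) - hy z - D2 (Complex a b)) \<le> e * (a + b)" if "0 \<le> a" "a \<le> t" "0 \<le> b" "b \<le> t" for a b
    proof -
      have "cmod (pt a b - z) < r2" using nab[of a b] that t by linarith
      from r2(2)[OF this] have "cmod (hy (pt a b) - hy z - D2 (Complex a b)) \<le> e * cmod (pt a b - z)" by (simp add: pt_def)
      also have "\<dots> \<le> e * (a + b)" using nab[of a b] that e by (intro mult_left_mono) auto
      finally show ?thesis .
    qed
    have vx: "((\<lambda>s. h (pt s b)) has_vector_derivative hx (pt s b)) (at s within {0..t})" if "0 \<le> s" "s \<le> t" "0 \<le> b" "b \<le> t" for s b
    proof -
      have p: "((\<lambda>s. pt s b) has_derivative (\<lambda>x. of_real x)) (at s within {0..t})"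
        unfolding pt_def Complex_eq by (auto intro!: derivative_eq_intros)
      have "(h has_derivative (\<lambda>w. of_real (Re w) * hx (pt s b) + of_real (Im w) * hy (pt s b))) (at (pt s b) within (\<lambda>s. pt s b) ` {0..t})"
        by (rule has_derivative_at_withinI, rule dh, rule inS) (use that in auto)
      from has_derivative_in_compose[OF p this] show ?thesis
        by (simp add: has_vector_derivative_def scaleR_conv_of_real)
    qed
    have vy: "((\<lambda>s. h (pt b s)) has_vector_derivative hy (pt b s)) (at s within {0..t})" if "0 \<le> s" "s \<le> t" "0 \<le> b" "b \<le> t" for s b
    proof -
      have p: "((\<lambda>s. pt b s) has_derivative (\<lambda>x. \<i> * of_real x)) (at s within {0..t})"
        unfolding pt_def Complex_eq by (auto intro!: derivative_eq_intros)
      have "(h has_derivative (\<lambda>w. of_real (Re w) * hx (pt b s) + of_real (Im w) * hy (pt b s))) (at (pt b s) within (\<lambda>s. pt b s) ` {0..t})"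
        by (rule has_derivative_at_withinI, rule dh, rule inS) (use that in auto)
      from has_derivative_in_compose[OF p this] show ?thesis
        by (simp add: has_vector_derivative_def scaleR_conv_of_real)
    qed
    have lin: "((\<lambda>s. of_real s * c) has_vector_derivative c) (at s within X)" for c :: complex and s X
      by (auto simp: has_vector_derivative_def scaleR_conv_of_real intro!: derivative_eq_intros)
    define \<Delta> where "\<Delta> = h (pt t t) - h (pt t 0) - h (pt 0 t) + h (pt 0 0)"
    have A: "cmod (\<Delta> - of_real (t * t) * D1 \<i>) \<le> 3 * e * t * t"
    proof -
      have I: "((\<lambda>s. hx (pt s t) - hx (pt s 0) - of_real t * D1 \<i>) has_integral
         ((h (pt t t) - h (pt t 0) - of_real t * (of_real t * D1 \<i>)) - (h (pt 0 t) - h (pt 0 0) - of_real 0 * (of_real t * D1 \<i>)))) {0..t}"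
        by (rule fundamental_theorem_of_calculus[where f = "\<lambda>s. h (pt s t) - h (pt s 0) - of_real s * (of_real t * D1 \<i>)"])
           (use t in simp, rule has_vector_derivative_diff[OF has_vector_derivative_diff[OF vx vx] lin], use t in auto)
      have "cmod ((h (pt t t) - h (pt t 0) - of_real t * (of_real t * D1 \<i>)) - (h (pt 0 t) - h (pt 0 0) - of_real 0 * (of_real t * D1 \<i>))) \<le> (3 * e * t) * measure lborel (cbox 0 t)"
      proof (rule has_integral_bound[of _ "\<lambda>s. hx (pt s t) - hx (pt s 0) - of_real t * D1 \<i>"])
        fix s assume s: "s \<in> cbox 0 t"
        have e1: "Complex s t = Complex s 0 + t *\<^sub>R \<i>" by (simp add: complex_eq_iff)
        have "D1 (Complex s t) = D1 (Complex s 0) + of_real t * D1 \<i>"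
          unfolding e1 D1.add D1.scaleR by (simp add: scaleR_conv_of_real)
        then have "hx (pt s t) - hx (pt s 0) - of_real t * D1 \<i> = (hx (pt s t) - hx z - D1 (Complex s t)) - (hx (pt s 0) - hx z - D1 (Complex s 0))"
          by simp
        then have "cmod (hx (pt s t) - hx (pt s 0) - of_real t * D1 \<i>)
          \<le> cmod (hx (pt s t) - hx z - D1 (Complex s t)) + cmod (hx (pt s 0) - hx z - D1 (Complex s 0))"
          by (simp only: norm_triangle_ineq4)
        also have "\<dots> \<le> e * (s + t) + e * (s + 0)"
          using ex[of s t] ex[of s 0] s t by (intro add_mono) auto
        also have "\<dots> \<le> e * (2 * t) + e * t" using s e by (intro add_mono mult_left_mono) auto
        finally show "cmod (hx (pt s t) - hx (pt s 0) - of_real t * D1 \<i>) \<le> 3 * e * t" by (simp add: algebra_simps)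
      qed (use I e t in auto)
      then show ?thesis using t by (simp add: \<Delta>_def algebra_simps)
    qed
    have B: "cmod (\<Delta> - of_real (t * t) * D2 1) \<le> 3 * e * t * t"
    proof -
      have I: "((\<lambda>s. hy (pt t s) - hy (pt 0 s) - of_real t * D2 1) has_integral
         ((h (pt t t) - h (pt 0 t) - of_real t * (of_real t * D2 1)) - (h (pt t 0) - h (pt 0 0) - of_real 0 * (of_real t * D2 1)))) {0..t}"
        by (rule fundamental_theorem_of_calculus[where f = "\<lambda>s. h (pt t s) - h (pt 0 s) - of_real s * (of_real t * D2 1)"])
           (use t in simp, rule has_vector_derivative_diff[OF has_vector_derivative_diff[OF vy vy] lin], use t in auto)
      have "cmod ((h (pt t t) - h (pt 0 t) - of_real t * (of_real t * D2 1)) - (h (pt t 0) - h (pt 0 0) - of_real 0 * (of_real t * D2 1))) \<le> (3 * e * t) * measure lborel (cbox 0 t)"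
      proof (rule has_integral_bound[of _ "\<lambda>s. hy (pt t s) - hy (pt 0 s) - of_real t * D2 1"])
        fix s assume s: "s \<in> cbox 0 t"
        have e1: "Complex t s = Complex 0 s + t *\<^sub>R 1" by (simp add: complex_eq_iff)
        have "D2 (Complex t s) = D2 (Complex 0 s) + of_real t * D2 1"
          unfolding e1 D2.add D2.scaleR by (simp add: scaleR_conv_of_real)
        then have "hy (pt t s) - hy (pt 0 s) - of_real t * D2 1 = (hy (pt t s) - hy z - D2 (Complex t s)) - (hy (pt 0 s) - hy z - D2 (Complex 0 s))"
          by simp
        then have "cmod (hy (pt t s) - hy (pt 0 s) - of_real t * D2 1)
          \<le> cmod (hy (pt t s) - hy z - D2 (Complex t s)) + cmod (hy (pt 0 s) - hy z - D2 (Complex 0 s))"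
          by (simp only: norm_triangle_ineq4)
        also have "\<dots> \<le> e * (t + s) + e * (0 + s)"
          using ey[of t s] ey[of 0 s] s t by (intro add_mono) auto
        also have "\<dots> \<le> e * (2 * t) + e * t" using s e by (intro add_mono mult_left_mono) auto
        finally show "cmod (hy (pt t s) - hy (pt 0 s) - of_real t * D2 1) \<le> 3 * e * t" by (simp add: algebra_simps)
      qed (use I e t in auto)
      then show ?thesis using t by (simp add: \<Delta>_def algebra_simps)
    qed
    have eqd: "of_real (t * t) * (D1 \<i> - D2 1) = (\<Delta> - of_real (t * t) * D2 1) - (\<Delta> - of_real (t * t) * D1 \<i>)"
      by (simp add: algebra_simps)
    have "cmod (of_real (t * t) * (D1 \<i> - D2 1)) \<le> 3 * e * t * t + 3 * e * t * t"
      unfolding eqd using A B norm_triangle_ineq4[of "\<Delta> - of_real (t * t) * D2 1" "\<Delta> - of_real (t * t) * D1 \<i>"] by linarith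
    moreover have "cmod (of_real (t * t) * (D1 \<i> - D2 1)) = (t * t) * cmod (D1 \<i> - D2 1)"
      unfolding norm_mult norm_of_real using t by simp
    ultimately have "(t * t) * cmod (D1 \<i> - D2 1) \<le> (t * t) * (6 * e)" by (simp add: mult_ac)
    then show ?thesis using t by simp
  qed
  have "cmod (D1 \<i> - D2 1) \<le> 0"
  proof (rule field_le_epsilon)
    fix e :: real assume "0 < e"
    then show "cmod (D1 \<i> - D2 1) \<le> 0 + e" using bound[of "e / 6"] by simp
  qed
  then show ?thesis by simp
qed

lemma C1_on_has_derivative:
  assumes "C1_on S h" "open S" "z \<in> S"
  shows "(h has_derivative (\<lambda>w. of_real (Re w) * partial_x h z + of_real (Im w) * partial_y h z)) (at z)"
proof -
  have "h differentiable (at z)"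
    using assms unfolding C1_on_def differentiable_on_def by (metis at_within_open)
  then have D: "(h has_derivative frechet_derivative h (at z)) (at z)"
    by (simp add: frechet_derivative_works)
  interpret bounded_linear "frechet_derivative h (at z)" using D by (rule has_derivative_bounded_linear)
  have "frechet_derivative h (at z) w = of_real (Re w) * partial_x h z + of_real (Im w) * partial_y h z" for w
  proof -
    have "w = Re w *\<^sub>R 1 + Im w *\<^sub>R \<i>" by (simp add: complex_eq_iff)
    then have "frechet_derivative h (at z) w = frechet_derivative h (at z) (Re w *\<^sub>R 1 + Im w *\<^sub>R \<i>)" by simp
    then show ?thesis unfolding add scaleR partial_x_def partial_y_def by (simp add: scaleR_conv_of_real)
  qed
  then have "frechet_derivative h (at z) = (\<lambda>w. of_real (Re w) * partial_x h z + of_real (Im w) * partial_y h z)" by auto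
  then show ?thesis using D by simp
qed

lemma harmonic_pair_partials:
  assumes "harmonic_pair S u p q" "z \<in> S"
  shows "partial_x u z = p z + cnj (q z)" "partial_y u z = \<i> * p z + cnj (\<i> * q z)"
    "wirtinger_z u z = p z" "wirtinger_zbar u z = cnj (q z)"
proof -
  have "frechet_derivative u (at z) = (\<lambda>w. p z * w + cnj (q z * w))"
    using assms frechet_derivative_at unfolding harmonic_pair_def by metis
  then show x: "partial_x u z = p z + cnj (q z)" and y: "partial_y u z = \<i> * p z + cnj (\<i> * q z)"
    by (simp_all add: partial_x_def partial_y_def mult.commute)
  show "wirtinger_z u z = p z" "wirtinger_zbar u z = cnj (q z)"
    unfolding wirtinger_z_def wirtinger_zbar_def x y by (simp_all add: algebra_simps)
qed

lemma harmonic_pair_cong: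
  assumes "harmonic_pair S u p q" "open S" "\<And>z. z \<in> S \<Longrightarrow> u z = u' z" "\<And>z. z \<in> S \<Longrightarrow> p z = p' z" "\<And>z. z \<in> S \<Longrightarrow> q z = q' z"
  shows "harmonic_pair S u' p' q'"
  unfolding harmonic_pair_def
proof (intro conjI ballI)
  show "p' holomorphic_on S" "q' holomorphic_on S"
    using assms holomorphic_transform unfolding harmonic_pair_def by blast+
  fix z assume z: "z \<in> S"
  have "(u has_derivative (\<lambda>w. p z * w + cnj (q z * w))) (at z)"
    using assms(1) z unfolding harmonic_pair_def by blast
  then have "(u' has_derivative (\<lambda>w. p z * w + cnj (q z * w))) (at z)"
    by (rule has_derivative_transform_within_open[OF _ assms(2) z]) (use assms(3) in auto)
  then show "(u' has_derivative (\<lambda>w. p' z * w + cnj (q' z * w))) (at z)" using assms(4,5) z by simp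
qed

text \<open>The Cauchy-Riemann equations for h_x - i h_y, and for the conjugate of h_x + i h_y, are
  the Laplace equation together with equality of the mixed partials.\<close>

lemma harmonic_on_imp_pair:
  assumes S: "open S" and h: "harmonic_on S h"
  shows "harmonic_pair S h (wirtinger_z h) (\<lambda>z. cnj (wirtinger_zbar h z))"
proof -
  let ?A = "partial_x h" and ?B = "partial_y h"
  have C: "C1_on S h" "C1_on S ?A" "C1_on S ?B"
    and lap: "\<And>z. z \<in> S \<Longrightarrow> partial_x ?A z + partial_y ?B z = 0"
    using h by (auto simp: harmonic_on_def)
  have hol: "(wirtinger_z h has_field_derivative (partial_x ?A z - \<i> * partial_x ?B z) / 2) (at z)"
    "((\<lambda>z. cnj (wirtinger_zbar h z)) has_field_derivative cnj ((partial_x ?A z + \<i> * partial_x ?B z) / 2)) (at z)" if z: "z \<in> S" for z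
  proof -
    note dA = C1_on_has_derivative[OF C(2) S z] and dB = C1_on_has_derivative[OF C(3) S z]
    have mixed: "partial_y ?A z = partial_x ?B z"
      using mixed_partials_eq[OF S z C1_on_has_derivative[OF C(1) S] dA dB] by simp
    have By: "partial_y ?B z = - partial_x ?A z" using lap[OF z] by (simp add: add_eq_0_iff)
    have "((\<lambda>z. (?A z - \<i> * ?B z) / 2) has_derivative
        (\<lambda>w. ((of_real (Re w) * partial_x ?A z + of_real (Im w) * partial_y ?A z) - \<i> * (of_real (Re w) * partial_x ?B z + of_real (Im w) * partial_y ?B z)) / 2)) (at z)"
      by (intro bounded_linear.has_derivative[OF bounded_linear_divide] has_derivative_diff has_derivative_mult_right dA dB)
    moreover have "(\<lambda>w. ((of_real (Re w) * partial_x ?A z + of_real (Im w) * partial_y ?A z) - \<i> * (of_real (Re w) * partial_x ?B z + of_real (Im w) * partial_y ?B z)) / 2)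
       = (\<lambda>w. (partial_x ?A z - \<i> * partial_x ?B z) / 2 * w)"
    proof
      fix w
      have w: "w = of_real (Re w) + \<i> * of_real (Im w)" by (simp add: complex_eq_iff)
      show "((of_real (Re w) * partial_x ?A z + of_real (Im w) * partial_y ?A z) - \<i> * (of_real (Re w) * partial_x ?B z + of_real (Im w) * partial_y ?B z)) / 2
       = (partial_x ?A z - \<i> * partial_x ?B z) / 2 * w"
        unfolding mixed By by (subst (5) w) (simp add: algebra_simps add_divide_distrib diff_divide_distrib)
    qed
    ultimately show "(wirtinger_z h has_field_derivative (partial_x ?A z - \<i> * partial_x ?B z) / 2) (at z)"
      unfolding has_field_derivative_def wirtinger_z_def[abs_def] by (simp only:)
    have "((\<lambda>z. cnj ((?A z + \<i> * ?B z) / 2)) has_derivative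
        (\<lambda>w. cnj (((of_real (Re w) * partial_x ?A z + of_real (Im w) * partial_y ?A z) + \<i> * (of_real (Re w) * partial_x ?B z + of_real (Im w) * partial_y ?B z)) / 2))) (at z)"
      by (intro bounded_linear.has_derivative[OF bounded_linear_cnj] bounded_linear.has_derivative[OF bounded_linear_divide]
          has_derivative_add has_derivative_mult_right dA dB)
    moreover have "(\<lambda>w. cnj (((of_real (Re w) * partial_x ?A z + of_real (Im w) * partial_y ?A z) + \<i> * (of_real (Re w) * partial_x ?B z + of_real (Im w) * partial_y ?B z)) / 2))
       = (\<lambda>w. cnj ((partial_x ?A z + \<i> * partial_x ?B z) / 2) * w)"
    proof
      fix w
      have w: "w = cnj (of_real (Re w) - \<i> * of_real (Im w))" by (simp add: complex_eq_iff)
      have "((of_real (Re w) * partial_x ?A z + of_real (Im w) * partial_y ?A z) + \<i> * (of_real (Re w) * partial_x ?B z + of_real (Im w) * partial_y ?B z)) / 2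
        = (partial_x ?A z + \<i> * partial_x ?B z) / 2 * (of_real (Re w) - \<i> * of_real (Im w))"
        unfolding mixed By by (simp add: algebra_simps add_divide_distrib diff_divide_distrib)
      then have "cnj (((of_real (Re w) * partial_x ?A z + of_real (Im w) * partial_y ?A z) + \<i> * (of_real (Re w) * partial_x ?B z + of_real (Im w) * partial_y ?B z)) / 2)
         = cnj ((partial_x ?A z + \<i> * partial_x ?B z) / 2) * cnj (of_real (Re w) - \<i> * of_real (Im w))"
        by (simp only: complex_cnj_mult)
      then show "cnj (((of_real (Re w) * partial_x ?A z + of_real (Im w) * partial_y ?A z) + \<i> * (of_real (Re w) * partial_x ?B z + of_real (Im w) * partial_y ?B z)) / 2)
       = cnj ((partial_x ?A z + \<i> * partial_x ?B z) / 2) * w"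
        using w by simp
    qed
    ultimately show "((\<lambda>z. cnj (wirtinger_zbar h z)) has_field_derivative cnj ((partial_x ?A z + \<i> * partial_x ?B z) / 2)) (at z)"
      unfolding has_field_derivative_def wirtinger_zbar_def[abs_def] by (simp only:)
  qed
  show ?thesis unfolding harmonic_pair_def
  proof (intro conjI ballI)
    show "wirtinger_z h holomorphic_on S" "(\<lambda>z. cnj (wirtinger_zbar h z)) holomorphic_on S"
      using hol S unfolding holomorphic_on_open[OF S] by blast+
    fix z assume z: "z \<in> S"
    have "(\<lambda>w. of_real (Re w) * ?A z + of_real (Im w) * ?B z) = (\<lambda>w. wirtinger_z h z * w + cnj (cnj (wirtinger_zbar h z) * w))"
    proof
      fix w
      have w: "w = of_real (Re w) + \<i> * of_real (Im w)" and cw: "cnj w = of_real (Re w) - \<i> * of_real (Im w)"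
        by (simp_all add: complex_eq_iff)
      show "of_real (Re w) * ?A z + of_real (Im w) * ?B z = wirtinger_z h z * w + cnj (cnj (wirtinger_zbar h z) * w)"
        unfolding complex_cnj_mult complex_cnj_cnj cw wirtinger_z_def wirtinger_zbar_def
        by (subst (3) w) (simp add: field_simps)
    qed
    then show "(h has_derivative (\<lambda>w. wirtinger_z h z * w + cnj (cnj (wirtinger_zbar h z) * w))) (at z)"
      using C1_on_has_derivative[OF C(1) S z] by simp
  qed
qed

lemma harmonic_pair_of_holomorphic:
  assumes "open S" "P holomorphic_on S" "Q holomorphic_on S"
  shows "harmonic_pair S (\<lambda>z. P z + cnj (Q z)) (deriv P) (deriv Q)"
  unfolding harmonic_pair_def
proof (intro conjI ballI)
  show "deriv P holomorphic_on S" "deriv Q holomorphic_on S" using assms holomorphic_deriv by blast+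
  fix z assume z: "z \<in> S"
  have "(P has_derivative (\<lambda>w. deriv P z * w)) (at z)" "(Q has_derivative (\<lambda>w. deriv Q z * w)) (at z)"
    using holomorphic_derivI[OF assms(2,1) z] holomorphic_derivI[OF assms(3,1) z] by (auto simp: has_field_derivative_def)
  then show "((\<lambda>z. P z + cnj (Q z)) has_derivative (\<lambda>w. deriv P z * w + cnj (deriv Q z * w))) (at z)"
    by (intro has_derivative_add bounded_linear.has_derivative[OF bounded_linear_cnj])
qed

lemma harmonic_pair_imp_C1:
  assumes S: "open S" and h: "harmonic_pair S u p q"
  shows "C1_on S u"
  unfolding C1_on_def
proof (intro conjI)
  show "u differentiable_on S"
    unfolding differentiable_on_def
    using h unfolding harmonic_pair_def by (meson differentiable_at_withinI differentiableI)
  have c: "continuous_on S p" "continuous_on S q"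
    using h holomorphic_on_imp_continuous_on unfolding harmonic_pair_def by blast+
  show "continuous_on S (partial_x u)"
    by (subst continuous_on_cong[OF refl harmonic_pair_partials(1)[OF h]]) (auto intro!: continuous_intros c)
  show "continuous_on S (partial_y u)"
    by (subst continuous_on_cong[OF refl harmonic_pair_partials(2)[OF h]]) (auto intro!: continuous_intros c)
qed

lemma harmonic_pair_imp_harmonic_on:
  assumes S: "open S" and h: "harmonic_pair S u p q"
  shows "harmonic_on S u"
proof -
  have pq: "p holomorphic_on S" "q holomorphic_on S" using h by (auto simp: harmonic_pair_def)
  have hx: "harmonic_pair S (partial_x u) (deriv p) (deriv q)"
    by (rule harmonic_pair_cong[OF harmonic_pair_of_holomorphic[OF S pq] S])
       (simp_all add: harmonic_pair_partials(1)[OF h])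
  have "harmonic_pair S (\<lambda>z. \<i> * p z + cnj (\<i> * q z)) (deriv (\<lambda>z. \<i> * p z)) (deriv (\<lambda>z. \<i> * q z))"
    by (rule harmonic_pair_of_holomorphic[OF S]) (intro holomorphic_intros pq)+
  then have hy: "harmonic_pair S (partial_y u) (\<lambda>z. \<i> * deriv p z) (\<lambda>z. \<i> * deriv q z)"
  proof (rule harmonic_pair_cong[OF _ S])
    show "\<i> * p z + cnj (\<i> * q z) = partial_y u z" if "z \<in> S" for z
      using harmonic_pair_partials(2)[OF h that] by simp
    fix z assume z: "z \<in> S"
    have "p field_differentiable at z" "q field_differentiable at z"
      using pq z S by (auto simp: holomorphic_on_imp_differentiable_at)
    then show "deriv (\<lambda>z. \<i> * p z) z = \<i> * deriv p z" "deriv (\<lambda>z. \<i> * q z) z = \<i> * deriv q z"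
      by (simp_all add: deriv_cmult)
  qed
  show ?thesis unfolding harmonic_on_def
  proof (intro conjI ballI)
    fix z assume z: "z \<in> S"
    show "partial_x (partial_x u) z + partial_y (partial_y u) z = 0"
      unfolding harmonic_pair_partials(1)[OF hx z] harmonic_pair_partials(2)[OF hy z]
      by (simp flip: mult.assoc)
  qed (use harmonic_pair_imp_C1[OF S] h hx hy in auto)
qed

lemma harmonic_pair_compose:
  assumes h: "harmonic_pair S u p q" and T: "open T" "\<phi> holomorphic_on T" "\<phi> ` T \<subseteq> S"
  shows "harmonic_pair T (\<lambda>z. u (\<phi> z)) (\<lambda>z. p (\<phi> z) * deriv \<phi> z) (\<lambda>z. q (\<phi> z) * deriv \<phi> z)"
  unfolding harmonic_pair_def
proof (intro conjI ballI)
  have pq: "p holomorphic_on S" "q holomorphic_on S" using h by (auto simp: harmonic_pair_def)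
  show "(\<lambda>z. p (\<phi> z) * deriv \<phi> z) holomorphic_on T" "(\<lambda>z. q (\<phi> z) * deriv \<phi> z) holomorphic_on T"
    using T holomorphic_on_compose_gen[OF T(2) pq(1) T(3)] holomorphic_on_compose_gen[OF T(2) pq(2) T(3)]
    by (auto intro!: holomorphic_intros holomorphic_deriv simp: o_def)
  fix z assume z: "z \<in> T"
  have "(\<phi> has_derivative (\<lambda>w. deriv \<phi> z * w)) (at z)"
    using holomorphic_derivI[OF T(2,1) z] by (simp add: has_field_derivative_def)
  moreover have "(u has_derivative (\<lambda>w. p (\<phi> z) * w + cnj (q (\<phi> z) * w))) (at (\<phi> z))"
    using h z T(3) unfolding harmonic_pair_def by blast
  ultimately have "((\<lambda>z. u (\<phi> z)) has_derivative (\<lambda>w. p (\<phi> z) * (deriv \<phi> z * w) + cnj (q (\<phi> z) * (deriv \<phi> z * w)))) (at z)"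
    by (rule has_derivative_compose)
  then show "((\<lambda>z. u (\<phi> z)) has_derivative (\<lambda>w. p (\<phi> z) * deriv \<phi> z * w + cnj (q (\<phi> z) * deriv \<phi> z * w))) (at z)"
    by (simp add: mult.assoc)
qed

text \<open>The coefficients of a pair are determined by u as its Wirtinger derivatives, so local
  pairs automatically agree and patch together. This is needed where a domain is covered by two
  charts.\<close>

lemma harmonic_pair_local:
  assumes "\<And>z. z \<in> S \<Longrightarrow> \<exists>T p q. open T \<and> z \<in> T \<and> harmonic_pair T u p q"
  shows "harmonic_pair S u (wirtinger_z u) (\<lambda>z. cnj (wirtinger_zbar u z))"
proof -
  have loc: "\<exists>T. open T \<and> z \<in> T \<and> harmonic_pair T u (wirtinger_z u) (\<lambda>z. cnj (wirtinger_zbar u z))" if zS: "z \<in> S" for z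
  proof -
    obtain T p q where T: "open T" "z \<in> T" "harmonic_pair T u p q" using assms[OF zS] by blast
    have "harmonic_pair T u (wirtinger_z u) (\<lambda>z. cnj (wirtinger_zbar u z))"
      by (rule harmonic_pair_cong[OF T(3,1)]) (simp_all add: harmonic_pair_partials[OF T(3)])
    then show ?thesis using T by blast
  qed
  have fd: "wirtinger_z u field_differentiable at z" "(\<lambda>z. cnj (wirtinger_zbar u z)) field_differentiable at z" if z: "z \<in> S" for z
  proof -
    obtain T where T: "open T" "z \<in> T" "harmonic_pair T u (wirtinger_z u) (\<lambda>z. cnj (wirtinger_zbar u z))"
      using loc[OF z] by blast
    then have "wirtinger_z u holomorphic_on T" "(\<lambda>z. cnj (wirtinger_zbar u z)) holomorphic_on T"
      by (auto simp: harmonic_pair_def)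
    then show "wirtinger_z u field_differentiable at z" "(\<lambda>z. cnj (wirtinger_zbar u z)) field_differentiable at z"
      using T(1,2) holomorphic_on_imp_differentiable_at by blast+
  qed
  show ?thesis unfolding harmonic_pair_def
  proof (intro conjI ballI)
    show "wirtinger_z u holomorphic_on S" "(\<lambda>z. cnj (wirtinger_zbar u z)) holomorphic_on S"
      unfolding holomorphic_on_def using fd field_differentiable_at_within by blast+
    show "(u has_derivative (\<lambda>w. wirtinger_z u z * w + cnj (cnj (wirtinger_zbar u z) * w))) (at z)" if "z \<in> S" for z
      using loc[OF that] unfolding harmonic_pair_def by blast
  qed
qed

subsection \<open>Moebius charts of the sphere\<close>

text \<open>The coordinate in which \<open>p\<^sub>0\<close> lies at infinity: the identity if it is
  infinity already, 1/(z - c) otherwise. The value at \<open>p\<^sub>0\<close> itself is a mere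
  default.\<close>

definition sphere_chart :: "complex option \<Rightarrow> complex option \<Rightarrow> complex" where
  "sphere_chart p\<^sub>0 p = (case p\<^sub>0 of None \<Rightarrow> the p
     | Some c \<Rightarrow> (case p of None \<Rightarrow> 0 | Some z \<Rightarrow> 1 / (z - c)))"

definition sphere_param :: "complex option \<Rightarrow> complex \<Rightarrow> complex option" where
  "sphere_param p\<^sub>0 w = (case p\<^sub>0 of None \<Rightarrow> Some w
     | Some c \<Rightarrow> (if w = 0 then None else Some (c + 1 / w)))"

lemma sphere_param_neq: "sphere_param p0 w \<noteq> p0"
  by (auto simp: sphere_param_def split: option.splits)

lemma sphere_chart_param [simp]: "sphere_chart p0 (sphere_param p0 w) = w"
  by (auto simp: sphere_chart_def sphere_param_def split: option.splits)

lemma sphere_param_chart: "p \<noteq> p0 \<Longrightarrow> sphere_param p0 (sphere_chart p0 p) = p"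
  by (auto simp: sphere_chart_def sphere_param_def split: option.splits)

lemma sphere_chart_inj: "inj_on (sphere_chart p0) (- {p0})"
  by (rule inj_on_inverseI[of _ "sphere_param p0"]) (simp add: sphere_param_chart)

lemma topspace_sphere [simp]: "topspace riemann_sphere = UNIV"
  by (auto simp: UNIV_option_conv)

lemma Hausdorff_sphere: "Hausdorff_space riemann_sphere"
  by (simp add: Hausdorff_space_Alexandroff_compactification locally_compact_space_euclidean)

lemma openin_sphere_iff:
  "openin riemann_sphere U \<longleftrightarrow> open {z. Some z \<in> U} \<and> (None \<in> U \<longrightarrow> bounded {z. Some z \<notin> U})"
proof
  assume "openin riemann_sphere U"
  then consider V where "open V" "U = Some ` V" | C where "compact C" "U = insert None (Some ` (- C))"
    by (auto simp: openin_Alexandroff_compactification Compl_eq_Diff_UNIV)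
  then show "open {z. Some z \<in> U} \<and> (None \<in> U \<longrightarrow> bounded {z. Some z \<notin> U})"
  proof cases
    case 1
    then have "{z. Some z \<in> U} = V" by auto
    then show ?thesis using 1 by auto
  next
    case 2
    then have "{z. Some z \<in> U} = - C" "{z. Some z \<notin> U} = C" by auto
    then show ?thesis using 2 by (simp add: compact_imp_bounded compact_imp_closed open_Compl)
  qed
next
  assume U: "open {z. Some z \<in> U} \<and> (None \<in> U \<longrightarrow> bounded {z. Some z \<notin> U})"
  show "openin riemann_sphere U"
  proof (cases "None \<in> U")
    case False
    have "x \<in> U \<longleftrightarrow> x \<in> Some ` {z. Some z \<in> U}" for x by (cases x) (use False in auto)
    then have "U = Some ` {z. Some z \<in> U}" by blast
    moreover have "openin euclidean {z. Some z \<in> U}" using U by simp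
    ultimately show ?thesis unfolding openin_Alexandroff_compactification by blast
  next
    case True
    have "{z. Some z \<notin> U} = - {z. Some z \<in> U}" by auto
    then have cl: "closed {z. Some z \<notin> U}" using U by (simp add: closed_Compl)
    then have "compact {z. Some z \<notin> U}" using U True by (simp add: compact_eq_bounded_closed)
    moreover have "x \<in> U \<longleftrightarrow> x \<in> insert None (Some ` (UNIV - {z. Some z \<notin> U}))" for x
      by (cases x) (use True in auto)
    then have "U = insert None (Some ` (topspace euclidean - {z. Some z \<notin> U}))"
      unfolding topspace_euclidean by (rule set_eqI)
    ultimately have "compactin euclidean {z. Some z \<notin> U} \<and> closedin euclidean {z. Some z \<notin> U} \<and>
        U = insert None (Some ` (topspace euclidean - {z. Some z \<notin> U}))" using cl by simp
    then show ?thesis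
      unfolding openin_Alexandroff_compactification by blast
  qed
qed

lemma continuous_sphere_param: "continuous_map euclidean riemann_sphere (sphere_param p0)"
  unfolding continuous_map_def
proof (intro conjI allI impI)
  fix U assume U: "openin riemann_sphere U"
  show "openin euclidean {w \<in> topspace euclidean. sphere_param p0 w \<in> U}"
  proof (cases p0)
    case None
    then show ?thesis using U by (simp add: sphere_param_def openin_sphere_iff)
  next
    case (Some c)
    let ?V = "{z. Some z \<in> U}"
    have oV: "open ?V" using U by (simp add: openin_sphere_iff)
    have "open (- {0} \<inter> (\<lambda>w. c + 1 / w) -` ?V)"
      by (rule continuous_open_preimage) (use oV in \<open>auto intro!: continuous_intros\<close>)
    moreover have "- {0} \<inter> (\<lambda>w. c + 1 / w) -` ?V = {w. w \<noteq> 0 \<and> Some (c + 1 / w) \<in> U}" by auto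
    ultimately have o1: "open {w. w \<noteq> 0 \<and> Some (c + 1 / w) \<in> U}" by simp
    have eq: "{w. sphere_param p0 w \<in> U} = {w. w \<noteq> 0 \<and> Some (c + 1 / w) \<in> U} \<union> (if None \<in> U then {0} else {})"
      by (auto simp: sphere_param_def Some split: if_splits)
    have "open {w. sphere_param p0 w \<in> U}"
    proof (cases "None \<in> U")
      case False
      then show ?thesis using eq o1 by simp
    next
      case True
      then obtain B where B: "\<And>z. Some z \<notin> U \<Longrightarrow> cmod z \<le> B" "B > 0"
        using U by (auto simp: openin_sphere_iff bounded_pos)
      have "ball 0 (1 / (B + cmod c)) \<subseteq> {w. sphere_param p0 w \<in> U}"
      proof
        fix w :: complex assume w: "w \<in> ball 0 (1 / (B + cmod c))"
        show "w \<in> {w. sphere_param p0 w \<in> U}"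
        proof (cases "w = 0")
          case False
          have pos: "0 < B + cmod c" using B by (simp add: add_pos_nonneg)
          have "cmod w < 1 / (B + cmod c)" using w by simp
          then have "(B + cmod c) * cmod w < 1" using pos by (simp add: field_simps)
          then have "B + cmod c < 1 / cmod w" using False by (simp add: field_simps)
          also have "\<dots> = cmod ((c + 1 / w) - c)" by (simp add: norm_divide)
          also have "\<dots> \<le> cmod (c + 1 / w) + cmod c" by (rule norm_triangle_ineq4)
          finally have "B < cmod (c + 1 / w)" by simp
          then have "Some (c + 1 / w) \<in> U" using B(1) by (meson not_le)
          then show ?thesis using False by (simp add: sphere_param_def Some)
        qed (use True in \<open>simp add: sphere_param_def Some\<close>)
      qed
      then have "{w. sphere_param p0 w \<in> U} = {w. w \<noteq> 0 \<and> Some (c + 1 / w) \<in> U} \<union> ball 0 (1 / (B + cmod c))"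
        using eq True B by (auto simp: add_pos_nonneg)
      then show ?thesis using o1 by (simp add: open_Un)
    qed
    then show ?thesis by simp
  qed
qed (auto simp del: topspace_Alexandroff_compactification)

lemma open_sphere_param_image:
  assumes V: "open V"
  shows "openin riemann_sphere (sphere_param p0 ` V)"
proof (cases p0)
  case None
  then show ?thesis using V by (simp add: sphere_param_def openin_Alexandroff_compactification) blast
next
  case (Some c)
  have ne: "{z. Some z \<in> sphere_param p0 ` V} = {z \<in> - {c}. 1 / (z - c) \<in> V}"
  proof (intro equalityI subsetI)
    fix z assume "z \<in> {z. Some z \<in> sphere_param p0 ` V}"
    then obtain w where "w \<in> V" "Some z = sphere_param p0 w" by auto
    then show "z \<in> {z \<in> - {c}. 1 / (z - c) \<in> V}" by (auto simp: sphere_param_def Some split: if_splits)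
  next
    fix z assume "z \<in> {z \<in> - {c}. 1 / (z - c) \<in> V}"
    then show "z \<in> {z. Some z \<in> sphere_param p0 ` V}"
      by (auto simp: sphere_param_def Some image_iff intro!: bexI[of _ "1 / (z - c)"])
  qed
  have "open (- {c} \<inter> (\<lambda>z. 1 / (z - c)) -` V)"
    by (rule continuous_open_preimage) (use V in \<open>auto intro!: continuous_intros\<close>)
  moreover have "- {c} \<inter> (\<lambda>z. 1 / (z - c)) -` V = {z \<in> - {c}. 1 / (z - c) \<in> V}" by auto
  ultimately have "open {z \<in> - {c}. 1 / (z - c) \<in> V}" by simp
  moreover have "bounded {z. Some z \<notin> sphere_param p0 ` V}" if N: "None \<in> sphere_param p0 ` V"
  proof -
    have "0 \<in> V" using N by (auto simp: sphere_param_def Some split: if_splits)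
    then obtain e where e: "e > 0" "ball 0 e \<subseteq> V" using V open_contains_ball by blast
    have "cmod z \<le> cmod c + 1 / e" if z: "Some z \<notin> sphere_param p0 ` V" for z
    proof (cases "z = c")
      case False
      then have "1 / (z - c) \<notin> V" using z ne by auto
      then have "1 / (z - c) \<notin> ball 0 e" using e(2) by blast
      then have "e \<le> 1 / cmod (z - c)" by (simp add: norm_divide)
      then have "cmod (z - c) \<le> 1 / e" using e(1) False by (simp add: field_simps)
      then show ?thesis using norm_triangle_ineq[of c "z - c"] by simp
    qed (use e in simp)
    then show ?thesis by (intro boundedI) auto
  qed
  ultimately show ?thesis unfolding openin_sphere_iff ne by blast
qed

lemma continuous_sphere_chart: "continuous_map (subtopology riemann_sphere (- {p0})) euclidean (sphere_chart p0)"
  unfolding continuous_map_def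
proof (intro conjI allI impI)
  fix V :: "complex set" assume "openin euclidean V"
  then have V: "open V" by simp
  have "{p \<in> topspace (subtopology riemann_sphere (- {p0})). sphere_chart p0 p \<in> V} = sphere_param p0 ` V"
  proof (intro equalityI subsetI)
    fix p assume "p \<in> {p \<in> topspace (subtopology riemann_sphere (- {p0})). sphere_chart p0 p \<in> V}"
    then show "p \<in> sphere_param p0 ` V" using sphere_param_chart[of p p0] by (auto intro!: image_eqI[of _ _ "sphere_chart p0 p"])
  qed (auto simp: sphere_param_neq simp del: topspace_Alexandroff_compactification)
  then show "openin (subtopology riemann_sphere (- {p0})) {p \<in> topspace (subtopology riemann_sphere (- {p0})). sphere_chart p0 p \<in> V}"
    using open_sphere_param_image[OF V, of p0] sphere_param_neq[of p0]
    by (auto simp: openin_subtopology intro!: exI[of _ "sphere_param p0 ` V"] simp del: topspace_Alexandroff_compactification)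
qed (auto simp del: topspace_Alexandroff_compactification)

lemma sphere_chart_image_compact:
  assumes "closedin riemann_sphere K" "p0 \<notin> K"
  shows "compact (sphere_chart p0 ` K)"
proof -
  have "compactin riemann_sphere K" using assms(1) by (simp add: closedin_compact_space)
  then have "compactin (subtopology riemann_sphere (- {p0})) K"
    using assms(2) by (auto simp: compactin_subtopology)
  then have "compactin euclidean (sphere_chart p0 ` K)"
    using continuous_sphere_chart image_compactin by blast
  then show ?thesis by simp
qed

text \<open>A point with a whole neighbourhood off the domain makes the domain bounded once that
  point is sent to infinity. To find one, a point p1 of the domain is sent to infinity first: the
  complement of the resulting plane Jordan curve has a bounded component, and this cannot meet the
  connected set \<Omega>, which contains p1.\<close>

lemma jordan_domain_complement_point:
  assumes jd: "jordan_domain \<Gamma> \<Omega>"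
  obtains p0 U and g :: "complex \<Rightarrow> complex option" where "p0 \<notin> \<Gamma>" "openin riemann_sphere U" "p0 \<in> U" "U \<inter> \<Omega> = {}"
    "continuous_map (top_of_set (sphere 0 1)) riemann_sphere g" "inj_on g (sphere 0 1)" "\<Gamma> = g ` sphere 0 1"
    "closedin riemann_sphere \<Gamma>"
proof -
  obtain g where g: "embedding_map (top_of_set (sphere (0::complex) 1)) riemann_sphere g" "\<Gamma> = g ` sphere 0 1"
    using jd unfolding jordan_domain_def jordan_curve_def by blast
  have cg: "continuous_map (top_of_set (sphere 0 1)) riemann_sphere g"
    using g(1) unfolding embedding_map_def
    by (metis homeomorphic_imp_continuous_map continuous_map_in_subtopology)
  have ig: "inj_on g (sphere 0 1)"
    using g(1) homeomorphic_imp_injective_map unfolding embedding_map_def by fastforce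
  have "compactin riemann_sphere \<Gamma>" unfolding g(2)
    by (rule image_compactin[OF _ cg]) simp
  then have cl: "closedin riemann_sphere \<Gamma>"
    using Hausdorff_sphere compactin_imp_closedin by blast
  have \<Omega>: "\<Omega> \<in> connected_components_of (subtopology riemann_sphere (- \<Gamma>))"
    using jd by (simp add: jordan_domain_def)
  have "connectedin (subtopology riemann_sphere (- \<Gamma>)) \<Omega>" using \<Omega> by (rule connectedin_connected_components_of)
  then have conn: "connectedin riemann_sphere \<Omega>" and sub: "\<Omega> \<subseteq> - \<Gamma>" by (auto simp: connectedin_subtopology)
  obtain p1 where p1: "p1 \<in> \<Omega>" using \<Omega> nonempty_connected_components_of by fastforce
  have p1\<Gamma>: "p1 \<notin> \<Gamma>" using p1 sub by auto
  define J1 where "J1 = sphere_chart p1 ` \<Gamma>"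
  have cJ1: "compact J1" unfolding J1_def by (rule sphere_chart_image_compact[OF cl p1\<Gamma>])
  have "continuous_map (top_of_set (sphere 0 1)) (subtopology riemann_sphere (- {p1})) g"
    using cg p1\<Gamma> g(2) by (auto simp: continuous_map_in_subtopology)
  then have "continuous_map (top_of_set (sphere 0 1)) euclidean (sphere_chart p1 \<circ> g)"
    using continuous_sphere_chart continuous_map_compose by blast
  then have c1: "continuous_on (sphere 0 1) (sphere_chart p1 \<circ> g)" by simp
  have i1: "inj_on (sphere_chart p1 \<circ> g) (sphere 0 1)"
    by (rule comp_inj_on[OF ig]) (rule inj_on_subset[OF sphere_chart_inj], use p1\<Gamma> g(2) in auto)
  have "(sphere (0::complex) 1) homeomorphic J1"
    by (rule homeomorphic_compact[OF _ c1 _ i1]) (auto simp: J1_def g(2) image_comp)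
  then have "J1 homeomorphic (sphere (0::complex) 1)" by (rule homeomorphic_sym[THEN iffD1])
  then have nconn: "\<not> connected (- J1)"
    by (rule Jordan_Brouwer_separation) simp
  \<comment> \<open>The complement of a bounded set in the plane has at most one unbounded
    component; without bounded ones it would be connected, against the separation theorem.\<close>
  have "\<exists>B\<in>components (- J1). bounded B"
  proof (rule ccontr)
    assume "\<not> ?thesis"
    then have unb: "\<And>C. C \<in> components (- J1) \<Longrightarrow> \<not> bounded C" by blast
    have bJ: "bounded (- (- J1))" using cJ1 compact_imp_bounded by simp
    have same: "C = D" if "C \<in> components (- J1)" "D \<in> components (- J1)" for C D
      by (rule cobounded_unique_unbounded_components[OF bJ that(2) unb[OF that(2)] that(1) unb[OF that(1)]]) simp
    have "connected (- J1)"
      unfolding connected_iff_connected_component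
    proof (intro ballI)
      fix x y assume xy: "x \<in> - J1" "y \<in> - J1"
      have "connected_component_set (- J1) x = connected_component_set (- J1) y"
        by (rule same) (use xy in \<open>auto simp: components_def\<close>)
      then show "connected_component (- J1) x y" using xy connected_component_refl by fastforce
    qed
    then show False using nconn by simp
  qed
  then obtain B where B: "B \<in> components (- J1)" "bounded B" by blast
  have oB: "open B" using B(1) cJ1 by (meson compact_imp_closed open_Compl open_components)
  have "B \<noteq> {}" using B(1) in_components_nonempty by blast
  then obtain b where b: "b \<in> B" by blast
  have BJ: "B \<inter> J1 = {}" using in_components_subset[OF B(1)] by auto
  have frB: "closure B \<subseteq> B \<union> J1"
  proof -
    have "frontier B \<subseteq> frontier (- J1)" using B(1) by (rule frontier_of_components_subset)
    also have "\<dots> \<subseteq> J1" using cJ1 by (simp add: frontier_complement compact_imp_closed frontier_subset_closed)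
    finally show ?thesis using closure_Un_frontier[of B] by auto
  qed
  have "closed (B \<union> J1)"
  proof -
    have "closure (B \<union> J1) \<subseteq> B \<union> J1" using frB cJ1 by (simp add: closure_Un compact_imp_closed closure_closed)
    then show ?thesis using closure_subset_eq by blast
  qed
  then have BJc: "compact (B \<union> J1)" using B(2) cJ1 by (simp add: compact_eq_bounded_closed)
  define U where "U = sphere_param p1 ` B"
  define U' where "U' = - (sphere_param p1 ` (B \<union> J1))"
  have oU: "openin riemann_sphere U" unfolding U_def by (rule open_sphere_param_image[OF oB])
  have "compactin riemann_sphere (sphere_param p1 ` (B \<union> J1))"
    by (rule image_compactin[OF _ continuous_sphere_param]) (use BJc in simp)
  then have "closedin riemann_sphere (sphere_param p1 ` (B \<union> J1))"
    using Hausdorff_sphere compactin_imp_closedin by blast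
  then have oU': "openin riemann_sphere U'" unfolding U'_def
    by (simp add: closedin_def Compl_eq_Diff_UNIV del: topspace_Alexandroff_compactification)
  have J1\<Gamma>: "sphere_param p1 ` J1 = \<Gamma>"
  proof -
    have "sphere_param p1 (sphere_chart p1 x) = x" if "x \<in> \<Gamma>" for x
      using that p1\<Gamma> by (metis sphere_param_chart)
    then show ?thesis by (simp add: J1_def image_image cong: image_cong)
  qed
  have cover: "\<Omega> \<subseteq> U \<union> U'"
    using sub J1\<Gamma> by (auto simp: U_def U'_def image_Un)
  have p1U': "p1 \<in> U'" unfolding U'_def using sphere_param_neq[of p1] by (metis ComplI imageE)
  have f1: "U \<inter> \<Omega> = {}"
  proof (rule ccontr)
    assume ne: "U \<inter> \<Omega> \<noteq> {}"
    have "U \<inter> U' = {}" by (auto simp: U_def U'_def)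
    then have "U \<inter> U' \<inter> \<Omega> = {}" "U' \<inter> \<Omega> \<noteq> {}" using p1 p1U' by auto
    then show False
      using conn oU oU' cover ne unfolding connectedin by blast
  qed
  have f2: "sphere_param p1 b \<in> U" using b by (simp add: U_def)
  have f3: "sphere_param p1 b \<notin> \<Gamma>"
  proof
    assume "sphere_param p1 b \<in> \<Gamma>"
    then obtain j where "j \<in> J1" "sphere_param p1 b = sphere_param p1 j" using J1\<Gamma> by blast
    then have "b = j" by (metis sphere_chart_param)
    then show False using b BJ \<open>j \<in> J1\<close> by auto
  qed
  show ?thesis by (rule that[OF f3 oU f2 f1 cg ig g(2) cl])
qed

subsection \<open>Disc biholomorphisms onto Jordan domains\<close>

lemma openin_sphere_delete: "openin riemann_sphere (- {p})"
proof (cases p)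
  case (Some a)
  have "{z. z \<noteq> a} = - {a}" by auto
  then show ?thesis using Some by (simp add: openin_sphere_iff open_Compl)
qed (simp add: openin_sphere_iff)

lemma open_preimage_delete:
  assumes "holomorphic_to_sphere f (ball 0 1)"
  shows "open {z \<in> ball 0 1. f z \<noteq> p}"
proof -
  have "openin (top_of_set (ball 0 1)) {z \<in> topspace (top_of_set (ball 0 1)). f z \<in> - {p}}"
    using assms openin_sphere_delete openin_continuous_map_preimage unfolding holomorphic_to_sphere_def by blast
  then show ?thesis by (simp add: openin_open_eq)
qed

text \<open>Holomorphy is checked on two open parts of the disc. Away from infinity the chart is
  1/(z - c); away from 0 it equals w/(1 - c w) with w = 1/z, which is regular at infinity.\<close>

lemma sphere_chart_holomorphic:
  assumes bi: "disk_biholomorphism f \<Omega>" and p0: "p0 \<notin> \<Omega>"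
  shows "(sphere_chart p0 \<circ> f) holomorphic_on ball 0 1" "inj_on (sphere_chart p0 \<circ> f) (ball 0 1)"
proof -
  have bij: "bij_betw f (ball 0 1) \<Omega>" and hs: "holomorphic_to_sphere f (ball 0 1)"
    using bi unfolding disk_biholomorphism_def by blast+
  have h1: "(the \<circ> f) holomorphic_on {z \<in> ball 0 1. f z \<noteq> None}"
    and h2: "(coord_inf \<circ> f) holomorphic_on {z \<in> ball 0 1. f z \<noteq> Some 0}"
    using hs unfolding holomorphic_to_sphere_def by blast+
  have f\<Omega>: "f z \<in> \<Omega>" if "z \<in> ball 0 1" for z using bij that by (auto simp: bij_betw_def)
  show "inj_on (sphere_chart p0 \<circ> f) (ball 0 1)"
    using bij p0 f\<Omega> by (intro comp_inj_on inj_on_subset[OF sphere_chart_inj]) (auto simp: bij_betw_def)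
  show "(sphere_chart p0 \<circ> f) holomorphic_on ball 0 1"
  proof (cases p0)
    case None
    have "f z \<noteq> None" if "z \<in> ball 0 1" for z using f\<Omega>[OF that] p0 None by metis
    then have "{z \<in> ball 0 1. f z \<noteq> None} = ball 0 1" by blast
    then have "(the \<circ> f) holomorphic_on ball 0 1" using h1 by simp
    then show ?thesis unfolding None sphere_chart_def option.case by (simp add: o_def)
  next
    case (Some c)
    have fc: "f z \<noteq> Some c" if "z \<in> ball 0 1" for z using f\<Omega>[OF that] p0 Some by auto
    have A: "(sphere_chart p0 \<circ> f) holomorphic_on {z \<in> ball 0 1. f z \<noteq> None}"
    proof (rule holomorphic_transform)
      show "(\<lambda>z. 1 / (the (f z) - c)) holomorphic_on {z \<in> ball 0 1. f z \<noteq> None}"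
        by (intro holomorphic_intros h1[unfolded o_def]) (use fc in auto)
    qed (auto simp: sphere_chart_def Some)
    have B: "(sphere_chart p0 \<circ> f) holomorphic_on {z \<in> ball 0 1. f z \<noteq> Some 0}"
    proof (rule holomorphic_transform)
      have nz: "1 - c * (coord_inf \<circ> f) z \<noteq> 0" if z: "z \<in> {z \<in> ball 0 1. f z \<noteq> Some 0}" for z
      proof (cases "f z")
        case (Some w)
        then show ?thesis using fc[of z] z by (auto simp: coord_inf_def field_simps)
      qed (simp add: coord_inf_def)
      then show "(\<lambda>z. (coord_inf \<circ> f) z / (1 - c * (coord_inf \<circ> f) z)) holomorphic_on {z \<in> ball 0 1. f z \<noteq> Some 0}"
        by (intro holomorphic_intros h2)
      fix z assume z: "z \<in> {z \<in> ball 0 1. f z \<noteq> Some 0}"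
      show "(coord_inf \<circ> f) z / (1 - c * (coord_inf \<circ> f) z) = (sphere_chart p0 \<circ> f) z"
      proof (cases "f z")
        case (Some w)
        then have w: "w \<noteq> 0" "w \<noteq> c" using z fc[of z] by auto
        have "1 / w / (1 - c * (1 / w)) = 1 / (w * (1 - c * (1 / w)))" by simp
        also have "w * (1 - c * (1 / w)) = w - c" using w by (simp add: field_simps)
        finally show ?thesis using Some \<open>p0 = Some c\<close> by (simp add: coord_inf_def sphere_chart_def)
      qed (simp add: coord_inf_def sphere_chart_def \<open>p0 = Some c\<close>)
    qed
    have eq: "{z \<in> ball 0 1. f z \<noteq> None} \<union> {z \<in> ball 0 1. f z \<noteq> Some 0} = ball 0 1" by auto
    show ?thesis
      using holomorphic_on_Un[OF A B open_preimage_delete[OF hs] open_preimage_delete[OF hs]] unfolding eq .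
  qed
qed

text \<open>Places the conformal map in the plane with bounded image, where area is finite and the
  planar theorems on Jordan curves apply.\<close>

lemma jordan_domain_chart:
  assumes jd: "jordan_domain \<Gamma> \<Omega>" and bi: "disk_biholomorphism f \<Omega>"
  obtains p0 g where "p0 \<notin> \<Omega>" "p0 \<notin> \<Gamma>"
    "jordan_conformal (sphere_chart p0 \<circ> f) (sphere_chart p0 ` \<Gamma>) g"
proof -
  obtain p0 U and g :: "complex \<Rightarrow> complex option" where *: "p0 \<notin> \<Gamma>" "openin riemann_sphere U" "p0 \<in> U" "U \<inter> \<Omega> = {}"
    "continuous_map (top_of_set (sphere 0 1)) riemann_sphere g" "inj_on g (sphere 0 1)" "\<Gamma> = g ` sphere 0 1"
    "closedin riemann_sphere \<Gamma>"
    by (rule jordan_domain_complement_point[OF jd])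
  have p0\<Omega>: "p0 \<notin> \<Omega>" using *(3,4) by blast
  have \<Omega>: "\<Omega> \<in> connected_components_of (subtopology riemann_sphere (- \<Gamma>))"
    using jd by (simp add: jordan_domain_def)
  have "connectedin (subtopology riemann_sphere (- \<Gamma>)) \<Omega>" using \<Omega> by (rule connectedin_connected_components_of)
  then have conn: "connectedin riemann_sphere \<Omega>" and sub: "\<Omega> \<subseteq> - \<Gamma>" by (auto simp: connectedin_subtopology)
  have fim: "f ` ball 0 1 = \<Omega>" using bi by (auto simp: disk_biholomorphism_def bij_betw_def)
  have img: "(sphere_chart p0 \<circ> f) ` ball 0 1 = sphere_chart p0 ` \<Omega>" by (metis fim image_comp)
  have pc: "sphere_param p0 (sphere_chart p0 p) = p" if "p \<in> \<Omega> \<union> \<Gamma>" for p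
    by (rule sphere_param_chart) (use that p0\<Omega> *(1) in blast)
  have closedK: "closedin riemann_sphere (- U)" using *(2) by (simp add: closedin_def Compl_eq_Diff_UNIV double_diff del: topspace_Alexandroff_compactification)
  have "jordan_conformal (sphere_chart p0 \<circ> f) (sphere_chart p0 ` \<Gamma>) (sphere_chart p0 \<circ> g)"
  proof
    show "(sphere_chart p0 \<circ> f) holomorphic_on ball 0 1" "inj_on (sphere_chart p0 \<circ> f) (ball 0 1)"
      by (rule sphere_chart_holomorphic[OF bi p0\<Omega>])+
    have "compact (sphere_chart p0 ` (- U))"
      by (rule sphere_chart_image_compact[OF closedK]) (use *(3) in simp)
    then have "bounded (sphere_chart p0 ` (- U))" by (rule compact_imp_bounded)
    then show "bounded ((sphere_chart p0 \<circ> f) ` ball 0 1)"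
      unfolding img by (rule bounded_subset) (use *(4) in blast)
    show "inj_on (sphere_chart p0 \<circ> g) (sphere 0 1)"
      by (rule comp_inj_on[OF *(6)]) (rule inj_on_subset[OF sphere_chart_inj], use *(1,7) in auto)
    show "sphere_chart p0 ` \<Gamma> = (sphere_chart p0 \<circ> g) ` sphere 0 1" by (simp add: *(7) image_comp)
    have "continuous_map (top_of_set (sphere 0 1)) (subtopology riemann_sphere (- {p0})) g"
      using *(1,5,7) by (auto simp: continuous_map_in_subtopology)
    then have "continuous_map (top_of_set (sphere 0 1)) euclidean (sphere_chart p0 \<circ> g)"
      using continuous_sphere_chart continuous_map_compose by blast
    then show "continuous_on (sphere 0 1) (sphere_chart p0 \<circ> g)" by simp
    show "(sphere_chart p0 \<circ> f) ` ball 0 1 \<in> components (- (sphere_chart p0 ` \<Gamma>))"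
      unfolding img in_components_maximal
    proof (intro conjI allI impI)
      show "sphere_chart p0 ` \<Omega> \<noteq> {}" using fim by auto
      show "sphere_chart p0 ` \<Omega> \<subseteq> - (sphere_chart p0 ` \<Gamma>)"
      proof
        fix w assume "w \<in> sphere_chart p0 ` \<Omega>"
        then obtain p where p: "p \<in> \<Omega>" "w = sphere_chart p0 p" by auto
        show "w \<in> - (sphere_chart p0 ` \<Gamma>)"
        proof
          assume "w \<in> sphere_chart p0 ` \<Gamma>"
          then obtain p' where "p' \<in> \<Gamma>" "w = sphere_chart p0 p'" by auto
          moreover have "sphere_param p0 w = p" unfolding p(2) by (rule pc) (use p(1) in blast)
          moreover have "sphere_param p0 w = p'" unfolding \<open>w = sphere_chart p0 p'\<close> by (rule pc) (use \<open>p' \<in> \<Gamma>\<close> in blast)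
          ultimately have "p = p'" by simp
          then show False using p \<open>p' \<in> \<Gamma>\<close> sub by blast
        qed
      qed
      have "connectedin (subtopology riemann_sphere (- {p0})) \<Omega>" using conn p0\<Omega> by (auto simp: connectedin_subtopology)
      then have "connectedin euclidean (sphere_chart p0 ` \<Omega>)"
        using continuous_sphere_chart connectedin_continuous_map_image by blast
      then show "connected (sphere_chart p0 ` \<Omega>)" by simp
      fix C assume C: "C \<noteq> {} \<and> sphere_chart p0 ` \<Omega> \<subseteq> C \<and> C \<subseteq> - (sphere_chart p0 ` \<Gamma>) \<and> connected C"
      have "connectedin riemann_sphere (sphere_param p0 ` C)"
        by (rule connectedin_continuous_map_image[OF continuous_sphere_param]) (use C in simp)
      moreover have "sphere_param p0 ` C \<subseteq> - \<Gamma>"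
      proof
        fix p assume "p \<in> sphere_param p0 ` C"
        then obtain w where w: "w \<in> C" "p = sphere_param p0 w" by auto
        then have "sphere_chart p0 p = w" by simp
        then show "p \<in> - \<Gamma>" using w C by blast
      qed
      ultimately have cc: "connectedin (subtopology riemann_sphere (- \<Gamma>)) (sphere_param p0 ` C)"
        by (simp add: connectedin_subtopology)
      have sub\<Omega>: "\<Omega> \<subseteq> sphere_param p0 ` C"
      proof
        fix p assume "p \<in> \<Omega>"
        then have "sphere_chart p0 p \<in> C" "p = sphere_param p0 (sphere_chart p0 p)" using C pc by auto
        then show "p \<in> sphere_param p0 ` C" by blast
      qed
      have "\<not> disjnt \<Omega> (sphere_param p0 ` C)" 
      proof -
        have "\<Omega> \<noteq> {}" using fim by auto
        moreover have "\<Omega> \<inter> sphere_param p0 ` C = \<Omega>" using sub\<Omega> by (rule Int_absorb2)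
        ultimately show ?thesis unfolding disjnt_def by simp
      qed
      then have "sphere_param p0 ` C \<subseteq> \<Omega>"
        using connected_components_of_maximal[OF \<Omega> cc] by blast
      then have "sphere_chart p0 ` sphere_param p0 ` C \<subseteq> sphere_chart p0 ` \<Omega>" by (rule image_mono)
      moreover have "sphere_chart p0 ` sphere_param p0 ` C = C" unfolding image_image by simp
      ultimately have "C \<subseteq> sphere_chart p0 ` \<Omega>" by simp
      then show "C = sphere_chart p0 ` \<Omega>" using C by blast
    qed
  qed
  then show ?thesis using that p0\<Omega> *(1) by blast
qed

section \<open>Caratheodory's theorem on the sphere and Borel sets of the boundary\<close>

lemma boundary_ext_eqI:
  assumes "cmod q = 1" "limitin riemann_sphere f p (at q within ball 0 1)"
  shows "boundary_ext f q = p"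
  unfolding boundary_ext_def
proof (rule the_equality)
  show "limitin riemann_sphere f p (at q within ball 0 1)" by (rule assms(2))
  fix p' assume "limitin riemann_sphere f p' (at q within ball 0 1)"
  moreover have "\<not> trivial_limit (at q within ball 0 1)"
    using assms(1) by (simp add: trivial_limit_within islimpt_ball)
  ultimately show "p' = p" using limitin_Hausdorff_unique[OF _ assms(2) _ Hausdorff_sphere] by blast
qed

lemma boundary_ext_Jordan:
  assumes jd: "jordan_domain \<Gamma> \<Omega>" and bi: "disk_biholomorphism f \<Omega>"
  shows "\<And>q. cmod q = 1 \<Longrightarrow> limitin riemann_sphere f (boundary_ext f q) (at q within ball 0 1)"
    and "inj_on (boundary_ext f) (sphere 0 1)"
    and "boundary_ext f ` sphere 0 1 = \<Gamma>"
    and "continuous_map (top_of_set (sphere 0 1)) riemann_sphere (boundary_ext f)"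
proof -
  obtain p0 g where p0: "p0 \<notin> \<Omega>" "p0 \<notin> \<Gamma>"
    and jc: "jordan_conformal (sphere_chart p0 \<circ> f) (sphere_chart p0 ` \<Gamma>) g"
    by (rule jordan_domain_chart[OF jd bi])
  interpret jordan_conformal "sphere_chart p0 \<circ> f" "sphere_chart p0 ` \<Gamma>" g by (rule jc)
  obtain Fb where Fb: "continuous_on (cball 0 1) Fb" "\<And>z. z \<in> ball 0 1 \<Longrightarrow> Fb z = (sphere_chart p0 \<circ> f) z"
    "Fb ` sphere 0 1 = sphere_chart p0 ` \<Gamma>"
    using boundary_extension by metis
  have fim: "f z \<in> \<Omega>" if "z \<in> ball 0 1" for z using bi that by (auto simp: disk_biholomorphism_def bij_betw_def)
  have lim: "limitin riemann_sphere f (sphere_param p0 (Fb q)) (at q within ball 0 1)" if q: "cmod q = 1" for q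
  proof -
    have "(Fb \<longlongrightarrow> Fb q) (at q within cball 0 1)"
      using Fb(1) q unfolding continuous_on_def by auto
    then have "(Fb \<longlongrightarrow> Fb q) (at q within ball 0 1)" by (rule tendsto_within_subset) auto
    then have "limitin euclidean Fb (Fb q) (at q within ball 0 1)" by simp
    then have "limitin riemann_sphere (sphere_param p0 \<circ> Fb) (sphere_param p0 (Fb q)) (at q within ball 0 1)"
      by (rule continuous_map_limit[OF continuous_sphere_param])
    moreover have "\<forall>\<^sub>F z in at q within ball 0 1. (sphere_param p0 \<circ> Fb) z = f z"
      unfolding eventually_at_filter
    proof (rule always_eventually, intro allI impI)
      fix z assume "z \<noteq> q" "z \<in> ball 0 1"
      then show "(sphere_param p0 \<circ> Fb) z = f z" 
        using Fb(2)[of z] sphere_param_chart[of "f z" p0] fim[of z] p0(1) by (metis comp_apply)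
    qed
    ultimately show ?thesis by (rule limitin_transform_eventually[rotated])
  qed
  have be: "boundary_ext f q = sphere_param p0 (Fb q)" if "cmod q = 1" for q
    by (rule boundary_ext_eqI[OF that lim[OF that]])
  show "\<And>q. cmod q = 1 \<Longrightarrow> limitin riemann_sphere f (boundary_ext f q) (at q within ball 0 1)"
    using lim be by simp
  have injp: "inj (sphere_param p0)" by (rule inj_on_inverseI[of _ "sphere_chart p0"]) simp
  have "inj_on (sphere_param p0 \<circ> Fb) (sphere 0 1)"
    by (rule comp_inj_on[OF boundary_extension_inj[OF Fb]]) (auto intro: inj_on_subset[OF injp])
  then show "inj_on (boundary_ext f) (sphere 0 1)"
    by (rule inj_on_cong[THEN iffD1, rotated]) (simp add: be)
  have "boundary_ext f ` sphere 0 1 = sphere_param p0 ` (Fb ` sphere 0 1)"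
    unfolding image_image by (intro image_cong refl) (simp add: be)
  also have "\<dots> = (\<lambda>p. p) ` \<Gamma>"
    unfolding Fb(3) image_image by (intro image_cong refl) (use p0 in \<open>auto intro: sphere_param_chart\<close>)
  finally show "boundary_ext f ` sphere 0 1 = \<Gamma>" by simp
  have "continuous_on (sphere 0 1) Fb" by (rule continuous_on_subset[OF Fb(1)]) auto
  then have "continuous_map (top_of_set (sphere 0 1)) euclidean Fb" by simp
  then have "continuous_map (top_of_set (sphere 0 1)) riemann_sphere (sphere_param p0 \<circ> Fb)"
    by (rule continuous_map_compose[OF _ continuous_sphere_param])
  then show "continuous_map (top_of_set (sphere 0 1)) riemann_sphere (boundary_ext f)"
    by (rule continuous_map_eq) (simp add: be)
qed

text \<open>Images of compact sets are compact, and injectivity turns complements in the circle into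
  complements in \<Gamma>; induction over the generated sigma-algebra does the rest. Exceptional
  sets found on the circle become Borel subsets of \<Gamma> in this way.\<close>

lemma boundary_ext_Borel_image:
  assumes jd: "jordan_domain \<Gamma> \<Omega>" and bi: "disk_biholomorphism f \<Omega>"
    and E: "E \<in> sets borel"
  shows "boundary_ext f ` (E \<inter> sphere 0 1) \<in> sigma_sets UNIV {U. openin riemann_sphere U}"
proof -
  note B = boundary_ext_Jordan[OF jd bi]
  let ?\<Sigma> = "sigma_sets UNIV {U. openin riemann_sphere U}"
  have closedin: "K \<in> ?\<Sigma>" if "closedin riemann_sphere K" for K
  proof -
    have "UNIV - K \<in> ?\<Sigma>"
      using that by (intro sigma_sets.Basic) (simp add: closedin_def del: topspace_Alexandroff_compactification)
    then have "UNIV - (UNIV - K) \<in> ?\<Sigma>" by (rule sigma_sets.Compl)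
    then show ?thesis by (simp add: double_diff)
  qed
  have compactE: "boundary_ext f ` K \<in> ?\<Sigma>" if K: "compact K" "K \<subseteq> sphere 0 1" for K
  proof -
    have "compactin (top_of_set (sphere 0 1)) K" using K by (simp add: compactin_subtopology)
    then have "compactin riemann_sphere (boundary_ext f ` K)" using B(4) image_compactin by blast
    then show ?thesis using closedin Hausdorff_sphere compactin_imp_closedin by blast
  qed
  interpret S: sigma_algebra UNIV ?\<Sigma> by (rule sigma_algebra_sigma_sets) simp
  have diff: "boundary_ext f ` (sphere 0 1 - X) = \<Gamma> - boundary_ext f ` (X \<inter> sphere 0 1)" for X
    using B(2,3) by (auto simp: inj_on_def)
  have \<Gamma>: "\<Gamma> \<in> ?\<Sigma>" using compactE[of "sphere 0 1"] B(3) by simp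
  have "E \<in> sigma_sets UNIV {S. open S}" using E by (simp add: borel_def)
  then show ?thesis
  proof induction
    case (Basic X)
    have "compact (sphere 0 1 - X)" using Basic by (simp add: compact_diff)
    then have "boundary_ext f ` (sphere 0 1 - X) \<in> ?\<Sigma>" by (rule compactE) auto
    then have "\<Gamma> - boundary_ext f ` (sphere 0 1 - X) \<in> ?\<Sigma>" using \<Gamma> by blast
    moreover have "\<Gamma> - boundary_ext f ` (sphere 0 1 - X) = boundary_ext f ` (X \<inter> sphere 0 1)"
      using B(3) unfolding diff by blast
    ultimately show ?case by simp
  next
    case (Compl X)
    have "(UNIV - X) \<inter> sphere 0 1 = sphere 0 1 - X" by auto
    then show ?case using Compl \<Gamma> diff by (metis S.Diff)
  next
    case (Union X)
    have "boundary_ext f ` ((\<Union>i. X i) \<inter> sphere 0 1) = (\<Union>i. boundary_ext f ` (X i \<inter> sphere 0 1))" by auto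
    then show ?case using Union by (metis sigma_sets.Union)
  qed (simp add: sigma_sets.Empty)
qed

lemma boundary_ext_Borel_preimage:
  assumes jd: "jordan_domain \<Gamma> \<Omega>" and bi: "disk_biholomorphism f \<Omega>"
    and N: "N \<in> sigma_sets UNIV {U. openin riemann_sphere U}"
  shows "{q \<in> sphere 0 1. boundary_ext f q \<in> N} \<in> sets borel"
  using N
proof induction
  case (Basic U)
  have "openin (top_of_set (sphere 0 1)) {q \<in> topspace (top_of_set (sphere 0 1)). boundary_ext f q \<in> U}"
    using boundary_ext_Jordan(4)[OF jd bi] Basic openin_continuous_map_preimage by blast
  then obtain T where "open T" "{q \<in> sphere 0 1. boundary_ext f q \<in> U} = sphere 0 1 \<inter> T"
    by (auto simp: openin_open)
  then show ?case by simp
next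
  case (Compl X)
  have "{q \<in> sphere 0 1. boundary_ext f q \<in> UNIV - X} = sphere 0 1 - {q \<in> sphere 0 1. boundary_ext f q \<in> X}" by auto
  then show ?case using Compl by simp
next
  case (Union X)
  have "{q \<in> sphere 0 1. boundary_ext f q \<in> (\<Union>i. X i)} = (\<Union>i. {q \<in> sphere 0 1. boundary_ext f q \<in> X i})" by auto
  then show ?case using Union by auto
qed simp

subsection \<open>Change of the disc biholomorphism\<close>

definition disc_aut :: "complex \<Rightarrow> complex \<Rightarrow> complex \<Rightarrow> complex" where
  "disc_aut c a z = c * (z - a) / (1 - cnj a * z)"

locale disc_automorphism =
  fixes c a :: complex
  assumes c: "cmod c = 1" and a: "cmod a < 1"
begin

lemma denominator:
  assumes "cmod z \<le> 1"
  shows "1 - cmod a \<le> cmod (1 - cnj a * z)" "cmod (1 - cnj a * z) \<le> 2" "1 - cnj a * z \<noteq> 0"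
proof -
  have le: "cmod (cnj a * z) \<le> cmod a" using assms by (simp add: norm_mult mult_left_le)
  show 1: "1 - cmod a \<le> cmod (1 - cnj a * z)" using norm_triangle_ineq2[of 1 "cnj a * z"] le by simp
  show "cmod (1 - cnj a * z) \<le> 2" using norm_triangle_ineq4[of 1 "cnj a * z"] le a by simp
  show "1 - cnj a * z \<noteq> 0" using 1 a by auto
qed

lemma positive: "0 < 1 - (cmod a)\<^sup>2"
  using a by (simp add: abs_square_less_1)

text \<open>An exact identity whose denominators lie between 1 - |a| and 2 on the closed disc; it
  gives both Lipschitz bounds that follow.\<close>

lemma disc_aut_diff:
  assumes z: "cmod z \<le> 1" and w: "cmod w \<le> 1"
  shows "cmod (disc_aut c a z - disc_aut c a w) = (1 - (cmod a)\<^sup>2) * cmod (z - w) / (cmod (1 - cnj a * z) * cmod (1 - cnj a * w))"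
proof -
  have aa: "cnj a * a = of_real ((cmod a)\<^sup>2)" by (simp only: complex_norm_square mult.commute)
  have "disc_aut c a z - disc_aut c a w = c * (((z - a) * (1 - cnj a * w) - (w - a) * (1 - cnj a * z)) / ((1 - cnj a * z) * (1 - cnj a * w)))"
    unfolding disc_aut_def using denominator(3)[OF z] denominator(3)[OF w] by (simp add: field_simps)
  also have "(z - a) * (1 - cnj a * w) - (w - a) * (1 - cnj a * z) = (1 - cnj a * a) * (z - w)" by (simp add: algebra_simps)
  also have "1 - cnj a * a = of_real (1 - (cmod a)\<^sup>2)" unfolding aa by simp
  finally show ?thesis
    using positive c by (simp add: norm_mult norm_divide del: of_real_diff)
qed

lemma disc_aut_lower:
  assumes z: "cmod z \<le> 1" and w: "cmod w \<le> 1"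
  shows "(1 - (cmod a)\<^sup>2) / 4 * cmod (z - w) \<le> cmod (disc_aut c a z - disc_aut c a w)"
proof -
  have d: "0 < cmod (1 - cnj a * z) * cmod (1 - cnj a * w)"
    using denominator(3)[OF z] denominator(3)[OF w] by simp
  have "cmod (1 - cnj a * z) * cmod (1 - cnj a * w) \<le> 2 * 2"
    by (intro mult_mono denominator z w) auto
  then have "(1 - (cmod a)\<^sup>2) * cmod (z - w) / 4 \<le> (1 - (cmod a)\<^sup>2) * cmod (z - w) / (cmod (1 - cnj a * z) * cmod (1 - cnj a * w))"
    using d positive by (intro divide_left_mono mult_pos_pos) auto
  then show ?thesis unfolding disc_aut_diff[OF z w] by simp
qed

lemma disc_aut_upper:
  assumes z: "cmod z \<le> 1" and w: "cmod w \<le> 1"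
  shows "cmod (disc_aut c a z - disc_aut c a w) \<le> (1 - (cmod a)\<^sup>2) / (1 - cmod a)\<^sup>2 * cmod (z - w)"
proof -
  have "(1 - cmod a) * (1 - cmod a) \<le> cmod (1 - cnj a * z) * cmod (1 - cnj a * w)"
    by (intro mult_mono denominator z w) (use a in auto)
  then have "(1 - (cmod a)\<^sup>2) * cmod (z - w) / (cmod (1 - cnj a * z) * cmod (1 - cnj a * w)) \<le> (1 - (cmod a)\<^sup>2) * cmod (z - w) / ((1 - cmod a) * (1 - cmod a))"
    using denominator(3)[OF z] denominator(3)[OF w] positive a by (intro divide_left_mono mult_pos_pos) auto
  then show ?thesis unfolding disc_aut_diff[OF z w] by (simp add: power2_eq_square)
qed

lemma disc_aut_norm:
  assumes z: "cmod z \<le> 1"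
  shows "1 - (cmod (disc_aut c a z))\<^sup>2 = (1 - (cmod a)\<^sup>2) * (1 - (cmod z)\<^sup>2) / (cmod (1 - cnj a * z))\<^sup>2"
proof -
  have d: "cmod (1 - cnj a * z) \<noteq> 0" using denominator(3)[OF z] by simp
  have "(cmod (1 - cnj a * z))\<^sup>2 - (cmod (z - a))\<^sup>2 = (1 - (cmod a)\<^sup>2) * (1 - (cmod z)\<^sup>2)"
    by (cases a; cases z) (simp add: cmod_power2, simp add: power2_eq_square algebra_simps)
  moreover have "(cmod (disc_aut c a z))\<^sup>2 = (cmod (z - a))\<^sup>2 / (cmod (1 - cnj a * z))\<^sup>2"
    using c by (simp add: disc_aut_def norm_mult norm_divide power_divide)
  ultimately show ?thesis using d by (simp add: field_simps)
qed

text \<open>The constant 8 is 4, from the squared denominator, times 2, from 1 - m^2 <= 2 (1 -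
  m).\<close>

lemma disc_aut_ball:
  assumes "cmod z < 1"
  shows "cmod (disc_aut c a z) < 1" "(1 - (cmod a)\<^sup>2) / 8 * (1 - cmod z) \<le> 1 - cmod (disc_aut c a z)"
proof -
  have z: "cmod z \<le> 1" using assms by simp
  have zz: "0 < 1 - (cmod z)\<^sup>2" using assms by (simp add: abs_square_less_1)
  have "0 < (1 - (cmod a)\<^sup>2) * (1 - (cmod z)\<^sup>2) / (cmod (1 - cnj a * z))\<^sup>2"
    using positive zz denominator(3)[OF z] by simp
  then have "(cmod (disc_aut c a z))\<^sup>2 < 1" using disc_aut_norm[OF z] by simp
  then show lt: "cmod (disc_aut c a z) < 1" using abs_square_less_1[of "cmod (disc_aut c a z)"] by simp
  define m where "m = cmod (disc_aut c a z)"
  have m: "0 \<le> m" "m < 1" using lt by (auto simp: m_def)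
  have "(cmod z)\<^sup>2 \<le> cmod z" using z by (simp add: power2_eq_square mult_left_le_one_le)
  have "(cmod (1 - cnj a * z))\<^sup>2 \<le> 2\<^sup>2" by (intro power_mono denominator z) auto
  then have "(1 - (cmod a)\<^sup>2) * (1 - cmod z) / 4 \<le> (1 - (cmod a)\<^sup>2) * (1 - (cmod z)\<^sup>2) / (cmod (1 - cnj a * z))\<^sup>2"
    using positive zz z denominator(3)[OF z] \<open>(cmod z)\<^sup>2 \<le> cmod z\<close> by (intro frac_le mult_left_mono) auto
  also have "\<dots> = 1 - m\<^sup>2" unfolding m_def disc_aut_norm[OF z] ..
  also have "1 - m\<^sup>2 = (1 - m) * (1 + m)" by (simp add: power2_eq_square algebra_simps)
  also have "\<dots> \<le> (1 - m) * 2" using m by (intro mult_left_mono) auto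
  finally show "(1 - (cmod a)\<^sup>2) / 8 * (1 - cmod z) \<le> 1 - cmod (disc_aut c a z)" unfolding m_def[symmetric] by simp
qed

lemma disc_aut_sphere:
  assumes "cmod z = 1"
  shows "cmod (disc_aut c a z) = 1"
proof -
  have "1 - (cmod (disc_aut c a z))\<^sup>2 = 0" using disc_aut_norm[of z] assms by simp
  then have "(cmod (disc_aut c a z))\<^sup>2 = 1\<^sup>2" by simp
  then show ?thesis by (rule power2_eq_imp_eq) auto
qed

lemma disc_aut_continuous: "continuous_on (cball 0 1) (disc_aut c a)"
  unfolding disc_aut_def by (intro continuous_intros) (use denominator(3) in auto)

end

text \<open>After moving the zero of k to the origin, Schwarz's lemma applies to the map and to its
  inverse. Comparing moduli at the sample point 1/2 gives equality there, so the map is a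
  rotation.\<close>

lemma disc_automorphism_form:
  assumes hol: "k holomorphic_on ball 0 1" and bij: "bij_betw k (ball 0 1) (ball 0 1)"
  obtains c a where "disc_automorphism c a" "\<And>z. cmod z < 1 \<Longrightarrow> k z = disc_aut c a z"
proof -
  have inj: "inj_on k (ball 0 1)" and im: "k ` ball 0 1 = ball 0 1" using bij by (auto simp: bij_betw_def)
  have "0 \<in> k ` ball 0 1" unfolding im by simp
  then obtain a where a: "cmod a < 1" "k a = 0" by auto
  obtain g where g: "g holomorphic_on k ` ball 0 1" "\<And>z. z \<in> ball 0 1 \<Longrightarrow> g (k z) = z"
    using holomorphic_has_inverse[OF hol open_ball inj] by metis
  have gh: "g holomorphic_on ball 0 1" using g(1) unfolding im .
  have gim: "cmod (g w) < 1" if w: "cmod w < 1" for w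
  proof -
    have "w \<in> k ` ball 0 1" unfolding im using w by simp
    then show ?thesis using g(2) by auto
  qed
  have kg: "k (g w) = w" if w: "cmod w < 1" for w
  proof -
    have "w \<in> k ` ball 0 1" unfolding im using w by simp
    then show ?thesis using g(2) by auto
  qed
  have kim: "cmod (k z) < 1" if "cmod z < 1" for z
  proof -
    have "k z \<in> k ` ball 0 1" using that by simp
    then show ?thesis unfolding im by simp
  qed
  let ?M = "Moebius_function 0 (- a)" and ?N = "Moebius_function 0 a"
  have Ml: "cmod (?M z) < 1" if "cmod z < 1" for z by (rule Moebius_function_norm_lt_1) (use a that in auto)
  have Nl: "cmod (?N z) < 1" if "cmod z < 1" for z by (rule Moebius_function_norm_lt_1) (use a that in auto)
  have MN: "?M (?N z) = z" if "cmod z < 1" for z by (rule Moebius_function_compose) (use a that in auto)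
  have NM: "?N (?M z) = z" if "cmod z < 1" for z by (rule Moebius_function_compose) (use a that in auto)
  define s where "s = k \<circ> ?M"
  define s' where "s' = ?N \<circ> g"
  have M0: "?M 0 = a" by (simp add: Moebius_function_def)
  have s: "s holomorphic_on ball 0 1" unfolding s_def
    by (rule holomorphic_on_compose_gen[OF Moebius_function_holomorphic hol]) (use a Ml in auto)
  have s': "s' holomorphic_on ball 0 1" unfolding s'_def
    by (rule holomorphic_on_compose_gen[OF gh Moebius_function_holomorphic]) (use a gim in auto)
  have s0: "s 0 = 0" by (simp add: s_def M0 a)
  have g0: "g 0 = a" using g(2)[of a] a by simp
  have s'0: "s' 0 = 0" by (simp add: s'_def g0 Moebius_function_eq_zero)
  have sb: "cmod (s z) < 1" if "cmod z < 1" for z using kim Ml that by (simp add: s_def)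
  have s'b: "cmod (s' z) < 1" if "cmod z < 1" for z using Nl gim that by (simp add: s'_def)
  have s's: "s' (s z) = z" if "cmod z < 1" for z
    using g(2)[of "?M z"] Ml[OF that] NM[OF that] by (simp add: s_def s'_def)
  have half: "cmod (1/2) < (1::real)" by (simp add: norm_divide)
  have "cmod (s (1/2)) \<le> cmod (1/2)" by (rule Schwarz_Lemma(1)[OF s s0 sb half])
  moreover have "cmod (s' (s (1/2))) \<le> cmod (s (1/2))" by (rule Schwarz_Lemma(1)[OF s' s'0 s'b sb[OF half]])
  ultimately have "cmod (s (1/2)) = cmod (1/2)" using s's[OF half] by simp
  then have ex: "(\<exists>z. cmod z < 1 \<and> z \<noteq> 0 \<and> cmod (s z) = cmod z) \<or> cmod (deriv s 0) = 1"
    using half by (intro disjI1 exI[of _ "1/2"]) auto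
  obtain \<alpha> where \<alpha>: "\<And>z. cmod z < 1 \<Longrightarrow> s z = \<alpha> * z" "cmod \<alpha> = 1"
    using Schwarz_Lemma(3)[OF s s0 sb half ex] by blast
  show ?thesis
  proof (rule that[of \<alpha> a])
    show "disc_automorphism \<alpha> a" using a \<alpha> by unfold_locales
    fix z assume z: "cmod z < 1"
    have "k z = s (?N z)" unfolding s_def using MN[OF z] by simp
    also have "\<dots> = disc_aut \<alpha> a z" using \<alpha>(1)[OF Nl[OF z]] by (simp add: Moebius_function_simple disc_aut_def)
    finally show "k z = disc_aut \<alpha> a z" .
  qed
qed

section \<open>Comparison of two disc biholomorphisms of the same domain\<close>

lemma chart_coord_inf: "p \<noteq> Some 0 \<Longrightarrow> chart_inf (coord_inf p) = p"
  by (auto simp: chart_inf_def coord_inf_def split: option.splits)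

text \<open>The two coordinates of the sphere cover the domain, so the transition map is holomorphic
  on two open parts whose union is the disc, and a bijective holomorphic self-map of the disc is a
  Moebius map.\<close>

lemma disk_biholomorphism_transition:
  assumes f: "disk_biholomorphism f \<Omega>" and f1: "disk_biholomorphism f1 \<Omega>"
  obtains c a where "disc_automorphism c a" "\<And>z. cmod z < 1 \<Longrightarrow> f z = f1 (disc_aut c a z)"
proof -
  let ?g = "the_inv_into (ball 0 1) f1"
  have bf: "bij_betw f (ball 0 1) \<Omega>" "holomorphic_to_sphere f (ball 0 1)"
    and bf1: "bij_betw f1 (ball 0 1) \<Omega>" "holomorphic_from_sphere ?g \<Omega>"
    using f f1 unfolding disk_biholomorphism_def by blast+
  have hf: "(the \<circ> f) holomorphic_on {z \<in> ball 0 1. f z \<noteq> None}"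
    "(coord_inf \<circ> f) holomorphic_on {z \<in> ball 0 1. f z \<noteq> Some 0}"
    using bf(2) unfolding holomorphic_to_sphere_def by blast+
  have hg: "(?g \<circ> Some) holomorphic_on {z. Some z \<in> \<Omega>}" "(?g \<circ> chart_inf) holomorphic_on {w. chart_inf w \<in> \<Omega>}"
    using bf1(2) unfolding holomorphic_from_sphere_def by blast+
  have f\<Omega>: "f z \<in> \<Omega>" if "z \<in> ball 0 1" for z using bf(1) that by (auto simp: bij_betw_def)
  define k where "k = (\<lambda>z. ?g (f z))"
  have "(?g \<circ> Some) \<circ> (the \<circ> f) holomorphic_on {z \<in> ball 0 1. f z \<noteq> None}"
  proof (rule holomorphic_on_compose_gen[OF hf(1) hg(1)], rule image_subsetI)
    fix z assume "z \<in> {z \<in> ball 0 1. f z \<noteq> None}"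
    then show "(the \<circ> f) z \<in> {z. Some z \<in> \<Omega>}" using f\<Omega>[of z] by auto
  qed
  then have A: "k holomorphic_on {z \<in> ball 0 1. f z \<noteq> None}"
    by (rule holomorphic_transform) (auto simp: k_def)
  have "(?g \<circ> chart_inf) \<circ> (coord_inf \<circ> f) holomorphic_on {z \<in> ball 0 1. f z \<noteq> Some 0}"
  proof (rule holomorphic_on_compose_gen[OF hf(2) hg(2)], rule image_subsetI)
    fix z assume "z \<in> {z \<in> ball 0 1. f z \<noteq> Some 0}"
    then show "(coord_inf \<circ> f) z \<in> {w. chart_inf w \<in> \<Omega>}" using f\<Omega>[of z] by (simp add: chart_coord_inf)
  qed
  then have B: "k holomorphic_on {z \<in> ball 0 1. f z \<noteq> Some 0}"
    by (rule holomorphic_transform) (auto simp: k_def chart_coord_inf)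
  have eq: "{z \<in> ball 0 1. f z \<noteq> None} \<union> {z \<in> ball 0 1. f z \<noteq> Some 0} = ball 0 1" by auto
  have hk: "k holomorphic_on ball 0 1"
    using holomorphic_on_Un[OF A B open_preimage_delete[OF bf(2)] open_preimage_delete[OF bf(2)]] unfolding eq .
  have "bij_betw ?g \<Omega> (ball 0 1)" by (rule bij_betw_the_inv_into[OF bf1(1)])
  then have bk: "bij_betw k (ball 0 1) (ball 0 1)"
    using bij_betw_trans[OF bf(1)] by (simp add: k_def o_def)
  obtain c a where ca: "disc_automorphism c a" "\<And>z. cmod z < 1 \<Longrightarrow> k z = disc_aut c a z"
    using disc_automorphism_form[OF hk bk] by blast
  have "f z = f1 (disc_aut c a z)" if z: "cmod z < 1" for z
  proof -
    have "f1 (?g (f z)) = f z"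
      by (rule f_the_inv_into_f_bij_betw[OF bf1(1)]) (use f\<Omega> z in simp)
    then show ?thesis using ca(2)[OF z] by (simp add: k_def)
  qed
  then show ?thesis using that ca(1) by blast
qed

context disc_automorphism
begin

lemma boundary_ext_disc_aut:
  assumes f: "\<And>z. cmod z < 1 \<Longrightarrow> f z = f1 (disc_aut c a z)" and q: "cmod q = 1"
    and lim: "limitin riemann_sphere f1 p (at (disc_aut c a q) within ball 0 1)"
  shows "boundary_ext f q = p"
proof (rule boundary_ext_eqI[OF q])
  have "(disc_aut c a \<longlongrightarrow> disc_aut c a q) (at q within cball 0 1)"
    using disc_aut_continuous q unfolding continuous_on_def by auto
  then have t: "(disc_aut c a \<longlongrightarrow> disc_aut c a q) (at q within ball 0 1)" by (rule tendsto_within_subset) auto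
  have ne: "disc_aut c a z \<in> ball 0 1 \<and> disc_aut c a z \<noteq> disc_aut c a q" if "z \<in> ball 0 1" for z
    using disc_aut_ball(1)[of z] disc_aut_sphere[OF q] that by auto
  have fl: "filterlim (disc_aut c a) (at (disc_aut c a q) within ball 0 1) (at q within ball 0 1)"
    unfolding filterlim_at using t ne by (auto simp: eventually_at_filter intro!: always_eventually)
  show "limitin riemann_sphere f p (at q within ball 0 1)"
    unfolding limitin_def
  proof (intro conjI allI impI)
    show "p \<in> topspace riemann_sphere" using lim by (simp add: limitin_def)
    fix U assume "openin riemann_sphere U \<and> p \<in> U"
    then have "\<forall>\<^sub>F w in at (disc_aut c a q) within ball 0 1. f1 w \<in> U" using lim by (simp add: limitin_def)
    then have "\<forall>\<^sub>F z in at q within ball 0 1. f1 (disc_aut c a z) \<in> U"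
      by (rule eventually_compose_filterlim[OF _ fl])
    moreover have "\<forall>\<^sub>F z in at q within ball 0 1. z \<in> ball 0 1" by (simp add: eventually_at_filter)
    ultimately show "\<forall>\<^sub>F z in at q within ball 0 1. f z \<in> U"
      by eventually_elim (simp add: f)
  qed
qed

text \<open>The automorphism maps a radius into a Stolz region: it enlarges the distance to the end
  point by at most the factor L and shrinks the distance to the circle by at most the factor l, so
  the aperture L/l + 1 suffices.\<close>

lemma nontangential_imp_radial:
  assumes f: "\<And>z. cmod z < 1 \<Longrightarrow> f z = f1 (disc_aut c a z)" and q: "cmod q = 1"
    and nt: "nontangential_limit (h \<circ> f1) (disc_aut c a q) \<zeta>"
  shows "((\<lambda>t. h (f (of_real t * q))) \<longlongrightarrow> \<zeta>) (at_left 1)"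
proof -
  define L where "L = (1 - (cmod a)\<^sup>2) / (1 - cmod a)\<^sup>2"
  define l where "l = (1 - (cmod a)\<^sup>2) / 8"
  have l: "l > 0" and L: "L > 0" using positive a by (auto simp: l_def L_def)
  define M where "M = L / l + 1"
  have M: "M > 1" using l L by (simp add: M_def)
  let ?S = "{z \<in> ball 0 1. cmod (disc_aut c a q - z) < M * (1 - cmod z)}"
  have lim: "((h \<circ> f1) \<longlongrightarrow> \<zeta>) (at (disc_aut c a q) within ?S)"
    using nt M unfolding nontangential_limit_def by blast
  have n: "cmod (of_real t * q) = t" if "t \<in> {0<..<1}" for t using that q by (simp add: norm_mult)
  have d: "cmod (q - of_real t * q) = 1 - t" if "t \<in> {0<..<1}" for t
  proof -
    have "q - of_real t * q = of_real (1 - t) * q" by (simp add: algebra_simps)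
    then show ?thesis using that q by (simp add: norm_mult del: of_real_diff)
  qed
  have inS: "disc_aut c a (of_real t * q) \<in> ?S \<and> disc_aut c a (of_real t * q) \<noteq> disc_aut c a q" if t: "t \<in> {0<..<1}" for t
  proof -
    have lt: "cmod (of_real t * q) < 1" using n[OF t] t by simp
    have "cmod (disc_aut c a q - disc_aut c a (of_real t * q)) \<le> L * cmod (q - of_real t * q)"
      unfolding L_def by (rule disc_aut_upper) (use q lt in auto)
    also have "\<dots> = L / l * (l * (1 - t))" using l d[OF t] by simp
    also have "\<dots> \<le> L / l * (1 - cmod (disc_aut c a (of_real t * q)))"
      using disc_aut_ball(2)[OF lt] n[OF t] l L unfolding l_def[symmetric] by (intro mult_left_mono) auto
    also have "\<dots> < M * (1 - cmod (disc_aut c a (of_real t * q)))"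
      using disc_aut_ball(1)[OF lt] by (intro mult_strict_right_mono) (auto simp: M_def)
    finally show ?thesis using disc_aut_ball(1)[OF lt] disc_aut_sphere[OF q] by auto
  qed
  have "continuous_on {0..1} (\<lambda>t. disc_aut c a (of_real t * q))"
    by (rule continuous_on_compose2[OF disc_aut_continuous]) (auto intro!: continuous_intros simp: norm_mult q)
  then have "((\<lambda>t. disc_aut c a (of_real t * q)) \<longlongrightarrow> disc_aut c a (of_real 1 * q)) (at 1 within {0..1})"
    unfolding continuous_on_def by (rule bspec) simp
  then have t1: "((\<lambda>t. disc_aut c a (of_real t * q)) \<longlongrightarrow> disc_aut c a q) (at_left 1)"
    by (simp add: at_within_Icc_at_left)
  have ev: "\<forall>\<^sub>F t in at_left 1. t \<in> {0<..<1::real}"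
    by (rule eventually_at_left_field[THEN iffD2]) (auto intro!: exI[of _ 0])
  have "filterlim (\<lambda>t. disc_aut c a (of_real t * q)) (at (disc_aut c a q) within ?S) (at_left 1)"
    unfolding filterlim_at using t1 eventually_mono[OF ev inS] by simp
  from filterlim_compose[OF lim this]
  have "((\<lambda>t. (h \<circ> f1) (disc_aut c a (of_real t * q))) \<longlongrightarrow> \<zeta>) (at_left 1)" .
  then show ?thesis
  proof (rule Lim_transform_eventually)
    show "\<forall>\<^sub>F t in at_left 1. (h \<circ> f1) (disc_aut c a (of_real t * q)) = h (f (of_real t * q))"
      using ev by eventually_elim (use f n in auto)
  qed
qed

end

text \<open>The biholomorphism witnessing a CNT limit is arbitrary. Injectivity of the boundary map
  identifies its boundary point with the image of q, so the limit can be read along the radii of the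
  given \<open>f\<close>.\<close>

lemma cnt_limit_imp_radial:
  assumes jd: "jordan_domain \<Gamma> \<Omega>" and bi: "disk_biholomorphism f \<Omega>"
    and cnt: "cnt_limit \<Omega> h p \<zeta>" and q: "cmod q = 1" "boundary_ext f q = p"
  shows "((\<lambda>t. h (f (of_real t * q))) \<longlongrightarrow> \<zeta>) (at_left 1)"
proof -
  obtain f1 q1 where f1: "disk_biholomorphism f1 \<Omega>" "q1 \<in> sphere 0 1" "boundary_ext f1 q1 = p"
    "nontangential_limit (h \<circ> f1) q1 \<zeta>"
    using cnt unfolding cnt_limit_def by blast
  obtain c a where ca: "disc_automorphism c a" "\<And>z. cmod z < 1 \<Longrightarrow> f z = f1 (disc_aut c a z)"
    using disk_biholomorphism_transition[OF bi f1(1)] by blast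
  interpret disc_automorphism c a by (rule ca(1))
  note B = boundary_ext_Jordan[OF jd f1(1)]
  have "boundary_ext f q = boundary_ext f1 (disc_aut c a q)"
    by (rule boundary_ext_disc_aut[OF ca(2) q(1) B(1)[OF disc_aut_sphere[OF q(1)]]])
  then have "disc_aut c a q = q1"
    using B(2) f1(2,3) q disc_aut_sphere[OF q(1)] unfolding inj_on_def by (metis mem_sphere_0)
  then show ?thesis using nontangential_imp_radial[of f f1 q h \<zeta>, OF ca(2) q(1)] f1(4) by blast
qed

text \<open>Capacity zero is known for the preimage under some other biholomorphism. The transition
  automorphism has a lower Lipschitz bound, which is what the comparison of capacity with arc length
  asks of its map \<open>k\<close>.\<close>

lemma null_on_imp_AE:
  assumes jd: "jordan_domain \<Gamma> \<Omega>" and bi: "disk_biholomorphism f \<Omega>" and N: "null_on \<Gamma> \<Omega> N"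
  shows "AE \<theta> in lborel. boundary_ext f (cis \<theta>) \<notin> N"
proof -
  obtain f1 where f1: "disk_biholomorphism f1 \<Omega>" "log_capacity {q \<in> sphere 0 1. boundary_ext f1 q \<in> N} = 0"
    and Nb: "N \<in> sigma_sets UNIV {U. openin riemann_sphere U}"
    using N unfolding null_on_def by blast
  obtain c a where ca: "disc_automorphism c a" "\<And>z. cmod z < 1 \<Longrightarrow> f z = f1 (disc_aut c a z)"
    using disk_biholomorphism_transition[OF bi f1(1)] by blast
  interpret disc_automorphism c a by (rule ca(1))
  note B = boundary_ext_Jordan[OF jd f1(1)]
  let ?F = "{q \<in> sphere 0 1. boundary_ext f q \<in> N}"
  have "AE \<theta> in lborel. cis \<theta> \<notin> ?F"
  proof (rule capacity_zero_imp_arc_null[OF f1(2), of _ "disc_aut c a" "(1 - (cmod a)\<^sup>2) / 4"])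
    show "?F \<in> sets borel" by (rule boundary_ext_Borel_preimage[OF jd bi Nb])
    show "continuous_on (sphere 0 1) (disc_aut c a)" by (rule continuous_on_subset[OF disc_aut_continuous]) auto
    show "0 < (1 - (cmod a)\<^sup>2) / 4" using positive by simp
    show "(1 - (cmod a)\<^sup>2) / 4 * dist p q \<le> dist (disc_aut c a p) (disc_aut c a q)" if "cmod p = 1" "cmod q = 1" for p q
      unfolding dist_norm by (rule disc_aut_lower) (use that in auto)
    fix q assume q: "q \<in> ?F" "cmod q = 1"
    have "boundary_ext f q = boundary_ext f1 (disc_aut c a q)"
      by (rule boundary_ext_disc_aut[OF ca(2) q(2) B(1)[OF disc_aut_sphere[OF q(2)]]])
    then show "disc_aut c a q \<in> {q \<in> sphere 0 1. boundary_ext f1 q \<in> N}" using q disc_aut_sphere[OF q(2)] by simp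
  qed
  then show ?thesis by simp
qed

subsection \<open>Dirichlet functions on the disc\<close>

abbreviation taylor_coeff :: "(complex \<Rightarrow> complex) \<Rightarrow> nat \<Rightarrow> complex" where
  "taylor_coeff P n \<equiv> (deriv ^^ n) P 0 / fact n"

lemma taylor_power_series:
  assumes "P holomorphic_on ball 0 1" "cmod z < 1"
  shows "power_series (taylor_coeff P) z = P z"
proof -
  have "(\<lambda>n. taylor_coeff P n * (z - 0) ^ n) sums P z"
    by (rule holomorphic_power_series[OF assms(1)]) (use assms(2) in simp)
  then show ?thesis unfolding power_series_def by (simp add: sums_iff)
qed

lemma taylor_coeff_deriv: "taylor_coeff (deriv P) n = of_nat (Suc n) * taylor_coeff P (Suc n)"
proof -
  have "(deriv ^^ n) (deriv P) 0 = (deriv ^^ Suc n) P 0" by (simp only: funpow_Suc_right o_def)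
  then show ?thesis by (simp add: field_simps del: of_nat_Suc funpow.simps)
qed

lemma dirichlet_coeffs_taylor:
  assumes "summable (\<lambda>n. (cmod (taylor_coeff (deriv P) n))\<^sup>2 / real (Suc n))"
  shows "dirichlet_coeffs (taylor_coeff P)"
proof -
  have "(cmod (taylor_coeff (deriv P) n))\<^sup>2 / real (Suc n) = real (Suc n) * (cmod (taylor_coeff P (Suc n)))\<^sup>2" for n
    unfolding taylor_coeff_deriv norm_mult norm_of_nat power_mult_distrib
    by (simp add: power2_eq_square del: of_nat_Suc)
  then have "summable (\<lambda>n. real (Suc n) * (cmod (taylor_coeff P (Suc n)))\<^sup>2)" using assms by simp
  then show ?thesis unfolding dirichlet_coeffs_def by (subst summable_Suc_iff[symmetric])
qed

text \<open>Holomorphy beyond the unit circle gives geometric decay of the coefficients. Applied to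
  the reflected parts of the Laurent splitting.\<close>

lemma dirichlet_coeffs_larger_disc:
  assumes hol: "P holomorphic_on ball 0 R" and R: "1 < R"
  shows "dirichlet_coeffs (taylor_coeff P)"
proof -
  obtain \<rho> where \<rho>: "1 < \<rho>" "\<rho> < R" using R dense by blast
  have "(\<lambda>n. taylor_coeff P n * (of_real \<rho> - 0) ^ n) sums P (of_real \<rho>)"
    by (rule holomorphic_power_series[OF hol]) (use \<rho> in simp)
  then have "summable (\<lambda>n. taylor_coeff P n * of_real \<rho> ^ n)" by (simp add: sums_iff)
  then have "Bseq (\<lambda>n. taylor_coeff P n * of_real \<rho> ^ n)" by (rule summable_imp_Bseq)
  then obtain K where K: "\<And>n. cmod (taylor_coeff P n * of_real \<rho> ^ n) \<le> K" unfolding Bseq_def by blast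
  define x where "x = (1 / \<rho>)\<^sup>2"
  have x: "0 \<le> x" "x < 1" unfolding x_def using \<rho> by (simp, intro power_less_one_iff[THEN iffD2]) auto
  have bd: "real n * (cmod (taylor_coeff P n))\<^sup>2 \<le> K\<^sup>2 * (real (Suc n) * x ^ n)" for n
  proof -
    have "cmod (taylor_coeff P n) * \<rho> ^ n \<le> K" using K[of n] \<rho> unfolding norm_mult norm_power norm_of_real by simp
    then have "cmod (taylor_coeff P n) \<le> K * (1 / \<rho>) ^ n" using \<rho> by (simp add: field_simps)
    then have "(cmod (taylor_coeff P n))\<^sup>2 \<le> (K * (1 / \<rho>) ^ n)\<^sup>2" by (intro power_mono) auto
    also have "\<dots> = K\<^sup>2 * x ^ n" by (simp add: x_def power_mult_distrib power_mult[symmetric] mult.commute)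
    finally have "real n * (cmod (taylor_coeff P n))\<^sup>2 \<le> real (Suc n) * (K\<^sup>2 * x ^ n)"
      by (intro mult_mono) auto
    then show ?thesis by (simp add: mult.left_commute)
  qed
  have "summable (\<lambda>n. K\<^sup>2 * (real (Suc n) * x ^ n))"
    using sums_diffs_geometric[OF x] by (intro summable_mult) (rule sums_summable)
  then show ?thesis unfolding dirichlet_coeffs_def
    by (rule summable_comparison_test') (use bd in \<open>simp add: abs_mult\<close>)
qed

lemma dirichlet_coeffs_lincomb:
  assumes "dirichlet_coeffs a" "dirichlet_coeffs b"
  shows "dirichlet_coeffs (\<lambda>n. a n + c * b n)"
    and "cmod z < 1 \<Longrightarrow> power_series (\<lambda>n. a n + c * b n) z = power_series a z + c * power_series b z"
proof -
  have le: "real n * (cmod (a n + c * b n))\<^sup>2 \<le> 2 * (real n * (cmod (a n))\<^sup>2) + 2 * (cmod c)\<^sup>2 * (real n * (cmod (b n))\<^sup>2)" for n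
  proof -
    have "(cmod (a n + c * b n))\<^sup>2 \<le> (cmod (a n) + cmod c * cmod (b n))\<^sup>2"
      by (intro power_mono) (metis norm_mult norm_triangle_ineq, simp)
    also have "\<dots> \<le> 2 * (cmod (a n))\<^sup>2 + 2 * (cmod c * cmod (b n))\<^sup>2"
      using sum_squares_bound[of "cmod (a n)" "cmod c * cmod (b n)"] by (simp add: power2_sum)
    finally have "real n * (cmod (a n + c * b n))\<^sup>2 \<le> real n * (2 * (cmod (a n))\<^sup>2 + 2 * (cmod c * cmod (b n))\<^sup>2)"
      by (intro mult_left_mono) auto
    then show ?thesis by (simp add: algebra_simps power_mult_distrib)
  qed
  have "summable (\<lambda>n. 2 * (real n * (cmod (a n))\<^sup>2) + 2 * (cmod c)\<^sup>2 * (real n * (cmod (b n))\<^sup>2))"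
    using assms unfolding dirichlet_coeffs_def by (intro summable_add summable_mult)
  then show "dirichlet_coeffs (\<lambda>n. a n + c * b n)" unfolding dirichlet_coeffs_def
    by (rule summable_comparison_test') (use le in \<open>simp add: abs_mult\<close>)
  assume z: "cmod z < 1"
  have "(\<lambda>n. a n * z ^ n + c * (b n * z ^ n)) sums (power_series a z + c * power_series b z)"
    by (intro sums_add sums_mult dirichlet_coeffs_sums assms z)
  then have "(\<lambda>n. (a n + c * b n) * z ^ n) sums (power_series a z + c * power_series b z)"
    by (simp add: algebra_simps)
  then show "power_series (\<lambda>n. a n + c * b n) z = power_series a z + c * power_series b z"
    unfolding power_series_def by (simp add: sums_iff)
qed

lemma power_series_holomorphic:
  assumes "dirichlet_coeffs a"
  shows "power_series a holomorphic_on ball 0 1"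
  unfolding holomorphic_on_open[OF open_ball] 
proof
  fix z :: complex assume "z \<in> ball 0 1"
  then show "\<exists>f'. (power_series a has_field_derivative f') (at z)"
    by (intro exI) (rule dirichlet_coeffs_DERIV[OF assms], simp)
qed

lemma taylor_coeff_power_series:
  assumes "dirichlet_coeffs a"
  shows "taylor_coeff (power_series a) n = a n"
proof -
  have "power_series a has_fps_expansion Abs_fps a"
    unfolding has_fps_expansion_def
  proof
    have "fps_conv_radius (Abs_fps a) \<ge> 1"
      unfolding fps_conv_radius_def
    proof (rule conv_radius_geI_ex')
      fix r :: real assume "0 < r" "ereal r < 1"
      then show "summable (\<lambda>n. fps_nth (Abs_fps a) n * of_real r ^ n)"
        using dirichlet_coeffs_sums[OF assms, of "of_real r"] by (simp add: sums_iff)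
    qed
    then show "fps_conv_radius (Abs_fps a) > 0" by (rule less_le_trans[rotated]) simp
    show "\<forall>\<^sub>F z in nhds 0. eval_fps (Abs_fps a) z = power_series a z"
      by (rule always_eventually) (simp add: eval_fps_def power_series_def)
  qed
  from fps_nth_fps_expansion[OF this, of n] show ?thesis by simp
qed

text \<open>On the annulus |g|^2 <= 2|p|^2 + 2K^2, and on the remaining compact disc g is
  bounded.\<close>

lemma nn_integral_square_disc:
  assumes g: "g holomorphic_on ball 0 1" and t: "0 \<le> t" "t < 1"
    and p: "p holomorphic_on annulus t"
    and fin: "square_integral (annulus t) p < \<infinity>"
    and K: "\<And>z. z \<in> annulus t \<Longrightarrow> cmod (g z - p z) \<le> K"
  shows "square_integral (ball 0 1) g < \<infinity>"
proof -
  have "continuous_on (cball 0 t) g"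
    by (rule continuous_on_subset[OF holomorphic_on_imp_continuous_on[OF g]]) (use t in auto)
  then have "compact (g ` cball 0 t)" by (intro compact_continuous_image) auto
  then have "bounded (g ` cball 0 t)" by (rule compact_imp_bounded)
  then obtain B where B: "\<And>z. z \<in> cball 0 t \<Longrightarrow> cmod (g z) \<le> B" unfolding bounded_iff by blast
  have [measurable]: "(\<lambda>z. p z * indicator (annulus t) z) \<in> borel_measurable borel"
  proof -
    have "(\<lambda>z. indicator (annulus t) z *\<^sub>R p z) \<in> borel_measurable borel"
      by (rule borel_measurable_continuous_on_indicator)
         (use holomorphic_on_imp_continuous_on[OF p] open_annulus in auto)
    then show ?thesis by (rule measurable_cong[THEN iffD1, rotated]) (auto simp: indicator_def)
  qed
  define f where "f = (\<lambda>z. 2 * ennreal ((cmod (p z * indicator (annulus t) z))\<^sup>2) + ennreal (2 * K\<^sup>2 + B\<^sup>2) * indicator (ball (0::complex) 1) z)"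
  have "square_integral (ball 0 1) g \<le> (\<integral>\<^sup>+z. f z \<partial>lborel)"
  proof (rule nn_integral_mono)
    fix z :: complex
    show "ennreal ((cmod (g z))\<^sup>2) * indicator (ball 0 1) z \<le> f z"
    proof (cases "z \<in> annulus t")
      case True
      have "(cmod (g z))\<^sup>2 \<le> (cmod (p z) + K)\<^sup>2"
        using K[OF True] norm_triangle_ineq2[of "g z" "p z"] by (intro power_mono) auto
      also have "\<dots> \<le> 2 * (cmod (p z))\<^sup>2 + (2 * K\<^sup>2 + B\<^sup>2)"
        using sum_squares_bound[of "cmod (p z)" K] zero_le_power2[of B] by (simp only: power2_sum)
      finally have "ennreal ((cmod (g z))\<^sup>2) \<le> ennreal (2 * (cmod (p z))\<^sup>2 + (2 * K\<^sup>2 + B\<^sup>2))" by (rule ennreal_leI)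
      also have "\<dots> = 2 * ennreal ((cmod (p z))\<^sup>2) + ennreal (2 * K\<^sup>2 + B\<^sup>2)"
        by (subst ennreal_plus) (auto simp: ennreal_mult)
      finally show ?thesis using True by (simp add: f_def)
    next
      case False
      show ?thesis
      proof (cases "z \<in> ball 0 1")
        case True
        then have "cmod (g z) \<le> B" using B[of z] False by auto
        then have "(cmod (g z))\<^sup>2 \<le> 2 * K\<^sup>2 + B\<^sup>2" using power_mono[of "cmod (g z)" B 2] by (simp add: add_increasing)
        then have "ennreal ((cmod (g z))\<^sup>2) \<le> ennreal (2 * K\<^sup>2 + B\<^sup>2)" by (rule ennreal_leI)
        then show ?thesis using False True by (simp add: f_def del: ennreal_plus)
      qed simp
    qed
  qed
  also have "\<dots> = 2 * (\<integral>\<^sup>+z. ennreal ((cmod (p z * indicator (annulus t) z))\<^sup>2) \<partial>lborel)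
      + ennreal (2 * K\<^sup>2 + B\<^sup>2) * emeasure lborel (ball (0::complex) 1)"
    unfolding f_def
  proof (subst nn_integral_add)
    show "(\<lambda>z. ennreal (2 * K\<^sup>2 + B\<^sup>2) * indicator (ball (0::complex) 1) z) \<in> borel_measurable lborel"
      by (intro borel_measurable_times_ennreal borel_measurable_const borel_measurable_indicator) simp
  qed (simp_all add: nn_integral_cmult nn_integral_cmult_indicator del: ennreal_plus)
  also have "(\<integral>\<^sup>+z. ennreal ((cmod (p z * indicator (annulus t) z))\<^sup>2) \<partial>lborel) = square_integral (annulus t) p"
    by (intro nn_integral_cong) (auto simp: indicator_def)
  also have "2 * \<dots> + ennreal (2 * K\<^sup>2 + B\<^sup>2) * emeasure lborel (ball (0::complex) 1) < \<infinity>"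
    using fin emeasure_lborel_ball_finite[of "0::complex" 1] by (simp add: ennreal_mult_less_top ennreal_add_less_top)
  finally show ?thesis .
qed

text \<open>The regular part has a primitive on the disc, and the energy bound for its coefficients
  is the Dirichlet condition for the coefficients of that primitive.\<close>

lemma laurent_dirichlet_decomposition:
  assumes r: "0 < t" "t < 1"
    and p1: "p1 holomorphic_on ball 0 1" and l: "l holomorphic_on ball 0 (1 / t)"
    and eq: "\<And>z. z \<in> annulus t \<Longrightarrow> p z = p1 z + l (1 / z) / z"
    and fin: "square_integral (annulus t) p < \<infinity>"
  obtains a where "dirichlet_coeffs a" "\<And>z. cmod z < 1 \<Longrightarrow> (power_series a has_field_derivative p1 z) (at z)"
proof -
  obtain P where P: "\<And>z. z \<in> ball 0 1 \<Longrightarrow> (P has_field_derivative p1 z) (at z within ball 0 1)"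
    by (rule holomorphic_convex_primitive'[OF convex_ball open_ball p1]) blast
  have Pd: "(P has_field_derivative p1 z) (at z)" if "cmod z < 1" for z
    using P[of z] that by (simp add: at_within_open[OF _ open_ball])
  have Ph: "P holomorphic_on ball 0 1" unfolding holomorphic_on_open[OF open_ball] using Pd by (intro ballI exI) auto
  have "taylor_coeff (deriv P) n = taylor_coeff p1 n" for n
  proof -
    have "(deriv ^^ n) (deriv P) 0 = (deriv ^^ n) p1 0"
      by (rule higher_deriv_transform_within_open[OF _ p1 open_ball])
         (use holomorphic_deriv[OF Ph open_ball] DERIV_imp_deriv[OF Pd] in auto)
    then show ?thesis by simp
  qed
  then have "dirichlet_coeffs (taylor_coeff P)"
    using laurent_coefficients_energy[OF r p1 l eq fin] by (intro dirichlet_coeffs_taylor) simp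
  moreover have "(power_series (taylor_coeff P) has_field_derivative p1 z) (at z)" if z: "cmod z < 1" for z
    by (rule DERIV_cong_ev[THEN iffD1, OF refl _ refl Pd[OF z]])
       (rule eventually_nhds_in_open[OF open_ball, of z 0 1, THEN eventually_mono], use z taylor_power_series[OF Ph] in auto)
  ultimately show ?thesis using that by blast
qed

subsection \<open>Harmonic functions of finite energy near the unit circle\<close>

text \<open>The regular part of p is the derivative of a Dirichlet function; the principal part is
  bounded near the circle and, up to a term c/z, the derivative of a function of 1/z that is
  holomorphic beyond the circle.\<close>

lemma annulus_bergman:
  assumes r: "0 \<le> r" "r < t" "t < 1" and p: "p holomorphic_on annulus r"
    and fin: "square_integral (annulus r) p < \<infinity>"
  obtains a L R c K where "dirichlet_coeffs a" "1 / t < R" "L holomorphic_on ball 0 R"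
    "\<And>z. z \<in> annulus t \<Longrightarrow> ((\<lambda>z. power_series a z - L (1 / z)) has_field_derivative (p z - c / z)) (at z)"
    "\<And>z. z \<in> annulus t \<Longrightarrow> cmod (p z - power_series (diffs a) z) \<le> K"
    "\<And>\<rho> n. t < \<rho> \<Longrightarrow> \<rho> < 1 \<Longrightarrow>
       contour_integral (circlepath 0 \<rho>) (\<lambda>w. p w / w ^ Suc n) = 2 * of_real pi * \<i> * diffs a n"
proof -
  \<comment> \<open>Splitting at a radius below t leaves room: the principal part is then
    holomorphic on a neighbourhood of the closed disc of radius 1/t, hence bounded there.\<close>
  obtain s where s: "r < s" "s < t" using r dense by blast
  have s0: "0 < s" "s < 1" using s r by auto
  have R: "1 / t < 1 / s" using s s0 r by (simp add: frac_less2)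
  obtain p1 l where p1: "p1 holomorphic_on ball 0 1" and l: "l holomorphic_on ball 0 (1 / s)"
    and eq: "\<And>z. z \<in> annulus s \<Longrightarrow> p z = p1 z + l (1 / z) / z"
    using laurent_split[OF r(1) s(1) s0(2) p] by blast
  have "square_integral (annulus s) p \<le> square_integral (annulus r) p"
    by (intro nn_integral_mono) (use s in \<open>auto simp: indicator_def\<close>)
  then have fins: "square_integral (annulus s) p < \<infinity>" using fin by (rule le_less_trans)
  obtain a where a: "dirichlet_coeffs a" and ad: "\<And>z. cmod z < 1 \<Longrightarrow> (power_series a has_field_derivative p1 z) (at z)"
    using laurent_dirichlet_decomposition[OF s0 p1 l eq fins] by blast
  have pa: "power_series (diffs a) z = p1 z" if "cmod z < 1" for z
    by (rule DERIV_unique[OF dirichlet_coeffs_DERIV[OF a that] ad[OF that]])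
  \<comment> \<open>\<open>l 0\<close> is the residue, the coefficient of 1/z, which has no
    single-valued primitive. Without it, (l(1/z) - l(0))/z is the derivative of -L(1/z), where
    \<open>L\<close> is a primitive of \<open>l1\<close>.\<close>
  define l1 where "l1 = (\<lambda>z. if z = 0 then deriv l 0 else (l z - l 0) / (z - 0))"
  have l1: "l1 holomorphic_on ball 0 (1 / s)"
    unfolding l1_def by (rule pole_lemma[OF l]) (use s0 in simp)
  obtain L where L: "\<And>z. z \<in> ball 0 (1 / s) \<Longrightarrow> (L has_field_derivative l1 z) (at z within ball 0 (1 / s))"
    by (rule holomorphic_convex_primitive'[OF convex_ball open_ball l1]) blast
  have Ld: "(L has_field_derivative l1 z) (at z)" if "cmod z < 1 / s" for z
    using L[of z] that by (simp add: at_within_open[OF _ open_ball])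
  have Lh: "L holomorphic_on ball 0 (1 / s)"
    using L field_differentiable_def unfolding holomorphic_on_def by blast
  have inv: "cmod (1 / z) < 1 / s" if "z \<in> annulus t" for z
    by (rule norm_inverse_less) (use that s s0 in auto)
  have D: "((\<lambda>z. power_series a z - L (1 / z)) has_field_derivative (p z - l 0 / z)) (at z)" if z: "z \<in> annulus t" for z
  proof -
    have z0: "z \<noteq> 0" using z s s0 by auto
    have "((\<lambda>z. 1 / z) has_field_derivative (- 1 / z\<^sup>2)) (at z)"
      using z0 by (auto intro!: derivative_eq_intros simp: power2_eq_square)
    from DERIV_chain2[OF Ld[OF inv[OF z]] this]
    have "((\<lambda>z. power_series a z - L (1 / z)) has_field_derivative (p1 z - l1 (1 / z) * (- 1 / z\<^sup>2))) (at z)"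
      by (intro DERIV_diff ad) (use z in auto)
    moreover have "p1 z - l1 (1 / z) * (- 1 / z\<^sup>2) = p z - l 0 / z"
      using eq[of z] z s z0 by (simp add: l1_def field_simps power2_eq_square)
    ultimately show ?thesis by simp
  qed
  have "continuous_on (cball 0 (1 / t)) l"
    by (rule continuous_on_subset[OF holomorphic_on_imp_continuous_on[OF l]]) (use R in auto)
  then have "compact (l ` cball 0 (1 / t))" by (intro compact_continuous_image) auto
  then have "bounded (l ` cball 0 (1 / t))" by (rule compact_imp_bounded)
  then obtain B where B: "\<forall>z\<in>l ` cball 0 (1 / t). cmod z \<le> B" unfolding bounded_iff by blast
  have E: "cmod (p z - power_series (diffs a) z) \<le> B / t" if z: "z \<in> annulus t" for z
  proof -
    have "1 / cmod z \<le> 1 / t" using z s s0 by (intro divide_left_mono mult_pos_pos) auto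
    then have "1 / z \<in> cball 0 (1 / t)" by (simp add: norm_divide)
    then have bl: "cmod (l (1 / z)) \<le> B" using B by blast
    have "p z - power_series (diffs a) z = l (1 / z) / z" using eq[of z] pa[of z] z s by simp
    then have "cmod (p z - power_series (diffs a) z) = cmod (l (1 / z)) / cmod z" by (simp add: norm_divide)
    also have "\<dots> \<le> B / t" using bl z s s0 order_trans[OF norm_ge_zero bl] by (intro frac_le) auto
    finally show ?thesis .
  qed
  have F: "contour_integral (circlepath 0 \<rho>) (\<lambda>w. p w / w ^ Suc n) = 2 * of_real pi * \<i> * diffs a n"
    if \<rho>: "t < \<rho>" "\<rho> < 1" for \<rho> n
  proof -
    have "taylor_coeff p1 n = taylor_coeff (deriv (power_series a)) n"
    proof -
      have "(deriv ^^ n) p1 0 = (deriv ^^ n) (deriv (power_series a)) 0"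
        by (rule higher_deriv_transform_within_open[OF p1 holomorphic_deriv[OF power_series_holomorphic[OF a] open_ball] open_ball])
           (use DERIV_imp_deriv[OF ad] in auto)
      then show ?thesis by simp
    qed
    also have "\<dots> = diffs a n"
      unfolding taylor_coeff_deriv taylor_coeff_power_series[OF a] diffs_def ..
    finally show ?thesis
      using laurent_coefficient[OF s0(1) _ \<rho>(2) p1 l eq, of n] \<rho> s by simp
  qed
  show ?thesis by (rule that[OF a R Lh D E F])
qed

text \<open>1/z and cnj z coincide on the unit circle and differ by (1 - |z|^2)/z; the mean value
  inequality on the disc of radius 1/t gives the linear bound.\<close>

lemma reflected_difference:
  assumes L: "L holomorphic_on ball 0 R" and t: "0 < t" "t < 1" "1 / t < R"
  obtains C where "\<And>z. z \<in> annulus t \<Longrightarrow> cmod (L (1 / z) - L (cnj z)) \<le> C * (1 - cmod z)"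
proof -
  have "continuous_on (cball 0 (1 / t)) (deriv L)"
    by (rule continuous_on_subset[OF continuous_on_deriv_holomorphic[OF L open_ball]]) (use t in auto)
  then have "compact (deriv L ` cball 0 (1 / t))" by (intro compact_continuous_image) auto
  then have "bounded (deriv L ` cball 0 (1 / t))" by (rule compact_imp_bounded)
  then obtain B where B: "\<forall>z\<in>deriv L ` cball 0 (1 / t). cmod z \<le> B" unfolding bounded_iff by blast
  have B0: "0 \<le> B" using B t order_trans[OF norm_ge_zero] by (metis (no_types) centre_in_cball image_eqI divide_nonneg_pos zero_le_one)
  have "cmod (L (1 / z) - L (cnj z)) \<le> (2 * B / t) * (1 - cmod z)" if z: "z \<in> annulus t" for z
  proof -
    have z0: "z \<noteq> 0" "0 < cmod z" using z t by auto
    have "1 / cmod z \<le> 1 / t" using z t by (intro divide_left_mono mult_pos_pos) auto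
    moreover have "1 \<le> 1 / t" using t by simp
    ultimately have in1: "1 / z \<in> cball 0 (1 / t)" "cnj z \<in> cball 0 (1 / t)" using z by (auto simp: norm_divide)
    have "cmod (L (1 / z) - L (cnj z)) \<le> B * cmod (1 / z - cnj z)"
    proof (rule field_differentiable_bound[OF convex_cball _ _ in1])
      fix x assume x: "x \<in> cball (0::complex) (1 / t)"
      then have "x \<in> ball 0 R" using t by auto
      then show "(L has_field_derivative deriv L x) (at x within cball 0 (1 / t))"
        by (rule has_field_derivative_at_within[OF holomorphic_derivI[OF L open_ball]])
      show "cmod (deriv L x) \<le> B" using B x by blast
    qed
    also have "1 / z - cnj z = of_real (1 - (cmod z)\<^sup>2) / z"
    proof -
      have "1 - cnj z * z = of_real (1 - (cmod z)\<^sup>2)"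
        unfolding of_real_diff complex_norm_square by (simp add: mult.commute)
      then show ?thesis using z0 by (simp add: field_simps)
    qed
    also have "B * cmod (of_real (1 - (cmod z)\<^sup>2) / z) = B * ((1 + cmod z) * (1 - cmod z) / cmod z)"
    proof -
      have "0 \<le> (1 + cmod z) * (1 - cmod z)" using z by auto
      moreover have "1 - (cmod z)\<^sup>2 = (1 + cmod z) * (1 - cmod z)" by (simp add: power2_eq_square algebra_simps)
      ultimately show ?thesis by (simp add: norm_divide del: of_real_diff of_real_mult)
    qed
    also have "\<dots> \<le> B * (2 * (1 - cmod z) / t)"
      using z t B0 by (intro mult_left_mono frac_le mult_right_mono) auto
    also have "\<dots> = (2 * B / t) * (1 - cmod z)" by simp
    finally show ?thesis .
  qed
  then show ?thesis using that by blast
qed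

text \<open>This is 2 ln |z|, written without the modulus so that it is differentiated directly; its
  coefficients in \<open>harmonic_pair\<close> form are both 1/z.\<close>

lemma has_derivative_log_norm:
  assumes "z \<noteq> 0"
  shows "((\<lambda>z. of_real (ln ((Re z)\<^sup>2 + (Im z)\<^sup>2))) has_derivative (\<lambda>w. w / z + cnj (w / z))) (at z)"
proof -
  have pos: "0 < (Re z)\<^sup>2 + (Im z)\<^sup>2" using assms by (simp add: complex_neq_0)
  have "((\<lambda>z. ln ((Re z)\<^sup>2 + (Im z)\<^sup>2)) has_derivative
      (\<lambda>w. (2 * Re z * Re w + 2 * Im z * Im w) / ((Re z)\<^sup>2 + (Im z)\<^sup>2))) (at z)"
    using pos by (auto intro!: derivative_eq_intros simp: field_simps)
  then have "((\<lambda>z. complex_of_real (ln ((Re z)\<^sup>2 + (Im z)\<^sup>2))) has_derivative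
      (\<lambda>w. of_real ((2 * Re z * Re w + 2 * Im z * Im w) / ((Re z)\<^sup>2 + (Im z)\<^sup>2)))) (at z)"
    by (rule has_derivative_of_real)
  moreover have "w / z + cnj (w / z) = of_real ((2 * Re z * Re w + 2 * Im z * Im w) / ((Re z)\<^sup>2 + (Im z)\<^sup>2))" for w
    unfolding complex_add_cnj by (simp add: Re_divide algebra_simps add_divide_distrib)
  ultimately show ?thesis by simp
qed

text \<open>The residues c and d of p and q obstruct primitives, but u returns to its value after
  one turn, so c = cnj d and the two terms combine into c ln |z|^2. What is left has zero derivative
  on a connected annulus. The constant C adds the two reflection errors and the logarithm, for which
  -ln |z| <= (1 - |z|)/t.\<close>

lemma annulus_decomposition:
  assumes r: "0 \<le> r" "r < 1" and u: "harmonic_pair (annulus r) u p q"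
    and finp: "square_integral (annulus r) p < \<infinity>"
    and finq: "square_integral (annulus r) q < \<infinity>"
  obtains t C a b where "r < t" "t < 1" "dirichlet_coeffs a" "dirichlet_coeffs b"
    "\<And>z. z \<in> annulus t \<Longrightarrow> cmod (u z - (power_series a z + cnj (power_series b z))) \<le> C * (1 - cmod z)"
    "square_integral (ball 0 1) (deriv (power_series a)) < \<infinity>"
    "square_integral (ball 0 1) (deriv (power_series b)) < \<infinity>"
proof -
  obtain t where t: "r < t" "t < 1" using r dense by blast
  have t0: "0 < t" using r t by simp
  have hp: "p holomorphic_on annulus r" and hq: "q holomorphic_on annulus r"
    and du: "\<And>z. z \<in> annulus r \<Longrightarrow> (u has_derivative (\<lambda>w. p z * w + cnj (q z * w))) (at z)"
    using u unfolding harmonic_pair_def by blast+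
  show ?thesis
  proof (rule annulus_bergman[OF r(1) t hp finp])
  fix a0 L R c K1 assume a0: "dirichlet_coeffs a0" and R: "1 / t < R" and L: "L holomorphic_on ball 0 R"
    and aD: "\<And>z. z \<in> annulus t \<Longrightarrow> ((\<lambda>z. power_series a0 z - L (1 / z)) has_field_derivative (p z - c / z)) (at z)"
    and aK: "\<And>z. z \<in> annulus t \<Longrightarrow> cmod (p z - power_series (diffs a0) z) \<le> K1"
    and "\<And>\<rho> n. t < \<rho> \<Longrightarrow> \<rho> < 1 \<Longrightarrow>
       contour_integral (circlepath 0 \<rho>) (\<lambda>w. p w / w ^ Suc n) = 2 * of_real pi * \<i> * diffs a0 n"
  show ?thesis
  proof (rule annulus_bergman[OF r(1) t hq finq])
  fix b0 M R' d K2 assume b0: "dirichlet_coeffs b0" and R': "1 / t < R'" and M: "M holomorphic_on ball 0 R'"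
    and bD: "\<And>z. z \<in> annulus t \<Longrightarrow> ((\<lambda>z. power_series b0 z - M (1 / z)) has_field_derivative (q z - d / z)) (at z)"
    and bK: "\<And>z. z \<in> annulus t \<Longrightarrow> cmod (q z - power_series (diffs b0) z) \<le> K2"
    and "\<And>\<rho> n. t < \<rho> \<Longrightarrow> \<rho> < 1 \<Longrightarrow>
       contour_integral (circlepath 0 \<rho>) (\<lambda>w. q w / w ^ Suc n) = 2 * of_real pi * \<i> * diffs b0 n"
  have R1: "1 < R" "1 < R'" using R R' t t0 less_trans[of 1 "1 / t"] by auto
  define u0 where "u0 = (\<lambda>z. u z - (power_series a0 z - L (1 / z)) - cnj (power_series b0 z - M (1 / z)))"
  have du0: "(u0 has_derivative (\<lambda>w. c * (w / z) + cnj (d * (w / z)))) (at z)" if z: "z \<in> annulus t" for z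
  proof -
    have "(u0 has_derivative (\<lambda>w. (p z * w + cnj (q z * w)) - (p z - c / z) * w - cnj ((q z - d / z) * w))) (at z)"
      unfolding u0_def
      by (intro has_derivative_diff has_derivative_cnj du aD[OF z, unfolded has_field_derivative_def] bD[OF z, unfolded has_field_derivative_def])
         (use z t in auto)
    moreover have "(p z * w + cnj (q z * w)) - (p z - c / z) * w - cnj ((q z - d / z) * w) = c * (w / z) + cnj (d * (w / z))" for w
      by (simp add: algebra_simps)
    ultimately show ?thesis by simp
  qed
  \<comment> \<open>\<open>u0\<close> is single-valued along a circle.\<close>
  have cd: "c = cnj d"
  proof -
    obtain \<rho> where \<rho>: "t < \<rho>" "\<rho> < 1" using t dense by blast
    have \<rho>0: "0 < \<rho>" using \<rho> t0 by simp
    define D where "D = c * \<i> + cnj (d * \<i>)"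
    have "((\<lambda>\<theta>. u0 (of_real \<rho> * cis \<theta>)) has_vector_derivative D) (at \<theta> within {0..2*pi})" for \<theta>
    proof -
      have in_ann: "of_real \<rho> * cis \<theta> \<in> annulus t" using \<rho> \<rho>0 by (simp add: norm_mult)
      have "((\<lambda>\<theta>. of_real \<rho> * cis \<theta>) has_vector_derivative (of_real \<rho> * (\<i> * cis \<theta>))) (at \<theta> within {0..2*pi})"
        by (auto intro!: derivative_eq_intros simp: has_vector_derivative_def cis.code scaleR_conv_of_real Complex_eq algebra_simps)
      then have "((\<lambda>\<theta>. of_real \<rho> * cis \<theta>) has_derivative (\<lambda>x. x *\<^sub>R (of_real \<rho> * (\<i> * cis \<theta>)))) (at \<theta> within {0..2*pi})"
        by (simp add: has_vector_derivative_def)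
      from has_derivative_compose[OF this du0[OF in_ann]]
      have "((\<lambda>\<theta>. u0 (of_real \<rho> * cis \<theta>)) has_derivative
        (\<lambda>x. c * (x *\<^sub>R (of_real \<rho> * (\<i> * cis \<theta>)) / (of_real \<rho> * cis \<theta>)) + cnj (d * (x *\<^sub>R (of_real \<rho> * (\<i> * cis \<theta>)) / (of_real \<rho> * cis \<theta>))))) (at \<theta> within {0..2*pi})" .
      moreover have "x *\<^sub>R (of_real \<rho> * (\<i> * cis \<theta>)) / (of_real \<rho> * cis \<theta>) = of_real x * \<i>" for x
        using \<rho>0 by (simp add: scaleR_conv_of_real)
      ultimately show ?thesis
        unfolding has_vector_derivative_def D_def by (simp add: scaleR_conv_of_real algebra_simps)
    qed
    then have "((\<lambda>_. D) has_integral (u0 (of_real \<rho> * cis (2*pi)) - u0 (of_real \<rho> * cis 0))) {0..2*pi}"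
      by (intro fundamental_theorem_of_calculus) auto
    then have "((\<lambda>_. D) has_integral 0) {0..2*pi}" by simp
    moreover have "((\<lambda>_. D) has_integral ((2*pi) *\<^sub>R D)) {0..2*pi}"
      using has_integral_const_real[of D 0 "2*pi"] by simp
    ultimately have "(2*pi) *\<^sub>R D = 0" by (rule has_integral_unique[symmetric])
    then have "D = 0" by simp
    then have "(c - cnj d) * \<i> = 0" by (simp add: D_def algebra_simps)
    then show ?thesis by simp
  qed
  define w0 where "w0 = (\<lambda>z. u0 z - c * of_real (ln ((Re z)\<^sup>2 + (Im z)\<^sup>2)))"
  have dw0: "(w0 has_derivative (\<lambda>w. 0)) (at z)" if z: "z \<in> annulus t" for z
  proof -
    have z0: "z \<noteq> 0" using z t0 by auto
    have "(w0 has_derivative (\<lambda>w. (c * (w / z) + cnj (d * (w / z))) - c * (w / z + cnj (w / z)))) (at z)"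
      unfolding w0_def by (intro has_derivative_diff has_derivative_mult_right du0 z has_derivative_log_norm z0)
    moreover have "(c * (w / z) + cnj (d * (w / z))) - c * (w / z + cnj (w / z)) = 0" for w
      by (simp add: cd algebra_simps)
    ultimately show ?thesis by simp
  qed
  obtain \<rho> where \<rho>: "t < \<rho>" "\<rho> < 1" using t dense by blast
  define K0 where "K0 = w0 (of_real \<rho>)"
  have w0: "w0 z = K0" if z: "z \<in> annulus t" for z
    unfolding K0_def
  proof (rule has_derivative_zero_unique_connected[OF open_annulus _ dw0 z])
    show "connected (annulus t)" using connected_annulus(1)[where 'N=complex, of t 0 1] by simp
  qed (use \<rho> t0 in auto)
  \<comment> \<open>On the unit circle \<open>1 / z = cnj z\<close>, so \<open>kM\<close> and \<open>cnj kL\<close> replace \<open>K0 - cnj (M (1 / z))\<close> and \<open>- L (1 / z)\<close>.\<close>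
  define kM where "kM = (\<lambda>z. K0 - cnj (M (cnj z)))"
  define kL where "kL = (\<lambda>z. - cnj (L (cnj z)))"
  have refl: "(\<lambda>z. cnj (X (cnj z))) holomorphic_on ball 0 Y" if "X holomorphic_on ball 0 Y" for X Y
  proof -
    have "cnj ` ball 0 Y = ball 0 Y"
    proof (intro equalityI subsetI)
      fix z assume "z \<in> ball (0::complex) Y"
      then show "z \<in> cnj ` ball 0 Y" by (intro image_eqI[of _ _ "cnj z"]) auto
    qed auto
    then have "cnj \<circ> X \<circ> cnj holomorphic_on ball 0 Y" using that by (intro holomorphic_on_compose_cnj_cnj) auto
    then show ?thesis by (simp add: o_def)
  qed
  have kM: "kM holomorphic_on ball 0 R'" unfolding kM_def by (intro holomorphic_intros refl M)
  have kL: "kL holomorphic_on ball 0 R" unfolding kL_def by (intro holomorphic_intros refl L)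
  have sub: "ball 0 1 \<subseteq> ball (0::complex) R" "ball 0 1 \<subseteq> ball (0::complex) R'" using R1 by auto
  define a where "a = (\<lambda>n. a0 n + 1 * taylor_coeff kM n)"
  define b where "b = (\<lambda>n. b0 n + 1 * taylor_coeff kL n)"
  note dM = dirichlet_coeffs_larger_disc[OF kM R1(2)] and dL = dirichlet_coeffs_larger_disc[OF kL R1(1)]
  have a: "dirichlet_coeffs a" and b: "dirichlet_coeffs b"
    unfolding a_def b_def by (rule dirichlet_coeffs_lincomb a0 b0 dM dL)+
  have pa: "power_series a z = power_series a0 z + kM z" if "cmod z < 1" for z
    unfolding a_def dirichlet_coeffs_lincomb(2)[OF a0 dM that]
    using taylor_power_series[OF holomorphic_on_subset[OF kM sub(2)] that] by simp
  have pb: "power_series b z = power_series b0 z + kL z" if "cmod z < 1" for z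
    unfolding b_def dirichlet_coeffs_lincomb(2)[OF b0 dL that]
    using taylor_power_series[OF holomorphic_on_subset[OF kL sub(1)] that] by simp
  obtain C1 where C1: "\<And>z. z \<in> annulus t \<Longrightarrow> cmod (L (1 / z) - L (cnj z)) \<le> C1 * (1 - cmod z)"
    by (rule reflected_difference[OF L t0 t(2) R]) blast
  obtain C2 where C2: "\<And>z. z \<in> annulus t \<Longrightarrow> cmod (M (1 / z) - M (cnj z)) \<le> C2 * (1 - cmod z)"
    by (rule reflected_difference[OF M t0 t(2) R']) blast
  have diff: "cmod (u z - (power_series a z + cnj (power_series b z))) \<le> (C1 + C2 + cmod c * (2 / t)) * (1 - cmod z)"
    if z: "z \<in> annulus t" for z
  proof -
    have zpos: "0 < cmod z" "t < cmod z" "cmod z < 1" using z t0 by auto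
    define \<Lambda> where "\<Lambda> = ln ((Re z)\<^sup>2 + (Im z)\<^sup>2)"
    have "\<Lambda> = ln ((cmod z)\<^sup>2)" by (simp add: \<Lambda>_def cmod_power2)
    also have "\<dots> = 2 * ln (cmod z)" using zpos by (simp add: ln_realpow)
    finally have \<Lambda>: "\<Lambda> = 2 * ln (cmod z)" .
    have "- ln (cmod z) = ln (1 / cmod z)" using zpos by (simp add: ln_div)
    also have "\<dots> \<le> 1 / cmod z - 1" by (rule ln_le_minus_one) (use zpos in simp)
    also have "\<dots> = (1 - cmod z) / cmod z" using zpos by (simp add: field_simps)
    also have "\<dots> \<le> (1 - cmod z) / t" using zpos t0 by (intro divide_left_mono mult_pos_pos) auto
    finally have "- ln (cmod z) \<le> (1 - cmod z) / t" .
    moreover have "ln (cmod z) \<le> 0" using zpos by simp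
    moreover have "\<bar>2 * l\<bar> \<le> 2 * X" if "- l \<le> X" "l \<le> 0" for l X :: real using that by simp
    ultimately have "\<bar>\<Lambda>\<bar> \<le> 2 * ((1 - cmod z) / t)" unfolding \<Lambda> by blast
    then have \<Lambda>le: "\<bar>\<Lambda>\<bar> \<le> 2 / t * (1 - cmod z)" by simp
    have "u0 z - c * of_real \<Lambda> = K0" using w0[OF z] by (simp add: w0_def \<Lambda>_def)
    then have "u z - (power_series a z + cnj (power_series b z)) = - (L (1 / z) - L (cnj z)) - cnj (M (1 / z) - M (cnj z)) + c * of_real \<Lambda>"
      unfolding u0_def pa[OF zpos(3)] pb[OF zpos(3)] kM_def kL_def by (simp add: algebra_simps)
    also have "cmod \<dots> \<le> cmod (L (1 / z) - L (cnj z)) + cmod (M (1 / z) - M (cnj z)) + cmod c * \<bar>\<Lambda>\<bar>"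
    proof -
      have "cmod (- X - cnj Y + Z) \<le> cmod X + cmod Y + cmod Z" for X Y Z
        using norm_triangle_ineq[of "- X - cnj Y" Z] norm_triangle_ineq4[of "- X" "cnj Y"] by simp
      from this[of "L (1 / z) - L (cnj z)" "M (1 / z) - M (cnj z)" "c * of_real \<Lambda>"]
      show ?thesis by (simp add: norm_mult)
    qed
    also have "\<dots> \<le> C1 * (1 - cmod z) + C2 * (1 - cmod z) + cmod c * (2 / t * (1 - cmod z))"
      by (intro add_mono C1 C2 z mult_left_mono \<Lambda>le) simp
    finally show ?thesis by (simp add: algebra_simps)
  qed
  \<comment> \<open>Stated once for both coefficient sequences: the reflected correction
    \<open>k\<close> is holomorphic beyond the circle, so the derivative of the corrected series
    differs from the square-integrable \<open>f\<close> by a bounded function near the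
    circle.\<close>
  have energy: "square_integral (ball 0 1) (deriv (power_series x)) < \<infinity>"
    if x: "dirichlet_coeffs x" and x0: "dirichlet_coeffs x0" and k: "k holomorphic_on ball 0 Y" "1 < Y"
      and px: "\<And>z. cmod z < 1 \<Longrightarrow> power_series x z = power_series x0 z + k z"
      and f: "f holomorphic_on annulus r" and fin: "square_integral (annulus r) f < \<infinity>"
      and fK: "\<And>z. z \<in> annulus t \<Longrightarrow> cmod (f z - power_series (diffs x0) z) \<le> K"
    for x x0 k Y f K
  proof -
    have "continuous_on (cball 0 1) (deriv k)"
      by (rule continuous_on_subset[OF continuous_on_deriv_holomorphic[OF k(1) open_ball]]) (use k in auto)
    then have "compact (deriv k ` cball 0 1)" by (intro compact_continuous_image) auto
    then have "bounded (deriv k ` cball 0 1)" by (rule compact_imp_bounded)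
    then obtain B where B: "\<forall>z\<in>deriv k ` cball 0 1. cmod z \<le> B" unfolding bounded_iff by blast
    have dx: "deriv (power_series x) z = power_series (diffs x0) z + deriv k z" if z: "cmod z < 1" for z
    proof -
      have "z \<in> ball 0 Y" using z k by auto
      then have "((\<lambda>z. power_series x0 z + k z) has_field_derivative (power_series (diffs x0) z + deriv k z)) (at z)"
        by (intro DERIV_add dirichlet_coeffs_DERIV[OF x0 z] holomorphic_derivI[OF k(1) open_ball])
      then have "(power_series x has_field_derivative (power_series (diffs x0) z + deriv k z)) (at z)"
        by (rule has_field_derivative_transform_within_open[OF _ open_ball, of _ _ _ 0 1]) (use z px in auto)
      then show ?thesis by (rule DERIV_imp_deriv)
    qed
    have "square_integral (annulus t) f \<le> square_integral (annulus r) f"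
      by (intro nn_integral_mono) (use t in \<open>auto simp: indicator_def\<close>)
    then have fint: "square_integral (annulus t) f < \<infinity>" using fin by (rule le_less_trans)
    show ?thesis
    proof (rule nn_integral_square_disc[OF _ _ t(2) _ fint, of _ "K + B"])
      show "deriv (power_series x) holomorphic_on ball 0 1"
        by (rule holomorphic_deriv[OF power_series_holomorphic[OF x] open_ball])
      show "f holomorphic_on annulus t" by (rule holomorphic_on_subset[OF f]) (use t in auto)
      fix z assume z: "z \<in> annulus t"
      then have "z \<in> cball 0 1" by auto
      then have bk: "cmod (deriv k z) \<le> B" using B by blast
      have eq: "deriv (power_series x) z - f z = deriv k z - (f z - power_series (diffs x0) z)"
        using dx[of z] z by simp
      show "cmod (deriv (power_series x) z - f z) \<le> K + B"
        unfolding eq using bk fK[OF z] norm_triangle_ineq4[of "deriv k z" "f z - power_series (diffs x0) z"] by linarith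
    qed (use t0 in simp)
  qed
  show ?thesis
    by (rule that[OF t a b diff energy[OF a a0 kM R1(2) pa hp finp aK] energy[OF b b0 kL R1(1) pb hq finq bK]])
  qed
  qed
qed

section \<open>Limits of integrals over circles of radius tending to 1\<close>

lemma bergman_little_o:
  assumes a: "dirichlet_coeffs a" and t: "t < 1"
    and K: "\<And>z. z \<in> annulus t \<Longrightarrow> cmod (p z - power_series (diffs a) z) \<le> K" and e: "0 < e"
  obtains d where "d > 0" "\<And>z. 1 - d < cmod z \<Longrightarrow> cmod z < 1 \<Longrightarrow> (1 - cmod z) * cmod (p z) < e"
proof -
  obtain d where d: "d > 0" "\<And>z. 1 - d < cmod z \<Longrightarrow> cmod z < 1 \<Longrightarrow> (1 - cmod z) * cmod (power_series (diffs a) z) < e / 2"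
    using little_bloch[OF a, of "e / 2"] e by auto
  define d' where "d' = min d (min (1 - t) (e / (2 * (\<bar>K\<bar> + 1))))"
  have "d' > 0" using d(1) t e by (simp add: d'_def)
  moreover have "(1 - cmod z) * cmod (p z) < e" if z: "1 - d' < cmod z" "cmod z < 1" for z
  proof -
    have z': "1 - d < cmod z" "z \<in> annulus t" "1 - cmod z < e / (2 * (\<bar>K\<bar> + 1))" using z by (auto simp: d'_def)
    have "cmod (p z) \<le> cmod (power_series (diffs a) z) + (\<bar>K\<bar> + 1)"
      using K[OF z'(2)] norm_triangle_ineq2[of "p z" "power_series (diffs a) z"] by simp
    then have "(1 - cmod z) * cmod (p z) \<le> (1 - cmod z) * cmod (power_series (diffs a) z) + (1 - cmod z) * (\<bar>K\<bar> + 1)"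
      using z by (simp add: distrib_left[symmetric] mult_left_mono)
    also have "(1 - cmod z) * (\<bar>K\<bar> + 1) < e / 2" using z'(3) by (simp add: field_simps)
    finally show ?thesis using d(2)[OF z'(1) z(2)] by simp
  qed
  ultimately show ?thesis using that by blast
qed

text \<open>Absolute summability gives uniform convergence on the closed unit interval, hence
  continuity at its right end point.\<close>

lemma abel_limit_absolute:
  fixes d :: "nat \<Rightarrow> complex"
  assumes "summable (\<lambda>n. cmod (d n))"
  shows "((\<lambda>x. \<Sum>n. d n * of_real x ^ n) \<longlongrightarrow> (\<Sum>n. d n)) (at_left (1::real))"
proof -
  have "uniform_limit {0..1} (\<lambda>n x. \<Sum>i<n. d i * of_real x ^ i) (\<lambda>x. \<Sum>i. d i * of_real x ^ i) sequentially"
    by (rule Weierstrass_m_test[OF _ assms]) (auto simp: norm_mult norm_power mult_left_le power_le_one)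
  then have "continuous_on {0..1} (\<lambda>x::real. \<Sum>i. d i * of_real x ^ i)"
    by (rule uniform_limit_theorem[rotated]) (auto intro!: always_eventually continuous_intros)
  then have "((\<lambda>x. \<Sum>n. d n * of_real x ^ n) \<longlongrightarrow> (\<Sum>n. d n * of_real 1 ^ n)) (at (1::real) within {0..1})"
    unfolding continuous_on_def by (rule bspec) simp
  then show ?thesis by (simp add: at_within_Icc_at_left)
qed

lemma contour_integrable_circle:
  assumes "continuous_on S g" "sphere 0 \<rho> \<subseteq> S" "0 \<le> \<rho>"
  shows "g contour_integrable_on (circlepath 0 \<rho>)"
  by (rule contour_integrable_continuous_circlepath)
     (use assms in \<open>auto intro: continuous_on_subset simp: path_image_circlepath\<close>)

text \<open>On the circle of radius \<rho>, cnj w = \<rho>^2 / w. Each antiholomorphic term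
  therefore becomes a coefficient integral of \<beta> times a power of \<rho>^2, and the series
  converges uniformly on the circle.\<close>

lemma cnj_power_series_contour_sums:
  assumes \<rho>: "0 < \<rho>" "\<rho> < 1" and b: "dirichlet_coeffs b" and \<beta>: "continuous_on (sphere 0 \<rho>) \<beta>"
  shows "(\<lambda>n. cnj (b n) * contour_integral (circlepath 0 \<rho>) (\<lambda>w. \<beta> w / w ^ n) * of_real (\<rho>\<^sup>2) ^ n) sums
    contour_integral (circlepath 0 \<rho>) (\<lambda>w. \<beta> w * cnj (power_series b w))"
proof -
  define f where "f = (\<lambda>n w. \<beta> w * cnj (b n * w ^ n))"
  have "compact (\<beta> ` sphere 0 \<rho>)" by (intro compact_continuous_image \<beta>) simp
  then have "bounded (\<beta> ` sphere 0 \<rho>)" by (rule compact_imp_bounded)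
  then obtain B where B: "\<forall>z\<in>\<beta> ` sphere 0 \<rho>. cmod z \<le> B" unfolding bounded_iff by blast
  have B0: "cmod (f n w) \<le> B * cmod (b n * of_real \<rho> ^ n)" if "w \<in> sphere 0 \<rho>" for n w
  proof -
    have "cmod (\<beta> w) \<le> B" using B that by blast
    then show ?thesis using that \<rho> by (simp add: f_def norm_mult norm_power mult_right_mono)
  qed
  have sB: "summable (\<lambda>n. B * cmod (b n * of_real \<rho> ^ n))"
    by (intro summable_mult dirichlet_coeffs_summable[OF b]) (use \<rho> in simp)
  have ul0: "uniform_limit (sphere 0 \<rho>) (\<lambda>N w. \<Sum>n<N. f n w) (\<lambda>w. \<Sum>n. f n w) sequentially"
    by (rule Weierstrass_m_test[OF B0 sB])
  have feq: "(\<Sum>n. f n w) = \<beta> w * cnj (power_series b w)" if "w \<in> sphere 0 \<rho>" for w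
  proof -
    have "(\<lambda>n. f n w) sums (\<beta> w * cnj (power_series b w))"
      unfolding f_def by (intro sums_mult sums_cnj[THEN iffD2] dirichlet_coeffs_sums[OF b]) (use that \<rho> in auto)
    then show ?thesis by (simp add: sums_iff)
  qed
  have ul: "uniform_limit (sphere 0 \<rho>) (\<lambda>N w. \<Sum>n<N. f n w) (\<lambda>w. \<beta> w * cnj (power_series b w)) sequentially"
    by (rule iffD1[OF uniform_limit_cong'[OF refl feq] ul0])
  have cf: "continuous_on (sphere 0 \<rho>) (f n)" for n
    unfolding f_def by (intro continuous_intros \<beta>)
  have fi: "f n contour_integrable_on (circlepath 0 \<rho>)" for n
    by (rule contour_integrable_circle[OF cf order_refl]) (use \<rho> in simp)
  have "(\<lambda>N. contour_integral (circlepath 0 \<rho>) (\<lambda>w. \<Sum>n<N. f n w)) \<longlonglongrightarrow> contour_integral (circlepath 0 \<rho>) (\<lambda>w. \<beta> w * cnj (power_series b w))"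
    by (rule contour_integral_uniform_limit_circlepath(2)[OF _ ul]) (use \<rho> fi in \<open>auto intro!: always_eventually contour_integrable_sum\<close>)
  moreover have "contour_integral (circlepath 0 \<rho>) (\<lambda>w. \<Sum>n<N. f n w) =
     (\<Sum>n<N. cnj (b n) * contour_integral (circlepath 0 \<rho>) (\<lambda>w. \<beta> w / w ^ n) * of_real (\<rho>\<^sup>2) ^ n)" for N
  proof -
    have "contour_integral (circlepath 0 \<rho>) (f n) = cnj (b n) * contour_integral (circlepath 0 \<rho>) (\<lambda>w. \<beta> w / w ^ n) * of_real (\<rho>\<^sup>2) ^ n" for n
    proof -
      have "contour_integral (circlepath 0 \<rho>) (f n) = contour_integral (circlepath 0 \<rho>) (\<lambda>w. (cnj (b n) * of_real (\<rho>\<^sup>2) ^ n) * (\<beta> w / w ^ n))"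
      proof (rule contour_integral_cong[OF refl])
        fix w assume "w \<in> path_image (circlepath 0 \<rho>)"
        then have w: "cmod w = \<rho>" "w \<noteq> 0" using \<rho> by (auto simp: path_image_circlepath)
        have "cnj w = of_real (\<rho>\<^sup>2) / w"
          using w complex_norm_square[of w] by (simp add: field_simps)
        then show "f n w = (cnj (b n) * of_real (\<rho>\<^sup>2) ^ n) * (\<beta> w / w ^ n)"
          by (simp add: f_def power_divide)
      qed
      also have "\<dots> = (cnj (b n) * of_real (\<rho>\<^sup>2) ^ n) * contour_integral (circlepath 0 \<rho>) (\<lambda>w. \<beta> w / w ^ n)"
      proof (rule contour_integral_lmul, rule contour_integrable_circle)
        show "continuous_on (sphere 0 \<rho>) (\<lambda>w. \<beta> w / w ^ n)" by (intro continuous_intros \<beta>) (use \<rho> in auto)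
      qed (use \<rho> in auto)
      finally show ?thesis by (simp add: ac_simps)
    qed
    then show ?thesis by (subst contour_integral_sum) (auto simp: fi)
  qed
  ultimately show ?thesis unfolding sums_def by simp
qed

text \<open>The coefficients paired with cnj(b_n) are those of the regular part of \<beta>, namely n
  c_n up to 2 pi i. Two Dirichlet sequences make sum n |b_n| |c_n| finite by Cauchy-Schwarz, which
  is the point where both finite-energy assumptions meet.\<close>

lemma circle_contour_limit:
  assumes r: "0 \<le> r" "r < 1" and \<beta>: "\<beta> holomorphic_on annulus r"
    and fin: "square_integral (annulus r) \<beta> < \<infinity>"
    and a: "dirichlet_coeffs a" and b: "dirichlet_coeffs b"
    and u: "continuous_on (annulus r) u" and t: "t < 1"
    and C: "\<And>z. z \<in> annulus t \<Longrightarrow> cmod (u z - (power_series a z + cnj (power_series b z))) \<le> C * (1 - cmod z)"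
  obtains L where
    "((\<lambda>s. contour_integral (circlepath 0 s) (\<lambda>z. \<beta> z * (power_series a z + cnj (power_series b z)))) \<longlongrightarrow> L) (at_left 1)"
    "((\<lambda>s. contour_integral (circlepath 0 s) (\<lambda>z. \<beta> z * u z)) \<longlongrightarrow> L) (at_left 1)"
proof -
  define v where "v = (\<lambda>z. power_series a z + cnj (power_series b z))"
  obtain t' where t': "r < t'" "t' < 1" using r dense by blast
  have t'0: "0 < t'" using t' r by simp
  have ca: "continuous_on (ball 0 1) (power_series a)" "continuous_on (ball 0 1) (power_series b)"
    using power_series_holomorphic a b by (auto intro: holomorphic_on_imp_continuous_on)
  have cv: "continuous_on (ball 0 1) v" unfolding v_def by (intro continuous_intros ca)
  have c\<beta>: "continuous_on (annulus r) \<beta>" by (rule holomorphic_on_imp_continuous_on[OF \<beta>])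
  show ?thesis
  proof (rule annulus_bergman[OF r(1) t' \<beta> fin])
    fix c and l :: "complex \<Rightarrow> complex" and R :: real and c0 :: complex and K
    assume c: "dirichlet_coeffs c"
      and K: "\<And>z. z \<in> annulus t' \<Longrightarrow> cmod (\<beta> z - power_series (diffs c) z) \<le> K"
      and coeff: "\<And>\<rho> n. t' < \<rho> \<Longrightarrow> \<rho> < 1 \<Longrightarrow>
        contour_integral (circlepath 0 \<rho>) (\<lambda>w. \<beta> w / w ^ Suc n) = 2 * of_real pi * \<i> * diffs c n"
    define \<rho>0 where "\<rho>0 = (t' + 1) / 2"
    have \<rho>0: "t' < \<rho>0" "\<rho>0 < 1" "0 < \<rho>0" using t' t'0 by (auto simp: \<rho>0_def)
    define \<kappa> where "\<kappa> = contour_integral (circlepath 0 \<rho>0) (\<lambda>z. \<beta> z * power_series a z)"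
    define \<kappa>0 where "\<kappa>0 = contour_integral (circlepath 0 \<rho>0) \<beta>"
    \<comment> \<open>For n >= 1 the integral of \<beta>/w^n is a Taylor coefficient of the regular
      part; for n = 0 it is 2 pi i times the residue of the principal part, hence the separate
      constant \<open>\<kappa>0\<close>.\<close>
    define d where "d = (\<lambda>n. cnj (b n) * (case n of 0 \<Rightarrow> \<kappa>0 | Suc m \<Rightarrow> 2 * of_real pi * \<i> * diffs c m))"
    have sph: "sphere 0 s \<subseteq> annulus r" "sphere 0 s \<subseteq> ball (0::complex) 1" if "t' < s" "s < 1" for s
      using that t' by auto
    have I1: "contour_integral (circlepath 0 s) (\<lambda>z. \<beta> z * power_series a z) = \<kappa>" if s: "t' < s" "s < 1" for s
      unfolding \<kappa>_def
    proof (rule contour_integral_circle_indep[of _ r 1])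
      show "(\<lambda>z. \<beta> z * power_series a z) holomorphic_on annulus r"
        by (intro holomorphic_intros \<beta> holomorphic_on_subset[OF power_series_holomorphic[OF a]]) auto
    qed (use s \<rho>0 t' t'0 in auto)
    have I0: "contour_integral (circlepath 0 s) \<beta> = \<kappa>0" if s: "t' < s" "s < 1" for s
      unfolding \<kappa>0_def by (rule contour_integral_circle_indep[of _ r 1, OF \<beta>]) (use s \<rho>0 t' t'0 in auto)
    have I2: "contour_integral (circlepath 0 s) (\<lambda>z. \<beta> z * cnj (power_series b z)) = (\<Sum>n. d n * of_real (s\<^sup>2) ^ n)"
      if s: "t' < s" "s < 1" for s
    proof -
      have "(\<lambda>n. cnj (b n) * contour_integral (circlepath 0 s) (\<lambda>w. \<beta> w / w ^ n) * of_real (s\<^sup>2) ^ n) sums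
        contour_integral (circlepath 0 s) (\<lambda>w. \<beta> w * cnj (power_series b w))"
        by (rule cnj_power_series_contour_sums[OF _ s(2) b continuous_on_subset[OF c\<beta> sph(1)[OF s]]]) (use s t'0 in simp)
      moreover have "cnj (b n) * contour_integral (circlepath 0 s) (\<lambda>w. \<beta> w / w ^ n) = d n" for n
        using coeff[OF s] I0[OF s] by (cases n) (auto simp: d_def)
      ultimately show ?thesis by (simp add: sums_iff)
    qed
    have "summable (\<lambda>n. cmod (d n))"
    proof (subst summable_Suc_iff[symmetric])
      have sq: "summable (\<lambda>n. (sqrt (real n) * cmod (x n))\<^sup>2)" if "dirichlet_coeffs x" for x
        using that by (simp add: dirichlet_coeffs_def power_mult_distrib)
      have "summable (\<lambda>n. \<bar>(sqrt (real n) * cmod (b n)) * (sqrt (real n) * cmod (c n))\<bar>)"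
        by (rule cauchy_schwarz_series(1)[OF sq[OF b] sq[OF c]])
      then have "summable (\<lambda>n. real n * (cmod (b n) * cmod (c n)))"
        by (rule summable_cong[THEN iffD1, rotated]) (auto intro!: always_eventually simp: abs_mult)
      then have "summable (\<lambda>n. real (Suc n) * (cmod (b (Suc n)) * cmod (c (Suc n))))"
        by (subst summable_Suc_iff)
      then have "summable (\<lambda>n. 2 * pi * (real (Suc n) * (cmod (b (Suc n)) * cmod (c (Suc n)))))" by (rule summable_mult)
      moreover have "cmod (d (Suc n)) = 2 * pi * (real (Suc n) * (cmod (b (Suc n)) * cmod (c (Suc n))))" for n
      proof -
        have "cmod (diffs c n) = real (Suc n) * cmod (c (Suc n))" unfolding diffs_def norm_mult norm_of_nat ..
        then show ?thesis by (simp add: d_def norm_mult del: of_nat_Suc)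
      qed
      ultimately show "summable (\<lambda>n. cmod (d (Suc n)))" by simp
    qed
    note abel = abel_limit_absolute[OF this]
    have ev: "\<forall>\<^sub>F s in at_left 1. t' < s \<and> s < (1::real)"
      by (rule eventually_at_left_field[THEN iffD2]) (use t' in \<open>auto intro!: exI[of _ t']\<close>)
    have "filterlim (\<lambda>s::real. s\<^sup>2) (at_left 1) (at_left 1)"
      unfolding filterlim_at
    proof
      show "\<forall>\<^sub>F s in at_left 1. s\<^sup>2 \<in> {..<1} \<and> s\<^sup>2 \<noteq> (1::real)"
        using ev by eventually_elim (use t'0 in \<open>auto simp: abs_square_less_1 power2_eq_1_iff\<close>)
      have "((\<lambda>s::real. s\<^sup>2) \<longlongrightarrow> 1\<^sup>2) (at_left 1)" by (intro tendsto_intros)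
      then show "((\<lambda>s::real. s\<^sup>2) \<longlongrightarrow> 1) (at_left 1)" by simp
    qed
    from filterlim_compose[OF abel this]
    have lim2: "((\<lambda>s. \<Sum>n. d n * of_real (s\<^sup>2) ^ n) \<longlongrightarrow> (\<Sum>n. d n)) (at_left 1)" .
    define L where "L = \<kappa> + (\<Sum>n. d n)"
    have "((\<lambda>s. \<kappa> + (\<Sum>n. d n * of_real (s\<^sup>2) ^ n)) \<longlongrightarrow> L) (at_left 1)"
      unfolding L_def by (intro tendsto_add tendsto_const lim2)
    then have limv: "((\<lambda>s. contour_integral (circlepath 0 s) (\<lambda>z. \<beta> z * v z)) \<longlongrightarrow> L) (at_left 1)"
    proof (rule Lim_transform_eventually)
      show "\<forall>\<^sub>F s in at_left 1. \<kappa> + (\<Sum>n. d n * of_real (s\<^sup>2) ^ n) = contour_integral (circlepath 0 s) (\<lambda>z. \<beta> z * v z)"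
        using ev
      proof eventually_elim
        case (elim s)
        have i1: "(\<lambda>z. \<beta> z * power_series a z) contour_integrable_on circlepath 0 s"
          "(\<lambda>z. \<beta> z * cnj (power_series b z)) contour_integrable_on circlepath 0 s"
          using elim t'0 sph[of s]
          by (auto intro!: contour_integrable_circle[of "sphere 0 s"] continuous_intros continuous_on_subset[OF c\<beta>] continuous_on_subset[OF ca(1)] continuous_on_subset[OF ca(2)])
        have "contour_integral (circlepath 0 s) (\<lambda>z. \<beta> z * v z) =
          contour_integral (circlepath 0 s) (\<lambda>z. \<beta> z * power_series a z + \<beta> z * cnj (power_series b z))"
          by (simp add: v_def distrib_left)
        also have "\<dots> = \<kappa> + (\<Sum>n. d n * of_real (s\<^sup>2) ^ n)"
          using elim by (subst contour_integral_add[OF i1]) (simp add: I1 I2)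
        finally show ?case by simp
      qed
    qed
    have "((\<lambda>s. contour_integral (circlepath 0 s) (\<lambda>z. \<beta> z * u z) - contour_integral (circlepath 0 s) (\<lambda>z. \<beta> z * v z)) \<longlongrightarrow> 0) (at_left 1)"
    proof (rule tendstoI)
      fix e :: real assume e: "e > 0"
      \<comment> \<open>Chosen so that the integrands differ by at most e/(4 pi); on a circle
        shorter than 2 pi the integrals then differ by less than e. Replacing C by |C| + 1 makes the
        divisor positive.\<close>
      have e': "0 < e / (4 * pi * (\<bar>C\<bar> + 1))" using e by simp
      obtain \<delta> where \<delta>: "\<delta> > 0" "\<And>z. 1 - \<delta> < cmod z \<Longrightarrow> cmod z < 1 \<Longrightarrow> (1 - cmod z) * cmod (\<beta> z) < e / (4 * pi * (\<bar>C\<bar> + 1))"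
        using bergman_little_o[OF c t'(2) K e'] by blast
      have "\<forall>\<^sub>F s in at_left 1. max t (1 - \<delta>) < s \<and> s < (1::real)"
        by (rule eventually_at_left_field[THEN iffD2]) (use t \<delta> in \<open>auto intro!: exI[of _ "max t (1 - \<delta>)"]\<close>)
      then show "\<forall>\<^sub>F s in at_left 1. dist (contour_integral (circlepath 0 s) (\<lambda>z. \<beta> z * u z) - contour_integral (circlepath 0 s) (\<lambda>z. \<beta> z * v z)) 0 < e"
        using ev
      proof eventually_elim
        case (elim s)
        then have s: "t < s" "1 - \<delta> < s" "s < 1" "t' < s" "0 < s" using t'0 by auto
        have i: "(\<lambda>z. \<beta> z * u z) contour_integrable_on circlepath 0 s" "(\<lambda>z. \<beta> z * v z) contour_integrable_on circlepath 0 s"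
          using s sph[of s]
          by (auto intro!: contour_integrable_circle[of "sphere 0 s"] continuous_intros continuous_on_subset[OF c\<beta>] continuous_on_subset[OF u] continuous_on_subset[OF cv])
        have "((\<lambda>z. \<beta> z * u z - \<beta> z * v z) has_contour_integral
          (contour_integral (circlepath 0 s) (\<lambda>z. \<beta> z * u z) - contour_integral (circlepath 0 s) (\<lambda>z. \<beta> z * v z))) (circlepath 0 s)"
          by (intro has_contour_integral_diff has_contour_integral_integral i)
        then have "cmod (contour_integral (circlepath 0 s) (\<lambda>z. \<beta> z * u z) - contour_integral (circlepath 0 s) (\<lambda>z. \<beta> z * v z)) \<le> (e / (4 * pi)) * (2 * pi * s)"
        proof (rule has_contour_integral_bound_circlepath)
          fix z assume "cmod (z - 0) = s"
          then have z: "cmod z = s" by simp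
          have "cmod (u z - v z) \<le> C * (1 - cmod z)" unfolding v_def by (rule C) (use z s in auto)
          also have "\<dots> \<le> (\<bar>C\<bar> + 1) * (1 - cmod z)" using z s by (intro mult_right_mono) auto
          finally have 1: "cmod (u z - v z) \<le> (\<bar>C\<bar> + 1) * (1 - cmod z)" .
          have "cmod (\<beta> z * u z - \<beta> z * v z) = cmod (\<beta> z) * cmod (u z - v z)" by (simp add: norm_mult[symmetric] algebra_simps)
          also have "\<dots> \<le> cmod (\<beta> z) * ((\<bar>C\<bar> + 1) * (1 - cmod z))" by (intro mult_left_mono 1) simp
          also have "\<dots> = (\<bar>C\<bar> + 1) * ((1 - cmod z) * cmod (\<beta> z))" by simp
          also have "\<dots> \<le> (\<bar>C\<bar> + 1) * (e / (4 * pi * (\<bar>C\<bar> + 1)))"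
            using \<delta>(2)[of z] z s by (intro mult_left_mono) auto
          also have "\<dots> = e / (4 * pi)"
          proof -
            have "k * (e / (4 * pi * k)) = e / (4 * pi)" if "0 < k" for k :: real using that by simp
            from this[of "\<bar>C\<bar> + 1"] show ?thesis by (metis abs_ge_zero add_nonneg_pos zero_less_one)
          qed
          finally show "cmod (\<beta> z * u z - \<beta> z * v z) \<le> e / (4 * pi)" .
        qed (use e s in auto)
        also have "\<dots> = e * s / 2" by simp
        also have "\<dots> < e" using e s by (simp add: field_simps)
        finally show ?case by simp
      qed
    qed
    from tendsto_add[OF this limv]
    have limu: "((\<lambda>s. contour_integral (circlepath 0 s) (\<lambda>z. \<beta> z * u z)) \<longlongrightarrow> L) (at_left 1)" by simp
    show ?thesis using that[of L] limu limv unfolding v_def by blast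
  qed
qed

subsection \<open>Boundary values and uniqueness\<close>

text \<open>A point z of the Stolz region at distance x from the circle is compared with a dyadic
  radial point w at comparable distance. The segment between them has length at most (M + 2) x and
  stays x away from the circle, where the derivative is at most e'/x.\<close>

lemma nontangential_power_series:
  assumes a: "dirichlet_coeffs a" and q: "cmod q = 1"
    and lim: "(\<lambda>k. power_series a (of_real (1 - (1/2) ^ k) * q)) \<longlonglongrightarrow> \<zeta>"
    and M: "1 < M"
  shows "(power_series a \<longlongrightarrow> \<zeta>) (at q within {z \<in> ball 0 1. cmod (q - z) < M * (1 - cmod z)})"
proof (rule tendstoI)
  fix e :: real assume e: "0 < e"
  define e' where "e' = e / (2 * (M + 2))"
  have e': "0 < e'" "e' * (M + 2) = e / 2" using e M by (auto simp: e'_def field_simps)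
  obtain d where d: "d > 0" "\<And>z. 1 - d < cmod z \<Longrightarrow> cmod z < 1 \<Longrightarrow> (1 - cmod z) * cmod (power_series (diffs a) z) < e'"
    using little_bloch[OF a e'(1)] by blast
  obtain k0 where k0: "\<And>k. k \<ge> k0 \<Longrightarrow> dist (power_series a (of_real (1 - (1/2) ^ k) * q)) \<zeta> < e / 2"
    using lim e unfolding lim_sequentially by (metis half_gt_zero)
  define \<delta> where "\<delta> = min (d / (M + 3)) ((1/2) ^ k0)"
  have \<delta>: "0 < \<delta>" using d(1) M by (simp add: \<delta>_def)
  have "dist (power_series a z) \<zeta> < e"
    if z: "z \<in> ball 0 1" "cmod (q - z) < M * (1 - cmod z)" and near: "dist z q < \<delta>" for z
  proof -
    define x where "x = 1 - cmod z"
    have x: "0 < x" "x \<le> 1" using z by (auto simp: x_def)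
    have "cmod q - cmod z \<le> cmod (q - z)" by (rule norm_triangle_ineq2)
    then have x\<delta>: "x < \<delta>" using near q by (simp add: x_def dist_norm norm_minus_commute)
    have ex: "\<exists>n. (1/2::real) ^ Suc n < x"
    proof -
      obtain n where "(1/2::real) ^ n < x" using real_arch_pow_inv[OF x(1), of "1/2"] by auto
      then have "(1/2::real) ^ Suc n < x" by (simp add: field_simps)
      then show ?thesis by blast
    qed
    \<comment> \<open>The dyadic scale of z: (1/2)^(k+1) < x <= (1/2)^k. The upper bound puts w
      inside radius 1 - x, the lower one keeps w within 2x of q.\<close>
    define k where "k = (LEAST n. (1/2::real) ^ Suc n < x)"
    have k1: "(1/2) ^ Suc k < x" unfolding k_def by (rule LeastI_ex[OF ex])
    have k2: "x \<le> (1/2) ^ k"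
    proof (cases k)
      case (Suc m)
      then have "\<not> (1/2::real) ^ Suc m < x" using not_less_Least[of m "\<lambda>n. (1/2::real) ^ Suc n < x"] by (simp add: k_def)
      then show ?thesis using Suc by simp
    qed (use x in simp)
    have "k0 \<le> k"
    proof (rule ccontr)
      assume "\<not> k0 \<le> k"
      then have "(1/2::real) ^ k0 \<le> (1/2) ^ Suc k" by (intro power_decreasing) auto
      then show False using k1 x\<delta> by (simp add: \<delta>_def)
    qed
    define w where "w = of_real (1 - (1/2) ^ k) * q"
    have p1: "(1/2::real) ^ k \<le> 1" by (rule power_le_one) auto
    have w: "cmod w = 1 - (1/2) ^ k" unfolding w_def norm_mult q norm_of_real using p1 by simp
    have qw: "cmod (q - w) = (1/2) ^ k"
    proof -
      have "q - w = of_real ((1/2) ^ k) * q" unfolding w_def of_real_diff by (simp add: algebra_simps)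
      then have "cmod (q - w) = cmod (of_real ((1/2) ^ k)) * cmod q" by (simp only: norm_mult)
      then show ?thesis unfolding norm_of_real q by simp
    qed
    have zw: "cmod (z - w) \<le> (M + 2) * x"
    proof -
      have "cmod (z - w) \<le> cmod (q - z) + cmod (q - w)"
        using norm_triangle_ineq4[of "q - w" "q - z"] by simp
      moreover have "(1/2) ^ k < 2 * x" using k1 by simp
      ultimately show ?thesis using z(2) qw by (simp add: x_def algebra_simps)
    qed
    have seg: "cmod y \<le> 1 - x \<and> 1 - d < cmod y" if y: "y \<in> closed_segment z w" for y
    proof
      have "y \<in> cball 0 (1 - x)"
        using y by (rule closed_segment_subset[OF _ _ convex_cball, THEN subsetD, rotated -1]) (use w k2 in \<open>auto simp: x_def\<close>)
      then show "cmod y \<le> 1 - x" by simp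
      have "cmod (z - y) \<le> cmod (z - w)"
        using segment_bound(1)[OF y] by (simp add: norm_minus_commute)
      then have "cmod z - cmod y \<le> (M + 2) * x" using zw norm_triangle_ineq2[of z y] by simp
      then have "1 - (M + 3) * x \<le> cmod y" by (simp add: x_def algebra_simps)
      moreover have "(M + 3) * x < d"
      proof -
        have "x < d / (M + 3)" using x\<delta> by (simp add: \<delta>_def)
        then show ?thesis using M by (simp add: field_simps)
      qed
      ultimately show "1 - d < cmod y" by simp
    qed
    have "cmod (power_series a z - power_series a w) \<le> e' / x * cmod (z - w)"
    proof (rule field_differentiable_bound[OF convex_closed_segment])
      fix y assume y: "y \<in> closed_segment z w"
      have y1: "cmod y < 1" using seg[OF y] x by simp
      show "(power_series a has_field_derivative power_series (diffs a) y) (at y within closed_segment z w)"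
        by (rule has_field_derivative_at_within[OF dirichlet_coeffs_DERIV[OF a y1]])
      have "x * cmod (power_series (diffs a) y) \<le> (1 - cmod y) * cmod (power_series (diffs a) y)"
        using seg[OF y] by (intro mult_right_mono) auto
      also have "\<dots> < e'" using d(2)[OF _ y1] seg[OF y] by simp
      finally show "cmod (power_series (diffs a) y) \<le> e' / x" using x by (simp add: field_simps)
    qed auto
    also have "\<dots> \<le> e' / x * ((M + 2) * x)" using e' x by (intro mult_left_mono zw) auto
    also have "\<dots> = e / 2" using e' x by simp
    finally have "dist (power_series a z) (power_series a w) \<le> e / 2" by (simp add: dist_norm)
    moreover have "dist (power_series a w) \<zeta> < e / 2" unfolding w_def by (rule k0[OF \<open>k0 \<le> k\<close>])
    ultimately show ?thesis using dist_triangle[of "power_series a z" \<zeta> "power_series a w"] by simp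
  qed
  then show "\<forall>\<^sub>F z in at q within {z \<in> ball 0 1. cmod (q - z) < M * (1 - cmod z)}. dist (power_series a z) \<zeta> < e"
    unfolding eventually_at using \<delta> by blast
qed

text \<open>On a circle a power series has only nonnegative frequencies: the coefficient formula
  evaluates these, and Cauchy's theorem makes the others vanish.\<close>

lemma integral_power_series_cis:
  assumes a: "dirichlet_coeffs a" and s: "0 < s" "s < 1"
  shows "integral {0..2*pi} (\<lambda>\<theta>. power_series a (of_real s * cis \<theta>) * cis (- real n * \<theta>)) = 2 * of_real pi * (a n * of_real s ^ n)"
    and "integral {0..2*pi} (\<lambda>\<theta>. power_series a (of_real s * cis \<theta>) * cis (real (Suc n) * \<theta>)) = 0"
proof -
  let ?P = "power_series a"
  have hP: "?P holomorphic_on ball 0 1" by (rule power_series_holomorphic[OF a])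
  have "contour_integral (circlepath 0 s) (\<lambda>w. ?P w / w ^ Suc n) = 2 * of_real pi * \<i> * taylor_coeff ?P n"
    by (rule laurent_coefficient[of "s / 2" s ?P "\<lambda>_. 0"]) (use s hP in auto)
  also have "contour_integral (circlepath 0 s) (\<lambda>w. ?P w / w ^ Suc n) =
      integral {0..2*pi} (\<lambda>\<theta>. (\<i> / of_real s ^ n) * (?P (of_real s * cis \<theta>) * cis (- real n * \<theta>)))"
    unfolding contour_integral_circle_eq
  proof (rule Henstock_Kurzweil_Integration.integral_cong)
    fix \<theta>
    have "cis (- real n * \<theta>) = 1 / cis \<theta> ^ n" using cis_inverse[of "real n * \<theta>"] by (simp add: Complex.DeMoivre divide_inverse)
    then show "?P (of_real s * cis \<theta>) / (of_real s * cis \<theta>) ^ Suc n * of_real s * \<i> * cis \<theta> =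
      (\<i> / of_real s ^ n) * (?P (of_real s * cis \<theta>) * cis (- real n * \<theta>))"
      using s by (simp add: power_mult_distrib field_simps)
  qed
  also have "\<dots> = (\<i> / of_real s ^ n) * integral {0..2*pi} (\<lambda>\<theta>. ?P (of_real s * cis \<theta>) * cis (- real n * \<theta>))" by simp
  finally show "integral {0..2*pi} (\<lambda>\<theta>. ?P (of_real s * cis \<theta>) * cis (- real n * \<theta>)) = 2 * of_real pi * (a n * of_real s ^ n)"
    unfolding taylor_coeff_power_series[OF a] using s by (simp add: field_simps)
  have "((\<lambda>w. ?P w * w ^ n) has_contour_integral 0) (circlepath 0 s)"
    by (rule Cauchy_theorem_disc_simple[of _ 0 1]) (use s hP in \<open>auto intro!: holomorphic_intros simp: path_image_circlepath\<close>)
  then have "0 = contour_integral (circlepath 0 s) (\<lambda>w. ?P w * w ^ n)" by (simp add: contour_integral_unique)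
  also have "\<dots> = integral {0..2*pi} (\<lambda>\<theta>. (\<i> * of_real s ^ Suc n) * (?P (of_real s * cis \<theta>) * cis (real (Suc n) * \<theta>)))"
    unfolding contour_integral_circle_eq
  proof (rule Henstock_Kurzweil_Integration.integral_cong)
    fix \<theta>
    show "?P (of_real s * cis \<theta>) * (of_real s * cis \<theta>) ^ n * of_real s * \<i> * cis \<theta> =
      (\<i> * of_real s ^ Suc n) * (?P (of_real s * cis \<theta>) * cis (real (Suc n) * \<theta>))"
      unfolding Complex.DeMoivre[symmetric] by (simp add: power_mult_distrib)
  qed
  also have "\<dots> = (\<i> * of_real s ^ Suc n) * integral {0..2*pi} (\<lambda>\<theta>. ?P (of_real s * cis \<theta>) * cis (real (Suc n) * \<theta>))" by simp
  finally show "integral {0..2*pi} (\<lambda>\<theta>. ?P (of_real s * cis \<theta>) * cis (real (Suc n) * \<theta>)) = 0" using s by simp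
qed

text \<open>Seven arcs of one radian cover (0, 2 pi), and uniform measure on each of them has finite
  energy.\<close>

lemma maximal_function_arc:
  assumes a: "dirichlet_coeffs a" and r: "\<And>k. 0 \<le> r k" "\<And>k::nat. r k < 1"
  shows "(\<integral>\<^sup>+\<theta>\<in>{0<..<2*pi}. (SUP k. ennreal (cmod (power_series a (of_real (r k) * cis \<theta>)))) \<partial>lborel) < \<infinity>"
proof -
  define m where "m = (\<lambda>\<theta>. SUP k. ennreal (cmod (power_series a (of_real (r k) * cis \<theta>))))"
  have [measurable]: "cis \<in> borel_measurable borel" by (intro borel_measurable_continuous_onI continuous_intros)
  have [measurable]: "(\<lambda>\<theta>. power_series a (of_real (r k) * cis \<theta>)) \<in> borel_measurable borel" for k
    by (rule borel_measurable_continuous_onI, rule circle_continuous[OF holomorphic_on_imp_continuous_on[OF power_series_holomorphic[OF a]]])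
       (use r[of k] in auto)
  have [measurable]: "m \<in> borel_measurable borel" unfolding m_def by measurable
  have arc: "(\<integral>\<^sup>+\<theta>\<in>{x..x+1}. m \<theta> \<partial>lborel) < \<infinity>" for x
  proof -
    interpret energy_measure "distr (uniform_measure lborel {x..x + 1}) borel cis" by (rule arc_energy_measure)
    have "(\<integral>\<^sup>+q. (SUP k. ennreal (cmod (power_series a (of_real (r k) * unimod q)))) \<partial>distr (uniform_measure lborel {x..x + 1}) borel cis) < \<infinity>"
      by (rule maximal_function_finite[OF a r])
    then have "(\<integral>\<^sup>+\<theta>. (SUP k. ennreal (cmod (power_series a (of_real (r k) * unimod (cis \<theta>))))) \<partial>uniform_measure lborel {x..x + 1}) < \<infinity>"
      by (subst (asm) nn_integral_distr) auto
    also have "(\<lambda>\<theta>. SUP k. ennreal (cmod (power_series a (of_real (r k) * unimod (cis \<theta>))))) = m"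
      by (simp add: m_def unimod_def)
    finally show ?thesis by (subst (asm) nn_integral_uniform_measure) (auto simp: divide_ennreal_def)
  qed
  have "(\<integral>\<^sup>+\<theta>\<in>{0<..<2*pi}. m \<theta> \<partial>lborel) \<le> (\<integral>\<^sup>+\<theta>. (\<Sum>j<7. m \<theta> * indicator {real j..real j + 1} \<theta>) \<partial>lborel)"
  proof (rule nn_integral_mono)
    fix \<theta> :: real
    show "m \<theta> * indicator {0<..<2*pi} \<theta> \<le> (\<Sum>j<7. m \<theta> * indicator {real j..real j + 1} \<theta>)"
    proof (cases "\<theta> \<in> {0<..<2*pi}")
      case True
      define j where "j = nat \<lfloor>\<theta>\<rfloor>"
      have "\<theta> < 7" using True pi_less_4 pi_approx by simp
      then have j: "j < 7" "real j \<le> \<theta>" "\<theta> \<le> real j + 1" using True unfolding j_def by (auto simp: nat_less_iff floor_less_iff) 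
      then have "m \<theta> * indicator {0<..<2*pi} \<theta> = m \<theta> * indicator {real j..real j + 1} \<theta>" using True by simp
      also have "\<dots> \<le> (\<Sum>j<7. m \<theta> * indicator {real j..real j + 1} \<theta>)"
        using j(1) by (intro member_le_sum) auto
      finally show ?thesis .
    qed simp
  qed
  also have "\<dots> = (\<Sum>j<7. \<integral>\<^sup>+\<theta>\<in>{real j..real j + 1}. m \<theta> \<partial>lborel)"
    by (subst nn_integral_sum) auto
  also have "\<dots> < \<infinity>" using arc by (simp add: infinity_ennreal_def)
  finally show ?thesis unfolding m_def .
qed

text \<open>Frequency n > 0 isolates a_n and frequency -n the conjugate of b_n. Frequency 0 yields
  only a_0 + cnj b_0 = 0, which matches the fact that the two constants are not determined
  separately by the function.\<close>

lemma radial_limit_zero_imp_zero: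
  assumes a: "dirichlet_coeffs a" and b: "dirichlet_coeffs b"
    and r: "\<And>k. 0 < r k" "\<And>k::nat. r k < 1" and lim: "r \<longlonglongrightarrow> 1"
    and AE: "AE \<theta> in lborel. (\<lambda>k. power_series a (of_real (r k) * cis \<theta>) + cnj (power_series b (of_real (r k) * cis \<theta>))) \<longlonglongrightarrow> 0"
    and z: "cmod z < 1"
  shows "power_series a z + cnj (power_series b z) = 0"
proof -
  define W where "W = (\<lambda>k \<theta>. power_series a (of_real (r k) * cis \<theta>) + cnj (power_series b (of_real (r k) * cis \<theta>)))"
  have cP: "continuous_on T (\<lambda>\<theta>. power_series x (of_real (r k) * cis \<theta>))" if "dirichlet_coeffs x" for x k T
    by (rule circle_continuous[OF holomorphic_on_imp_continuous_on[OF power_series_holomorphic[OF that]]])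
       (use r(1)[of k] r(2)[of k] in auto)
  have [measurable]: "(\<lambda>\<theta>. power_series x (of_real (r k) * cis \<theta>)) \<in> borel_measurable borel" if "dirichlet_coeffs x" for x k
    by (rule borel_measurable_continuous_onI[OF cP[OF that]])
  note [measurable] = this[OF a] this[OF b]
  have cW: "continuous_on T (W k)" for k T unfolding W_def by (intro continuous_intros cP a b)
  have [measurable]: "W k \<in> borel_measurable borel" for k by (rule borel_measurable_continuous_onI[OF cW])
  have [measurable]: "cis \<in> borel_measurable borel" by (intro borel_measurable_continuous_onI continuous_intros)
  let ?m = "\<lambda>x \<theta>. SUP k. ennreal (cmod (power_series x (of_real (r k) * cis \<theta>)))"
  let ?I = "indicator {0<..<2*pi} :: real \<Rightarrow> ennreal"
  define w where "w = (\<lambda>\<theta>. ?m a \<theta> * ?I \<theta> + ?m b \<theta> * ?I \<theta>)"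
  have [measurable]: "w \<in> borel_measurable borel" unfolding w_def by measurable
  have "(\<lambda>k. \<integral>\<^sup>+\<theta>. ennreal (cmod (W k \<theta>)) * ?I \<theta> \<partial>lborel) \<longlonglongrightarrow> (\<integral>\<^sup>+(\<theta>::real). 0 \<partial>lborel)"
  proof (rule nn_integral_dominated_convergence[of _ _ _ w])
    have "(\<integral>\<^sup>+\<theta>. ?m a \<theta> * ?I \<theta> + ?m b \<theta> * ?I \<theta> \<partial>lborel) = (\<integral>\<^sup>+\<theta>. ?m a \<theta> * ?I \<theta> \<partial>lborel) + (\<integral>\<^sup>+\<theta>. ?m b \<theta> * ?I \<theta> \<partial>lborel)"
      by (rule nn_integral_add) auto
    also have "\<dots> < \<infinity>"
      using maximal_function_arc[OF a less_imp_le[OF r(1)] r(2)] maximal_function_arc[OF b less_imp_le[OF r(1)] r(2)]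
      by (simp add: ennreal_add_less_top)
    finally show "(\<integral>\<^sup>+\<theta>. w \<theta> \<partial>lborel) < \<infinity>" unfolding w_def .
    fix k
    show "AE \<theta> in lborel. ennreal (cmod (W k \<theta>)) * ?I \<theta> \<le> w \<theta>"
      unfolding w_def
    proof (rule AE_I2)
      fix \<theta>
      have "ennreal (cmod (W k \<theta>)) \<le> ennreal (cmod (power_series a (of_real (r k) * cis \<theta>)) + cmod (power_series b (of_real (r k) * cis \<theta>)))"
        unfolding W_def by (intro ennreal_leI) (metis complex_mod_cnj norm_triangle_ineq)
      also have "\<dots> = ennreal (cmod (power_series a (of_real (r k) * cis \<theta>))) + ennreal (cmod (power_series b (of_real (r k) * cis \<theta>)))"
        by (rule ennreal_plus) auto
      also have "\<dots> \<le> ?m a \<theta> + ?m b \<theta>" by (intro add_mono SUP_upper) auto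
      finally show "ennreal (cmod (W k \<theta>)) * ?I \<theta> \<le> ?m a \<theta> * ?I \<theta> + ?m b \<theta> * ?I \<theta>"
        unfolding distrib_right[symmetric] by (rule mult_right_mono) simp
    qed
  next
    show "AE \<theta> in lborel. (\<lambda>k. ennreal (cmod (W k \<theta>)) * ?I \<theta>) \<longlonglongrightarrow> 0"
      using AE
    proof eventually_elim
      case (elim \<theta>)
      then have "(\<lambda>k. ennreal (cmod (W k \<theta>))) \<longlonglongrightarrow> ennreal 0"
        unfolding W_def[symmetric] by (intro tendsto_ennrealI tendsto_norm_zero) (simp add: W_def)
      then show ?case by (cases "\<theta> \<in> {0<..<2*pi}") auto
    qed
  qed auto
  moreover have "(\<integral>\<^sup>+\<theta>. ennreal (cmod (W k \<theta>)) * ?I \<theta> \<partial>lborel) = ennreal (integral {0..2*pi} (\<lambda>\<theta>. cmod (W k \<theta>)))" for k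
    by (rule continuous_nn_integral_Icc) (auto intro!: continuous_intros cW)
  ultimately have "(\<lambda>k. ennreal (integral {0..2*pi} (\<lambda>\<theta>. cmod (W k \<theta>)))) \<longlonglongrightarrow> ennreal 0" by simp
  moreover have int: "(\<lambda>\<theta>. cmod (W k \<theta>)) integrable_on {0..2*pi}" for k
    by (intro integrable_continuous_interval continuous_intros cW)
  ultimately have lim0: "(\<lambda>k. integral {0..2*pi} (\<lambda>\<theta>. cmod (W k \<theta>))) \<longlonglongrightarrow> 0"
    by (subst (asm) tendsto_ennreal_iff) (auto intro!: always_eventually Henstock_Kurzweil_Integration.integral_nonneg)
  have lim1: "(\<lambda>k. integral {0..2*pi} (\<lambda>\<theta>. W k \<theta> * cis (c * \<theta>))) \<longlonglongrightarrow> 0" for c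
  proof (rule Lim_null_comparison[OF _ lim0], rule always_eventually, rule allI)
    fix k
    show "cmod (integral {0..2*pi} (\<lambda>\<theta>. W k \<theta> * cis (c * \<theta>))) \<le> integral {0..2*pi} (\<lambda>\<theta>. cmod (W k \<theta>))"
      by (rule Henstock_Kurzweil_Integration.integral_norm_bound_integral)
         (auto intro!: integrable_continuous_interval continuous_intros cW int simp: norm_mult)
  qed
  have limr: "(\<lambda>k. of_real (r k) ^ n :: complex) \<longlonglongrightarrow> 1" for n
    using tendsto_power[OF tendsto_of_real[OF lim], of n] by simp
  have split: "integral {0..2*pi} (\<lambda>\<theta>. W k \<theta> * cis (c * \<theta>)) =
    integral {0..2*pi} (\<lambda>\<theta>. power_series a (of_real (r k) * cis \<theta>) * cis (c * \<theta>)) +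
    cnj (integral {0..2*pi} (\<lambda>\<theta>. power_series b (of_real (r k) * cis \<theta>) * cis (- c * \<theta>)))" for k c
  proof -
    have "integral {0..2*pi} (\<lambda>\<theta>. W k \<theta> * cis (c * \<theta>)) = integral {0..2*pi} (\<lambda>\<theta>. power_series a (of_real (r k) * cis \<theta>) * cis (c * \<theta>) + cnj (power_series b (of_real (r k) * cis \<theta>) * cis (- c * \<theta>)))"
      by (rule Henstock_Kurzweil_Integration.integral_cong) (simp add: W_def distrib_right cis_cnj)
    also have "\<dots> = integral {0..2*pi} (\<lambda>\<theta>. power_series a (of_real (r k) * cis \<theta>) * cis (c * \<theta>)) +
        integral {0..2*pi} (\<lambda>\<theta>. cnj (power_series b (of_real (r k) * cis \<theta>) * cis (- c * \<theta>)))"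
      by (rule Henstock_Kurzweil_Integration.integral_add) (intro integrable_continuous_interval continuous_intros cP a b)+
    also have "integral {0..2*pi} (\<lambda>\<theta>. cnj (power_series b (of_real (r k) * cis \<theta>) * cis (- c * \<theta>))) =
      cnj (integral {0..2*pi} (\<lambda>\<theta>. power_series b (of_real (r k) * cis \<theta>) * cis (- c * \<theta>)))"
      by (rule integral_linear[OF _ bounded_linear_cnj, unfolded o_def])
         (intro integrable_continuous_interval continuous_intros cP b)
    finally show ?thesis .
  qed
  note Ia = integral_power_series_cis[OF a r(1) r(2)] and Ib = integral_power_series_cis[OF b r(1) r(2)]
  have a0: "a n = 0" "b n = 0" if n: "0 < n" for n
  proof -
    obtain m where m: "n = Suc m" using n by (cases n) auto
    have "(\<lambda>k. 2 * of_real pi * (a n * of_real (r k) ^ n) + 0) \<longlonglongrightarrow> 0"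
      using lim1[of "- real n"] unfolding split Ia(1) m minus_minus Ib(2) by simp
    moreover have "(\<lambda>k. 2 * of_real pi * (a n * of_real (r k) ^ n) + 0) \<longlonglongrightarrow> 2 * of_real pi * (a n * 1) + 0"
      by (intro tendsto_intros limr)
    ultimately show "a n = 0" using LIMSEQ_unique by fastforce
    have "(\<lambda>k. 0 + cnj (2 * of_real pi * (b n * of_real (r k) ^ n))) \<longlonglongrightarrow> 0"
      using lim1[of "real n"] unfolding split Ib(1) unfolding m Ia(2) by simp
    moreover have "(\<lambda>k. 0 + cnj (2 * of_real pi * (b n * of_real (r k) ^ n))) \<longlonglongrightarrow> 0 + cnj (2 * of_real pi * (b n * 1))"
      by (intro tendsto_intros limr)
    ultimately show "b n = 0" using LIMSEQ_unique by fastforce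
  qed
  have "integral {0..2*pi} (\<lambda>\<theta>. W k \<theta> * cis (- real 0 * \<theta>)) = 2 * of_real pi * (a 0 + cnj (b 0))" for k
  proof -
    have "integral {0..2*pi} (\<lambda>\<theta>. power_series x (of_real (r k) * cis \<theta>) * cis (- (- real 0) * \<theta>)) = 2 * of_real pi * (x 0 * of_real (r k) ^ 0)"
      if "dirichlet_coeffs x" for x
      using integral_power_series_cis(1)[OF that r(1) r(2), of k 0] by simp
    from this[OF b] show ?thesis unfolding split Ia(1) by (simp add: algebra_simps)
  qed
  then have "2 * of_real pi * (a 0 + cnj (b 0)) = 0"
    using lim1[of "- real 0"] LIMSEQ_unique[OF tendsto_const] by simp
  then have ab: "a 0 + cnj (b 0) = 0" by simp
  have const: "power_series x z = x 0" if "\<And>n. 0 < n \<Longrightarrow> x n = 0" for x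
  proof -
    have "(\<lambda>n. x n * z ^ n) sums (\<Sum>n\<in>{0}. x n * z ^ n)" by (rule sums_finite) (use that in auto)
    then show ?thesis unfolding power_series_def by (simp add: sums_iff)
  qed
  show ?thesis using const[of a] const[of b] a0 ab by simp
qed

subsection \<open>Transport between the disc and the Jordan domain\<close>

text \<open>Conformal invariance of the square norm of one-forms; it carries both the Dirichlet
  energy and the Bergman norm to the disc.\<close>

lemma conformal_square_integral:
  assumes V: "open V" and \<phi>: "\<phi> holomorphic_on V" "inj_on \<phi> V" and G: "continuous_on (\<phi> ` V) G"
  shows "square_integral V (\<lambda>z. G (\<phi> z) * deriv \<phi> z) = square_integral (\<phi> ` V) G"
proof -
  have op: "open (\<phi> ` V)" by (rule open_mapping_thm3[OF \<phi>(1) V \<phi>(2)])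
  have [measurable]: "(\<lambda>w. indicator (\<phi> ` V) w *\<^sub>R G w) \<in> borel_measurable borel"
    by (rule borel_measurable_continuous_on_indicator[OF _ G]) (use op in simp)
  define g where "g = (\<lambda>w. ennreal ((cmod (indicator (\<phi> ` V) w *\<^sub>R G w))\<^sup>2))"
  have [measurable]: "g \<in> borel_measurable borel" unfolding g_def by measurable
  have "square_integral (\<phi> ` V) G = (\<integral>\<^sup>+w\<in>\<phi> ` V. g w \<partial>lborel)"
    by (intro nn_integral_cong) (auto simp: g_def indicator_def)
  also have "\<dots> = (\<integral>\<^sup>+z\<in>V. g (\<phi> z) * ennreal ((cmod (deriv \<phi> z))\<^sup>2) \<partial>lborel)"
    by (rule nn_integral_conformal[OF V \<phi>]) measurable
  also have "\<dots> = square_integral V (\<lambda>z. G (\<phi> z) * deriv \<phi> z)"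
    by (intro nn_integral_cong) (auto simp: g_def indicator_def norm_mult power_mult_distrib ennreal_mult)
  finally show ?thesis by simp
qed

lemma harmonic_on_subset: "harmonic_on S h \<Longrightarrow> T \<subseteq> S \<Longrightarrow> harmonic_on T h"
  unfolding harmonic_on_def C1_on_def by (meson differentiable_on_subset continuous_on_subset subsetD)

locale disc_map =
  fixes f :: "complex \<Rightarrow> complex option" and \<Omega> :: "complex option set"
  assumes biholomorphism: "disk_biholomorphism f \<Omega>"
begin

abbreviation finite_part :: "complex set" where
  "finite_part \<equiv> {z \<in> ball 0 1. f z \<noteq> None}"

abbreviation nonzero_part :: "complex set" where
  "nonzero_part \<equiv> {z \<in> ball 0 1. f z \<noteq> Some 0}"

abbreviation f_inverse :: "complex option \<Rightarrow> complex" where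
  "f_inverse \<equiv> the_inv_into (ball 0 1) f"

lemma bij: "bij_betw f (ball 0 1) \<Omega>"
  and to_sphere: "holomorphic_to_sphere f (ball 0 1)"
  and from_sphere: "holomorphic_from_sphere f_inverse \<Omega>"
  using biholomorphism unfolding disk_biholomorphism_def by blast+

lemma inj: "inj_on f (ball 0 1)" and image: "f ` ball 0 1 = \<Omega>"
  using bij unfolding bij_betw_def by blast+

lemma in_domain: "cmod z < 1 \<Longrightarrow> f z \<in> \<Omega>"
  using image by auto

lemma inverse_f [simp]: "cmod z < 1 \<Longrightarrow> f_inverse (f z) = z"
  by (rule the_inv_into_f_f[OF inj]) simp

lemma f_inverse_in: "x \<in> \<Omega> \<Longrightarrow> f_inverse x \<in> ball 0 1"
  using bij_betw_the_inv_into[OF bij] unfolding bij_betw_def by blast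

lemma open_parts: "open finite_part" "open nonzero_part"
  by (rule open_preimage_delete[OF to_sphere])+

lemma hol_the: "(the \<circ> f) holomorphic_on finite_part"
  and hol_coord: "(coord_inf \<circ> f) holomorphic_on nonzero_part"
  using to_sphere unfolding holomorphic_to_sphere_def by blast+

lemma inj_the: "inj_on (the \<circ> f) finite_part"
proof (rule inj_onI)
  fix x y assume "x \<in> finite_part" "y \<in> finite_part" "(the \<circ> f) x = (the \<circ> f) y"
  then have "x \<in> ball 0 1" "y \<in> ball 0 1" "f x = f y" by auto
  then show "x = y" using inj by (meson inj_onD)
qed

lemma inj_coord: "inj_on (coord_inf \<circ> f) nonzero_part"
proof (rule inj_onI)
  fix x y assume "x \<in> nonzero_part" "y \<in> nonzero_part" "(coord_inf \<circ> f) x = (coord_inf \<circ> f) y"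
  then have "x \<in> ball 0 1" "y \<in> ball 0 1" "f x = f y" by (auto, metis chart_coord_inf)
  then show "x = y" using inj by (meson inj_onD)
qed

lemma Some_the: "z \<in> finite_part \<Longrightarrow> Some ((the \<circ> f) z) = f z"
  by auto

lemma domain_charts:
  "{z. Some z \<in> \<Omega>} = (the \<circ> f) ` finite_part" "{w. chart_inf w \<in> \<Omega>} = (coord_inf \<circ> f) ` nonzero_part"
  "open {z. Some z \<in> \<Omega>}" "open {w. chart_inf w \<in> \<Omega>}"
proof -
  show 1: "{z. Some z \<in> \<Omega>} = (the \<circ> f) ` finite_part"
  proof (intro equalityI subsetI)
    fix w assume "w \<in> {z. Some z \<in> \<Omega>}"
    then have "Some w \<in> f ` ball 0 1" unfolding image by simp
    then obtain z where "z \<in> ball 0 1" "f z = Some w" by (metis imageE)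
    then show "w \<in> (the \<circ> f) ` finite_part" by (intro image_eqI[of _ _ z]) auto
  next
    fix w assume "w \<in> (the \<circ> f) ` finite_part"
    then obtain z where "z \<in> finite_part" "w = (the \<circ> f) z" by blast
    then show "w \<in> {z. Some z \<in> \<Omega>}" using in_domain[of z] Some_the[of z] by simp
  qed
  show 2: "{w. chart_inf w \<in> \<Omega>} = (coord_inf \<circ> f) ` nonzero_part"
  proof (intro equalityI subsetI)
    fix w assume "w \<in> {w. chart_inf w \<in> \<Omega>}"
    then have "chart_inf w \<in> f ` ball 0 1" unfolding image by simp
    then obtain z where z: "z \<in> ball 0 1" "f z = chart_inf w" by (metis imageE)
    moreover have "chart_inf w \<noteq> Some 0" "coord_inf (chart_inf w) = w" by (auto simp: chart_inf_def coord_inf_def)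
    ultimately show "w \<in> (coord_inf \<circ> f) ` nonzero_part" by (intro image_eqI[of _ _ z]) auto
  next
    fix w assume "w \<in> (coord_inf \<circ> f) ` nonzero_part"
    then obtain z where "z \<in> nonzero_part" "w = (coord_inf \<circ> f) z" by blast
    then show "w \<in> {w. chart_inf w \<in> \<Omega>}" using in_domain[of z] chart_coord_inf[of "f z"] by simp
  qed
  show "open {z. Some z \<in> \<Omega>}" unfolding 1 by (rule open_mapping_thm3[OF hol_the open_parts(1) inj_the])
  show "open {w. chart_inf w \<in> \<Omega>}" unfolding 2 by (rule open_mapping_thm3[OF hol_coord open_parts(2) inj_coord])
qed

text \<open>\<open>f\<close> takes the value infinity at most once, so beyond that point all circles
  can be treated in the finite coordinate.\<close>

lemma annulus_avoiding_pole:
  obtains r where "0 < r" "r < 1" "annulus r \<subseteq> finite_part"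
proof (cases "\<exists>z\<in>ball 0 1. f z = None")
  case True
  then obtain z0 where z0: "z0 \<in> ball 0 1" "f z0 = None" by blast
  have uniq: "z = z0" if "z \<in> ball 0 1" "f z = None" for z using inj that z0 by (metis inj_onD)
  show ?thesis
  proof (rule that)
    show "0 < (1 + cmod z0) / 2" "(1 + cmod z0) / 2 < 1" using z0 by (auto intro: add_pos_nonneg)
    show "annulus ((1 + cmod z0) / 2) \<subseteq> finite_part"
    proof
      fix z assume z: "z \<in> annulus ((1 + cmod z0) / 2)"
      then have "z \<noteq> z0" using z0 by auto
      then show "z \<in> finite_part" using uniq[of z] z by auto
    qed
  qed
next
  case False
  then show ?thesis by (intro that[of "1/2"]) auto
qed

text \<open>The collar comes from another biholomorphism. Its transition automorphism enlarges the
  distance to the circle by at most the factor L, so points within (1 - r1)/L of the circle land in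
  the prescribed annulus.\<close>

lemma collar_annulus:
  assumes "collar_nbhd \<Omega> A"
  obtains r where "0 < r" "r < 1" "annulus r \<subseteq> finite_part" "f ` annulus r \<subseteq> A"
proof -
  obtain f1 r1 where f1: "disk_biholomorphism f1 \<Omega>" "0 < r1" "r1 < 1" "A = f1 ` annulus r1"
    using assms unfolding collar_nbhd_def by blast
  obtain c a where ca: "disc_automorphism c a" "\<And>z. cmod z < 1 \<Longrightarrow> f z = f1 (disc_aut c a z)"
    using disk_biholomorphism_transition[OF biholomorphism f1(1)] by blast
  interpret disc_automorphism c a by (rule ca(1))
  obtain r0 where r0: "0 < r0" "r0 < 1" "annulus r0 \<subseteq> finite_part" by (rule annulus_avoiding_pole)
  define L where "L = (1 - (cmod a)\<^sup>2) / (1 - cmod a)\<^sup>2"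
  have L: "0 < L" using positive a by (simp add: L_def)
  define r where "r = max r0 (1 - (1 - r1) / L)"
  show ?thesis
  proof (rule that)
    show "0 < r" "r < 1" using r0 f1 L by (auto simp: r_def)
    show "annulus r \<subseteq> finite_part" using r0(3) by (auto simp: r_def)
    show "f ` annulus r \<subseteq> A"
    proof (rule image_subsetI)
      fix z assume "z \<in> annulus r"
      then have z: "cmod z < 1" "0 < cmod z" "1 - (1 - r1) / L < cmod z" using r0 by (auto simp: r_def)
      have "(1 - cmod z) < (1 - r1) / L" using z by simp
      then have lt: "L * (1 - cmod z) < 1 - r1" using L by (simp add: field_simps)
      define w where "w = z / of_real (cmod z)"
      have w: "cmod w = 1" using z by (simp add: w_def norm_divide)
      have "w - z = of_real (1 - cmod z) * w" using z by (simp add: w_def field_simps)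
      then have "cmod (w - z) = 1 - cmod z" using w z by (simp add: norm_mult del: of_real_diff)
      then have "cmod (disc_aut c a w - disc_aut c a z) \<le> L * (1 - cmod z)"
        using disc_aut_upper[of w z] w z by (simp add: L_def)
      then have "r1 < cmod (disc_aut c a z)"
        using norm_triangle_ineq2[of "disc_aut c a w" "disc_aut c a z"] disc_aut_sphere[OF w] lt by simp
      then have "disc_aut c a z \<in> annulus r1" using disc_aut_ball(1)[OF z(1)] by simp
      then show "f z \<in> A" unfolding f1(4) ca(2)[OF z(1)] by blast
    qed
  qed
qed

lemma chart_image: "V \<subseteq> finite_part \<Longrightarrow> f ` V \<subseteq> U \<Longrightarrow> (the \<circ> f) ` V \<subseteq> {z. Some z \<in> U}"
  using Some_the by fastforce

lemma pullback_harmonic: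
  assumes h: "sphere_harmonic_on U h" and V: "open V" "V \<subseteq> finite_part" "f ` V \<subseteq> U"
  shows "harmonic_pair V (h \<circ> f) (\<lambda>z. wirtinger_z (h \<circ> Some) ((the \<circ> f) z) * deriv (the \<circ> f) z)
      (\<lambda>z. cnj (wirtinger_zbar (h \<circ> Some) ((the \<circ> f) z)) * deriv (the \<circ> f) z)"
    and "harmonic_pair ((the \<circ> f) ` V) (h \<circ> Some) (wirtinger_z (h \<circ> Some)) (\<lambda>z. cnj (wirtinger_zbar (h \<circ> Some) z))"
proof -
  have hV: "(the \<circ> f) holomorphic_on V" by (rule holomorphic_on_subset[OF hol_the V(2)])
  have op: "open ((the \<circ> f) ` V)" by (rule open_mapping_thm3[OF hV V(1) inj_on_subset[OF inj_the V(2)]])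
  have "harmonic_on ((the \<circ> f) ` V) (h \<circ> Some)"
    by (rule harmonic_on_subset[OF _ chart_image[OF V(2,3)]]) (use h in \<open>simp add: sphere_harmonic_on_def\<close>)
  then show pr: "harmonic_pair ((the \<circ> f) ` V) (h \<circ> Some) (wirtinger_z (h \<circ> Some)) (\<lambda>z. cnj (wirtinger_zbar (h \<circ> Some) z))"
    by (rule harmonic_on_imp_pair[OF op])
  show "harmonic_pair V (h \<circ> f) (\<lambda>z. wirtinger_z (h \<circ> Some) ((the \<circ> f) z) * deriv (the \<circ> f) z)
      (\<lambda>z. cnj (wirtinger_zbar (h \<circ> Some) ((the \<circ> f) z)) * deriv (the \<circ> f) z)"
    by (rule harmonic_pair_cong[OF harmonic_pair_compose[OF pr V(1) hV order_refl] V(1)])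
       (use V(2) Some_the in auto)
qed

text \<open>Covers the possible preimage of infinity, which the finite coordinate does not
  reach.\<close>

lemma pullback_harmonic_inf:
  assumes h: "sphere_harmonic_on \<Omega> h"
  shows "\<exists>p q. harmonic_pair nonzero_part (h \<circ> f) p q"
proof -
  have "harmonic_on {w. chart_inf w \<in> \<Omega>} (h \<circ> chart_inf)" using h by (simp add: sphere_harmonic_on_def)
  note pr = harmonic_on_imp_pair[OF domain_charts(4) this]
  have "harmonic_pair nonzero_part (h \<circ> f)
      (\<lambda>z. wirtinger_z (h \<circ> chart_inf) ((coord_inf \<circ> f) z) * deriv (coord_inf \<circ> f) z)
      (\<lambda>z. cnj (wirtinger_zbar (h \<circ> chart_inf) ((coord_inf \<circ> f) z)) * deriv (coord_inf \<circ> f) z)"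
    by (rule harmonic_pair_cong[OF harmonic_pair_compose[OF pr open_parts(2) hol_coord] open_parts(2)])
       (auto simp: domain_charts(2) chart_coord_inf)
  then show ?thesis by blast
qed

lemma pullback_energy:
  assumes h: "h \<in> D_harm U" and V: "open V" "V \<subseteq> finite_part" "f ` V \<subseteq> U"
  shows "square_integral V (\<lambda>z. wirtinger_z (h \<circ> Some) ((the \<circ> f) z) * deriv (the \<circ> f) z) < \<infinity>"
    and "square_integral V (\<lambda>z. cnj (wirtinger_zbar (h \<circ> Some) ((the \<circ> f) z)) * deriv (the \<circ> f) z) < \<infinity>"
proof -
  have hV: "(the \<circ> f) holomorphic_on V" by (rule holomorphic_on_subset[OF hol_the V(2)])
  have iV: "inj_on (the \<circ> f) V" by (rule inj_on_subset[OF inj_the V(2)])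
  have sh: "sphere_harmonic_on U h" and en: "dirichlet_energy U h < \<infinity>" using h by (auto simp: D_harm_def)
  note pr = pullback_harmonic(2)[OF sh V]
  have c: "continuous_on ((the \<circ> f) ` V) (wirtinger_z (h \<circ> Some))"
    "continuous_on ((the \<circ> f) ` V) (\<lambda>z. cnj (wirtinger_zbar (h \<circ> Some) z))"
    using pr unfolding harmonic_pair_def by (auto intro: holomorphic_on_imp_continuous_on)
  have fin: "(\<integral>\<^sup>+z\<in>{z. Some z \<in> U}. ennreal ((cmod (wirtinger_z (h \<circ> Some) z))\<^sup>2 + (cmod (wirtinger_zbar (h \<circ> Some) z))\<^sup>2) \<partial>lborel) < \<infinity>"
    using en unfolding dirichlet_energy_def by (auto simp: ennreal_mult_less_top)
  have sub: "(the \<circ> f) ` V \<subseteq> {z. Some z \<in> U}" by (rule chart_image[OF V(2,3)])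
  have "square_integral ((the \<circ> f) ` V) (wirtinger_z (h \<circ> Some)) \<le>
    (\<integral>\<^sup>+z\<in>{z. Some z \<in> U}. ennreal ((cmod (wirtinger_z (h \<circ> Some) z))\<^sup>2 + (cmod (wirtinger_zbar (h \<circ> Some) z))\<^sup>2) \<partial>lborel)"
    using sub by (intro nn_integral_mono mult_mono ennreal_leI) (auto simp: indicator_def)
  from le_less_trans[OF this fin]
  show "square_integral V (\<lambda>z. wirtinger_z (h \<circ> Some) ((the \<circ> f) z) * deriv (the \<circ> f) z) < \<infinity>"
    unfolding conformal_square_integral[OF V(1) hV iV c(1)] .
  have "square_integral ((the \<circ> f) ` V) (\<lambda>z. cnj (wirtinger_zbar (h \<circ> Some) z)) \<le>
    (\<integral>\<^sup>+z\<in>{z. Some z \<in> U}. ennreal ((cmod (wirtinger_z (h \<circ> Some) z))\<^sup>2 + (cmod (wirtinger_zbar (h \<circ> Some) z))\<^sup>2) \<partial>lborel)"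
    using sub by (intro nn_integral_mono mult_mono ennreal_leI) (auto simp: indicator_def)
  from le_less_trans[OF this fin]
  show "square_integral V (\<lambda>z. cnj (wirtinger_zbar (h \<circ> Some) ((the \<circ> f) z)) * deriv (the \<circ> f) z) < \<infinity>"
    unfolding conformal_square_integral[OF V(1) hV iV c(2)] .
qed

lemma pullback_bergman:
  assumes \<alpha>: "\<alpha> \<in> bergman U" and V: "open V" "V \<subseteq> finite_part" "f ` V \<subseteq> U"
  shows "(\<lambda>z. \<alpha> ((the \<circ> f) z) * deriv (the \<circ> f) z) holomorphic_on V"
    and "square_integral V (\<lambda>z. \<alpha> ((the \<circ> f) z) * deriv (the \<circ> f) z) < \<infinity>"
proof -
  have hV: "(the \<circ> f) holomorphic_on V" by (rule holomorphic_on_subset[OF hol_the V(2)])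
  have iV: "inj_on (the \<circ> f) V" by (rule inj_on_subset[OF inj_the V(2)])
  have sub: "(the \<circ> f) ` V \<subseteq> {z. Some z \<in> U}" by (rule chart_image[OF V(2,3)])
  have h\<alpha>: "\<alpha> holomorphic_on {z. Some z \<in> U}" and fin: "square_integral {z. Some z \<in> U} \<alpha> < \<infinity>"
    using \<alpha> unfolding bergman_def holomorphic_one_form_def by (auto simp: ennreal_mult_less_top)
  have "(\<alpha> \<circ> (the \<circ> f)) holomorphic_on V" by (rule holomorphic_on_compose_gen[OF hV h\<alpha> sub])
  then have "(\<lambda>z. \<alpha> ((the \<circ> f) z)) holomorphic_on V" by (simp add: o_def)
  then show "(\<lambda>z. \<alpha> ((the \<circ> f) z) * deriv (the \<circ> f) z) holomorphic_on V"
    by (intro holomorphic_on_mult holomorphic_deriv[OF hV V(1)])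
  have "square_integral ((the \<circ> f) ` V) \<alpha> \<le> square_integral {z. Some z \<in> U} \<alpha>"
    using sub by (intro nn_integral_mono mult_mono) (auto simp: indicator_def)
  from le_less_trans[OF this fin]
  show "square_integral V (\<lambda>z. \<alpha> ((the \<circ> f) z) * deriv (the \<circ> f) z) < \<infinity>"
    unfolding conformal_square_integral[OF V(1) hV iV continuous_on_subset[OF holomorphic_on_imp_continuous_on[OF h\<alpha>] sub]] .
qed

lemma level_curve_integral_eq:
  assumes r: "annulus r \<subseteq> finite_part" and s: "0 < r" "r < exp (- \<epsilon>)" "0 < \<epsilon>"
  shows "level_curve_integral f \<epsilon> \<alpha> h =
    contour_integral (circlepath 0 (exp (- \<epsilon>))) (\<lambda>z. (\<alpha> ((the \<circ> f) z) * deriv (the \<circ> f) z) * (h \<circ> f) z)"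
proof -
  have hV: "(the \<circ> f) holomorphic_on annulus r" by (rule holomorphic_on_subset[OF hol_the r])
  have an: "(the \<circ> f) analytic_on annulus r" using hV analytic_on_open[OF open_annulus[of r 1]] by simp
  have pi: "path_image (circlepath 0 (exp (- \<epsilon>))) \<subseteq> annulus r" using s by (auto simp: path_image_circlepath)
  have "level_curve_integral f \<epsilon> \<alpha> h =
    contour_integral (circlepath 0 (exp (- \<epsilon>))) (\<lambda>z. deriv (the \<circ> f) z * (\<alpha> ((the \<circ> f) z) * h (Some ((the \<circ> f) z))))"
    unfolding level_curve_integral_def by (rule contour_integral_comp_analyticW[OF an _ pi]) simp
  also have "\<dots> = contour_integral (circlepath 0 (exp (- \<epsilon>))) (\<lambda>z. (\<alpha> ((the \<circ> f) z) * deriv (the \<circ> f) z) * (h \<circ> f) z)"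
  proof (rule contour_integral_cong[OF refl])
    fix z assume "z \<in> path_image (circlepath 0 (exp (- \<epsilon>)))"
    then have "Some ((the \<circ> f) z) = f z" using pi r Some_the by blast
    then show "deriv (the \<circ> f) z * (\<alpha> ((the \<circ> f) z) * h (Some ((the \<circ> f) z))) = (\<alpha> ((the \<circ> f) z) * deriv (the \<circ> f) z) * (h \<circ> f) z"
      by simp
  qed
  finally show ?thesis .
qed

lemma level_curve_limit:
  assumes r: "annulus r \<subseteq> finite_part" "0 < r" "r < 1"
    and lim: "((\<lambda>s. contour_integral (circlepath 0 s) (\<lambda>z. (\<alpha> ((the \<circ> f) z) * deriv (the \<circ> f) z) * (h \<circ> f) z)) \<longlongrightarrow> L) (at_left 1)"
  shows "((\<lambda>\<epsilon>. level_curve_integral f \<epsilon> \<alpha> h) \<longlongrightarrow> L) (at_right 0)"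
proof -
  have pos: "0 < - ln r" using r by simp
  have ev: "\<forall>\<^sub>F \<epsilon> in at_right 0. 0 < \<epsilon> \<and> \<epsilon> < - ln r"
    by (rule eventually_at_right_field[THEN iffD2]) (use pos in blast)
  have "filterlim (\<lambda>\<epsilon>::real. exp (- \<epsilon>)) (at_left 1) (at_right 0)"
    unfolding filterlim_at
  proof
    show "\<forall>\<^sub>F \<epsilon> in at_right 0. exp (- \<epsilon>) \<in> {..<1} \<and> exp (- \<epsilon>) \<noteq> (1::real)"
      using ev by eventually_elim auto
    have "((\<lambda>\<epsilon>::real. exp (- \<epsilon>)) \<longlongrightarrow> exp (- 0)) (at_right 0)" by (intro tendsto_intros)
    then show "((\<lambda>\<epsilon>::real. exp (- \<epsilon>)) \<longlongrightarrow> 1) (at_right 0)" by simp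
  qed
  from filterlim_compose[OF lim this]
  show ?thesis
  proof (rule Lim_transform_eventually)
    show "\<forall>\<^sub>F \<epsilon> in at_right 0. contour_integral (circlepath 0 (exp (- \<epsilon>))) (\<lambda>z. (\<alpha> ((the \<circ> f) z) * deriv (the \<circ> f) z) * (h \<circ> f) z) = level_curve_integral f \<epsilon> \<alpha> h"
      using ev
    proof eventually_elim
      case (elim \<epsilon>)
      have "r < exp (- \<epsilon>)" using elim r by (metis exp_less_cancel_iff exp_ln less_minus_iff)
      then show ?case using level_curve_integral_eq[OF r(1,2) _ , of \<epsilon>] elim by simp
    qed
  qed
qed

text \<open>The default value off \<Omega> is the one demanded by \<open>extensional\<close>, so
  that the result can be the value of \<open>bounce\<close>.\<close>

definition push_forward :: "(complex \<Rightarrow> complex) \<Rightarrow> complex option \<Rightarrow> complex" where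
  "push_forward v x = (if x \<in> \<Omega> then v (f_inverse x) else undefined)"

lemma push_forward_f: "cmod z < 1 \<Longrightarrow> push_forward v (f z) = v z"
  by (simp add: push_forward_def in_domain)

lemma push_forward_D_harm:
  assumes a: "dirichlet_coeffs a" and b: "dirichlet_coeffs b"
    and fa: "square_integral (ball 0 1) (deriv (power_series a)) < \<infinity>"
    and fb: "square_integral (ball 0 1) (deriv (power_series b)) < \<infinity>"
  defines "H \<equiv> push_forward (\<lambda>z. power_series a z + cnj (power_series b z))"
  shows "H \<in> D_harm \<Omega>" "H \<in> extensional \<Omega>"
proof -
  let ?p = "deriv (power_series a)" and ?q = "deriv (power_series b)"
  let ?v = "\<lambda>z. power_series a z + cnj (power_series b z)"
  note pr = harmonic_pair_of_holomorphic[OF open_ball power_series_holomorphic[OF a] power_series_holomorphic[OF b]]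
  let ?T = "{z. Some z \<in> \<Omega>}" and ?W = "{w. chart_inf w \<in> \<Omega>}"
  let ?\<phi> = "f_inverse \<circ> Some"
  have h\<phi>: "?\<phi> holomorphic_on ?T" "(f_inverse \<circ> chart_inf) holomorphic_on ?W"
    using from_sphere unfolding holomorphic_from_sphere_def by blast+
  have prT: "harmonic_pair ?T (H \<circ> Some) (\<lambda>z. ?p (?\<phi> z) * deriv ?\<phi> z) (\<lambda>z. ?q (?\<phi> z) * deriv ?\<phi> z)"
    by (rule harmonic_pair_cong[OF harmonic_pair_compose[OF pr domain_charts(3) h\<phi>(1)] domain_charts(3)])
       (use f_inverse_in in \<open>auto simp: H_def push_forward_def\<close>)
  have prW: "harmonic_pair ?W (H \<circ> chart_inf) (\<lambda>z. ?p ((f_inverse \<circ> chart_inf) z) * deriv (f_inverse \<circ> chart_inf) z) (\<lambda>z. ?q ((f_inverse \<circ> chart_inf) z) * deriv (f_inverse \<circ> chart_inf) z)"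
    by (rule harmonic_pair_cong[OF harmonic_pair_compose[OF pr domain_charts(4) h\<phi>(2)] domain_charts(4)])
       (use f_inverse_in in \<open>auto simp: H_def push_forward_def\<close>)
  have sh: "sphere_harmonic_on \<Omega> H"
    unfolding sphere_harmonic_on_def
    using harmonic_pair_imp_harmonic_on[OF domain_charts(3) prT] harmonic_pair_imp_harmonic_on[OF domain_charts(4) prW] by blast
  have inj\<phi>: "inj_on ?\<phi> ?T"
    using bij_betw_imp_inj_on[OF bij_betw_the_inv_into[OF bij]] by (auto simp: inj_on_def)
  have cp: "continuous_on (ball 0 1) ?p" "continuous_on (ball 0 1) ?q"
    by (rule continuous_on_deriv_holomorphic[OF power_series_holomorphic open_ball], rule a b)+
  have [measurable]: "(\<lambda>z. indicator (ball 0 1) z *\<^sub>R ?p z) \<in> borel_measurable borel"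
    "(\<lambda>z. indicator (ball 0 1) z *\<^sub>R ?q z) \<in> borel_measurable borel"
    by (rule borel_measurable_continuous_on_indicator; use cp in simp)+
  define g where "g = (\<lambda>z. ennreal ((cmod (indicator (ball 0 1) z *\<^sub>R ?p z))\<^sup>2) + ennreal ((cmod (indicator (ball 0 1) z *\<^sub>R ?q z))\<^sup>2))"
  have [measurable]: "g \<in> borel_measurable borel" unfolding g_def by measurable
  have "(\<integral>\<^sup>+z\<in>?T. ennreal ((cmod (wirtinger_z (H \<circ> Some) z))\<^sup>2 + (cmod (wirtinger_zbar (H \<circ> Some) z))\<^sup>2) \<partial>lborel) =
    (\<integral>\<^sup>+z\<in>?T. g (?\<phi> z) * ennreal ((cmod (deriv ?\<phi> z))\<^sup>2) \<partial>lborel)"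
  proof (rule nn_integral_cong)
    fix z
    show "ennreal ((cmod (wirtinger_z (H \<circ> Some) z))\<^sup>2 + (cmod (wirtinger_zbar (H \<circ> Some) z))\<^sup>2) * indicator ?T z =
      g (?\<phi> z) * ennreal ((cmod (deriv ?\<phi> z))\<^sup>2) * indicator ?T z"
    proof (cases "z \<in> ?T")
      case True
      have "?\<phi> z \<in> ball 0 1" using True f_inverse_in by simp
      then have "g (?\<phi> z) = ennreal ((cmod (?p (?\<phi> z)))\<^sup>2 + (cmod (?q (?\<phi> z)))\<^sup>2)" by (simp add: g_def)
      then show ?thesis
        unfolding harmonic_pair_partials(3)[OF prT True] harmonic_pair_partials(4)[OF prT True]
        by (simp add: norm_mult power_mult_distrib ennreal_mult[symmetric] distrib_right del: ennreal_plus)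
    qed simp
  qed
  also have "\<dots> = (\<integral>\<^sup>+w\<in>?\<phi> ` ?T. g w \<partial>lborel)"
    by (rule nn_integral_conformal[symmetric, OF domain_charts(3) h\<phi>(1) inj\<phi>]) measurable
  also have "\<dots> \<le> (\<integral>\<^sup>+w. g w \<partial>lborel)"
    by (intro nn_integral_mono) (auto simp: indicator_def)
  also have "\<dots> = (\<integral>\<^sup>+z. ennreal ((cmod (indicator (ball 0 1) z *\<^sub>R ?p z))\<^sup>2) \<partial>lborel) + (\<integral>\<^sup>+z. ennreal ((cmod (indicator (ball 0 1) z *\<^sub>R ?q z))\<^sup>2) \<partial>lborel)"
    unfolding g_def by (rule nn_integral_add) measurable
  also have "(\<integral>\<^sup>+z. ennreal ((cmod (indicator (ball 0 1) z *\<^sub>R ?p z))\<^sup>2) \<partial>lborel) = square_integral (ball 0 1) ?p"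
    by (intro nn_integral_cong) (auto simp: indicator_def)
  also have "(\<integral>\<^sup>+z. ennreal ((cmod (indicator (ball 0 1) z *\<^sub>R ?q z))\<^sup>2) \<partial>lborel) = square_integral (ball 0 1) ?q"
    by (intro nn_integral_cong) (auto simp: indicator_def)
  finally have le: "(\<integral>\<^sup>+z\<in>?T. ennreal ((cmod (wirtinger_z (H \<circ> Some) z))\<^sup>2 + (cmod (wirtinger_zbar (H \<circ> Some) z))\<^sup>2) \<partial>lborel)
      \<le> square_integral (ball 0 1) ?p + square_integral (ball 0 1) ?q" .
  also have "\<dots> < \<infinity>" using fa fb by (simp add: ennreal_add_less_top)
  finally have "dirichlet_energy \<Omega> H < \<infinity>"
    unfolding dirichlet_energy_def
    by (simp only: infinity_ennreal_def ennreal_mult_less_top ennreal_less_top simp_thms)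
  then show "H \<in> D_harm \<Omega>" using sh by (simp add: D_harm_def)
  show "H \<in> extensional \<Omega>" by (simp add: H_def push_forward_def extensional_def)
qed

end

subsection \<open>The bounce operator\<close>

lemma dirichlet_coeffs_zero: "dirichlet_coeffs (\<lambda>_. 0)" "power_series (\<lambda>_. 0) = (\<lambda>_. 0)"
  by (auto simp: dirichlet_coeffs_def power_series_def)

context disc_map
begin

text \<open>Energy is pulled back only on an annulus beyond the possible pole, but that suffices to
  bound the Taylor coefficients of functions holomorphic on the whole disc, here with zero principal
  part. The remaining additive constant is absorbed into the coefficient a_0.\<close>

lemma disc_decomposition:
  assumes h: "h \<in> D_harm \<Omega>"
  obtains a b where "dirichlet_coeffs a" "dirichlet_coeffs b"
    "\<And>z. cmod z < 1 \<Longrightarrow> h (f z) = power_series a z + cnj (power_series b z)"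
proof -
  have sh: "sphere_harmonic_on \<Omega> h" using h by (simp add: D_harm_def)
  define p where "p = wirtinger_z (h \<circ> f)"
  define q where "q = (\<lambda>z. cnj (wirtinger_zbar (h \<circ> f) z))"
  have pr: "harmonic_pair (ball 0 1) (h \<circ> f) p q"
    unfolding p_def q_def
  proof (rule harmonic_pair_local)
    fix z :: complex assume z: "z \<in> ball 0 1"
    show "\<exists>T p q. open T \<and> z \<in> T \<and> harmonic_pair T (h \<circ> f) p q"
    proof (cases "f z = None")
      case False
      have "f ` finite_part \<subseteq> \<Omega>" using in_domain by auto
      then show ?thesis using pullback_harmonic(1)[OF sh open_parts(1) order_refl] open_parts(1) z False by blast
    next
      case True
      obtain p q where "harmonic_pair nonzero_part (h \<circ> f) p q" using pullback_harmonic_inf[OF sh] by blast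
      moreover have "z \<in> nonzero_part" using True z by simp
      ultimately show ?thesis using open_parts(2) by blast
    qed
  qed
  have hp: "p holomorphic_on ball 0 1" and hq: "q holomorphic_on ball 0 1"
    and du: "\<And>z. z \<in> ball 0 1 \<Longrightarrow> ((h \<circ> f) has_derivative (\<lambda>w. p z * w + cnj (q z * w))) (at z)"
    using pr unfolding harmonic_pair_def by blast+
  obtain r where r: "0 < r" "r < 1" "annulus r \<subseteq> finite_part" by (rule annulus_avoiding_pole)
  have fr: "f ` annulus r \<subseteq> \<Omega>" using in_domain by auto
  note pa = pullback_harmonic(1)[OF sh open_annulus r(3) fr]
  note en = pullback_energy[OF h open_annulus r(3) fr]
  have eqp: "wirtinger_z (h \<circ> Some) ((the \<circ> f) z) * deriv (the \<circ> f) z = p z"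
    "cnj (wirtinger_zbar (h \<circ> Some) ((the \<circ> f) z)) * deriv (the \<circ> f) z = q z" if "z \<in> annulus r" for z
    using harmonic_pair_partials(3,4)[OF pa that] by (simp_all add: p_def q_def)
  have "square_integral (annulus r) p =
    square_integral (annulus r) (\<lambda>z. wirtinger_z (h \<circ> Some) ((the \<circ> f) z) * deriv (the \<circ> f) z)"
    by (intro nn_integral_cong) (use eqp(1) in \<open>auto simp: indicator_def\<close>)
  then have finp: "square_integral (annulus r) p < \<infinity>" using en(1) by simp
  have "square_integral (annulus r) q =
    square_integral (annulus r) (\<lambda>z. cnj (wirtinger_zbar (h \<circ> Some) ((the \<circ> f) z)) * deriv (the \<circ> f) z)"
    by (intro nn_integral_cong) (use eqp(2) in \<open>auto simp: indicator_def\<close>)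
  then have finq: "square_integral (annulus r) q < \<infinity>" using en(2) by simp
  obtain a where a: "dirichlet_coeffs a" "\<And>z. cmod z < 1 \<Longrightarrow> (power_series a has_field_derivative p z) (at z)"
    by (rule laurent_dirichlet_decomposition[OF r(1,2) hp holomorphic_on_const[of 0] _ finp]) auto
  obtain b where b: "dirichlet_coeffs b" "\<And>z. cmod z < 1 \<Longrightarrow> (power_series b has_field_derivative q z) (at z)"
    by (rule laurent_dirichlet_decomposition[OF r(1,2) hq holomorphic_on_const[of 0] _ finq]) auto
  define w where "w = (\<lambda>z. (h \<circ> f) z - power_series a z - cnj (power_series b z))"
  have dw: "(w has_derivative (\<lambda>_. 0)) (at z)" if z: "z \<in> ball 0 1" for z
  proof -
    have z1: "cmod z < 1" using z by simp
    have "(w has_derivative (\<lambda>x. (p z * x + cnj (q z * x)) - p z * x - cnj (q z * x))) (at z)"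
      unfolding w_def
      by (intro has_derivative_diff has_derivative_cnj du[OF z] a(2)[OF z1, unfolded has_field_derivative_def] b(2)[OF z1, unfolded has_field_derivative_def])
    then show ?thesis by simp
  qed
  have w: "w z = w 0" if "cmod z < 1" for z
    by (rule has_derivative_zero_unique_connected[where s = "ball 0 1" and f = w, OF open_ball connected_ball dw]) (use that in auto)
  define k where "k = (\<lambda>n::nat. if n = 0 then 1 else 0 :: complex)"
  have k: "dirichlet_coeffs k" unfolding dirichlet_coeffs_def
    by (rule summable_finite[of "{0}"]) (auto simp: k_def)
  have pk: "power_series k z = 1" for z
  proof -
    have "(\<lambda>n. k n * z ^ n) sums (\<Sum>n\<in>{0}. k n * z ^ n)" by (rule sums_finite) (auto simp: k_def)
    then show ?thesis unfolding power_series_def by (simp add: sums_iff k_def)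
  qed
  show ?thesis
  proof (rule that[OF dirichlet_coeffs_lincomb(1)[OF a(1) k, of "w 0"] b(1)])
    fix z assume z: "cmod z < 1"
    show "h (f z) = power_series (\<lambda>n. a n + w 0 * k n) z + cnj (power_series b z)"
      using w[OF z] unfolding dirichlet_coeffs_lincomb(2)[OF a(1) k z] pk by (simp add: w_def algebra_simps)
  qed
qed

end

locale jordan_disc_map = disc_map +
  fixes \<Gamma> :: "complex option set"
  assumes jordan: "jordan_domain \<Gamma> \<Omega>"
begin

text \<open>Off two null sets both candidates share the boundary values of h, hence have equal
  radial limits for almost every angle. Their difference is a sum of a Dirichlet series and a
  conjugate one with vanishing radial limits; off \<Omega> extensionality decides.\<close>

lemma bounce_unique:
  assumes H1: "H1 \<in> D_harm \<Omega>" "H1 \<in> extensional \<Omega>" "cnt_agree \<Gamma> \<Omega> h H1"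
    and H2: "H2 \<in> D_harm \<Omega>" "H2 \<in> extensional \<Omega>" "cnt_agree \<Gamma> \<Omega> h H2"
  shows "H1 = H2"
proof -
  note B = boundary_ext_Jordan[OF jordan biholomorphism]
  obtain N1 where N1: "null_on \<Gamma> \<Omega> N1" "\<And>p. p \<in> \<Gamma> - N1 \<Longrightarrow> \<exists>\<zeta>. cnt_limit \<Omega> h p \<zeta> \<and> cnt_limit \<Omega> H1 p \<zeta>"
    using H1(3) unfolding cnt_agree_def by blast
  obtain N2 where N2: "null_on \<Gamma> \<Omega> N2" "\<And>p. p \<in> \<Gamma> - N2 \<Longrightarrow> \<exists>\<zeta>. cnt_limit \<Omega> h p \<zeta> \<and> cnt_limit \<Omega> H2 p \<zeta>"
    using H2(3) unfolding cnt_agree_def by blast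
  obtain a1 b1 where 1: "dirichlet_coeffs a1" "dirichlet_coeffs b1"
    "\<And>z. cmod z < 1 \<Longrightarrow> H1 (f z) = power_series a1 z + cnj (power_series b1 z)"
    using disc_decomposition[OF H1(1)] by blast
  obtain a2 b2 where 2: "dirichlet_coeffs a2" "dirichlet_coeffs b2"
    "\<And>z. cmod z < 1 \<Longrightarrow> H2 (f z) = power_series a2 z + cnj (power_series b2 z)"
    using disc_decomposition[OF H2(1)] by blast
  define a where "a = (\<lambda>n. a1 n + (- 1) * a2 n)"
  define b where "b = (\<lambda>n. b1 n + (- 1) * b2 n)"
  have a: "dirichlet_coeffs a" and b: "dirichlet_coeffs b"
    unfolding a_def b_def by (rule dirichlet_coeffs_lincomb 1 2)+
  have ab: "power_series a z + cnj (power_series b z) = H1 (f z) - H2 (f z)" if "cmod z < 1" for z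
    unfolding 1(3)[OF that] 2(3)[OF that] a_def b_def dirichlet_coeffs_lincomb(2)[OF 1(1) 2(1) that]
      dirichlet_coeffs_lincomb(2)[OF 1(2) 2(2) that] by simp
  \<comment> \<open>The exponent starts at 1 so that every radius is positive, as the coefficient
    integrals require.\<close>
  define r where "r = (\<lambda>k. 1 - (1/2::real) ^ Suc k)"
  have r: "0 < r k" "r k < 1" for k
    using power_decreasing[of 1 "Suc k" "1/2::real"] by (auto simp: r_def intro: le_less_trans)
  have "r \<longlonglongrightarrow> 1 - 0" unfolding r_def
    by (intro tendsto_diff tendsto_const LIMSEQ_Suc[OF LIMSEQ_power_zero]) simp
  then have rl: "r \<longlonglongrightarrow> 1" by simp
  have rf: "filterlim r (at_left 1) sequentially"
    unfolding filterlim_at using rl r by (auto intro!: always_eventually simp: less_imp_neq)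
  have "AE \<theta> in lborel. (\<lambda>k. power_series a (of_real (r k) * cis \<theta>) + cnj (power_series b (of_real (r k) * cis \<theta>))) \<longlonglongrightarrow> 0"
    using null_on_imp_AE[OF jordan biholomorphism N1(1)] null_on_imp_AE[OF jordan biholomorphism N2(1)]
  proof eventually_elim
    case (elim \<theta>)
    define p where "p = boundary_ext f (cis \<theta>)"
    have c1: "cmod (cis \<theta>) = 1" by simp
    have p: "p \<in> \<Gamma> - N1" "p \<in> \<Gamma> - N2" using elim B(3) by (auto simp: p_def)
    obtain \<zeta>1 where z1: "cnt_limit \<Omega> h p \<zeta>1" "cnt_limit \<Omega> H1 p \<zeta>1" using N1(2)[OF p(1)] by blast
    obtain \<zeta>2 where z2: "cnt_limit \<Omega> h p \<zeta>2" "cnt_limit \<Omega> H2 p \<zeta>2" using N2(2)[OF p(2)] by blast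
    note R = cnt_limit_imp_radial[OF jordan biholomorphism _ c1 p_def[symmetric]]
    have eq: "\<zeta>1 = \<zeta>2" by (rule tendsto_unique[OF _ R[OF z1(1)] R[OF z2(1)]]) simp
    have "((\<lambda>t. H1 (f (of_real t * cis \<theta>)) - H2 (f (of_real t * cis \<theta>))) \<longlongrightarrow> \<zeta>1 - \<zeta>2) (at_left 1)"
      by (intro tendsto_diff R z1 z2)
    from filterlim_compose[OF this rf]
    have "(\<lambda>k. H1 (f (of_real (r k) * cis \<theta>)) - H2 (f (of_real (r k) * cis \<theta>))) \<longlonglongrightarrow> 0" by (simp add: eq)
    moreover have "H1 (f (of_real (r k) * cis \<theta>)) - H2 (f (of_real (r k) * cis \<theta>)) =
      power_series a (of_real (r k) * cis \<theta>) + cnj (power_series b (of_real (r k) * cis \<theta>))" for k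
      using ab[of "of_real (r k) * cis \<theta>"] r[of k] by (simp add: norm_mult)
    ultimately show ?case by simp
  qed
  note zero = radial_limit_zero_imp_zero[OF a b r rl this]
  show ?thesis
  proof
    fix x
    show "H1 x = H2 x"
    proof (cases "x \<in> \<Omega>")
      case True
      then obtain z where z: "cmod z < 1" "x = f z" using image by auto
      have "H1 (f z) - H2 (f z) = 0" using zero[OF z(1)] ab[OF z(1)] by simp
      then show ?thesis using z by simp
    next
      case False
      then show ?thesis using H1(2) H2(2) by (simp add: extensional_def)
    qed
  qed
qed

text \<open>The exceptional set is the boundary image of the points of the circle where one of the
  two series fails to be Cauchy along dyadic radii; it is Borel and has capacity zero. Elsewhere the
  push-forward has a nontangential limit, and h has the same one because the difference is O(1 -
  |z|).\<close>

lemma cnt_agree_push_forward: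
  assumes a: "dirichlet_coeffs a" and b: "dirichlet_coeffs b" and t: "t < 1"
    and C: "\<And>z. z \<in> annulus t \<Longrightarrow> cmod (h (f z) - (power_series a z + cnj (power_series b z))) \<le> C * (1 - cmod z)"
  shows "cnt_agree \<Gamma> \<Omega> h (push_forward (\<lambda>z. power_series a z + cnj (power_series b z)))"
proof -
  note B = boundary_ext_Jordan[OF jordan biholomorphism]
  let ?s = "\<lambda>k. 1 - (1/2::real) ^ k"
  let ?v = "\<lambda>z. power_series a z + cnj (power_series b z)"
  have s: "0 \<le> ?s k" "?s k < 1" for k by (auto simp: power_le_one)
  have "?s \<longlonglongrightarrow> 1 - 0" by (intro tendsto_diff tendsto_const LIMSEQ_power_zero) simp
  then have sl: "?s \<longlonglongrightarrow> 1" by simp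
  define E where "E = {q \<in> sphere 0 1. \<not> Cauchy (\<lambda>k. power_series a (of_real (?s k) * q)) \<or> \<not> Cauchy (\<lambda>k. power_series b (of_real (?s k) * q))}"
  have cap: "log_capacity E = 0"
    by (rule capacity_zero_of_not_Cauchy[OF a b s sl]) (auto simp: E_def)
  have Cm: "{q. Cauchy (\<lambda>k. power_series x (of_real (?s k) * q))} \<in> sets borel" for x
    using sets_Collect_Cauchy[of "\<lambda>k q. power_series x (of_real (?s k) * q)" borel] by simp
  have "E = sphere 0 1 - ({q. Cauchy (\<lambda>k. power_series a (of_real (?s k) * q))} \<inter> {q. Cauchy (\<lambda>k. power_series b (of_real (?s k) * q))})"
    unfolding E_def by auto
  then have Em: "E \<in> sets borel" using Cm by simp
  have Es: "E \<subseteq> sphere 0 1" "E \<inter> sphere 0 1 = E" unfolding E_def by auto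
  define N where "N = boundary_ext f ` E"
  have "{q \<in> sphere 0 1. boundary_ext f q \<in> N} = E"
    using inj_on_image_mem_iff[OF B(2) _ Es(1)] Es(1) unfolding N_def by blast
  moreover have "N \<in> sigma_sets UNIV {U. openin riemann_sphere U}"
    using boundary_ext_Borel_image[OF jordan biholomorphism Em] unfolding N_def Es(2) .
  moreover have "N \<subseteq> \<Gamma>" using B(3) Es(1) unfolding N_def by blast
  ultimately have "null_on \<Gamma> \<Omega> N" unfolding null_on_def using biholomorphism cap by metis
  moreover have "\<exists>\<zeta>. cnt_limit \<Omega> h p \<zeta> \<and> cnt_limit \<Omega> (push_forward ?v) p \<zeta>" if p: "p \<in> \<Gamma> - N" for p
  proof -
    obtain q where q: "q \<in> sphere 0 1" "boundary_ext f q = p" using p B(3) by blast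
    have q1: "cmod q = 1" using q by simp
    have "q \<notin> E" using p q unfolding N_def by blast
    then have "Cauchy (\<lambda>k. power_series a (of_real (?s k) * q))" "Cauchy (\<lambda>k. power_series b (of_real (?s k) * q))"
      using q by (auto simp: E_def)
    then obtain \<zeta>a \<zeta>b where za: "(\<lambda>k. power_series a (of_real (?s k) * q)) \<longlonglongrightarrow> \<zeta>a" and zb: "(\<lambda>k. power_series b (of_real (?s k) * q)) \<longlonglongrightarrow> \<zeta>b"
      using Cauchy_convergent convergent_def by metis
    have v: "(?v \<longlongrightarrow> \<zeta>a + cnj \<zeta>b) (at q within {z \<in> ball 0 1. cmod (q - z) < M * (1 - cmod z)})" if M: "1 < M" for M
      by (intro tendsto_intros nontangential_power_series[OF a q1 za M] nontangential_power_series[OF b q1 zb M])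
    have ntv: "nontangential_limit (push_forward ?v \<circ> f) q (\<zeta>a + cnj \<zeta>b)"
      unfolding nontangential_limit_def
    proof (intro allI impI)
      fix M :: real assume M: "1 < M"
      show "((push_forward ?v \<circ> f) \<longlongrightarrow> \<zeta>a + cnj \<zeta>b) (at q within {z \<in> ball 0 1. cmod (q - z) < M * (1 - cmod z)})"
        by (rule Lim_transform_eventually[OF v[OF M]])
           (auto simp: eventually_at_filter push_forward_f intro!: always_eventually)
    qed
    have nth: "nontangential_limit (h \<circ> f) q (\<zeta>a + cnj \<zeta>b)"
      unfolding nontangential_limit_def
    proof (intro allI impI)
      fix M :: real assume M: "1 < M"
      let ?S = "{z \<in> ball 0 1. cmod (q - z) < M * (1 - cmod z)}"
      have "((\<lambda>z. (h \<circ> f) z - ?v z) \<longlongrightarrow> 0) (at q within ?S)"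
      proof (rule Lim_null_comparison)
        have nq: "(norm \<longlongrightarrow> cmod q) (at q within ?S)" by (intro tendsto_intros)
        then have "((\<lambda>z. C * (1 - cmod z)) \<longlongrightarrow> C * (1 - cmod q)) (at q within ?S)" by (intro tendsto_intros)
        then show "((\<lambda>z. C * (1 - cmod z)) \<longlongrightarrow> 0) (at q within ?S)" using q1 by simp
        have "\<forall>\<^sub>F z in at q within ?S. t < cmod z" using order_tendstoD(1)[OF nq] t q1 by simp
        moreover have "\<forall>\<^sub>F z in at q within ?S. z \<in> ?S" by (simp add: eventually_at_filter)
        ultimately show "\<forall>\<^sub>F z in at q within ?S. cmod ((h \<circ> f) z - ?v z) \<le> C * (1 - cmod z)"
          by eventually_elim (use C in auto)
      qed
      from tendsto_add[OF this v[OF M]]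
      show "((h \<circ> f) \<longlongrightarrow> \<zeta>a + cnj \<zeta>b) (at q within ?S)" by (simp add: o_def)
    qed
    show ?thesis unfolding cnt_limit_def using biholomorphism q ntv nth by blast
  qed
  ultimately show ?thesis unfolding cnt_agree_def by blast
qed

lemma bounce_eqI:
  assumes "H \<in> D_harm \<Omega>" "H \<in> extensional \<Omega>" "cnt_agree \<Gamma> \<Omega> h H"
  shows "bounce \<Gamma> \<Omega> h = H"
  unfolding bounce_def by (rule the_equality) (use assms bounce_unique in blast)+

text \<open>The zero function is itself a competitor in the definition of the bounce, with the same
  biholomorphism and boundary point witnessing its CNT limit as for h. It is written as the
  push-forward of the zero series.\<close>

lemma bounce_eq_zero:
  assumes "null_on \<Gamma> \<Omega> N" "\<And>p. p \<in> \<Gamma> - N \<Longrightarrow> cnt_limit \<Omega> h p 0"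
  shows "bounce \<Gamma> \<Omega> h = push_forward (\<lambda>_. 0)"
proof (rule bounce_eqI)
  have e: "square_integral (ball 0 1) (\<lambda>z. deriv (power_series (\<lambda>_. 0)) z) < \<infinity>"
    by (simp add: dirichlet_coeffs_zero)
  note P = push_forward_D_harm[OF dirichlet_coeffs_zero(1) dirichlet_coeffs_zero(1) e e]
  show "push_forward (\<lambda>_. 0) \<in> D_harm \<Omega>" "push_forward (\<lambda>_. 0) \<in> extensional \<Omega>"
    using P by (simp_all add: dirichlet_coeffs_zero)
  have "cnt_limit \<Omega> (push_forward (\<lambda>_. 0)) p 0" if p: "p \<in> \<Gamma> - N" for p
  proof -
    obtain f1 q1 where f1: "disk_biholomorphism f1 \<Omega>" "q1 \<in> sphere 0 1" "boundary_ext f1 q1 = p"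
      using assms(2)[OF p] unfolding cnt_limit_def by blast
    have "f1 z \<in> \<Omega>" if "z \<in> ball 0 1" for z
      using f1(1) that unfolding disk_biholomorphism_def bij_betw_def by blast
    then have "nontangential_limit (push_forward (\<lambda>_. 0) \<circ> f1) q1 0"
      unfolding nontangential_limit_def
      by (intro allI impI tendsto_eventually) (auto simp: eventually_at_filter push_forward_def intro!: always_eventually)
    then show ?thesis unfolding cnt_limit_def using f1 by blast
  qed
  then show "cnt_agree \<Gamma> \<Omega> h (push_forward (\<lambda>_. 0))" unfolding cnt_agree_def using assms by blast
qed

end

theorem lemma3p21:
  fixes \<Gamma> \<Omega> A :: "complex option set"
    and f :: "complex \<Rightarrow> complex option"
    and h :: "complex option \<Rightarrow> complex"
    and \<alpha> :: "complex \<Rightarrow> complex"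
  assumes "jordan_domain \<Gamma> \<Omega>"
    and "collar_nbhd \<Omega> A"
    and "disk_biholomorphism f \<Omega>"
    and "h \<in> D_harm A"
    and "\<alpha> \<in> bergman A"
  shows "(\<exists>L. ((\<lambda>\<epsilon>. level_curve_integral f \<epsilon> \<alpha> h) \<longlongrightarrow> L) (at_right 0) \<and>
              ((\<lambda>\<epsilon>. level_curve_integral f \<epsilon> \<alpha> (bounce \<Gamma> \<Omega> h)) \<longlongrightarrow> L) (at_right 0)) \<and>
         ((\<exists>N. null_on \<Gamma> \<Omega> N \<and> (\<forall>p\<in>\<Gamma> - N. cnt_limit \<Omega> h p 0)) \<longrightarrow>
          ((\<lambda>\<epsilon>. level_curve_integral f \<epsilon> \<alpha> h) \<longlongrightarrow> 0) (at_right 0))"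
proof -
  interpret jordan_disc_map f \<Omega> \<Gamma> by unfold_locales (rule assms)+
  obtain r where r: "0 < r" "r < 1" "annulus r \<subseteq> finite_part" "f ` annulus r \<subseteq> A"
    by (rule collar_annulus[OF assms(2)])
  have sh: "sphere_harmonic_on A h" using assms(4) by (simp add: D_harm_def)
  note u = pullback_harmonic(1)[OF sh open_annulus r(3,4)]
  note e = pullback_energy[OF assms(4) open_annulus r(3,4)]
  note \<beta> = pullback_bergman[OF assms(5) open_annulus r(3,4)]
  show ?thesis
  proof (rule annulus_decomposition[OF less_imp_le[OF r(1)] r(2) u e])
  fix t C a b assume t: "r < t" "t < 1" and a: "dirichlet_coeffs a" and b: "dirichlet_coeffs b"
    and C: "\<And>z. z \<in> annulus t \<Longrightarrow> cmod ((h \<circ> f) z - (power_series a z + cnj (power_series b z))) \<le> C * (1 - cmod z)"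
    and ea: "square_integral (ball 0 1) (deriv (power_series a)) < \<infinity>"
    and eb: "square_integral (ball 0 1) (deriv (power_series b)) < \<infinity>"
  let ?v = "\<lambda>z. power_series a z + cnj (power_series b z)"
  have bounce: "bounce \<Gamma> \<Omega> h = push_forward ?v"
    by (rule bounce_eqI[OF push_forward_D_harm[OF a b ea eb] cnt_agree_push_forward[OF a b t(2)]])
       (use C in simp)
  have cu: "continuous_on (annulus r) (h \<circ> f)"
    using u unfolding harmonic_pair_def
    by (intro continuous_at_imp_continuous_on ballI) (meson has_derivative_continuous)
  let ?\<beta> = "\<lambda>z. \<alpha> ((the \<circ> f) z) * deriv (the \<circ> f) z"
  obtain L where Lv: "((\<lambda>s. contour_integral (circlepath 0 s) (\<lambda>z. ?\<beta> z * ?v z)) \<longlongrightarrow> L) (at_left 1)"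
    and Lu: "((\<lambda>s. contour_integral (circlepath 0 s) (\<lambda>z. ?\<beta> z * (h \<circ> f) z)) \<longlongrightarrow> L) (at_left 1)"
    by (rule circle_contour_limit[OF less_imp_le[OF r(1)] r(2) \<beta> a b cu t(2) C])
  have ev: "\<forall>\<^sub>F s in at_left 1. 0 < s \<and> s < (1::real)"
    by (rule eventually_at_left_field[THEN iffD2]) (auto intro!: exI[of _ 0])
  have push: "\<forall>\<^sub>F s in at_left 1. contour_integral (circlepath 0 s) (\<lambda>z. ?\<beta> z * v z) =
      contour_integral (circlepath 0 s) (\<lambda>z. ?\<beta> z * (push_forward v \<circ> f) z)" for v
    using ev
  proof eventually_elim
    case (elim s)
    show ?case
      by (rule contour_integral_cong[OF refl]) (use elim in \<open>auto simp: path_image_circlepath push_forward_f\<close>)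
  qed
  have Lh: "((\<lambda>\<epsilon>. level_curve_integral f \<epsilon> \<alpha> h) \<longlongrightarrow> L) (at_right 0)"
    by (rule level_curve_limit[OF r(3,1,2) Lu])
  have LH: "((\<lambda>\<epsilon>. level_curve_integral f \<epsilon> \<alpha> (bounce \<Gamma> \<Omega> h)) \<longlongrightarrow> L) (at_right 0)"
    unfolding bounce by (rule level_curve_limit[OF r(3,1,2) Lim_transform_eventually[OF Lv push]])
  \<comment> \<open>The bounce vanishes on \<Omega>, so its integrals tend to 0, and uniqueness of
    the limit gives L = 0.\<close>
  have "L = 0" if N: "null_on \<Gamma> \<Omega> N" "\<forall>p\<in>\<Gamma> - N. cnt_limit \<Omega> h p 0" for N
  proof -
    have "((\<lambda>s. contour_integral (circlepath 0 s) (\<lambda>z. ?\<beta> z * 0)) \<longlongrightarrow> 0) (at_left 1)" by simp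
    from level_curve_limit[OF r(3,1,2) Lim_transform_eventually[OF this push]]
    have "((\<lambda>\<epsilon>. level_curve_integral f \<epsilon> \<alpha> (bounce \<Gamma> \<Omega> h)) \<longlongrightarrow> 0) (at_right 0)"
      using bounce_eq_zero[OF N(1)] N(2) by simp
    then show ?thesis by (rule tendsto_unique[OF trivial_limit_at_right_real LH])
  qed
  then show ?thesis using Lh LH by blast
  qed
qed

end
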